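(* Let $\Omega\subset\mathbb{R}^d$, $d\ge2$, be a bounded domain with $\partial\Omega\in C^\infty$. Let $a,\tau\in C^\infty(\overline{\Omega})$ satisfy $a>0$ on $\overline\Omega$, $\tau>0$ on $\Omega$, and $\tau(x)={\rm dist}(x,\partial\Omega)$ in a vicinity of $\partial\Omega$. Let $\gamma\ge0$ and $V(x)=\tau(x)^\gamma a(x)$, $x\in\Omega$. Then the operator $T_V$ is unitarily equivalent to (the closure of) the operator $J^{-1/2}J_VJ^{-1/2}$ in $L^2(\partial\Omega)$.
   Context: A domain is an open, connected, non-empty set. $\mathcal{H}(\Omega)=\{u\in L^2(\Omega):\Delta u=0\text{ in }\Omega\}$; $P$ is the orthogonal projection of $L^2(\Omega)$ onto $\mathcal{H}(\Omega)$; $T_V=PV:\mathcal{H}(\Omega)\to\mathcal{H}(\Omega)$, $T_Vu=P(Vu)$. $L^2(\partial\Omega)=L^2(\partial\Omega;dS)$ with $dS$ the surface measure induced by the Euclidean metric. $G:L^2(\partial\Omega)\to L^2(\Omega)$ is the Poisson operator: $Gf=u$ is the unique solution $u\in H^{1/2}(\Omega)$ of $\Delta u=0$ in $\Omega$, $u=f$ on $\partial\Omega$; it is compact and injective. Put $J=G^*G$ and $J_V=G^*VG$, bounded operators in $L^2(\partial\Omega)$. $J$ is compact, non-negative, with ${\rm Ker}\,J=\{0\}$; $J^{-1/2}$ is the (unbounded, self-adjoint) operator $(J^{1/2})^{-1}$ defined by the spectral theorem. *)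

theory Defs
  imports "HOL-Analysis.Analysis"
begin

section \<open>Smooth functions, harmonic functions, smooth domains\<close>

definition partial_deriv ::
    "'a::euclidean_space \<Rightarrow> ('a \<Rightarrow> 'b::real_normed_vector) \<Rightarrow> 'a \<Rightarrow> 'b" where
  "partial_deriv b f x = frechet_derivative f (at x) b"

text \<open>Continuous differentiability of order \<open>k\<close> on a set \<open>S\<close>; only used for open \<open>S\<close>.\<close>

fun Ck_on :: "nat \<Rightarrow> 'a::euclidean_space set \<Rightarrow> ('a \<Rightarrow> 'b::real_normed_vector) \<Rightarrow> bool" where
  "Ck_on 0 S f \<longleftrightarrow> continuous_on S f"
| "Ck_on (Suc k) S f \<longleftrightarrow>
     (\<forall>x\<in>S. f differentiable (at x)) \<and> (\<forall>b\<in>Basis. Ck_on k S (partial_deriv b f))"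

definition smooth_on :: "'a::euclidean_space set \<Rightarrow> ('a \<Rightarrow> 'b::real_normed_vector) \<Rightarrow> bool" where
  "smooth_on S f \<longleftrightarrow> (\<forall>k. Ck_on k S f)"

text \<open>The class \<open>C\<^sup>\<infinity>\<close> of the closure of \<open>\<Omega>\<close>: restrictions to the closure of smooth functions
  on the whole space.\<close>

definition smooth_on_closure ::
    "'a::euclidean_space set \<Rightarrow> ('a \<Rightarrow> 'b::real_normed_vector) \<Rightarrow> bool" where
  "smooth_on_closure \<Omega> f \<longleftrightarrow> (\<exists>F. smooth_on UNIV F \<and> (\<forall>x\<in>closure \<Omega>. f x = F x))"

definition laplacian :: "('a::euclidean_space \<Rightarrow> 'b::real_normed_vector) \<Rightarrow> 'a \<Rightarrow> 'b" where
  "laplacian f x = (\<Sum>b\<in>Basis. partial_deriv b (partial_deriv b f) x)"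

definition harmonic_on :: "'a::euclidean_space set \<Rightarrow> ('a \<Rightarrow> 'b::real_normed_vector) \<Rightarrow> bool" where
  "harmonic_on \<Omega> u \<longleftrightarrow> Ck_on 2 \<Omega> u \<and> (\<forall>x\<in>\<Omega>. laplacian u x = 0)"

definition local_defining_function ::
    "'a::euclidean_space set \<Rightarrow> 'a set \<Rightarrow> ('a \<Rightarrow> real) \<Rightarrow> bool" where
  "local_defining_function \<Omega> W \<rho> \<longleftrightarrow>
     open W \<and> smooth_on W \<rho> \<and> (\<forall>x\<in>W. \<exists>g. GDERIV \<rho> x :> g \<and> g \<noteq> 0) \<and>
     \<Omega> \<inter> W = {x\<in>W. \<rho> x < 0}"

definition smooth_boundary :: "'a::euclidean_space set \<Rightarrow> bool" where
  "smooth_boundary \<Omega> \<longleftrightarrow> (\<forall>x\<in>frontier \<Omega>. \<exists>W \<rho>. x \<in> W \<and> local_defining_function \<Omega> W \<rho>)"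

definition outward_normal :: "'a::euclidean_space set \<Rightarrow> 'a \<Rightarrow> 'a" where
  "outward_normal \<Omega> x =
     (THE n. \<exists>W \<rho> g. x \<in> W \<and> local_defining_function \<Omega> W \<rho> \<and> GDERIV \<rho> x :> g \<and> n = sgn g)"


section \<open>Measures\<close>

text \<open>The \<open>s\<close>-dimensional Hausdorff measure for \<open>s \<ge> 1\<close>, normalised so that for \<open>s = d - 1\<close>
  it is the Riemannian surface measure on smooth hypersurfaces of a \<open>d\<close>-dimensional Euclidean
  space.  The covering sets have to be bounded, since \<open>diameter\<close> is meaningless otherwise.\<close>

definition hausdorff_outer :: "nat \<Rightarrow> 'a::metric_space set \<Rightarrow> ennreal" where
  "hausdorff_outer s A =
     (SUP \<delta>\<in>{0::real<..}.
        INF C\<in>{C :: nat \<Rightarrow> 'a set. A \<subseteq> (\<Union>i. C i) \<and> (\<forall>i. bounded (C i) \<and> diameter (C i) \<le> \<delta>)}.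
          \<Sum>i. ennreal (unit_ball_vol (real s) * (diameter (C i) / 2) ^ s))"

definition hausdorff_measure :: "nat \<Rightarrow> 'a::metric_space measure" where
  "hausdorff_measure s = measure_of UNIV (sets borel) (hausdorff_outer s)"

definition surface_measure :: "'a::euclidean_space set \<Rightarrow> 'a measure" where
  "surface_measure \<Omega> = restrict_space (hausdorff_measure (DIM('a) - 1)) (frontier \<Omega>)"

definition volume_on :: "'a::euclidean_space set \<Rightarrow> 'a measure" where
  "volume_on \<Omega> = restrict_space lborel \<Omega>"


section \<open>Complex L2 spaces\<close>

text \<open>Elements of \<open>L2 M\<close> are functions; those that agree almost everywhere represent the same
  vector.\<close>

definition L2 :: "'a measure \<Rightarrow> ('a \<Rightarrow> complex) set" where
  "L2 M = {f \<in> borel_measurable M. integrable M (\<lambda>x. (cmod (f x))\<^sup>2)}"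

definition l2_inner :: "'a measure \<Rightarrow> ('a \<Rightarrow> complex) \<Rightarrow> ('a \<Rightarrow> complex) \<Rightarrow> complex" where
  "l2_inner M f g = (LINT x|M. f x * cnj (g x))"

definition l2_norm :: "'a measure \<Rightarrow> ('a \<Rightarrow> complex) \<Rightarrow> real" where
  "l2_norm M f = sqrt (LINT x|M. (cmod (f x))\<^sup>2)"


section \<open>Operators in L2 spaces\<close>

text \<open>Since unbounded operators occur, an operator is represented by its graph.  All operators below
  have graphs closed under replacing either component by an almost everywhere equal function of the
  relevant space, so an equation between graphs is an equation between operators on equivalence
  classes, including equality of domains.\<close>

type_synonym ('a, 'b) l2_op = "(('a \<Rightarrow> complex) \<times> ('b \<Rightarrow> complex)) set"

text \<open>The operator between the subspaces \<open>D\<close> and \<open>E\<close> of \<open>L2 M\<close> and \<open>L2 N\<close> given by a map on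
  representatives.\<close>

definition op_graph ::
    "('a \<Rightarrow> complex) set \<Rightarrow> 'b measure \<Rightarrow> ('b \<Rightarrow> complex) set \<Rightarrow>
     (('a \<Rightarrow> complex) \<Rightarrow> ('b \<Rightarrow> complex)) \<Rightarrow> ('a, 'b) l2_op" where
  "op_graph D N E F = {(f, g). f \<in> D \<and> g \<in> E \<and> (AE x in N. g x = F f x)}"

text \<open>Composition with natural domain, in the order of function composition; the underlying
  \<open>relcomp\<close> has the opposite order.\<close>

abbreviation op_comp :: "('b, 'c) l2_op \<Rightarrow> ('a, 'b) l2_op \<Rightarrow> ('a, 'c) l2_op"
    (infixr \<open>\<circ>\<^sub>o\<close> 75) where
  "B \<circ>\<^sub>o A \<equiv> A O B"

abbreviation op_inverse :: "('a, 'b) l2_op \<Rightarrow> ('b, 'a) l2_op" where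
  "op_inverse A \<equiv> converse A"

definition op_adjoint ::
    "'a measure \<Rightarrow> 'b measure \<Rightarrow> ('a, 'b) l2_op \<Rightarrow> ('b, 'a) l2_op" where
  "op_adjoint M N A =
     {(v, w). v \<in> L2 N \<and> w \<in> L2 M \<and> (\<forall>(f, u)\<in>A. l2_inner N u v = l2_inner M f w)}"

definition op_closure ::
    "'a measure \<Rightarrow> 'b measure \<Rightarrow> ('a, 'b) l2_op \<Rightarrow> ('a, 'b) l2_op" where
  "op_closure M N A =
     {(f, g). f \<in> L2 M \<and> g \<in> L2 N \<and>
        (\<forall>e>0. \<exists>(f', g')\<in>A. l2_norm M (\<lambda>x. f' x - f x) < e \<and> l2_norm N (\<lambda>x. g' x - g x) < e)}"

definition self_adjoint_op :: "'a measure \<Rightarrow> ('a, 'a) l2_op \<Rightarrow> bool" where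
  "self_adjoint_op M A \<longleftrightarrow> op_adjoint M M A = A"

definition nonneg_op :: "'a measure \<Rightarrow> ('a, 'a) l2_op \<Rightarrow> bool" where
  "nonneg_op M A \<longleftrightarrow> (\<forall>(f, g)\<in>A. l2_inner M g f \<in> \<real> \<and> 0 \<le> Re (l2_inner M g f))"

text \<open>The square root given by the spectral theorem is the unique non-negative self-adjoint operator
  whose square is \<open>A\<close>.\<close>

definition op_sqrt :: "'a measure \<Rightarrow> ('a, 'a) l2_op \<Rightarrow> ('a, 'a) l2_op" where
  "op_sqrt M A = (THE S. self_adjoint_op M S \<and> nonneg_op M S \<and> S \<circ>\<^sub>o S = A)"

definition mult_op :: "'a measure \<Rightarrow> ('a \<Rightarrow> real) \<Rightarrow> ('a, 'a) l2_op" where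
  "mult_op M V = op_graph (L2 M) M (L2 M) (\<lambda>u x. complex_of_real (V x) * u x)"

definition orth_proj :: "'a measure \<Rightarrow> ('a \<Rightarrow> complex) set \<Rightarrow> ('a, 'a) l2_op" where
  "orth_proj M H =
     {(u, h). u \<in> L2 M \<and> h \<in> H \<and> (\<forall>g\<in>H. l2_inner M (\<lambda>x. u x - h x) g = 0)}"

definition unitary_map ::
    "'a measure \<Rightarrow> ('a \<Rightarrow> complex) set \<Rightarrow> 'b measure \<Rightarrow> ('b \<Rightarrow> complex) set \<Rightarrow>
     (('a \<Rightarrow> complex) \<Rightarrow> ('b \<Rightarrow> complex)) \<Rightarrow> bool" where
  "unitary_map M D N E U \<longleftrightarrow>
     (\<forall>f\<in>D. U f \<in> E) \<and>
     (\<forall>f\<in>D. \<forall>g\<in>D. \<forall>c. AE x in N. U (\<lambda>y. f y + c * g y) x = U f x + c * U g x) \<and>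
     (\<forall>f\<in>D. \<forall>g\<in>D. l2_inner N (U f) (U g) = l2_inner M f g) \<and>
     (\<forall>h\<in>E. \<exists>f\<in>D. AE x in N. h x = U f x)"

text \<open>Unitary equivalence of \<open>T\<close> in the Hilbert space \<open>E \<subseteq> L2 N\<close> and \<open>A\<close> in the Hilbert space
  \<open>D \<subseteq> L2 M\<close>.\<close>

definition unitarily_equivalent ::
    "'b measure \<Rightarrow> ('b \<Rightarrow> complex) set \<Rightarrow> ('b, 'b) l2_op \<Rightarrow>
     'a measure \<Rightarrow> ('a \<Rightarrow> complex) set \<Rightarrow> ('a, 'a) l2_op \<Rightarrow> bool" where
  "unitarily_equivalent N E T M D A \<longleftrightarrow>
     (\<exists>U. unitary_map M D N E U \<and>
        T = op_graph D N E U \<circ>\<^sub>o A \<circ>\<^sub>o op_inverse (op_graph D N E U))"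


section \<open>Harmonic Toeplitz operators\<close>

definition harmonic_L2 :: "'a::euclidean_space set \<Rightarrow> ('a \<Rightarrow> complex) set" where
  "harmonic_L2 \<Omega> =
     {u \<in> L2 (volume_on \<Omega>). \<exists>h. harmonic_on \<Omega> h \<and> (AE x in volume_on \<Omega>. u x = h x)}"

definition toeplitz_op :: "'a::euclidean_space set \<Rightarrow> ('a \<Rightarrow> real) \<Rightarrow> ('a, 'a) l2_op" where
  "toeplitz_op \<Omega> V =
     orth_proj (volume_on \<Omega>) (harmonic_L2 \<Omega>) \<circ>\<^sub>o mult_op (volume_on \<Omega>) V \<circ>\<^sub>o Id_on (harmonic_L2 \<Omega>)"


section \<open>The Poisson operator\<close>

text \<open>The space \<open>H\<^sup>1\<^sup>/\<^sup>2(\<Omega>)\<close>, with the Gagliardo (Slobodeckij) seminorm; the exponent is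
  \<open>d + 2s\<close> for \<open>s = 1/2\<close>.\<close>

definition sobolev_half :: "'a::euclidean_space set \<Rightarrow> ('a \<Rightarrow> complex) set" where
  "sobolev_half \<Omega> =
     {u \<in> L2 (volume_on \<Omega>).
        (\<integral>\<^sup>+x. \<integral>\<^sup>+y. ennreal ((cmod (u x - u y))\<^sup>2 / dist x y ^ (DIM('a) + 1))
           \<partial>volume_on \<Omega> \<partial>volume_on \<Omega>) < \<infinity>}"

text \<open>There is no bounded trace on all of \<open>H\<^sup>1\<^sup>/\<^sup>2(\<Omega>)\<close>, but its harmonic elements have boundary values
  in \<open>L2\<close> of the boundary, attained in the \<open>L2\<close> sense along the normals.  For \<open>t > 0\<close> small,
  \<open>x - t \<nu>(x)\<close> lies in \<open>\<Omega>\<close> for all \<open>x\<close> on the boundary.\<close>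

definition has_boundary_values ::
    "'a::euclidean_space set \<Rightarrow> ('a \<Rightarrow> complex) \<Rightarrow> ('a \<Rightarrow> complex) \<Rightarrow> bool" where
  "has_boundary_values \<Omega> u f \<longleftrightarrow>
     ((\<lambda>t. \<integral>\<^sup>+x. ennreal ((cmod (u (x - t *\<^sub>R outward_normal \<Omega> x) - f x))\<^sup>2) \<partial>surface_measure \<Omega>)
        \<longlongrightarrow> 0) (at_right 0)"

definition dirichlet_solution ::
    "'a::euclidean_space set \<Rightarrow> ('a \<Rightarrow> complex) \<Rightarrow> ('a \<Rightarrow> complex) \<Rightarrow> bool" where
  "dirichlet_solution \<Omega> f u \<longleftrightarrow>
     u \<in> sobolev_half \<Omega> \<and> harmonic_on \<Omega> u \<and> has_boundary_values \<Omega> u f"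

text \<open>\<open>G\<close> maps each \<open>f\<close> to the unique solution of the Dirichlet problem with boundary data \<open>f\<close>.\<close>

definition poisson_operator ::
    "'a::euclidean_space set \<Rightarrow> (('a \<Rightarrow> complex) \<Rightarrow> ('a \<Rightarrow> complex)) \<Rightarrow> bool" where
  "poisson_operator \<Omega> G \<longleftrightarrow>
     (\<forall>f\<in>L2 (surface_measure \<Omega>). dirichlet_solution \<Omega> f (G f) \<and>
        (\<forall>u. dirichlet_solution \<Omega> f u \<longrightarrow> (\<forall>x\<in>\<Omega>. u x = G f x)))"

definition poisson_graph ::
    "'a::euclidean_space set \<Rightarrow> (('a \<Rightarrow> complex) \<Rightarrow> ('a \<Rightarrow> complex)) \<Rightarrow> ('a, 'a) l2_op" where
  "poisson_graph \<Omega> G = op_graph (L2 (surface_measure \<Omega>)) (volume_on \<Omega>) (L2 (volume_on \<Omega>)) G"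

text \<open>The operator \<open>G\<^sup>* V G\<close>.\<close>

definition J_weighted ::
    "'a::euclidean_space set \<Rightarrow> (('a \<Rightarrow> complex) \<Rightarrow> ('a \<Rightarrow> complex)) \<Rightarrow> ('a \<Rightarrow> real) \<Rightarrow> ('a, 'a) l2_op" where
  "J_weighted \<Omega> G V =
     op_adjoint (surface_measure \<Omega>) (volume_on \<Omega>) (poisson_graph \<Omega> G) \<circ>\<^sub>o
     mult_op (volume_on \<Omega>) V \<circ>\<^sub>o poisson_graph \<Omega> G"

definition J_op ::
    "'a::euclidean_space set \<Rightarrow> (('a \<Rightarrow> complex) \<Rightarrow> ('a \<Rightarrow> complex)) \<Rightarrow> ('a, 'a) l2_op" where
  "J_op \<Omega> G =
     op_adjoint (surface_measure \<Omega>) (volume_on \<Omega>) (poisson_graph \<Omega> G) \<circ>\<^sub>o poisson_graph \<Omega> G"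

definition J_inv_sqrt ::
    "'a::euclidean_space set \<Rightarrow> (('a \<Rightarrow> complex) \<Rightarrow> ('a \<Rightarrow> complex)) \<Rightarrow> ('a, 'a) l2_op" where
  "J_inv_sqrt \<Omega> G = op_inverse (op_sqrt (surface_measure \<Omega>) (J_op \<Omega> G))"

end

theory Submission
  imports Defs "HOL-Library.Function_Algebras"
begin

text \<open>
 Put \<open>Q = J\<^sup>1\<^sup>/\<^sup>2\<close>. Since \<open>\<langle>Q f, Q g\<rangle> = \<langle>J f, g\<rangle> = \<langle>G f, G g\<rangle>\<close> and \<open>Q\<close> has dense range, \<open>G = U Q\<close> with a unitary \<open>U\<close> from
 \<open>L\<^sup>2(\<partial>\<Omega>)\<close> onto the closure of the range of \<open>G\<close>. So \<open>J\<^sup>-\<^sup>1\<^sup>/\<^sup>2 J\<^sub>V J\<^sup>-\<^sup>1\<^sup>/\<^sup>2\<close> is the restriction of the bounded operator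
 \<open>U\<^sup>* V U\<close> to the range of \<open>Q\<close>, and its closure is \<open>U\<^sup>* V U = U\<^sup>* T\<^sub>V U\<close> once the range of \<open>G\<close> is known to be dense in \<open>\<H>(\<Omega>)\<close>.

 Two facts about \<open>G\<close> need analysis. It is bounded: apply Green's formula to \<open>u\<^sup>2\<close> and truncations of a
 superharmonic function that vanishes on the boundary, and estimate integrals over thin layers by integrals over
 the boundary. Its range is dense: it contains the point sources with poles outside of \<open>\<Omega>\<close>; if \<open>v\<close> is orthogonal
 to them, its potential \<open>w\<close> vanishes outside \<open>\<Omega>\<close>, and \<open>\<integral> v\<^sup>2 = \<integral> v \<Delta>w\<close> is the limit of \<open>\<integral> v \<Delta>(\<chi> w) = 0\<close> for cutoff
 functions \<open>\<chi>\<close>.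
\<close>

section \<open>Hilbert spaces up to null vectors\<close>

text \<open>Unique solvability is all that is known of \<open>G\<close>, so bounds for it must come
  from the geometry of the boundary and from harmonic functions themselves. The function
  \<open>\<tau>\<close> supplies that geometry: its smooth extension \<open>F\<close> equals the
  distance to the boundary in a collar inside \<Omega>, so its gradient is the inner unit normal
  there and no regularity theory of the distance function enters. The surface measure is defined
  through coverings, and coverings bound the volume of a collar from above; this one-sided estimate
  replaces the coarea formula. The density argument hinges on matching powers of the width
  \<open>e\<close> of the cutoff layer: derivatives of the cutoff cost \<open>1/e\<close> and
  \<open>1/e^2\<close>, while a potential that vanishes on the outer side has size
  \<open>e^2\<close>, and its gradient size \<open>e\<close>, in the square mean over the layer. The
  square root comes from a power series, but \<open>op_sqrt\<close> is a definite description over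
  all graphs, so uniqueness has to be shown among possibly unbounded operators.\<close>

text \<open>Vectors of norm zero are not identified with zero, so that square integrable functions can
 serve as vectors. Operators are therefore specified through inner products.\<close>

locale semi_inner =
 fixes H :: "'v::ab_group_add set" and sc :: "complex => 'v => 'v"
  and ip :: "'v => 'v => complex"
 assumes zero_mem: "0 \<in> H"
  and add_mem: "x \<in> H ==> y \<in> H ==> x + y \<in> H"
  and sc_mem: "x \<in> H ==> sc c x \<in> H"
  and sc_minus_one: "x \<in> H ==> sc (- 1) x = - x"
  and ip_add_left: "x \<in> H ==> y \<in> H ==> z \<in> H ==> ip (x + y) z = ip x z + ip y z"
  and ip_sc_left: "x \<in> H ==> z \<in> H ==> ip (sc c x) z = c * ip x z"
  and ip_cnj: "x \<in> H ==> y \<in> H ==> ip y x = cnj (ip x y)"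
  and ip_nonneg: "x \<in> H ==> 0 <= Re (ip x x)"
begin

definition nrm :: "'v => real" where
 "nrm x = sqrt (Re (ip x x))"

lemma nrm_nonneg: "x \<in> H ==> 0 <= nrm x"
 by (simp add: nrm_def ip_nonneg)

lemma nrm_sq: "x \<in> H ==> (nrm x)^2 = Re (ip x x)"
 by (simp add: nrm_def ip_nonneg)

lemma ip_self:
 assumes "x \<in> H"
 shows "ip x x = complex_of_real ((nrm x)^2)"
proof -
 have "Im (ip x x) = 0"
  using ip_cnj[OF assms assms] by (metis cnj.simps(2) equal_neg_zero)
 then show ?thesis using assms by (simp add: nrm_sq complex_eq_iff)
qed

lemma minus_mem: "x \<in> H ==> - x \<in> H"
 by (metis sc_mem sc_minus_one)

lemma diff_mem: "x \<in> H ==> y \<in> H ==> x - y \<in> H"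
 by (metis add_mem minus_mem diff_conv_add_uminus)

lemma ip_minus_left: "x \<in> H ==> z \<in> H ==> ip (- x) z = - ip x z"
 by (metis ip_sc_left sc_minus_one mult_minus1)

lemma ip_diff_left: "x \<in> H ==> y \<in> H ==> z \<in> H ==> ip (x - y) z = ip x z - ip y z"
 using ip_add_left[of x "- y" z] ip_minus_left[of y z] minus_mem[of y] by simp

lemma ip_add_right: "x \<in> H ==> y \<in> H ==> z \<in> H ==> ip z (x + y) = ip z x + ip z y"
 using ip_cnj[of z "x + y"] ip_cnj[of z x] ip_cnj[of z y] ip_add_left[of x y z] add_mem[of x y]
 by (metis complex_cnj_add complex_cnj_cnj)

lemma ip_sc_right: "x \<in> H ==> z \<in> H ==> ip z (sc c x) = cnj c * ip z x"
 by (metis ip_cnj ip_sc_left complex_cnj_mult sc_mem)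

lemma ip_diff_right: "x \<in> H ==> y \<in> H ==> z \<in> H ==> ip z (x - y) = ip z x - ip z y"
 by (metis ip_cnj ip_diff_left complex_cnj_diff diff_mem)

lemma ip_zero_left: "z \<in> H ==> ip 0 z = 0"
 using ip_diff_left[of 0 0 z] zero_mem by simp

lemma ip_zero_right: "z \<in> H ==> ip z 0 = 0"
 using ip_diff_right[of 0 0 z] zero_mem by simp

lemmas mems = zero_mem add_mem sc_mem diff_mem minus_mem
lemmas ip_simps = ip_add_left ip_sc_left ip_diff_left ip_minus_left ip_zero_left
 ip_add_right ip_sc_right ip_diff_right ip_zero_right

lemma nrm_add_sq:
 assumes "x \<in> H" "y \<in> H"
 shows "(nrm (x + y))^2 = (nrm x)^2 + 2 * Re (ip x y) + (nrm y)^2"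
proof -
 have "Re (ip y x) = Re (ip x y)" using ip_cnj[OF assms] by simp
 then show ?thesis using assms by (simp add: nrm_sq ip_simps mems)
qed

lemma nrm_diff_sq:
 assumes "x \<in> H" "y \<in> H"
 shows "(nrm (x - y))^2 = (nrm x)^2 - 2 * Re (ip x y) + (nrm y)^2"
proof -
 have "Re (ip y x) = Re (ip x y)" using ip_cnj[OF assms] by simp
 then show ?thesis using assms by (simp add: nrm_sq ip_simps mems)
qed

lemma nrm_sc_sq: "x \<in> H ==> (nrm (sc c x))^2 = (cmod c)^2 * (nrm x)^2"
proof -
 assume x: "x \<in> H"
 have cc: "c * cnj c = complex_of_real ((cmod c)^2)"
  by (simp only: complex_norm_square)
 have "ip (sc c x) (sc c x) = c * cnj c * ip x x"
  using x by (simp add: ip_simps mems)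
 also have "\<dots> = complex_of_real ((cmod c)^2 * (nrm x)^2)"
  unfolding cc ip_self[OF x] by simp
 finally show ?thesis using x by (simp add: nrm_sq mems)
qed

lemma nrm_sc: "x \<in> H ==> nrm (sc c x) = cmod c * nrm x"
 using nrm_sc_sq[of x c] nrm_nonneg[of x] nrm_nonneg[of "sc c x"] sc_mem[of x c]
 by (metis norm_ge_zero power2_eq_imp_eq mult_nonneg_nonneg power_mult_distrib)

lemma nrm_minus: "x \<in> H ==> nrm (- x) = nrm x"
 using nrm_sc[of x "-1"] sc_minus_one[of x] by simp

lemma nrm_diff_commute: "x \<in> H ==> y \<in> H ==> nrm (x - y) = nrm (y - x)"
 using nrm_minus[of "x - y"] diff_mem[of x y] by simp

text \<open>Expand the norm of \<open>x - t y\<close> with \<open>t\<close> a real multiple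
  \<open>e\<close> of \<open>ip x y\<close>. A null vector \<open>y\<close> need not be zero, so its
  pairing with \<open>x\<close> is shown to vanish separately.\<close>

lemma Cauchy_Schwarz:
 assumes x: "x \<in> H" and y: "y \<in> H"
 shows "cmod (ip x y) <= nrm x * nrm y"
proof -
 define d where "d = ip x y"
 have key: "0 <= (nrm x)^2 - 2 * e * (cmod d)^2 + e^2 * (cmod d)^2 * (nrm y)^2" for e :: real
 proof -
  define t where "t = complex_of_real e * d"
  have "d * cnj d = complex_of_real ((cmod d)^2)"
   by (simp only: complex_norm_square)
  moreover have "ip x (sc t y) = e * (d * cnj d)"
   using x y by (simp add: ip_simps t_def mult_ac flip: d_def)
  ultimately have "ip x (sc t y) = complex_of_real (e * (cmod d)^2)"
   by (metis of_real_mult)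
  moreover have "(nrm (sc t y))^2 = e^2 * (cmod d)^2 * (nrm y)^2"
   using y by (simp add: nrm_sc_sq t_def norm_mult power_mult_distrib)
  moreover have "0 <= (nrm (x - sc t y))^2" by simp
  ultimately show ?thesis
   using nrm_diff_sq[OF x sc_mem[OF y, of t]] by simp
 qed
 have "(cmod d)^2 <= (nrm x * nrm y)^2"
 proof (cases "nrm y = 0")
  case True
  have "(cmod d)^2 = 0"
  proof (rule ccontr)
   assume nz: "(cmod d)^2 \<noteq> 0"
   \<comment> \<open>For null \<open>y\<close> the bound is affine in \<open>e\<close>; this value
     of \<open>e\<close> makes it negative.\<close>
   have "0 <= (nrm x)^2 - 2 * (((nrm x)^2 + 1) / (cmod d)^2) * (cmod d)^2"
    using key[of "((nrm x)^2 + 1) / (cmod d)^2"] True by simp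
   moreover have "((nrm x)^2 + 1) / (cmod d)^2 * (cmod d)^2 = (nrm x)^2 + 1"
    using nz by simp
   ultimately have "0 <= (nrm x)^2 - 2 * ((nrm x)^2 + 1)"
    by (metis mult.assoc)
   then show False by (smt (verit) zero_le_power2)
  qed
  then show ?thesis by simp
 next
  case False
  then have p: "(nrm y)^2 > 0" by simp
  have "0 <= (nrm x)^2 - (cmod d)^2 / (nrm y)^2"
  proof -
   have "(1 / (nrm y)^2)^2 * (cmod d)^2 * (nrm y)^2 = (cmod d)^2 / (nrm y)^2"
    using p by (simp only: power2_eq_square) (auto simp: divide_simps)
   then show ?thesis using key[of "1 / (nrm y)^2"] by simp
  qed
  then show ?thesis using p by (simp add: field_simps power_mult_distrib)
 qed
 then show ?thesis
  unfolding d_def using nrm_nonneg x y by (meson mult_nonneg_nonneg power2_le_imp_le)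
qed

lemma nrm_triangle:
 assumes x: "x \<in> H" and y: "y \<in> H"
 shows "nrm (x + y) <= nrm x + nrm y"
proof -
 have "(nrm (x + y))^2 <= (nrm x + nrm y)^2"
  using nrm_add_sq[OF x y] Cauchy_Schwarz[OF x y] complex_Re_le_cmod[of "ip x y"]
  by (simp add: power2_sum)
 then show ?thesis
  using nrm_nonneg x y by (meson add_nonneg_nonneg power2_le_imp_le)
qed

lemma nrm_triangle3:
 assumes "x \<in> H" "y \<in> H" "z \<in> H"
 shows "nrm (x - z) <= nrm (x - y) + nrm (y - z)"
 using nrm_triangle[of "x - y" "y - z"] assms by (simp add: mems)

lemma tendsto_ip:
 assumes "\<And>n. s n \<in> H" "\<And>n. t n \<in> H" "x \<in> H" "y \<in> H"
  and s: "(\<lambda>n. nrm (s n - x)) \<longlonglongrightarrow> 0" and t: "(\<lambda>n. nrm (t n - y)) \<longlonglongrightarrow> 0"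
 shows "(\<lambda>n. ip (s n) (t n)) \<longlonglongrightarrow> ip x y"
proof -
 have b: "cmod (ip (s n) (t n) - ip x y)
   <= nrm (s n - x) * nrm (t n - y) + nrm (s n - x) * nrm y + nrm x * nrm (t n - y)" for n
 proof -
  have "ip (s n) (t n) - ip x y = ip (s n - x) (t n - y) + ip (s n - x) y + ip x (t n - y)"
   using assms by (simp add: ip_simps mems)
  then show ?thesis
   using Cauchy_Schwarz[of "s n - x" "t n - y"] Cauchy_Schwarz[of "s n - x" y]
    Cauchy_Schwarz[of x "t n - y"] assms(1-4)
   by (smt (verit) mems(4) norm_triangle_ineq)
 qed
 have "(\<lambda>n. nrm (s n - x) * nrm (t n - y) + nrm (s n - x) * nrm y + nrm x * nrm (t n - y))
   \<longlonglongrightarrow> 0 * 0 + 0 * nrm y + nrm x * 0"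
  by (intro tendsto_intros s t)
 then have "(\<lambda>n. nrm (s n - x) * nrm (t n - y) + nrm (s n - x) * nrm y + nrm x * nrm (t n - y))
   \<longlonglongrightarrow> 0"
  by simp
 moreover have "\<forall>\<^sub>F n in sequentially. norm (ip (s n) (t n) - ip x y) \<le>
   nrm (s n - x) * nrm (t n - y) + nrm (s n - x) * nrm y + nrm x * nrm (t n - y)"
  using b by simp
 ultimately have "(\<lambda>n. ip (s n) (t n) - ip x y) \<longlonglongrightarrow> 0"
  by (rule Lim_null_comparison[rotated])
 then show ?thesis using LIM_zero_iff by blast
qed

lemma tendsto_ip_left:
 assumes "\<And>n. s n \<in> H" "x \<in> H" "y \<in> H" and s: "(\<lambda>n. nrm (s n - x)) \<longlonglongrightarrow> 0"
 shows "(\<lambda>n. ip (s n) y) \<longlonglongrightarrow> ip x y"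
proof (rule tendsto_ip[OF assms(1) _ assms(2,3) s])
 show "(\<lambda>n. nrm (y - y)) \<longlonglongrightarrow> 0" by (simp add: nrm_def ip_zero_left zero_mem)
qed (use assms in auto)

lemma nrm_eq_zero_iff_orth:
 assumes "x \<in> H"
 shows "nrm x = 0 \<longleftrightarrow> (\<forall>z\<in>H. ip x z = 0)"
proof
 assume "nrm x = 0"
 then show "\<forall>z\<in>H. ip x z = 0"
  using Cauchy_Schwarz[OF assms] by fastforce
next
 assume "\<forall>z\<in>H. ip x z = 0"
 then show "nrm x = 0" using assms by (simp add: nrm_def)
qed

end

section \<open>Completeness: Riesz representation and density\<close>

locale semi_hilbert = semi_inner +
 assumes complete: "(\<And>n. s n \<in> H) ==>
  (\<And>e. e > 0 ==> \<exists>N. \<forall>m\<ge>N. \<forall>n\<ge>N. nrm (s m - s n) < e) ==>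
  \<exists>l\<in>H. (\<lambda>n. nrm (s n - l)) \<longlonglongrightarrow> 0"
begin

text \<open>A minimising sequence of \<open>|d|^2 - 2 Re (\<psi> d)\<close> in \<open>D\<close> is
  Cauchy and its limit represents \<psi>. The subspace \<open>D\<close> may fail to be closed;
  keeping the approximating sequence inside \<open>D\<close> lets one argument serve both the Riesz
  theorem and density.\<close>

lemma functional_limit_representation:
 assumes D: "D \<subseteq> H" "0 \<in> D" "\<And>x y. x \<in> D ==> y \<in> D ==> x + y \<in> D"
   "\<And>c x. x \<in> D ==> sc c x \<in> D"
  and lin: "\<And>x y. x \<in> D ==> y \<in> D ==> \<psi> (x + y) = \<psi> x + \<psi> y"
   "\<And>c x. x \<in> D ==> \<psi> (sc c x) = c * \<psi> x"
  and bdd: "\<And>x. x \<in> D ==> cmod (\<psi> x) <= C * nrm x"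
 obtains s p where "\<And>n::nat. s n \<in> D" "p \<in> H" "(\<lambda>n. nrm (s n - p)) \<longlonglongrightarrow> 0"
  "\<And>z. z \<in> D ==> ip z p = \<psi> z"
proof -
 have DH: "x \<in> H" if "x \<in> D" for x using that D by auto
 define Q where "Q d = (nrm d)^2 - 2 * Re (\<psi> d)" for d
 have Qlow: "- C\<^sup>2 <= Q d" if "d \<in> D" for d
 proof -
  have "Re (\<psi> d) <= C * nrm d" using bdd[OF that] complex_Re_le_cmod order_trans by blast
  moreover have "0 <= (nrm d - C)^2" by simp
  ultimately show ?thesis unfolding Q_def power2_diff by (simp add: mult.commute[of C])
 qed
 have bddQ: "bdd_below (Q ` D)" using Qlow by (intro bdd_belowI[of _ "- C\<^sup>2"]) auto
 define m where "m = Inf (Q ` D)"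
 have m_le: "m <= Q d" if "d \<in> D" for d
  unfolding m_def using that bddQ by (intro cInf_lower) auto
 have "\<exists>d\<in>D. Q d < m + 1 / real (Suc n)" for n
 proof -
  have "m < m + 1 / real (Suc n)" by simp
  then show ?thesis
   unfolding m_def using cInf_lessD[of "Q ` D"] D(2) by blast
 qed
 then obtain s where s: "\<And>n. s n \<in> D" "\<And>n. Q (s n) < m + 1 / real (Suc n)" by metis
 \<comment> \<open>Parallelogram law: the midpoint of \<open>x\<close> and \<open>y\<close> lies in
   \<open>D\<close>, where \<open>Q\<close> is at least \<open>m\<close>.\<close>
 have half: "(nrm (x - y))^2 <= 2 * Q x + 2 * Q y - 4 * m" if xy: "x \<in> D" "y \<in> D" for x y
 proof -
  have "m <= Q (sc (1/2) (x + y))" using m_le D xy by simp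
  also have "\<dots> = ((nrm x)^2 + 2 * Re (ip x y) + (nrm y)^2) / 4 - (Re (\<psi> x) + Re (\<psi> y))"
   using xy DH lin D unfolding Q_def
   by (simp add: nrm_sc_sq nrm_add_sq mems power_divide add_divide_distrib)
  finally show ?thesis
   using nrm_diff_sq[of x y] xy DH unfolding Q_def by (simp add: field_simps)
 qed
 have cau: "\<exists>N. \<forall>m\<ge>N. \<forall>n\<ge>N. nrm (s m - s n) < e" if e: "e > 0" for e
 proof -
  obtain N where N: "1 / real (Suc N) < e^2 / 4"
   using e nat_approx_posE[of "e^2 / 4"] by auto
  have "nrm (s k - s n) < e" if "k >= N" "n >= N" for k n
  proof -
   have "1 / real (Suc k) <= 1 / real (Suc N)" "1 / real (Suc n) <= 1 / real (Suc N)"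
    using that by (simp_all add: frac_le)
   then have "(nrm (s k - s n))^2 < e^2"
    using half[OF s(1)[of k] s(1)[of n]] s(2)[of k] s(2)[of n] N
    by linarith
   then show ?thesis using e power_less_imp_less_base by fastforce
  qed
  then show ?thesis by blast
 qed
 obtain p where p: "p \<in> H" "(\<lambda>n. nrm (s n - p)) \<longlonglongrightarrow> 0"
  using complete[of s] cau s(1) DH by metis
 have "ip z p = \<psi> z" if z: "z \<in> D" for z
 proof -
  define d where "d = ip z p - \<psi> z"
  \<comment> \<open>First variation in the direction \<open>t z\<close>, carried out at
    \<open>s n\<close> and passed to the limit because \<open>p\<close> may lie outside
    \<open>D\<close>.\<close>
  have ineq: "0 <= 2 * Re (t * d) + (cmod t)^2 * (nrm z)^2" for t
  proof -
   have "m - 1 / real (Suc n) - m <= Q (s n + sc t z) - Q (s n)" for n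
   proof -
    have "m <= Q (s n + sc t z)" using m_le s(1) z D by simp
    then show ?thesis using s(2)[of n] by linarith
   qed
   moreover have "Q (s n + sc t z) - Q (s n)
    = 2 * Re (cnj t * ip (s n) z) + (cmod t)^2 * (nrm z)^2 - 2 * Re (t * \<psi> z)" for n
    unfolding Q_def using s(1)[of n] z DH D lin
    by (simp add: nrm_add_sq nrm_sc_sq ip_simps mems)
   ultimately have "- (1 / real (Suc n))
    <= 2 * Re (cnj t * ip (s n) z) + (cmod t)^2 * (nrm z)^2 - 2 * Re (t * \<psi> z)" for n
    by (smt (verit))
   moreover have "(\<lambda>n. - (1 / real (Suc n))) \<longlonglongrightarrow> - 0"
    by (intro tendsto_minus) (rule LIMSEQ_inverse_real_of_nat[unfolded inverse_eq_divide])
   moreover have "(\<lambda>n. 2 * Re (cnj t * ip (s n) z) + (cmod t)^2 * (nrm z)^2 - 2 * Re (t * \<psi> z))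
     \<longlonglongrightarrow> 2 * Re (cnj t * ip p z) + (cmod t)^2 * (nrm z)^2 - 2 * Re (t * \<psi> z)"
    by (intro tendsto_intros tendsto_ip_left p) (use s DH z in auto)
   ultimately have "- 0 <= 2 * Re (cnj t * ip p z) + (cmod t)^2 * (nrm z)^2 - 2 * Re (t * \<psi> z)"
    by (intro LIMSEQ_le[of "\<lambda>n. - (1 / real (Suc n))"]) auto
   moreover have "Re (cnj t * ip p z) = Re (t * ip z p)"
    using ip_cnj[of z p] z DH p by (metis cnj.simps(1) complex_cnj_mult complex_cnj_cnj)
   ultimately show ?thesis unfolding d_def by (simp add: algebra_simps)
  qed
  have "d = 0"
  proof (rule ccontr)
   assume "d \<noteq> 0"
   then have dp: "(cmod d)^2 > 0" by simp
   \<comment> \<open>Small enough that the quadratic term stays below half of the linear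
     one.\<close>
   define e where "e = 1 / ((nrm z)^2 + 1)"
   have N: "(nrm z)^2 + 1 > 0" by (simp add: add_nonneg_pos)
   then have e: "e > 0" "e * (nrm z)^2 < 1" unfolding e_def by (auto simp: field_simps)
   have "0 <= - 2 * e * (cmod d)^2 + e^2 * (cmod d)^2 * (nrm z)^2"
   proof -
    have "d * cnj d = complex_of_real ((cmod d)^2)"
     by (simp only: complex_norm_square)
    then have "(- complex_of_real e * cnj d) * d = complex_of_real (- e * (cmod d)^2)"
     by (simp add: mult_ac)
    then have "Re ((- complex_of_real e * cnj d) * d) = - e * (cmod d)^2"
     by (metis Re_complex_of_real)
    moreover have "(cmod (- complex_of_real e * cnj d))^2 = e^2 * (cmod d)^2"
     by (simp add: norm_mult power_mult_distrib)
    ultimately show ?thesis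
     using ineq[of "- complex_of_real e * cnj d"] by simp
   qed
   also have "\<dots> = e * (cmod d)^2 * (e * (nrm z)^2 - 2)"
    by (simp add: power2_eq_square algebra_simps)
   also have "\<dots> < 0" using e dp by (intro mult_pos_neg) auto
   finally show False by simp
  qed
  then show ?thesis by (simp add: d_def)
 qed
 with s(1) p show ?thesis using that by blast
qed

lemma Riesz:
 assumes "\<And>x y. x \<in> H ==> y \<in> H ==> \<psi> (x + y) = \<psi> x + \<psi> y"
   "\<And>c x. x \<in> H ==> \<psi> (sc c x) = c * \<psi> x"
  and "\<And>x. x \<in> H ==> cmod (\<psi> x) <= C * nrm x"
 shows "\<exists>p\<in>H. \<forall>z\<in>H. ip z p = \<psi> z"
proof -
 obtain s p where "p \<in> H" "\<And>z. z \<in> H ==> ip z p = \<psi> z"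
  by (rule functional_limit_representation[of H \<psi> C]) (use assms mems in auto)
 then show ?thesis by blast
qed

text \<open>Represent \<open>z \<mapsto> ip z x\<close> on \<open>D\<close> by a limit
  \<open>p\<close> of elements of \<open>D\<close>: then \<open>p - x\<close> is orthogonal to
  \<open>D\<close>, hence null, and the sequence converges to \<open>x\<close> as well.\<close>

lemma dense_if_orthogonal_trivial:
 assumes D: "D \<subseteq> H" "0 \<in> D" "\<And>x y. x \<in> D ==> y \<in> D ==> x + y \<in> D"
   "\<And>c x. x \<in> D ==> sc c x \<in> D"
  and orth: "\<And>y. y \<in> H ==> (\<And>z. z \<in> D ==> ip z y = 0) ==> nrm y = 0"
  and x: "x \<in> H"
 obtains s where "\<And>n::nat. s n \<in> D" "(\<lambda>n. nrm (s n - x)) \<longlonglongrightarrow> 0"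
proof -
 have DH: "x \<in> H" if "x \<in> D" for x using that D by auto
 obtain s p where s: "\<And>n::nat. s n \<in> D" "p \<in> H" "(\<lambda>n. nrm (s n - p)) \<longlonglongrightarrow> 0"
  "\<And>z. z \<in> D ==> ip z p = ip z x"
 proof (rule functional_limit_representation[of D "\<lambda>z. ip z x" "nrm x"])
  show "cmod (ip z x) <= nrm x * nrm z" if "z \<in> D" for z
   using Cauchy_Schwarz[of z x] that DH x by (simp add: mult.commute)
 qed (use D DH x in \<open>auto simp: ip_simps mems\<close>)
 have "nrm (p - x) = 0"
  using s x DH by (intro orth) (auto simp: ip_simps mems)
 then have "nrm (s n - x) <= nrm (s n - p)" for n
  using nrm_triangle3[of "s n" p x] s x DH by auto
 then have "(\<lambda>n. nrm (s n - x)) \<longlonglongrightarrow> 0"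
  using s x DH
  by (intro tendsto_sandwich[OF _ _ tendsto_const s(3)] always_eventually)
   (auto intro!: nrm_nonneg diff_mem)
 then show ?thesis using s(1) that by blast
qed

text \<open>\<open>T\<close> is linear only when paired with vectors, so its image need not be a
  subspace; \<open>D\<close> is the image enlarged by all vectors with the same pairings.\<close>

lemma dense_range:
 fixes T :: "'w::ab_group_add => 'a"
 assumes A: "semi_inner A sc' ip'" and T: "\<And>f. f \<in> A ==> T f \<in> H"
  and lin: "\<And>f g z. f \<in> A ==> g \<in> A ==> z \<in> H ==> ip (T (f + g)) z = ip (T f) z + ip (T g) z"
   "\<And>c f z. f \<in> A ==> z \<in> H ==> ip (T (sc' c f)) z = c * ip (T f) z"
  and orth: "\<And>y. y \<in> H ==> (\<And>f. f \<in> A ==> ip (T f) y = 0) ==> nrm y = 0"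
  and x: "x \<in> H"
 obtains s where "\<And>n::nat. s n \<in> A" "(\<lambda>n. nrm (T (s n) - x)) \<longlonglongrightarrow> 0"
proof -
 interpret A: semi_inner A sc' ip' by (rule A)
 define D where "D = {w \<in> H. \<exists>h\<in>A. \<forall>z\<in>H. ip w z = ip (T h) z}"
 obtain t where t: "\<And>n::nat. t n \<in> D" "(\<lambda>n. nrm (t n - x)) \<longlonglongrightarrow> 0"
 proof (rule dense_if_orthogonal_trivial[of D x])
  show "D \<subseteq> H" by (auto simp: D_def)
  have "\<forall>z\<in>H. ip 0 z = ip (T (sc' 0 0)) z" using lin(2)[OF A.zero_mem, of _ 0] by (simp add: ip_zero_left)
  then show "0 \<in> D" unfolding D_def using zero_mem A.sc_mem[OF A.zero_mem] by blast
  show "w + w' \<in> D" if w: "w \<in> D" "w' \<in> D" for w w'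
  proof -
   obtain h h' where h: "h \<in> A" "h' \<in> A" "\<forall>z\<in>H. ip w z = ip (T h) z" "\<forall>z\<in>H. ip w' z = ip (T h') z"
    and wm: "w \<in> H" "w' \<in> H" using w by (auto simp: D_def)
   have "\<forall>z\<in>H. ip (w + w') z = ip (T (h + h')) z" using h wm by (simp add: ip_add_left lin(1))
   then show ?thesis unfolding D_def using h(1,2) wm add_mem A.add_mem by blast
  qed
  show "sc c w \<in> D" if w: "w \<in> D" for c w
  proof -
   obtain h where h: "h \<in> A" "\<forall>z\<in>H. ip w z = ip (T h) z" and wm: "w \<in> H" using w by (auto simp: D_def)
   have "\<forall>z\<in>H. ip (sc c w) z = ip (T (sc' c h)) z" using h wm by (simp add: ip_sc_left lin(2))
   then show ?thesis unfolding D_def using A.sc_mem[OF h(1)] sc_mem[OF wm] by blast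
  qed
  show "nrm y = 0" if "y \<in> H" "\<And>z. z \<in> D ==> ip z y = 0" for y
   using that(1) by (rule orth) (rule that(2), use T in \<open>auto simp: D_def\<close>)
 qed (rule x, rule that)
 have "\<exists>h. h \<in> A \<and> (\<forall>z\<in>H. ip (t n) z = ip (T h) z)" for n using t(1)[of n] by (auto simp: D_def)
 then obtain s where s: "\<And>n. s n \<in> A" "\<And>n z. z \<in> H ==> ip (t n) z = ip (T (s n)) z" by metis
 have tm: "t n \<in> H" for n using t(1)[of n] by (simp add: D_def)
 have "nrm (T (s n) - t n) = 0" for n
  using nrm_eq_zero_iff_orth[of "T (s n) - t n"] by (simp add: mems ip_diff_left T tm s)
 then have "nrm (T (s n) - x) <= nrm (t n - x)" for n
  using nrm_triangle3[of "T (s n)" "t n" x] x tm[of n] T[OF s(1)[of n]] by simp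
 then have "(\<lambda>n. nrm (T (s n) - x)) \<longlonglongrightarrow> 0"
  by (intro tendsto_sandwich[OF _ _ tendsto_const t(2)] always_eventually allI nrm_nonneg diff_mem T s(1) x)
 then show ?thesis using s(1) that by blast
qed

end

text \<open>The Taylor coefficients of \<open>1 - sqrt (1 - x)\<close>.\<close>

fun sqrt_coeff :: "nat => real" where
 "sqrt_coeff n = (if n = 0 then 0 else if n = 1 then 1 / 2
   else (\<Sum>i\<in>{1..<n}. sqrt_coeff i * sqrt_coeff (n - i)) / 2)"

declare sqrt_coeff.simps [simp del]

lemma sqrt_coeff_nonneg: "0 <= sqrt_coeff n"
proof (induction n rule: less_induct)
 case (less n)
 show ?case
  by (subst sqrt_coeff.simps) (auto intro!: sum_nonneg mult_nonneg_nonneg less)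
qed

lemma sqrt_coeff_0: "sqrt_coeff 0 = 0" and sqrt_coeff_1: "sqrt_coeff (Suc 0) = 1 / 2"
 by (simp_all add: sqrt_coeff.simps)

text \<open>The Cauchy product form of \<open>f^2 = 2 f - x\<close> for
  \<open>f = 1 - sqrt (1 - x)\<close>.\<close>

lemma sqrt_coeff_square:
 "(\<Sum>i\<le>n. sqrt_coeff i * sqrt_coeff (n - i)) = 2 * sqrt_coeff n - (if n = 1 then 1 else 0)"
proof -
 consider "n = 0" | "n = 1" | "n >= 2" by linarith
 then show ?thesis
 proof cases
  case 3
  then have "{..n} = insert 0 (insert n {1..<n})" by auto
  with 3 have "(\<Sum>i\<le>n. sqrt_coeff i * sqrt_coeff (n - i))
   = (\<Sum>i\<in>{1..<n}. sqrt_coeff i * sqrt_coeff (n - i))"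
   by (simp add: sqrt_coeff_0)
  then show ?thesis using 3 by (subst (3) sqrt_coeff.simps) simp
 qed (auto simp: sqrt_coeff_0 sqrt_coeff_1)
qed

text \<open>A product with \<open>i + j <= n + 1\<close> that has a factor of index
  \<open>n + 1\<close> has the zeroth coefficient as its other factor, which vanishes. So the
  partial sums satisfy \<open>2 s(n+1) - 1 <= s(n)^2\<close> and never exceed one.\<close>

lemma sqrt_coeff_partial_sum: "(\<Sum>i\<le>n. sqrt_coeff i) <= 1"
proof (induction n)
 case (Suc n)
 let ?a = sqrt_coeff
 have "2 * (\<Sum>k\<le>Suc n. ?a k) - 1 = (\<Sum>k\<le>Suc n. 2 * ?a k - (if k = 1 then 1 else 0))"
  by (simp add: sum_subtractf sum_distrib_left)
 also have "\<dots> = (\<Sum>k\<le>Suc n. \<Sum>i\<le>k. ?a i * ?a (k - i))"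
  by (simp only: sqrt_coeff_square)
 also have "\<dots> = (\<Sum>(i, j)\<in>{(i, j). i + j <= Suc n}. ?a i * ?a j)"
  by (simp add: sum.triangle_reindex_eq)
 also have "\<dots> <= (\<Sum>(i, j)\<in>{..n} \<times> {..n}. ?a i * ?a j)"
 proof -
  let ?P = "{(i, j). i + j <= Suc n}" and ?f = "\<lambda>(i, j). ?a i * ?a j"
  have fin: "finite ?P"
   by (rule finite_subset[of _ "{..Suc n} \<times> {..Suc n}"]) auto
  have "sum ?f ?P = sum ?f (?P \<inter> {..n} \<times> {..n})"
  proof (rule sum.mono_neutral_right[OF fin])
   have "i = 0 \<or> j = 0" if "i + j <= Suc n" "\<not> (i <= n \<and> j <= n)" for i j
    using that by linarith
   then show "\<forall>p\<in>?P - ?P \<inter> {..n} \<times> {..n}. ?f p = 0"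
    by (fastforce simp: sqrt_coeff_0)
  qed auto
  also have "\<dots> <= sum ?f ({..n} \<times> {..n})"
   by (rule sum_mono2) (auto simp: sqrt_coeff_nonneg)
  finally show ?thesis .
 qed
 also have "\<dots> = (\<Sum>i\<le>n. ?a i)^2"
  by (simp add: power2_eq_square sum_product sum.cartesian_product)
 also have "\<dots> <= 1"
  using Suc sum_nonneg[of "{..n}" ?a] sqrt_coeff_nonneg by (simp add: power_le_one)
 finally show ?case by simp
qed (simp add: sqrt_coeff_0)

lemma summable_sqrt_coeff: "summable sqrt_coeff"
 by (rule bounded_imp_summable[of _ 1]) (auto simp: sqrt_coeff_nonneg sqrt_coeff_partial_sum)

lemma suminf_sqrt_coeff_le_1: "suminf sqrt_coeff <= 1"
proof (rule suminf_le_const[OF summable_sqrt_coeff])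
 show "sum sqrt_coeff {..<n} <= 1" for n
  using sqrt_coeff_partial_sum[of "n - 1"] by (cases n) (auto simp: lessThan_Suc_atMost)
qed

text \<open>With \<open>q n = ip (X^n f) g\<close> this turns the iterated series for
  \<open>R (R f)\<close> into a Cauchy product; boundedness of \<open>q\<close> and summability of
  \<open>a\<close> give absolute convergence of the double series.\<close>

lemma sums_antidiagonal:
 fixes a :: "nat => real" and q r :: "nat => complex"
 assumes a: "\<And>n. 0 <= a n" "summable a" and q: "\<And>n. cmod (q n) <= B"
  and inner: "\<And>n. (\<lambda>i. a i * q (n + i)) sums r n" and outer: "(\<lambda>n. a n * r n) sums s"
 shows "(\<lambda>n. complex_of_real (\<Sum>i\<le>n. a i * a (n - i)) * q n) sums s"
proof -
 define F where "F = (\<lambda>(n, i). a n * a i * q (n + i))"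
 have "(\<lambda>(n, i). a n * a i) summable_on UNIV \<times> UNIV"
 proof (rule summable_on_SigmaI[where g = "\<lambda>n. a n * suminf a"])
  show "((\<lambda>i. case (n, i) of (n, i) => a n * a i) has_sum a n * suminf a) UNIV" for n
   using sums_mult[OF summable_sums[OF a(2)], of "a n"] a
   by (intro norm_summable_imp_has_sum) (auto simp: abs_mult intro!: summable_mult)
  show "(\<lambda>n. a n * suminf a) summable_on UNIV"
   using a by (intro norm_summable_imp_summable_on)
    (auto simp: abs_mult suminf_nonneg intro!: summable_mult2)
 qed (use a in auto)
 then have s1: "(\<lambda>p. (case p of (n, i) => a n * a i) * B) summable_on UNIV"
  using summable_on_cmult_left by (metis UNIV_Times_UNIV)
 have "(\<lambda>p. cmod (F p)) summable_on UNIV"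
 proof (rule summable_on_comparison_test[OF s1])
  show "cmod (F p) <= (case p of (n, i) => a n * a i) * B" for p
   using a q by (auto simp: F_def norm_mult abs_mult split: prod.splits intro!: mult_left_mono)
 qed auto
 then have Fs: "F summable_on UNIV" by (rule abs_summable_summable)
 then have hs: "(F has_sum infsum F UNIV) UNIV" by simp
 have "((\<lambda>i. F (n, i)) has_sum (a n * r n)) UNIV" for n
 proof -
  have "inj_on (Pair n) UNIV" by (simp add: inj_on_def)
  then have "(F \<circ> Pair n) summable_on UNIV"
   using Fs summable_on_subset_banach[OF Fs] by (subst summable_on_reindex[symmetric]) auto
  then have 1: "((\<lambda>i. F (n, i)) has_sum infsum (\<lambda>i. F (n, i)) UNIV) UNIV" by (simp add: o_def)
  have "(\<lambda>i. F (n, i)) sums (a n * r n)"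
   using sums_mult[OF inner[of n], of "complex_of_real (a n)"] by (simp add: F_def mult.assoc)
  then show ?thesis using 1 has_sum_imp_sums sums_unique2 by metis
 qed
 moreover have "(F has_sum infsum F UNIV) (UNIV \<times> UNIV)" using hs by simp
 ultimately have "((\<lambda>n. a n * r n) has_sum infsum F UNIV) UNIV"
  using has_sum_SigmaD[where f = F and A = UNIV and B = "\<lambda>_. UNIV" and S = "infsum F UNIV"
    and g = "\<lambda>n. a n * r n"] by simp
 then have s: "infsum F UNIV = s" using outer has_sum_imp_sums sums_unique2 by metis
 have "bij_betw (\<lambda>(n, i). (n - i, i)) (SIGMA n:UNIV. {..n}) (UNIV :: (nat \<times> nat) set)"
  by (rule bij_betw_byWitness[where f' = "\<lambda>(m, i). (m + i, i)"]) auto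
 then have "((\<lambda>x. F ((\<lambda>(n, i). (n - i, i)) x)) has_sum s) (SIGMA n:UNIV. {..n})"
  using hs s has_sum_reindex_bij_betw by blast
 moreover have "((\<lambda>i. F ((\<lambda>(n, i). (n - i, i)) (n, i))) has_sum
   complex_of_real (\<Sum>i\<le>n. a i * a (n - i)) * q n) {..n}" for n
 proof -
  have "(\<Sum>i\<le>n. F ((\<lambda>(n, i). (n - i, i)) (n, i))) = complex_of_real (\<Sum>i\<le>n. a i * a (n - i)) * q n"
   by (auto simp: F_def sum_distrib_left mult_ac intro!: sum.cong)
  moreover have "((\<lambda>i. F ((\<lambda>(n, i). (n - i, i)) (n, i))) has_sum
    (\<Sum>i\<le>n. F ((\<lambda>(n, i). (n - i, i)) (n, i)))) {..n}"
   by (rule has_sum_finite) simp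
  ultimately show ?thesis by (simp only:)
 qed
 ultimately have "((\<lambda>n. complex_of_real (\<Sum>i\<le>n. a i * a (n - i)) * q n) has_sum s) UNIV"
  by (rule has_sum_SigmaD)
 then show ?thesis by (rule has_sum_imp_sums)
qed

section \<open>Square roots of positive bounded operators\<close>

context semi_inner
begin

text \<open>Symmetry moves \<open>A\<close> to the other argument, where additivity is that of the
  inner product; the representatives \<open>A x\<close> themselves may depend on \<open>x\<close> in
  a nonlinear way.\<close>

lemma symmetric_weakly_linear:
 assumes A: "\<And>f. f \<in> H ==> A f \<in> H" "\<And>f g. f \<in> H ==> g \<in> H ==> ip (A f) g = ip f (A g)"
  and "x \<in> H" "y \<in> H" "z \<in> H"
 shows "ip (A (x + y)) z = ip (A x) z + ip (A y) z" "ip (A (x - y)) z = ip (A x) z - ip (A y) z"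
  "ip (A (sc c x)) z = c * ip (A x) z"
 using assms by (simp_all add: ip_simps mems)

text \<open>The form of \<open>A\<close> is minimal at \<open>h\<close>, so its first variation in
  the direction \<open>A h\<close>, which is twice the squared norm of \<open>A h\<close>,
  vanishes.\<close>

lemma symmetric_nonneg_null:
 assumes A: "\<And>f. f \<in> H ==> A f \<in> H" "\<And>f g. f \<in> H ==> g \<in> H ==> ip (A f) g = ip f (A g)"
  and nn: "\<And>f. f \<in> H ==> 0 <= Re (ip (A f) f)"
  and h: "h \<in> H" "Re (ip (A h) h) = 0"
 shows "nrm (A h) = 0"
proof -
 define z where "z = A h"
 have z: "z \<in> H" using A h by (simp add: z_def)
 define K where "K = Re (ip (A z) z)"
 have K: "K >= 0" using nn z by (simp add: K_def)
 define N where "N = (nrm z)^2"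
 have ineq: "0 <= 2 * t * N + t^2 * K" for t :: real
 proof -
  define y where "y = sc (complex_of_real t) z"
  have y: "y \<in> H" using z by (simp add: y_def sc_mem)
  have "ip (A (h + y)) (h + y) = ip (A h) h + ip (A h) y + ip (A y) h + ip (A y) y"
   using h y A by (simp add: symmetric_weakly_linear[where A = A] ip_simps mems)
  moreover have "Re (ip (A h) y) = t * N"
   using z ip_self[OF z] by (simp add: y_def ip_simps N_def flip: z_def)
  moreover have "Re (ip (A y) h) = Re (ip (A h) y)"
   using A h y ip_cnj[of "A h" y] by simp
  moreover have "Re (ip (A y) y) = t^2 * K"
   using z A by (simp add: y_def ip_simps symmetric_weakly_linear[where A = A] mems K_def power2_eq_square)
  ultimately show ?thesis
   using nn[of "h + y"] h y mems(2) by (simp add: h(2) algebra_simps)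
 qed
 have "N <= 0"
 proof (rule ccontr)
  assume "\<not> N <= 0"
  then have N: "N > 0" by simp
  define e where "e = N / (K + 1)"
  have e: "e > 0" "e * K <= N" using N K by (auto simp: e_def field_simps)
  have "0 <= e * (e * K - 2 * N)"
   using ineq[of "- e"] by (simp add: power2_eq_square algebra_simps)
  then show False using e N by (simp add: zero_le_mult_iff)
 qed
 then show ?thesis by (simp add: N_def z_def)
qed

end

context semi_hilbert
begin

text \<open>\<open>R\<close> is \<open>1 - sqrt (1 - X)\<close> as a power series in the contraction
  \<open>X\<close>. The series is summed inside inner products, so Riesz representation takes the
  place of operator convergence. The coefficients add up to at most one, which bounds the form of
  \<open>R\<close> and later makes the root positive.\<close>

lemma sqrt_series:
 assumes X: "\<And>f. f \<in> H ==> X f \<in> H" "\<And>f g. f \<in> H ==> g \<in> H ==> ip (X f) g = ip f (X g)"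
  "\<And>f. f \<in> H ==> nrm (X f) <= nrm f"
 obtains R where "\<And>f. f \<in> H ==> R f \<in> H"
  "\<And>f g. f \<in> H ==> g \<in> H ==> (\<lambda>n. sqrt_coeff n * ip ((X ^^ n) f) g) sums ip (R f) g"
  "\<And>f g. f \<in> H ==> g \<in> H ==> ip (R f) g = ip f (R g)"
  "\<And>f. f \<in> H ==> Re (ip (R f) f) <= (nrm f)^2"
  "\<And>f g. f \<in> H ==> g \<in> H ==> ip (R (R f)) g = 2 * ip (R f) g - ip (X f) g"
proof -
 let ?a = sqrt_coeff
 have XH: "(X ^^ n) f \<in> H" if "f \<in> H" for n f using that X(1) by (induction n) auto
 have Xb: "nrm ((X ^^ n) f) <= nrm f" if "f \<in> H" for n f
  using that X(3) XH by (induction n) (auto intro: order_trans)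
 have Xs: "ip ((X ^^ n) f) g = ip f ((X ^^ n) g)" if "f \<in> H" "g \<in> H" for n f g
  using that
 proof (induction n arbitrary: g)
  case (Suc n)
  then show ?case using X XH by (metis (no_types, lifting) comp_apply funpow.simps(2) funpow_Suc_right)
 qed simp
 have tb: "cmod (?a n * ip ((X ^^ n) f) g) <= ?a n * (nrm f * nrm g)" if "f \<in> H" "g \<in> H" for n f g
 proof -
  have "cmod (ip ((X ^^ n) f) g) <= nrm ((X ^^ n) f) * nrm g"
   using Cauchy_Schwarz XH that by blast
  also have "\<dots> <= nrm f * nrm g" using Xb that nrm_nonneg by (intro mult_right_mono) auto
  finally show ?thesis
   using sqrt_coeff_nonneg by (simp add: norm_mult mult_left_mono)
 qed
 have sn: "summable (\<lambda>n. cmod (?a n * ip ((X ^^ n) f) g))" if "f \<in> H" "g \<in> H" for f g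
  by (rule summable_comparison_test'[OF summable_mult2[OF summable_sqrt_coeff, of "nrm f * nrm g"]])
   (use tb that in auto)
 have bd: "cmod (\<Sum>n. ?a n * ip ((X ^^ n) f) g) <= nrm f * nrm g" if "f \<in> H" "g \<in> H" for f g
 proof -
  have "cmod (\<Sum>n. ?a n * ip ((X ^^ n) f) g) <= (\<Sum>n. cmod (?a n * ip ((X ^^ n) f) g))"
   using summable_norm[OF sn] that by blast
  also have "\<dots> <= (\<Sum>n. ?a n * (nrm f * nrm g))"
   by (intro suminf_le tb sn summable_mult2 summable_sqrt_coeff that)
  also have "\<dots> = suminf ?a * (nrm f * nrm g)"
   by (rule suminf_mult2[symmetric, OF summable_sqrt_coeff])
  also have "\<dots> <= 1 * (nrm f * nrm g)"
   using that nrm_nonneg suminf_sqrt_coeff_le_1 by (intro mult_right_mono) auto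
  finally show ?thesis by simp
 qed
 have smm: "summable (\<lambda>n. ?a n * ip ((X ^^ n) f) g)" if "f \<in> H" "g \<in> H" for f g
  by (rule summable_norm_cancel[OF sn[OF that]])
 \<comment> \<open>Riesz puts the vector into the second argument; \<open>sym\<close> below moves
   \<open>R\<close> to the first one.\<close>
 have "\<exists>p\<in>H. \<forall>z\<in>H. ip z p = (\<Sum>n. ?a n * ip ((X ^^ n) z) f)" if f: "f \<in> H" for f
 proof (rule Riesz)
  fix x y c assume x: "x \<in> H"
  show "(\<Sum>n. ?a n * ip ((X ^^ n) (sc c x)) f) = c * (\<Sum>n. ?a n * ip ((X ^^ n) x) f)"
   using smm[OF x f] x f XH by (subst suminf_mult[symmetric]) (auto simp: Xs ip_simps mems mult_ac)
  show "cmod (\<Sum>n. ?a n * ip ((X ^^ n) x) f) <= nrm f * nrm x"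
   using bd[OF x f] by (simp add: mult.commute)
  assume y: "y \<in> H"
  show "(\<Sum>n. ?a n * ip ((X ^^ n) (x + y)) f)
   = (\<Sum>n. ?a n * ip ((X ^^ n) x) f) + (\<Sum>n. ?a n * ip ((X ^^ n) y) f)"
   using smm[OF x f] smm[OF y f] x y f XH
   by (subst suminf_add) (auto simp: Xs ip_simps mems distrib_left)
 qed
 then obtain R where R: "\<And>f. f \<in> H ==> R f \<in> H"
  "\<And>f z. f \<in> H ==> z \<in> H ==> ip z (R f) = (\<Sum>n. ?a n * ip ((X ^^ n) z) f)"
  by metis
 have sms: "(\<lambda>n. ?a n * ip ((X ^^ n) f) g) sums ip f (R g)" if "f \<in> H" "g \<in> H" for f g
  using smm[OF that] R(2) that by (simp add: summable_sums)
 have sym: "ip (R f) g = ip f (R g)" if fg: "f \<in> H" "g \<in> H" for f g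
 proof -
  have "(\<lambda>n. cnj (?a n * ip ((X ^^ n) g) f)) sums cnj (ip g (R f))"
   using sms[OF fg(2,1)] by (simp only: sums_cnj)
  moreover have "(\<lambda>n. cnj (?a n * ip ((X ^^ n) g) f)) = (\<lambda>n. ?a n * ip ((X ^^ n) f) g)"
  proof
   show "cnj (?a n * ip ((X ^^ n) g) f) = ?a n * ip ((X ^^ n) f) g" for n
    using fg ip_cnj[of "(X ^^ n) g" f] XH[of g n] Xs[of f g n] by simp
  qed
  moreover have "cnj (ip g (R f)) = ip (R f) g" using ip_cnj[of g "R f"] R(1) fg by simp
  ultimately have "(\<lambda>n. ?a n * ip ((X ^^ n) f) g) sums ip (R f) g" by simp
  then show ?thesis using sums_unique2[OF sms[OF fg]] by metis
 qed
 have RR: "ip (R (R f)) g = 2 * ip (R f) g - ip (X f) g" if fg: "f \<in> H" "g \<in> H" for f g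
 proof -
  have "(\<lambda>i. ?a i * ip ((X ^^ (n + i)) f) g) sums ip ((X ^^ n) (R f)) g" for n
  proof -
   have "(\<lambda>i. ?a i * ip ((X ^^ i) f) ((X ^^ n) g)) sums (ip f (R ((X ^^ n) g)))"
    by (intro sms fg XH)
   moreover have "ip ((X ^^ i) f) ((X ^^ n) g) = ip ((X ^^ (n + i)) f) g" for i
    using fg XH Xs by (metis comp_apply funpow_add)
   moreover have "ip f (R ((X ^^ n) g)) = ip ((X ^^ n) (R f)) g"
    using fg XH Xs R(1) sym by metis
   ultimately show ?thesis by simp
  qed
  moreover have "(\<lambda>n. ?a n * ip ((X ^^ n) (R f)) g) sums ip (R (R f)) g"
   using sms[OF R(1)[OF fg(1)] fg(2)] sym[OF R(1)[OF fg(1)] fg(2)] by simp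
  moreover have "cmod (ip ((X ^^ n) f) g) <= nrm f * nrm g" for n
   using Cauchy_Schwarz[OF XH[OF fg(1)] fg(2)] Xb[OF fg(1)] nrm_nonneg[OF fg(2)]
   by (meson mult_right_mono order_trans)
  ultimately have "(\<lambda>n. complex_of_real (\<Sum>i\<le>n. ?a i * ?a (n - i)) * ip ((X ^^ n) f) g) sums ip (R (R f)) g"
   by (intro sums_antidiagonal[OF sqrt_coeff_nonneg summable_sqrt_coeff,
      where B = "nrm f * nrm g" and r = "\<lambda>n. ip ((X ^^ n) (R f)) g"])
  moreover have "(\<lambda>n. 2 * (?a n * ip ((X ^^ n) f) g) - (if n = 1 then ip ((X ^^ n) f) g else 0))
   sums (2 * ip f (R g) - ip ((X ^^ 1) f) g)"
   by (intro sums_diff sums_mult sms fg sums_single)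
  moreover have "complex_of_real (\<Sum>i\<le>n. ?a i * ?a (n - i)) * ip ((X ^^ n) f) g
   = 2 * (?a n * ip ((X ^^ n) f) g) - (if n = 1 then ip ((X ^^ n) f) g else 0)" for n
   unfolding sqrt_coeff_square by (simp add: algebra_simps)
  ultimately show ?thesis using sums_unique2 sym[OF fg] by fastforce
 qed
 have "Re (ip (R f) f) <= (nrm f)^2" if f: "f \<in> H" for f
 proof -
  have "ip (R f) f = (\<Sum>n. ?a n * ip ((X ^^ n) f) f)"
   using sms[OF f f] sym[OF f f] sums_unique by metis
  then show ?thesis
   using bd[OF f f] complex_Re_le_cmod[of "ip (R f) f"] by (simp add: power2_eq_square)
 qed
 show ?thesis
  by (rule that[of R]) (use R sms sym RR \<open>\<And>f. f \<in> H ==> Re (ip (R f) f) <= (nrm f)^2\<close> in auto)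
qed

text \<open>Apply the series to \<open>X = 1 - J / c\<close> and rescale:
  \<open>S = sqrt c (1 - R)\<close>. The last clause, commutation with every symmetric map that
  commutes with \<open>J\<close>, prepares the uniqueness of the root.\<close>

lemma positive_sqrt_exists:
 assumes J: "\<And>f. f \<in> H ==> J f \<in> H" "\<And>f g. f \<in> H ==> g \<in> H ==> ip (J f) g = ip f (J g)"
  and c: "c > 0" "\<And>f. f \<in> H ==> (nrm (J f))^2 <= c * Re (ip (J f) f)"
 obtains S where "\<And>f. f \<in> H ==> S f \<in> H"
  "\<And>f g. f \<in> H ==> g \<in> H ==> ip (S f) g = ip f (S g)"
  "\<And>f. f \<in> H ==> 0 <= Re (ip (S f) f)"
  "\<And>f g. f \<in> H ==> g \<in> H ==> ip (S (S f)) g = ip (J f) g"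
  "\<And>T f g. (\<And>f. f \<in> H ==> T f \<in> H) ==>
   (\<And>f g. f \<in> H ==> g \<in> H ==> ip (T f) g = ip f (T g)) ==>
   (\<And>f g. f \<in> H ==> g \<in> H ==> ip (T (J f)) g = ip (J (T f)) g) ==>
   f \<in> H ==> g \<in> H ==> ip (T (S f)) g = ip (S (T f)) g"
proof -
 define X where "X f = f - sc (complex_of_real (1 / c)) (J f)" for f
 have X1: "X f \<in> H" if "f \<in> H" for f using that J by (simp add: X_def mems)
 have Xip: "ip (X f) g = ip f g - complex_of_real (1 / c) * ip (J f) g" if "f \<in> H" "g \<in> H" for f g
  using that J by (simp add: X_def ip_simps mems)
 have X2: "ip (X f) g = ip f (X g)" if "f \<in> H" "g \<in> H" for f g
  using that J by (simp add: X_def ip_simps mems)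
 \<comment> \<open>The hypothesis on \<open>c\<close> bounds the quadratic term
   \<open>(nrm (J f))^2 / c^2\<close> by half of the linear one.\<close>
 have X3: "nrm (X f) <= nrm f" if f: "f \<in> H" for f
 proof -
  have "(nrm (X f))^2 = (nrm f)^2 - 2 / c * Re (ip (J f) f) + (nrm (J f))^2 / c^2"
   using f J c unfolding X_def
   by (simp add: nrm_diff_sq mems nrm_sc_sq ip_simps norm_divide power_divide)
  moreover have "(nrm (J f))^2 / c^2 <= c * Re (ip (J f) f) / c^2"
   using c(2)[OF f] by (intro divide_right_mono) auto
  moreover have "c * Re (ip (J f) f) / c^2 = Re (ip (J f) f) / c"
   by (simp add: power2_eq_square)
  moreover have "0 <= c * Re (ip (J f) f)" using c(2)[OF f] by (smt (verit) zero_le_power2)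
  then have "0 <= Re (ip (J f) f) / c" using c by (simp add: zero_le_mult_iff)
  ultimately have "(nrm (X f))^2 <= (nrm f)^2" by simp
  then show ?thesis using nrm_nonneg f by (meson power2_le_imp_le)
 qed
 obtain R where R: "\<And>f. f \<in> H ==> R f \<in> H"
  "\<And>f g. f \<in> H ==> g \<in> H ==> (\<lambda>n. sqrt_coeff n * ip ((X ^^ n) f) g) sums ip (R f) g"
  "\<And>f g. f \<in> H ==> g \<in> H ==> ip (R f) g = ip f (R g)"
  "\<And>f. f \<in> H ==> Re (ip (R f) f) <= (nrm f)^2"
  "\<And>f g. f \<in> H ==> g \<in> H ==> ip (R (R f)) g = 2 * ip (R f) g - ip (X f) g"
  using sqrt_series[of X] X1 X2 X3 by blast
 have XH: "(X ^^ n) f \<in> H" if "f \<in> H" for n f using that X1 by (induction n) auto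
 define q where "q = complex_of_real (sqrt c)"
 have q2: "q * q = complex_of_real c" using c by (simp add: q_def flip: of_real_mult)
 have qc: "cnj q = q" by (simp add: q_def)
 define S where "S f = sc q (f - R f)" for f
 have S1: "S f \<in> H" if "f \<in> H" for f using that R by (simp add: S_def mems)
 have Sip: "ip (S f) g = q * (ip f g - ip (R f) g)" if "f \<in> H" "g \<in> H" for f g
  using that R by (simp add: S_def ip_simps mems)
 have S2: "ip (S f) g = ip f (S g)" if "f \<in> H" "g \<in> H" for f g
  using that R by (simp add: S_def ip_simps mems qc)
 have S3: "0 <= Re (ip (S f) f)" if f: "f \<in> H" for f
 proof -
  have "Re (ip (S f) f) = sqrt c * ((nrm f)^2 - Re (ip (R f) f))"
   using Sip[OF f f] f by (simp add: q_def nrm_sq)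
  then show ?thesis using R(4)[OF f] c by simp
 qed
 have S4: "ip (S (S f)) g = ip (J f) g" if fg: "f \<in> H" "g \<in> H" for f g
 proof -
  have "ip (S (S f)) g = q * (ip (S f) g - ip (S f) (R g))"
   using fg S1 R by (simp add: Sip)
  also have "\<dots> = q * q * (ip f g - 2 * ip (R f) g + ip (R (R f)) g)"
   using fg S1 R by (simp add: Sip algebra_simps)
  also have "\<dots> = complex_of_real c * (ip f g - ip (X f) g)"
   using fg R by (simp add: q2)
  also have "\<dots> = ip (J f) g" using c fg by (simp add: Xip)
  finally show ?thesis .
 qed
 have S5: "ip (T (S f)) g = ip (S (T f)) g"
  if T: "\<And>f. f \<in> H ==> T f \<in> H" "\<And>f g. f \<in> H ==> g \<in> H ==> ip (T f) g = ip f (T g)"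
   "\<And>f g. f \<in> H ==> g \<in> H ==> ip (T (J f)) g = ip (J (T f)) g"
   and fg: "f \<in> H" "g \<in> H" for T f g
 proof -
  have TX: "ip (T (X h)) z = ip (X (T h)) z" if "h \<in> H" "z \<in> H" for h z
  proof -
   have "ip (T (X h)) z = ip h (T z) - complex_of_real (1 / c) * ip (J h) (T z)"
    using that T X1 Xip by simp
   also have "\<dots> = ip (T h) z - complex_of_real (1 / c) * ip (T (J h)) z"
    using that T J by simp
   also have "\<dots> = ip (X (T h)) z" using that T by (simp add: Xip)
   finally show ?thesis .
  qed
  have TXn: "ip (T ((X ^^ n) h)) z = ip ((X ^^ n) (T h)) z" if "h \<in> H" "z \<in> H" for n h z
   using that(2)
  proof (induction n arbitrary: z)
   case (Suc n)
   have "ip (T ((X ^^ Suc n) h)) z = ip (X (T ((X ^^ n) h))) z"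
    using TX XH that Suc by simp
   also have "\<dots> = ip (T ((X ^^ n) h)) (X z)" using T XH that Suc X2 by simp
   also have "\<dots> = ip ((X ^^ n) (T h)) (X z)" using Suc X1 by simp
   also have "\<dots> = ip ((X ^^ Suc n) (T h)) z" using T XH that Suc X2 by simp
   finally show ?case .
  qed simp
  have "(\<lambda>n. sqrt_coeff n * ip ((X ^^ n) f) (T g)) sums ip (R f) (T g)"
   using R(2) fg T by blast
  moreover have "ip ((X ^^ n) f) (T g) = ip ((X ^^ n) (T f)) g" for n
   using TXn[OF fg, of n] T XH fg by simp
  ultimately have "(\<lambda>n. sqrt_coeff n * ip ((X ^^ n) (T f)) g) sums ip (T (R f)) g"
   using T R(1) fg by simp
  then have "ip (T (R f)) g = ip (R (T f)) g"
   using R(2)[of "T f" g] fg T sums_unique2 by blast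
  then show ?thesis
   using fg T R(1) S1 by (simp add: Sip)
 qed
 show ?thesis using that[of S] S1 S2 S3 S4 S5 by blast
qed

text \<open>For \<open>h = S f - T f\<close> the forms of \<open>S\<close> and \<open>T\<close> at
  \<open>h\<close> add up to the pairing of \<open>(S^2 - T^2) f\<close> with \<open>h\<close>,
  which is zero. Both forms are nonnegative, so \<open>S h\<close> and \<open>T h\<close> are null,
  and then so is \<open>h\<close>.\<close>

lemma positive_sqrt_unique:
 assumes S: "\<And>f. f \<in> H ==> S f \<in> H" "\<And>f g. f \<in> H ==> g \<in> H ==> ip (S f) g = ip f (S g)"
  "\<And>f. f \<in> H ==> 0 <= Re (ip (S f) f)"
  and T: "\<And>f. f \<in> H ==> T f \<in> H" "\<And>f g. f \<in> H ==> g \<in> H ==> ip (T f) g = ip f (T g)"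
  "\<And>f. f \<in> H ==> 0 <= Re (ip (T f) f)"
  and sq: "\<And>f g. f \<in> H ==> g \<in> H ==> ip (S (S f)) g = ip (T (T f)) g"
  and comm: "\<And>f g. f \<in> H ==> g \<in> H ==> ip (T (S f)) g = ip (S (T f)) g"
  and f: "f \<in> H"
 shows "nrm (S f - T f) = 0"
proof -
 define h where "h = S f - T f"
 have h: "h \<in> H" using S T f by (simp add: h_def mems)
 have Sh: "ip (S h) z = ip (S (S f)) z - ip (S (T f)) z" if "z \<in> H" for z
  unfolding h_def using that S T f by (simp add: symmetric_weakly_linear[where A = S])
 have Th: "ip (T h) z = ip (T (S f)) z - ip (T (T f)) z" if "z \<in> H" for z
  unfolding h_def using that S T f by (simp add: symmetric_weakly_linear[where A = T])
 have "ip (S h) h + ip (T h) h = 0"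
  using Sh[OF h] Th[OF h] sq[OF f h] comm[OF f h] by simp
 then have "Re (ip (S h) h) + Re (ip (T h) h) = 0" by (metis plus_complex.simps(1) zero_complex.simps(1))
 then have "Re (ip (S h) h) = 0" "Re (ip (T h) h) = 0" using S(3)[OF h] T(3)[OF h] by auto
 then have "nrm (S h) = 0" "nrm (T h) = 0"
  using symmetric_nonneg_null[of S h] symmetric_nonneg_null[of T h] S T h by auto
 then have "ip (S h) f = 0" "ip (T h) f = 0"
  using nrm_eq_zero_iff_orth S(1) T(1) h f by blast+
 then have "ip h (S f) = 0" "ip h (T f) = 0" using S(2) T(2) h f by auto
 then have "ip h h = 0"
  using ip_diff_right[of "S f" "T f" h] S(1) T(1) f h by (simp add: h_def)
 then show ?thesis by (simp add: nrm_def flip: h_def)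
qed

end

section \<open>Square integrable functions\<close>

lemma L2_measurable [measurable_dest]: "f \<in> L2 M ==> f \<in> borel_measurable M"
 by (simp add: L2_def)

lemma L2_integrable: "f \<in> L2 M ==> integrable M (\<lambda>x. (cmod (f x))^2)"
 by (simp add: L2_def)

lemma L2_dominated:
 assumes "f \<in> borel_measurable M" "integrable M g" "AE x in M. (cmod (f x))^2 <= g x"
 shows "f \<in> L2 M"
 unfolding L2_def using assms
 by (auto intro!: Bochner_Integration.integrable_bound[OF assms(2)] elim!: eventually_mono)

lemma L2_zero: "(\<lambda>x. 0) \<in> L2 M"
 by (simp add: L2_def)

lemma cmod_add_sq_le: "(cmod (a + b))^2 <= 2 * (cmod a)^2 + 2 * (cmod b)^2"
proof -
 have "(cmod (a + b))^2 <= (cmod a + cmod b)^2"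
  by (intro power_mono norm_triangle_ineq) simp
 also have "\<dots> <= 2 * (cmod a)^2 + 2 * (cmod b)^2"
  using sum_squares_bound[of "cmod a" "cmod b"] by (simp add: power2_sum)
 finally show ?thesis .
qed

lemma L2_add: "f \<in> L2 M ==> g \<in> L2 M ==> (\<lambda>x. f x + g x) \<in> L2 M"
 by (rule L2_dominated[where g = "\<lambda>x. 2 * (cmod (f x))^2 + 2 * (cmod (g x))^2"])
  (auto simp: cmod_add_sq_le L2_measurable intro!: L2_integrable)

lemma L2_mult_bounded:
 assumes "f \<in> L2 M" "c \<in> borel_measurable M" "AE x in M. cmod (c x) <= B"
 shows "(\<lambda>x. c x * f x) \<in> L2 M"
proof (rule L2_dominated[where g = "\<lambda>x. B^2 * (cmod (f x))^2"])
 show "AE x in M. (cmod (c x * f x))^2 <= B^2 * (cmod (f x))^2"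
  using assms(3) by eventually_elim (auto simp: norm_mult power_mult_distrib intro!: mult_right_mono power_mono)
qed (use assms in \<open>auto simp: L2_measurable intro!: L2_integrable\<close>)

lemma L2_cmult: "f \<in> L2 M ==> (\<lambda>x. c * f x) \<in> L2 M"
 by (rule L2_mult_bounded[where B = "cmod c"]) auto

lemma L2_diff: "f \<in> L2 M ==> g \<in> L2 M ==> (\<lambda>x. f x - g x) \<in> L2 M"
 using L2_add[of f M "\<lambda>x. (- 1) * g x"] L2_cmult[of g M "- 1"] by simp

lemma L2_cong_AE:
 assumes "f \<in> L2 M" "g \<in> borel_measurable M" "AE x in M. f x = g x"
 shows "g \<in> L2 M"
 by (rule L2_dominated[OF assms(2) L2_integrable[OF assms(1)]]) (use assms(3) in auto)

lemma borel_measurable_cnj [measurable (raw)]: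
 "f \<in> borel_measurable M ==> (\<lambda>x. cnj (f x)) \<in> borel_measurable M"
 by (rule borel_measurable_continuous_on[where f = cnj]) (auto intro: continuous_intros)

lemma L2_inner_integrable:
 assumes "f \<in> L2 M" "g \<in> L2 M"
 shows "integrable M (\<lambda>x. f x * cnj (g x))"
proof (rule Bochner_Integration.integrable_bound[where f = "\<lambda>x. (cmod (f x))^2 + (cmod (g x))^2"])
 have "a * b <= a^2 + b^2" for a b :: real
 proof -
  have "2 * (a * b) <= a^2 + b^2" using sum_squares_bound[of a b] by (simp add: mult.assoc)
  moreover have "0 <= a^2 + b^2" by simp
  ultimately show ?thesis by linarith
 qed
 then show "AE x in M. norm (f x * cnj (g x)) <= norm ((cmod (f x))^2 + (cmod (g x))^2)"
  by (simp add: norm_mult)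
qed (use assms in \<open>auto simp: L2_measurable intro!: L2_integrable\<close>)

lemma l2_inner_cong_AE:
 assumes "AE x in M. f x = f' x" "AE x in M. g x = g' x"
  "f \<in> borel_measurable M" "f' \<in> borel_measurable M" "g \<in> borel_measurable M" "g' \<in> borel_measurable M"
 shows "l2_inner M f g = l2_inner M f' g'"
 unfolding l2_inner_def using assms(1,2) assms(3-)
 by (intro integral_cong_AE) (auto elim: eventually_elim2)

abbreviation (input) L2_scale :: "complex => ('a => complex) => 'a => complex" where
 "L2_scale \<equiv> \<lambda>c f x. c * f x"

lemma Re_l2_inner_self:
 assumes "f \<in> L2 M"
 shows "Re (l2_inner M f f) = (LINT x|M. (cmod (f x))^2)"
proof -
 have "l2_inner M f f = (LINT x|M. complex_of_real ((cmod (f x))^2))"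
  unfolding l2_inner_def by (intro Bochner_Integration.integral_cong refl) (simp only: complex_norm_square)
 then show ?thesis by (simp only: integral_complex_of_real Re_complex_of_real)
qed

lemma semi_inner_L2_subspace:
 assumes D: "D \<subseteq> L2 M" "(\<lambda>x. 0) \<in> D" "\<And>f g. f \<in> D ==> g \<in> D ==> (\<lambda>x. f x + g x) \<in> D"
  "\<And>c f. f \<in> D ==> (\<lambda>x. c * f x) \<in> D"
 shows "semi_inner D L2_scale (l2_inner M)"
proof
 show "0 \<in> D" using D(2) by (simp add: zero_fun_def)
 fix f g assume f: "f \<in> D" and g: "g \<in> D"
 then have f2: "f \<in> L2 M" and g2: "g \<in> L2 M" using D by auto
 show "f + g \<in> D" using D(3)[OF f g] by (simp add: plus_fun_def)
 show "l2_inner M g f = cnj (l2_inner M f g)"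
 proof -
  have "(\<lambda>x. g x * cnj (f x)) = (\<lambda>x. cnj (f x * cnj (g x)))" by (simp add: mult.commute)
  then show ?thesis unfolding l2_inner_def by (simp only: Bochner_Integration.integral_cnj)
 qed
 fix h assume h: "h \<in> D"
 then have h2: "h \<in> L2 M" using D by auto
 show "l2_inner M (f + g) h = l2_inner M f h + l2_inner M g h"
  unfolding l2_inner_def using f2 g2 h2
  by (subst Bochner_Integration.integral_add[symmetric]) (auto simp: distrib_right intro!: L2_inner_integrable)
next
 fix c f assume f: "f \<in> D"
 then have f2: "f \<in> L2 M" using D by auto
 show "L2_scale c f \<in> D" using D(4)[OF f] .
 show "L2_scale (- 1) f = - f" by (simp add: fun_eq_iff)
 show "0 <= Re (l2_inner M f f)" by (simp add: Re_l2_inner_self[OF f2])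
 fix h assume "h \<in> D"
 then have "h \<in> L2 M" using D by auto
 then show "l2_inner M (L2_scale c f) h = c * l2_inner M f h"
  unfolding l2_inner_def using f2 by (simp add: mult.assoc)
qed

interpretation L2: semi_inner "L2 M" L2_scale "l2_inner M" for M
 by (intro semi_inner_L2_subspace L2_zero L2_add L2_cmult) auto

lemma L2_nrm_eq: "f \<in> L2 M ==> L2.nrm M f = l2_norm M f"
 by (simp add: L2.nrm_def l2_norm_def Re_l2_inner_self)

lemma L2_nrm_sq: "f \<in> L2 M ==> (L2.nrm M f)^2 = (LINT x|M. (cmod (f x))^2)"
 by (simp add: L2.nrm_sq Re_l2_inner_self)

lemma L2_nn_integral:
 assumes "f \<in> L2 M"
 shows "(\<integral>\<^sup>+x. ennreal ((cmod (f x))^2) \<partial>M) = ennreal ((L2.nrm M f)^2)"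
 using L2_integrable[OF assms] by (simp add: L2_nrm_sq[OF assms] nn_integral_eq_integral)

lemma L2_nn_integral_iff:
 assumes "f \<in> borel_measurable M"
 shows "f \<in> L2 M \<longleftrightarrow> (\<integral>\<^sup>+x. ennreal ((cmod (f x))^2) \<partial>M) < \<infinity>"
 using assms by (auto simp: L2_def integrable_iff_bounded)

lemma L2_nrm_zero_iff:
 assumes "f \<in> L2 M"
 shows "L2.nrm M f = 0 \<longleftrightarrow> (AE x in M. f x = 0)"
proof -
 have "L2.nrm M f = 0 \<longleftrightarrow> (L2.nrm M f)^2 = 0" by simp
 also have "\<dots> \<longleftrightarrow> (\<integral>\<^sup>+x. ennreal ((cmod (f x))^2) \<partial>M) = 0"
  by (simp add: L2_nn_integral[OF assms])
 also have "\<dots> \<longleftrightarrow> (AE x in M. f x = 0)"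
  using L2_measurable[OF assms] by (subst nn_integral_0_iff_AE) auto
 finally show ?thesis .
qed

text \<open>Riesz-Fischer: a subsequence with geometrically small increments converges absolutely
  almost everywhere, and Fatou's lemma shows that the whole sequence tends to its limit.\<close>

lemma L2_complete:
 assumes s: "\<And>n. s n \<in> L2 M"
  and cau: "\<And>e. e > 0 ==> \<exists>N. \<forall>m\<ge>N. \<forall>n\<ge>N. L2.nrm M (s m - s n) < e"
 shows "\<exists>l\<in>L2 M. (\<lambda>n. L2.nrm M (s n - l)) \<longlonglongrightarrow> 0"
proof -
 have "\<exists>N. \<forall>m\<ge>N. \<forall>n\<ge>N. L2.nrm M (s m - s n) < (1/2) ^ k" for k :: nat
  using cau[of "(1/2) ^ k"] by simp
 then obtain N where N: "\<And>k m n. m >= N k ==> n >= N k ==> L2.nrm M (s m - s n) < (1/2) ^ k"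
  by metis
 \<comment> \<open>The sum makes \<open>r\<close> increasing with \<open>r k >= N k\<close>; the
   summand \<open>k\<close> sends it to infinity.\<close>
 define r where "r k = (\<Sum>i\<le>k. N i) + k" for k :: nat
 have rN: "r k >= N k" for k
  unfolding r_def using member_le_sum[of k "{..k}" N] by simp
 have rmono: "r k <= r (Suc k)" for k by (simp add: r_def)
 have rk: "r k >= k" for k by (simp add: r_def)
 define d where "d k x = s (r (Suc k)) x - s (r k) x" for k x
 have dL: "d k \<in> L2 M" for k unfolding d_def[abs_def] by (intro L2_diff s)
 have "d k = s (r (Suc k)) - s (r k)" for k by (simp add: fun_eq_iff d_def)
 then have dn: "L2.nrm M (d k) <= (1/2) ^ k" for k
  using N[of k "r (Suc k)" "r k"] rN[of k] rmono[of k] by fastforce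
 \<comment> \<open>Complex valued, so that the triangle inequality for \<open>L2.nrm\<close> bounds
   its norm by a geometric series.\<close>
 define g where "g n x = (\<Sum>k<n. complex_of_real (cmod (d k x)))" for n x
 have gL: "g n \<in> L2 M \<and> L2.nrm M (g n) <= (\<Sum>k<n. (1/2) ^ k)" for n
 proof (induction n)
  case 0
  have "g 0 = 0" by (simp add: fun_eq_iff g_def)
  then show ?case
   using L2.zero_mem[of M] L2.ip_zero_left[of 0 M] by (simp add: L2.nrm_def del: zero_fun_apply)
 next
  case (Suc n)
  define c where "c x = complex_of_real (cmod (d n x))" for x
  have c: "c \<in> L2 M"
   by (rule L2_dominated[OF _ L2_integrable[OF dL[of n]]])
    (use L2_measurable[OF dL[of n]] in \<open>auto simp: c_def[abs_def]\<close>)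
  have "L2.nrm M c = L2.nrm M (d n)"
   by (simp add: L2_nrm_eq c dL) (simp add: l2_norm_def c_def)
  moreover have e: "g (Suc n) = g n + c" by (simp add: fun_eq_iff g_def c_def)
  moreover have "L2.nrm M (g n + c) <= L2.nrm M (g n) + L2.nrm M c" "g n + c \<in> L2 M"
   using L2.nrm_triangle[of "g n" M c] L2.add_mem[of "g n" M c] Suc c by blast+
  moreover have "L2.nrm M (g n) <= (\<Sum>k<n. (1/2) ^ k)" using Suc by simp
  ultimately have "g (Suc n) \<in> L2 M" "L2.nrm M (g (Suc n)) <= (\<Sum>k<n. (1/2) ^ k) + (1/2) ^ n"
   unfolding e using dn[of n] by (blast, linarith)
  then show ?case by simp
 qed
 have gm [measurable]: "g n \<in> borel_measurable M" for n
  using gL L2_measurable by blast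
 have geo: "(\<Sum>k<n. (1/2::real) ^ k) <= 2" for n
  using sum_le_suminf[of "\<lambda>k. (1/2::real) ^ k" "{..<n}"] suminf_geometric[of "1/2::real"] by simp
 have g4: "(\<integral>\<^sup>+x. ennreal ((cmod (g n x))^2) \<partial>M) <= 4" for n
 proof -
  have "(L2.nrm M (g n))^2 <= 2^2"
   using gL[of n] geo[of n] L2.nrm_nonneg[of "g n" M] by (intro power_mono) auto
  then show ?thesis using gL[of n] by (simp add: L2_nn_integral ennreal_le_iff[symmetric])
 qed
 have gx: "cmod (g n x) = (\<Sum>k<n. cmod (d k x))" for n x
  unfolding g_def of_real_sum[symmetric] norm_of_real by (simp add: sum_nonneg)
 have "(\<integral>\<^sup>+x. (SUP n. ennreal ((cmod (g n x))^2)) \<partial>M) = (SUP n. \<integral>\<^sup>+x. ennreal ((cmod (g n x))^2) \<partial>M)"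
 proof (rule nn_integral_monotone_convergence_SUP)
  show "incseq (\<lambda>n x. ennreal ((cmod (g n x))^2))"
   by (intro incseq_SucI le_funI ennreal_leI power_mono) (auto simp: gx sum_nonneg)
 qed (use gm in measurable)
 also have "\<dots> <= 4" by (intro SUP_least g4)
 finally have "(\<integral>\<^sup>+x. (SUP n. ennreal ((cmod (g n x))^2)) \<partial>M) \<noteq> \<infinity>"
  by (auto simp: top_unique)
 then have fin: "AE x in M. (SUP n. ennreal ((cmod (g n x))^2)) \<noteq> \<infinity>"
  by (intro nn_integral_PInf_AE) auto
 have conv: "AE x in M. convergent (\<lambda>k. s (r k) x)"
  using fin
 proof eventually_elim
  case (elim x)
  then obtain B where B: "(SUP n. ennreal ((cmod (g n x))^2)) = ennreal B" "B >= 0"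
   by (metis ennreal_cases infinity_ennreal_def)
  have "(\<Sum>k<n. cmod (d k x)) <= sqrt B" for n
  proof -
   have "ennreal ((cmod (g n x))^2) <= ennreal B"
    unfolding B(1)[symmetric] by (rule SUP_upper) simp
   then have "(cmod (g n x))^2 <= B" using B by simp
   then show ?thesis using real_le_rsqrt gx by metis
  qed
  then have "sum (\<lambda>k. cmod (d k x)) {..n} <= sqrt B" for n
   by (metis lessThan_Suc_atMost)
  then have "summable (\<lambda>k. cmod (d k x))"
   by (intro bounded_imp_summable[of _ "sqrt B"]) auto
  then have "summable (\<lambda>k. d k x)" by (rule summable_norm_cancel)
  then have "convergent (\<lambda>n. \<Sum>k<n. d k x)" by (simp add: summable_iff_convergent)
  moreover have "(\<Sum>k<n. d k x) = s (r n) x - s (r 0) x" for n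
   unfolding d_def by (rule sum_lessThan_telescope)
  ultimately have "convergent (\<lambda>n. s (r n) x - s (r 0) x)" by simp
  then show ?case
   using convergent_add[OF _ convergent_const[of "s (r 0) x"]] by fastforce
 qed
 define l where "l x = lim (\<lambda>k. s (r k) x)" for x
 have lm: "l \<in> borel_measurable M"
  unfolding l_def[abs_def] by (intro borel_measurable_lim_metric L2_measurable s)
 have lim: "AE x in M. (\<lambda>k. s (r k) x) \<longlonglongrightarrow> l x"
  using conv by eventually_elim (simp add: l_def convergent_LIMSEQ_iff)
 have key: "(\<integral>\<^sup>+x. ennreal ((cmod (s n x - l x))^2) \<partial>M) <= ennreal (e^2)"
  if e: "e > 0" and n: "n >= K" and K: "\<forall>m\<ge>K. \<forall>n\<ge>K. L2.nrm M (s m - s n) < e" for e n K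
 proof -
  have "(\<integral>\<^sup>+x. ennreal ((cmod (s n x - l x))^2) \<partial>M)
    <= (\<integral>\<^sup>+x. liminf (\<lambda>k. ennreal ((cmod (s n x - s (r k) x))^2)) \<partial>M)"
  proof (rule nn_integral_mono_AE, use lim in eventually_elim)
   case (elim x)
   then have "(\<lambda>k. ennreal ((cmod (s n x - s (r k) x))^2)) \<longlonglongrightarrow> ennreal ((cmod (s n x - l x))^2)"
    by (intro tendsto_intros)
   then have "liminf (\<lambda>k. ennreal ((cmod (s n x - s (r k) x))^2)) = ennreal ((cmod (s n x - l x))^2)"
    by (rule lim_imp_Liminf[rotated]) simp
   then show ?case by simp
  qed
  also have "\<dots> <= liminf (\<lambda>k. \<integral>\<^sup>+x. ennreal ((cmod (s n x - s (r k) x))^2) \<partial>M)"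
   using s L2_measurable by (intro nn_integral_liminf) auto
  also have "\<dots> <= ennreal (e^2)"
  proof (rule Liminf_le)
   show "\<forall>\<^sub>F k in sequentially. (\<integral>\<^sup>+x. ennreal ((cmod (s n x - s (r k) x))^2) \<partial>M) <= ennreal (e^2)"
    unfolding eventually_sequentially
   proof (intro exI[of _ K] allI impI)
    fix k assume "K <= k"
    then have "L2.nrm M (s n - s (r k)) < e" using K n rk[of k] by auto
    then have "(L2.nrm M (s n - s (r k)))^2 <= e^2"
     using L2.nrm_nonneg[OF L2.diff_mem[OF s s]] by (intro power_mono) auto
    then show "(\<integral>\<^sup>+x. ennreal ((cmod (s n x - s (r k) x))^2) \<partial>M) <= ennreal (e^2)"
     using L2_nn_integral[OF L2.diff_mem[OF s[of n] s[of "r k"]]] by simp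
   qed
  qed simp
  finally show ?thesis .
 qed
 obtain K1 where K1: "\<forall>m\<ge>K1. \<forall>n\<ge>K1. L2.nrm M (s m - s n) < 1" using cau[of 1] by auto
 have "(\<lambda>x. s K1 x - l x) \<in> L2 M"
  using key[OF _ order_refl K1] s L2_measurable lm
  by (subst L2_nn_integral_iff) (auto intro!: borel_measurable_diff elim: le_less_trans)
 from L2_diff[OF s[of K1] this] have lL: "l \<in> L2 M" by simp
 have "(\<lambda>n. L2.nrm M (s n - l)) \<longlonglongrightarrow> 0"
 proof (rule LIMSEQ_I)
  fix e :: real assume e: "e > 0"
  obtain K where K: "\<forall>m\<ge>K. \<forall>n\<ge>K. L2.nrm M (s m - s n) < e/2" using cau[of "e/2"] e by auto
  have "norm (L2.nrm M (s n - l) - 0) < e" if "n >= K" for n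
  proof -
   have m: "s n - l \<in> L2 M" using s lL by (rule L2.diff_mem)
   have "(L2.nrm M (s n - l))^2 <= (e/2)^2"
   proof -
    have "ennreal ((L2.nrm M (s n - l))^2) <= ennreal ((e/2)^2)"
     using key[OF _ that K] e unfolding L2_nn_integral[OF m, symmetric] by simp
    then show ?thesis by (simp add: ennreal_le_iff)
   qed
   then have "L2.nrm M (s n - l) <= e/2" by (rule power2_le_imp_le) (use e in simp)
   then show ?thesis using e L2.nrm_nonneg[OF m] by simp
  qed
  then show "\<exists>no. \<forall>n\<ge>no. norm (L2.nrm M (s n - l) - 0) < e" by blast
 qed
 with lL show ?thesis by blast
qed

interpretation L2: semi_hilbert "L2 M" L2_scale "l2_inner M" for M
 by unfold_locales (rule L2_complete)

lemma semi_hilbert_L2_closed_subspace: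
 assumes D: "D \<subseteq> L2 M" "(\<lambda>x. 0) \<in> D" "\<And>f g. f \<in> D ==> g \<in> D ==> (\<lambda>x. f x + g x) \<in> D"
  "\<And>c f. f \<in> D ==> (\<lambda>x. c * f x) \<in> D"
  and closed: "\<And>(s :: nat => _) l. (\<And>n. s n \<in> D) ==> l \<in> L2 M ==> (\<lambda>n. L2.nrm M (s n - l)) \<longlonglongrightarrow> 0 ==> l \<in> D"
 shows "semi_hilbert D L2_scale (l2_inner M)"
proof -
 interpret D: semi_inner D L2_scale "l2_inner M"
  by (rule semi_inner_L2_subspace[OF D])
 show ?thesis
 proof
  fix s :: "nat => _" assume s: "\<And>n. s n \<in> D"
   and cau: "\<And>e. e > 0 ==> \<exists>N. \<forall>m\<ge>N. \<forall>n\<ge>N. D.nrm (s m - s n) < e"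
  have "s n \<in> L2 M" for n using s D(1) by auto
  then have "\<exists>l\<in>L2 M. (\<lambda>n. L2.nrm M (s n - l)) \<longlonglongrightarrow> 0"
   by (rule L2_complete) (rule cau)
  then obtain l where l: "l \<in> L2 M" "(\<lambda>n. L2.nrm M (s n - l)) \<longlonglongrightarrow> 0" by (elim bexE)
  show "\<exists>l\<in>D. (\<lambda>n. D.nrm (s n - l)) \<longlonglongrightarrow> 0"
   using l(2) closed[OF s l] by (rule bexI)
 qed
qed

section \<open>Functions with continuous derivatives\<close>

text \<open>The derivative is a parameter, so the rules for sums, products and compositions produce
  explicit derivatives and Laplacians become computations. In finite dimension, continuity in each
  fixed direction is continuity of the derivative.\<close>

definition C1_on ::
  "'a::euclidean_space set => ('a => 'b::real_normed_vector) => ('a => 'a => 'b) => bool" where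
 "C1_on S f f' \<longleftrightarrow>
   (\<forall>x\<in>S. (f has_derivative f' x) (at x)) \<and> (\<forall>h. continuous_on S (\<lambda>x. f' x h))"

text \<open>\<open>f'' b x h\<close> is the derivative in the direction \<open>h\<close> of
  \<open>f' x b\<close>: the first argument is the direction of the first derivative.\<close>

definition C2_on ::
  "'a::euclidean_space set => ('a => 'b::real_normed_vector) => ('a => 'a => 'b) =>
   ('a => 'a => 'a => 'b) => bool" where
 "C2_on S f f' f'' \<longleftrightarrow> C1_on S f f' \<and> (\<forall>b. C1_on S (\<lambda>x. f' x b) (f'' b))"

text \<open>The Laplacian, when \<open>f''\<close> comes from \<open>C2_on\<close>.\<close>

definition trace2 :: "('a::euclidean_space => 'a => 'a => 'b::real_normed_vector) => 'a => 'b" where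
 "trace2 f'' x = (\<Sum>b\<in>Basis. f'' b x b)"

lemma C1_onD: "C1_on S f f' ==> x \<in> S ==> (f has_derivative f' x) (at x)"
 by (simp add: C1_on_def)

lemma C1_on_cont': "C1_on S f f' ==> continuous_on S (\<lambda>x. f' x h)"
 by (simp add: C1_on_def)

lemma C1_on_cont: "C1_on S f f' ==> continuous_on S f"
 by (meson C1_onD continuous_at_imp_continuous_on has_derivative_continuous)

lemma C1_on_linear: "C1_on S f f' ==> x \<in> S ==> bounded_linear (f' x)"
 using C1_onD has_derivative_bounded_linear by blast

lemma C2_onD1: "C2_on S f f' f'' ==> C1_on S f f'"
 and C2_onD2: "C2_on S f f' f'' ==> C1_on S (\<lambda>x. f' x b) (f'' b)"
 by (auto simp: C2_on_def)

lemma C2_on_cont: "C2_on S f f' f'' ==> continuous_on S f"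
 and C2_on_cont': "C2_on S f f' f'' ==> continuous_on S (\<lambda>x. f' x h)"
 and C2_on_cont'': "C2_on S f f' f'' ==> continuous_on S (\<lambda>x. f'' b x h)"
 by (rule C1_on_cont[OF C2_onD1] C1_on_cont'[OF C2_onD1] C1_on_cont'[OF C2_onD2], assumption)+

lemma C2_on_cont_trace: "C2_on S f f' f'' ==> continuous_on S (trace2 f'')"
 unfolding trace2_def[abs_def] by (intro continuous_on_sum C2_on_cont'')

lemma C1_on_subset: "C1_on S f f' ==> T \<subseteq> S ==> C1_on T f f'"
 unfolding C1_on_def by (meson continuous_on_subset subsetD)

lemma C2_on_subset: "C2_on S f f' f'' ==> T \<subseteq> S ==> C2_on T f f' f''"
 unfolding C2_on_def by (meson C1_on_subset)

lemma C1_on_transform: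
 assumes "C1_on S f f'" "open S" "\<And>x. x \<in> S ==> g x = f x" "\<And>x h. x \<in> S ==> g' x h = f' x h"
 shows "C1_on S g g'"
proof -
 have "g' x = f' x" if "x \<in> S" for x using assms(4)[OF that] by blast
 moreover have "continuous_on S (\<lambda>x. g' x h) = continuous_on S (\<lambda>x. f' x h)" for h
  using assms(4) by (intro continuous_on_cong) auto
 ultimately show ?thesis
  using assms(1-3) has_derivative_transform_within_open unfolding C1_on_def by metis
qed

lemma C1_on_add: "C1_on S f f' ==> C1_on S g g' ==> C1_on S (\<lambda>x. f x + g x) (\<lambda>x h. f' x h + g' x h)"
 unfolding C1_on_def by (auto intro!: has_derivative_add continuous_on_add)

lemma C1_on_sum:
 "(\<And>i. i \<in> I ==> C1_on S (f i) (f' i)) ==> C1_on S (\<lambda>x. \<Sum>i\<in>I. f i x) (\<lambda>x h. \<Sum>i\<in>I. f' i x h)"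
 unfolding C1_on_def by (auto intro!: has_derivative_sum continuous_on_sum)

lemma C1_on_bounded_linear:
 assumes "bounded_linear T" "C1_on S f f'"
 shows "C1_on S (\<lambda>x. T (f x)) (\<lambda>x h. T (f' x h))"
 using assms(2) unfolding C1_on_def
 by (auto intro!: bounded_linear.has_derivative[OF assms(1)] bounded_linear.continuous_on[OF assms(1)])

lemma C1_on_mult:
 fixes f g :: "'a::euclidean_space => real"
 assumes "C1_on S f f'" "C1_on S g g'"
 shows "C1_on S (\<lambda>x. f x * g x) (\<lambda>x h. f x * g' x h + f' x h * g x)"
 using assms C1_on_cont[OF assms(1)] C1_on_cont[OF assms(2)] unfolding C1_on_def
 by (auto intro!: has_derivative_mult continuous_intros)

lemma C1_on_chain:
 fixes f :: "'a::euclidean_space => real" and t t' :: "real => real"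
 assumes "C1_on S f f'" "\<And>x. x \<in> S ==> (t has_real_derivative t' (f x)) (at (f x))"
  "continuous_on (f ` S) t'"
 shows "C1_on S (\<lambda>x. t (f x)) (\<lambda>x h. t' (f x) * f' x h)"
 unfolding C1_on_def
proof (intro conjI ballI allI)
 fix x assume x: "x \<in> S"
 have "(t has_derivative (\<lambda>h. t' (f x) * h)) (at (f x))"
  using assms(2)[OF x] by (simp add: has_field_derivative_def)
 from has_derivative_compose[OF C1_onD[OF assms(1) x] this]
 show "((\<lambda>x. t (f x)) has_derivative (\<lambda>h. t' (f x) * f' x h)) (at x)" .
next
 show "continuous_on S (\<lambda>x. t' (f x) * f' x h)" for h
  using C1_on_cont'[OF assms(1)] C1_on_cont[OF assms(1)] assms(3)
  by (intro continuous_on_mult) (auto intro: continuous_on_compose2)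
qed

lemma C2_on_add: "C2_on S f f' f'' ==> C2_on S g g' g'' ==>
  C2_on S (\<lambda>x. f x + g x) (\<lambda>x h. f' x h + g' x h) (\<lambda>b x h. f'' b x h + g'' b x h)"
 unfolding C2_on_def by (intro conjI allI C1_on_add) auto

lemma C2_on_bounded_linear: "bounded_linear T ==> C2_on S f f' f'' ==>
  C2_on S (\<lambda>x. T (f x)) (\<lambda>x h. T (f' x h)) (\<lambda>b x h. T (f'' b x h))"
 unfolding C2_on_def by (intro conjI allI C1_on_bounded_linear[of T]) auto

lemma C2_on_mult:
 fixes f g :: "'a::euclidean_space => real"
 assumes f: "C2_on S f f' f''" and g: "C2_on S g g' g''"
 shows "C2_on S (\<lambda>x. f x * g x) (\<lambda>x h. f x * g' x h + f' x h * g x)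
   (\<lambda>b x h. f x * g'' b x h + f' x h * g' x b + f' x b * g' x h + f'' b x h * g x)"
proof -
 have "C1_on S (\<lambda>x. f x * g' x b + f' x b * g x)
   (\<lambda>x h. f x * g'' b x h + f' x h * g' x b + (f' x b * g' x h + f'' b x h * g x))" for b
  by (intro C1_on_add C1_on_mult C2_onD1[OF f] C2_onD1[OF g] C2_onD2[OF f] C2_onD2[OF g])
 then show ?thesis
  unfolding C2_on_def add.assoc using C1_on_mult[OF C2_onD1[OF f] C2_onD1[OF g]] by blast
qed

lemma C2_on_chain:
 fixes f :: "'a::euclidean_space => real" and t t' t'' :: "real => real"
 assumes f: "C2_on S f f' f''" and t: "\<And>s. s \<in> f ` S ==> (t has_real_derivative t' s) (at s)"
  "\<And>s. s \<in> f ` S ==> (t' has_real_derivative t'' s) (at s)" "continuous_on (f ` S) t''"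
 shows "C2_on S (\<lambda>x. t (f x)) (\<lambda>x h. t' (f x) * f' x h)
   (\<lambda>b x h. t' (f x) * f'' b x h + t'' (f x) * f' x h * f' x b)"
proof -
 have ct': "continuous_on (f ` S) t'"
  using t(2) by (meson DERIV_continuous continuous_at_imp_continuous_on)
 have 1: "C1_on S (\<lambda>x. t (f x)) (\<lambda>x h. t' (f x) * f' x h)"
  by (intro C1_on_chain C2_onD1[OF f] t ct') auto
 have "C1_on S (\<lambda>x. t' (f x)) (\<lambda>x h. t'' (f x) * f' x h)"
  by (intro C1_on_chain C2_onD1[OF f] t) auto
 then have "C1_on S (\<lambda>x. t' (f x) * f' x b)
   (\<lambda>x h. t' (f x) * f'' b x h + t'' (f x) * f' x h * f' x b)" for b
  by (intro C1_on_mult C2_onD2[OF f])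
 with 1 show ?thesis unfolding C2_on_def by blast
qed

lemma C2_on_const: "C2_on S (\<lambda>x. c) (\<lambda>x h. 0) (\<lambda>b x h. 0)"
 by (auto simp: C2_on_def C1_on_def)

lemma C2_on_cmult:
 fixes f :: "'a::euclidean_space => real"
 shows "C2_on S f f' f'' ==> C2_on S (\<lambda>x. c * f x) (\<lambda>x h. c * f' x h) (\<lambda>b x h. c * f'' b x h)"
 by (rule C2_on_bounded_linear[OF bounded_linear_mult_right])

lemma C2_on_shift:
 assumes "C2_on UNIV f f' f''"
 shows "C2_on S (\<lambda>x. f (c - x)) (\<lambda>x h. - f' (c - x) h) (\<lambda>b x h. f'' b (c - x) h)"
proof -
 have 1: "C1_on S (\<lambda>x. g (c - x)) (\<lambda>x h. - g' (c - x) h)" if g: "C1_on UNIV g g'"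
  for g :: "'a => 'b" and g'
  unfolding C1_on_def
 proof (intro conjI ballI allI)
  fix x
  have "((\<lambda>x. c - x) has_derivative (\<lambda>h. - h)) (at x)" by (auto intro!: derivative_eq_intros)
  from has_derivative_compose[OF this C1_onD[OF g UNIV_I]]
  have "((\<lambda>x. g (c - x)) has_derivative (\<lambda>h. g' (c - x) (- h))) (at x)" .
  then show "((\<lambda>x. g (c - x)) has_derivative (\<lambda>h. - g' (c - x) h)) (at x)"
   using bounded_linear.linear[OF C1_on_linear[OF g UNIV_I]] by (simp add: linear_neg)
 next
  show "continuous_on S (\<lambda>x. - g' (c - x) h)" for h
   by (intro continuous_on_minus continuous_on_compose2[OF C1_on_cont'[OF g]] continuous_intros) auto
 qed
 have "C1_on S (\<lambda>x. - f' (c - x) b) (\<lambda>x h. - (- f'' b (c - x) h))" for b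
  by (rule C1_on_bounded_linear[OF bounded_linear_minus[OF bounded_linear_ident]
    1[OF C2_onD2[OF assms, of b]]])
 then show ?thesis
  unfolding C2_on_def using 1[OF C2_onD1[OF assms]] by simp
qed

lemma C1_mean_value:
 fixes f :: "'a::euclidean_space => real"
 assumes f: "C1_on S f f'" and seg: "closed_segment x y \<subseteq> S"
 obtains z where "z \<in> closed_segment x y" "f y - f x = f' z (y - x)"
proof -
 define p where "p t = x + t *\<^sub>R (y - x)" for t :: real
 have p: "p t \<in> closed_segment x y" if "0 <= t" "t <= 1" for t
 proof -
  have "p t = (1 - t) *\<^sub>R x + t *\<^sub>R y" by (simp add: p_def algebra_simps)
  then show ?thesis using that by (auto simp: closed_segment_def)
 qed
 have "((\<lambda>t. f (p t)) has_derivative (\<lambda>s. f' (p t) (s *\<^sub>R (y - x)))) (at t within {0..1})"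
  if "0 <= t" "t <= 1" for t
 proof -
  have "(p has_derivative (\<lambda>s. s *\<^sub>R (y - x))) (at t within {0..1})"
   unfolding p_def[abs_def] by (auto intro!: derivative_eq_intros)
  from has_derivative_compose[OF this C1_onD[OF f]] p[OF that] seg show ?thesis by auto
 qed
 from mvt_very_simple[OF zero_le_one this]
 obtain t where t: "t \<in> {0..1}" "f (p 1) - f (p 0) = f' (p t) ((1 - 0) *\<^sub>R (y - x))"
  by fastforce
 show ?thesis
  by (rule that[of "p t"]) (use t p in \<open>auto simp: p_def\<close>)
qed

section \<open>Integration by parts\<close>

lemma integrable_continuous_compact_support:
 fixes f :: "'a::euclidean_space => real"
 assumes "continuous_on UNIV f" "compact K" "\<And>x. x \<notin> K ==> f x = 0"
 shows "integrable lborel f"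
proof -
 have "integrable lborel (\<lambda>x. indicator K x *\<^sub>R f x)"
  using assms(1,2) continuous_on_subset by (intro borel_integrable_compact) blast+
 moreover have "(\<lambda>x. indicator K x *\<^sub>R f x) = f"
  using assms(3) by (auto simp: fun_eq_iff indicator_def)
 ultimately show ?thesis by simp
qed

lemma lborel_integral_translate:
 fixes f :: "'a::euclidean_space => real"
 assumes "f \<in> borel_measurable borel"
 shows "(LINT x|lborel. f (x + c)) = (LINT x|lborel. f x)"
  "integrable lborel f ==> integrable lborel (\<lambda>x. f (x + c))"
proof -
 have m: "(\<lambda>x. c + x) \<in> measurable lborel borel" by measurable
 have "(LINT x|lborel. f (c + x)) = (LINT x|distr lborel borel (\<lambda>x. c + x). f x)"
  using assms by (intro integral_distr[symmetric] m) auto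
 then show "(LINT x|lborel. f (x + c)) = (LINT x|lborel. f x)"
  by (simp add: lborel_distr_plus) (simp add: add.commute)
 assume "integrable lborel f"
 then have "integrable (distr lborel borel (\<lambda>x. c + x)) f" by (simp add: lborel_distr_plus)
 then show "integrable lborel (\<lambda>x. f (x + c))"
  using integrable_distr_eq[OF m, of f] assms by (simp add: add.commute)
qed

text \<open>Difference quotients have integral zero by translation invariance, and the mean value
  theorem dominates them by a constant on a fixed ball.\<close>

lemma integral_deriv_compact_support:
 fixes f :: "'a::euclidean_space => real"
 assumes f: "C1_on UNIV f f'" and K: "compact K" "\<And>x. x \<notin> K ==> f x = 0"
 shows "integrable lborel (\<lambda>x. f' x b)" "(LINT x|lborel. f' x b) = 0"
proof -
 have f0: "f' x b = 0" if "x \<notin> K" for x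
 proof -
  have "(f has_derivative (\<lambda>h. 0)) (at x)"
   by (rule has_derivative_transform_within_open[of "\<lambda>x. 0" _ _ _ "- K"])
    (use that K compact_imp_closed in auto)
  then have "f' x = (\<lambda>h. 0)" using C1_onD[OF f UNIV_I] has_derivative_unique by blast
  then show ?thesis by simp
 qed
 show i: "integrable lborel (\<lambda>x. f' x b)"
  by (rule integrable_continuous_compact_support[OF C1_on_cont'[OF f] K(1) f0])
 obtain B where B0: "B >= 0" "\<And>x. x \<in> K ==> norm (f' x b) <= B"
  by (rule continuous_on_compact_bound[OF K(1) continuous_on_subset[OF C1_on_cont'[OF f]]]) auto
 then have B: "\<bar>f' x b\<bar> <= B" for x using f0[of x] by (cases "x \<in> K") auto
 obtain R where "\<forall>x\<in>K. norm x <= R" using compact_imp_bounded[OF K(1)] unfolding bounded_iff by blast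
 then have R: "K \<subseteq> cball 0 R" by auto
 define q where "q n x = real (Suc n) * (f (x + (1 / real (Suc n)) *\<^sub>R b) - f x)" for n x
 have fi: "integrable lborel f"
  by (rule integrable_continuous_compact_support[OF C1_on_cont[OF f] K])
 have fm: "f \<in> borel_measurable borel"
  using C1_on_cont[OF f] by (rule borel_measurable_continuous_onI)
 have qb: "\<bar>q n x\<bar> <= B" for n x
 proof -
  obtain z where "f (x + (1 / real (Suc n)) *\<^sub>R b) - f x = f' z ((1 / real (Suc n)) *\<^sub>R b)"
   using C1_mean_value[OF f, of x "x + (1 / real (Suc n)) *\<^sub>R b"] by auto
  then have "q n x = f' z b"
   using bounded_linear.linear[OF C1_on_linear[OF f UNIV_I, of z]]
   by (simp add: q_def linear_scale del: of_nat_Suc)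
  then show ?thesis using B by simp
 qed
 have q0: "q n x = 0" if "x \<notin> cball 0 (R + norm b)" for n x
 proof -
  have "norm ((1 / real (Suc n)) *\<^sub>R b) <= norm b"
   by (simp add: divide_le_eq mult_le_cancel_left1)
  then have "x + (1 / real (Suc n)) *\<^sub>R b \<notin> cball 0 R" "x \<notin> cball 0 R"
   using that norm_triangle_ineq4[of "x + (1 / real (Suc n)) *\<^sub>R b" "(1 / real (Suc n)) *\<^sub>R b"]
    norm_ge_zero[of b] unfolding mem_cball_0 add_diff_cancel_right' by linarith+
  then have "f (x + (1 / real (Suc n)) *\<^sub>R b) = 0" "f x = 0" using R K(2) by blast+
  then show ?thesis by (simp add: q_def)
 qed
 have "(\<lambda>n. LINT x|lborel. q n x) \<longlonglongrightarrow> (LINT x|lborel. f' x b)"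
 proof (rule integral_dominated_convergence[where w = "\<lambda>x. B * indicator (cball 0 (R + norm b)) x"])
  show "integrable lborel (\<lambda>x. B * indicator (cball 0 (R + norm b)) x)"
   by (intro integrable_mult_right integrable_real_indicator emeasure_bounded_finite) auto
  show "AE x in lborel. (\<lambda>n. q n x) \<longlonglongrightarrow> f' x b"
  proof (rule AE_I2)
   fix x
   have "((\<lambda>t. x + t *\<^sub>R b) has_derivative (\<lambda>t. t *\<^sub>R b)) (at 0)"
    by (auto intro!: derivative_eq_intros)
   from has_derivative_compose[OF this, of f "f' x"]
   have "((\<lambda>t. f (x + t *\<^sub>R b)) has_derivative (\<lambda>t. f' x (t *\<^sub>R b))) (at 0)"
    using C1_onD[OF f UNIV_I, of x] by simp
   moreover have "(\<lambda>t. f' x (t *\<^sub>R b)) = (*) (f' x b)"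
    using bounded_linear.linear[OF C1_on_linear[OF f UNIV_I, of x]]
    by (simp add: fun_eq_iff linear_scale)
   ultimately have "((\<lambda>t. f (x + t *\<^sub>R b)) has_real_derivative f' x b) (at 0)"
    by (simp add: has_field_derivative_def)
   then have "((\<lambda>t. (f (x + t *\<^sub>R b) - f x) / t) \<longlongrightarrow> f' x b) (at 0)"
    by (simp add: DERIV_def)
   moreover have "filterlim (\<lambda>n. 1 / real (Suc n)) (at 0) sequentially"
    unfolding filterlim_at using LIMSEQ_inverse_real_of_nat[unfolded inverse_eq_divide] by simp
   ultimately have "(\<lambda>n. (f (x + (1 / real (Suc n)) *\<^sub>R b) - f x) / (1 / real (Suc n))) \<longlonglongrightarrow> f' x b"
    by (rule filterlim_compose)
   then show "(\<lambda>n. q n x) \<longlonglongrightarrow> f' x b" by (simp add: q_def[abs_def] mult.commute)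
  qed
  show "AE x in lborel. norm (q n x) <= B * indicator (cball 0 (R + norm b)) x" for n
   using qb[of n] q0[of _ n] by (intro AE_I2) (auto simp: indicator_def)
  show "q n \<in> borel_measurable lborel" for n
   unfolding q_def[abs_def] using fm by measurable
  show "(\<lambda>x. f' x b) \<in> borel_measurable lborel" using i by simp
 qed
 moreover have "(LINT x|lborel. q n x) = 0" for n
 proof -
  have "(LINT x|lborel. f (x + (1 / real (Suc n)) *\<^sub>R b) - f x) = 0"
   using lborel_integral_translate[OF fm] fi by (subst Bochner_Integration.integral_diff) auto
  then show ?thesis unfolding q_def[abs_def] by (subst integral_mult_right_zero) simp
 qed
 ultimately have "(\<lambda>n. 0) \<longlonglongrightarrow> (LINT x|lborel. f' x b)" by simp
 then show "(LINT x|lborel. f' x b) = 0" by (simp add: LIMSEQ_const_iff)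
qed

lemma C1_on_extend_zero:
 fixes f :: "'a::euclidean_space => real"
 assumes "open \<Omega>" and K: "compact K" "K \<subseteq> \<Omega>" and f: "C1_on \<Omega> f f'"
  and f0: "\<And>x. x \<in> \<Omega> - K ==> f x = 0"
 shows "C1_on UNIV (\<lambda>x. if x \<in> \<Omega> then f x else 0) (\<lambda>x h. if x \<in> \<Omega> then f' x h else 0)"
  (is "C1_on UNIV ?g ?g'")
proof -
 have op: "open (- K)" using K compact_imp_closed by auto
 have g: "C1_on \<Omega> ?g ?g'"
  by (rule C1_on_transform[OF f assms(1)]) auto
 have g0: "(?g has_derivative (\<lambda>h. 0)) (at x)" if "x \<notin> K" for x
  by (rule has_derivative_transform_within_open[of "\<lambda>x. 0" _ _ _ "- K"]) (use op that f0 in auto)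
 have g0': "?g' x h = 0" if "x \<notin> K" for x h
 proof (cases "x \<in> \<Omega>")
  case True
  then show ?thesis
   using fun_cong[OF has_derivative_unique[OF g0[OF that] C1_onD[OF g True]], of h] by simp
 qed simp
 show ?thesis
  unfolding C1_on_def
 proof (intro conjI ballI allI)
  fix x
  show "(?g has_derivative ?g' x) (at x)"
  proof (cases "x \<in> \<Omega>")
   case True then show ?thesis using C1_onD[OF g] by simp
  next
   case False then show ?thesis using g0[of x] K by auto
  qed
 next
  fix h
  have "continuous_on (- K) (\<lambda>x. ?g' x h)"
   using g0' by (intro continuous_on_cong[THEN iffD2, OF refl _ continuous_on_const]) auto
  then have "continuous_on (\<Omega> \<union> - K) (\<lambda>x. ?g' x h)"
   using assms(1) op C1_on_cont'[OF g] by (intro continuous_on_open_Un)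
  moreover have "\<Omega> \<union> - K = UNIV" using K by auto
  ultimately show "continuous_on UNIV (\<lambda>x. ?g' x h)" by simp
 qed
qed

lemma integrable_continuous_compact_support_on:
 fixes f :: "'a::euclidean_space => real"
 assumes "open \<Omega>" "continuous_on \<Omega> f" "compact K" "K \<subseteq> \<Omega>" "\<And>x. x \<in> \<Omega> - K ==> f x = 0"
 shows "set_integrable lborel \<Omega> f"
proof -
 have "integrable lborel (\<lambda>x. indicator K x *\<^sub>R f x)"
  using assms continuous_on_subset by (intro borel_integrable_compact) blast+
 moreover have "(\<lambda>x. indicator K x *\<^sub>R f x) = (\<lambda>x. indicator \<Omega> x *\<^sub>R f x)"
  using assms(4,5) by (auto simp: fun_eq_iff indicator_def)
 ultimately show ?thesis unfolding set_integrable_def by simp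
qed

lemma integral_deriv_compact_support_on:
 fixes f :: "'a::euclidean_space => real"
 assumes "open \<Omega>" "compact K" "K \<subseteq> \<Omega>" "C1_on \<Omega> f f'" "\<And>x. x \<in> \<Omega> - K ==> f x = 0"
 shows "set_integrable lborel \<Omega> (\<lambda>x. f' x b)" "(LINT x:\<Omega>|lborel. f' x b) = 0"
proof -
 have e: "(\<lambda>x. if x \<in> \<Omega> then f' x b else 0) = (\<lambda>x. indicator \<Omega> x *\<^sub>R f' x b)"
  by (auto simp: fun_eq_iff)
 have s: "x \<notin> K ==> (if x \<in> \<Omega> then f x else 0) = 0" for x using assms(5) by auto
 note I = integral_deriv_compact_support[OF C1_on_extend_zero[OF assms] assms(2) s, of b, unfolded e]
 show "set_integrable lborel \<Omega> (\<lambda>x. f' x b)" "(LINT x:\<Omega>|lborel. f' x b) = 0"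
  unfolding set_integrable_def set_lebesgue_integral_def using I by auto
qed

lemma C1_on_deriv_zero:
 fixes f :: "'a::euclidean_space => real"
 assumes "C1_on \<Omega> f f'" "open N" "N \<subseteq> \<Omega>" "x \<in> N" "\<And>x. x \<in> N ==> f x = 0"
 shows "f' x h = 0"
proof -
 have "(f has_derivative (\<lambda>h. 0)) (at x)"
  by (rule has_derivative_transform_within_open[of "\<lambda>x. 0" _ _ _ N]) (use assms in auto)
 then have "f' x = (\<lambda>h. 0)" using C1_onD[OF assms(1)] assms(3,4) has_derivative_unique by blast
 then show ?thesis by simp
qed

text \<open>Integrate the divergence of \<open>u \<nabla>\<phi> - \<phi> \<nabla>u\<close>. Only
  \<open>\<phi>\<close> vanishes near the boundary, so \<open>u\<close> may be unbounded
  there.\<close>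

lemma Green_identity:
 fixes u \<phi> :: "'a::euclidean_space => real"
 assumes \<Omega>: "open \<Omega>" and K: "compact K" "K \<subseteq> \<Omega>"
  and u: "C2_on \<Omega> u u' u''" and p: "C2_on \<Omega> \<phi> \<phi>' \<phi>''"
  and p0: "\<And>x. x \<in> \<Omega> - K ==> \<phi> x = 0"
 shows "set_integrable lborel \<Omega> (\<lambda>x. u x * trace2 \<phi>'' x)"
  "set_integrable lborel \<Omega> (\<lambda>x. \<phi> x * trace2 u'' x)"
  "(LINT x:\<Omega>|lborel. u x * trace2 \<phi>'' x) = (LINT x:\<Omega>|lborel. \<phi> x * trace2 u'' x)"
proof -
 have op: "open (\<Omega> - K)" using \<Omega> K compact_imp_closed by auto
 have p1: "\<phi>' x h = 0" if "x \<in> \<Omega> - K" for x h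
  by (rule C1_on_deriv_zero[OF C2_onD1[OF p] op _ that p0]) auto
 have p2: "\<phi>'' b x h = 0" if "x \<in> \<Omega> - K" for b x h
  by (rule C1_on_deriv_zero[OF C2_onD2[OF p] op _ that p1]) auto
 show i1: "set_integrable lborel \<Omega> (\<lambda>x. u x * trace2 \<phi>'' x)"
  by (intro integrable_continuous_compact_support_on[OF \<Omega> _ K] continuous_on_mult
    C2_on_cont[OF u] C2_on_cont_trace[OF p]) (simp add: trace2_def p2)
 show i2: "set_integrable lborel \<Omega> (\<lambda>x. \<phi> x * trace2 u'' x)"
  by (intro integrable_continuous_compact_support_on[OF \<Omega> _ K] continuous_on_mult
    C2_on_cont[OF p] C2_on_cont_trace[OF u]) (simp add: p0)
 have C: "C1_on \<Omega> (\<lambda>x. u x * \<phi>' x b + - (\<phi> x * u' x b))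
   (\<lambda>x h. u x * \<phi>'' b x h + u' x h * \<phi>' x b + - (\<phi> x * u'' b x h + \<phi>' x h * u' x b))" for b
  by (intro C1_on_add C1_on_bounded_linear[OF bounded_linear_minus[OF bounded_linear_ident]]
    C1_on_mult C2_onD1[OF u] C2_onD2[OF u] C2_onD1[OF p] C2_onD2[OF p])
 have "u x * \<phi>'' b x b + u' x b * \<phi>' x b + - (\<phi> x * u'' b x b + \<phi>' x b * u' x b)
   = u x * \<phi>'' b x b - \<phi> x * u'' b x b" for b x by simp
 note J = integral_deriv_compact_support_on[OF \<Omega> K C, unfolded this]
 have J1: "set_integrable lborel \<Omega> (\<lambda>x. u x * \<phi>'' b x b - \<phi> x * u'' b x b)"
  and J2: "(LINT x:\<Omega>|lborel. u x * \<phi>'' b x b - \<phi> x * u'' b x b) = 0" for b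
  using J[of b b] p0 p1 by auto
 have "(LINT x:\<Omega>|lborel. u x * trace2 \<phi>'' x - \<phi> x * trace2 u'' x)
   = (LINT x:\<Omega>|lborel. (\<Sum>b\<in>Basis. u x * \<phi>'' b x b - \<phi> x * u'' b x b))"
  by (simp add: trace2_def sum_subtractf sum_distrib_left)
 also have "\<dots> = (\<Sum>b\<in>Basis. LINT x:\<Omega>|lborel. u x * \<phi>'' b x b - \<phi> x * u'' b x b)"
  using J1 unfolding set_lebesgue_integral_def set_integrable_def scaleR_sum_right
  by (intro Bochner_Integration.integral_sum) auto
 also have "\<dots> = 0" using J2 by simp
 finally show "(LINT x:\<Omega>|lborel. u x * trace2 \<phi>'' x) = (LINT x:\<Omega>|lborel. \<phi> x * trace2 u'' x)"
  using set_integral_diff(2)[OF i1 i2] by simp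
qed

section \<open>Harmonic functions\<close>

lemma frechet_derivative_basis:
 fixes f :: "'a::euclidean_space => 'b::real_normed_vector"
 assumes "f differentiable (at x)"
 shows "frechet_derivative f (at x) h = (\<Sum>c\<in>Basis. (h \<bullet> c) *\<^sub>R partial_deriv c f x)"
proof -
 have "linear (frechet_derivative f (at x))"
  using assms by (simp add: linear_frechet_derivative)
 then have "frechet_derivative f (at x) (\<Sum>c\<in>Basis. (h \<bullet> c) *\<^sub>R c)
  = (\<Sum>c\<in>Basis. (h \<bullet> c) *\<^sub>R frechet_derivative f (at x) c)"
  by (simp add: linear_sum linear_scale)
 then show ?thesis by (simp add: euclidean_representation partial_deriv_def)
qed

text \<open>\<open>Ck_on\<close> records partial derivatives along the basis; the derivatives in all
  other directions are rebuilt linearly from them.\<close>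

lemma Ck_on_2_imp_C2_on:
 fixes u :: "'a::euclidean_space => 'b::real_normed_vector"
 assumes "Ck_on 2 \<Omega> u"
 obtains u' u'' where "C2_on \<Omega> u u' u''" "\<And>x. x \<in> \<Omega> ==> trace2 u'' x = laplacian u x"
proof -
 from assms have d1: "\<And>x. x \<in> \<Omega> ==> u differentiable (at x)"
  and d2: "\<And>x c. x \<in> \<Omega> ==> c \<in> Basis ==> partial_deriv c u differentiable (at x)"
  and ct: "\<And>c e. c \<in> Basis ==> e \<in> Basis ==> continuous_on \<Omega> (partial_deriv e (partial_deriv c u))"
  by (auto simp: numeral_2_eq_2)
 define u' where "u' x h = (\<Sum>c\<in>Basis. (h \<bullet> c) *\<^sub>R partial_deriv c u x)" for x h
 define u'' where "u'' b x h = (\<Sum>c\<in>Basis. (b \<bullet> c) *\<^sub>R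
   (\<Sum>e\<in>Basis. (h \<bullet> e) *\<^sub>R partial_deriv e (partial_deriv c u) x))" for b x h
 have 1: "(u has_derivative u' x) (at x)" if "x \<in> \<Omega>" for x
 proof -
  have "frechet_derivative u (at x) = u' x"
   using frechet_derivative_basis[OF d1[OF that]] by (auto simp: u'_def fun_eq_iff)
  then show ?thesis using d1[OF that] frechet_derivative_works by metis
 qed
 have 2: "(partial_deriv c u has_derivative (\<lambda>h. \<Sum>e\<in>Basis. (h \<bullet> e) *\<^sub>R partial_deriv e (partial_deriv c u) x)) (at x)"
  if "x \<in> \<Omega>" "c \<in> Basis" for x c
 proof -
  have "frechet_derivative (partial_deriv c u) (at x)
    = (\<lambda>h. \<Sum>e\<in>Basis. (h \<bullet> e) *\<^sub>R partial_deriv e (partial_deriv c u) x)"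
   using frechet_derivative_basis[OF d2[OF that]] by (simp add: fun_eq_iff)
  then show ?thesis using d2[OF that] frechet_derivative_works by metis
 qed
 have 3: "C1_on \<Omega> (partial_deriv c u) (\<lambda>x h. \<Sum>e\<in>Basis. (h \<bullet> e) *\<^sub>R partial_deriv e (partial_deriv c u) x)"
  if "c \<in> Basis" for c
  unfolding C1_on_def using 2 ct that by (auto intro!: continuous_intros)
 have "C1_on \<Omega> u u'"
  unfolding C1_on_def using 1 C1_on_cont[OF 3]
  by (auto simp: u'_def intro!: continuous_on_sum continuous_on_scaleR continuous_on_const)
 moreover have "C1_on \<Omega> (\<lambda>x. u' x b) (u'' b)" for b
  unfolding u'_def u''_def[abs_def]
  by (intro C1_on_sum C1_on_bounded_linear[OF bounded_linear_scaleR_right] 3)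
 moreover have "trace2 u'' x = laplacian u x" if "x \<in> \<Omega>" for x
 proof -
  have "u'' b x b = partial_deriv b (partial_deriv b u) x" if "b \<in> Basis" for b
   using that by (simp add: u''_def inner_Basis if_distrib[of "\<lambda>t. t *\<^sub>R _"] cong: if_cong)
  then show ?thesis by (simp add: trace2_def laplacian_def)
 qed
 ultimately show ?thesis using that unfolding C2_on_def by blast
qed

lemma harmonic_on_iff:
 fixes u :: "'a::euclidean_space => 'b::real_normed_vector"
 assumes op: "open \<Omega>"
 shows "harmonic_on \<Omega> u \<longleftrightarrow> (\<exists>u' u''. C2_on \<Omega> u u' u'' \<and> (\<forall>x\<in>\<Omega>. trace2 u'' x = 0))"
proof
 assume "harmonic_on \<Omega> u"
 then show "\<exists>u' u''. C2_on \<Omega> u u' u'' \<and> (\<forall>x\<in>\<Omega>. trace2 u'' x = 0)"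
  unfolding harmonic_on_def using Ck_on_2_imp_C2_on by metis
next
 assume "\<exists>u' u''. C2_on \<Omega> u u' u'' \<and> (\<forall>x\<in>\<Omega>. trace2 u'' x = 0)"
 then obtain u' u'' where u: "C2_on \<Omega> u u' u''" and tr: "\<forall>x\<in>\<Omega>. trace2 u'' x = 0" by blast
 have p1: "partial_deriv b u x = u' x b" if "x \<in> \<Omega>" for b x
  unfolding partial_deriv_def using frechet_derivative_at[OF C1_onD[OF C2_onD1[OF u] that]] by simp
 have p2: "(partial_deriv b u has_derivative u'' b x) (at x)" if "x \<in> \<Omega>" for b x
  by (rule has_derivative_transform_within_open[OF C1_onD[OF C2_onD2[OF u] that] op that]) (simp add: p1)
 have p3: "partial_deriv e (partial_deriv b u) x = u'' b x e" if "x \<in> \<Omega>" for b e x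
  unfolding partial_deriv_def[of e] using frechet_derivative_at[OF p2[OF that]] by simp
 have "continuous_on \<Omega> (partial_deriv e (partial_deriv b u))" for b e
  using C2_on_cont''[OF u, of b e] by (subst continuous_on_cong[OF refl p3]) auto
 moreover have "u differentiable (at x)" "partial_deriv b u differentiable (at x)" if "x \<in> \<Omega>" for b x
  using C1_onD[OF C2_onD1[OF u] that] p2[OF that] by (auto intro: differentiableI)
 ultimately show "harmonic_on \<Omega> u"
  unfolding harmonic_on_def numeral_2_eq_2 using tr by (simp add: laplacian_def p3 trace2_def)
qed

lemma harmonic_on_bounded_linear:
 "open \<Omega> ==> bounded_linear T ==> harmonic_on \<Omega> u ==> harmonic_on \<Omega> (\<lambda>x. T (u x))"
proof -
 assume op: "open \<Omega>" and T: "bounded_linear T" and "harmonic_on \<Omega> u"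
 then obtain u' u'' where u: "C2_on \<Omega> u u' u''" "\<forall>x\<in>\<Omega>. trace2 u'' x = 0"
  using harmonic_on_iff by blast
 have "trace2 (\<lambda>b x h. T (u'' b x h)) x = T (trace2 u'' x)" for x
  by (simp add: trace2_def linear_sum[OF bounded_linear.linear[OF T]])
 then show ?thesis
  using C2_on_bounded_linear[OF T u(1)] u(2) linear_0[OF bounded_linear.linear[OF T]]
  unfolding harmonic_on_iff[OF op] by metis
qed

lemma harmonic_on_add:
 "open \<Omega> ==> harmonic_on \<Omega> u ==> harmonic_on \<Omega> v ==> harmonic_on \<Omega> (\<lambda>x. u x + v x)"
proof -
 assume op: "open \<Omega>" and "harmonic_on \<Omega> u" "harmonic_on \<Omega> v"
 then obtain u' u'' v' v'' where u: "C2_on \<Omega> u u' u''" "\<forall>x\<in>\<Omega>. trace2 u'' x = 0"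
  and v: "C2_on \<Omega> v v' v''" "\<forall>x\<in>\<Omega>. trace2 v'' x = 0"
  using harmonic_on_iff by metis
 have "trace2 (\<lambda>b x h. u'' b x h + v'' b x h) x = trace2 u'' x + trace2 v'' x" for x
  by (simp add: trace2_def sum.distrib)
 then show ?thesis
  using C2_on_add[OF u(1) v(1)] u(2) v(2) unfolding harmonic_on_iff[OF op] by fastforce
qed

lemma harmonic_on_const: "open \<Omega> ==> harmonic_on \<Omega> (\<lambda>x. c)"
 unfolding harmonic_on_iff using C2_on_const by (fastforce simp: trace2_def)

lemma harmonic_on_cmult:
 fixes u :: "'a::euclidean_space => complex"
 shows "open \<Omega> ==> harmonic_on \<Omega> u ==> harmonic_on \<Omega> (\<lambda>x. c * u x)"
 by (rule harmonic_on_bounded_linear[OF _ bounded_linear_mult_right])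

lemma harmonic_on_Re: "open \<Omega> ==> harmonic_on \<Omega> u ==> harmonic_on \<Omega> (\<lambda>x. Re (u x))"
 and harmonic_on_Im: "open \<Omega> ==> harmonic_on \<Omega> u ==> harmonic_on \<Omega> (\<lambda>x. Im (u x))"
 by (rule harmonic_on_bounded_linear[OF _ bounded_linear_Re] harmonic_on_bounded_linear[OF _ bounded_linear_Im],
   assumption+)+

lemma harmonic_on_complex:
 "open \<Omega> ==> harmonic_on \<Omega> u ==> harmonic_on \<Omega> v ==> harmonic_on \<Omega> (\<lambda>x. Complex (u x) (v x))"
 unfolding Complex_eq
 by (intro harmonic_on_add harmonic_on_cmult harmonic_on_bounded_linear[OF _ bounded_linear_of_real])

lemma harmonic_on_continuous: "open \<Omega> ==> harmonic_on \<Omega> u ==> continuous_on \<Omega> u"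
 using harmonic_on_iff C2_on_cont by metis

lemma Ck_on_local:
 assumes "\<And>x. x \<in> S ==> \<exists>N. open N \<and> x \<in> N \<and> Ck_on k N f"
 shows "Ck_on k S f"
 using assms
proof (induction k arbitrary: f)
 case 0
 show ?case
  unfolding Ck_on.simps
 proof (rule continuous_at_imp_continuous_on, rule ballI)
  fix x assume "x \<in> S"
  then obtain N where "open N" "x \<in> N" "continuous_on N f" using 0 by force
  then show "isCont f x" by (simp add: continuous_on_eq_continuous_at)
 qed
next
 case (Suc k)
 then show ?case by (fastforce simp del: split_paired_Ex)
qed

lemma harmonic_on_local:
 assumes "\<And>x. x \<in> \<Omega> ==> \<exists>N. open N \<and> x \<in> N \<and> harmonic_on N u"
 shows "harmonic_on \<Omega> u"
 unfolding harmonic_on_def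
proof (intro conjI ballI)
 show "Ck_on 2 \<Omega> u" by (rule Ck_on_local) (use assms harmonic_on_def in blast)
 show "laplacian u x = 0" if "x \<in> \<Omega>" for x
  using assms[OF that] unfolding harmonic_on_def by blast
qed

lemma harmonic_on_cong:
 assumes "open \<Omega>" "harmonic_on \<Omega> u" "\<And>x. x \<in> \<Omega> ==> v x = u x"
 shows "harmonic_on \<Omega> v"
proof -
 obtain u' u'' where u: "C2_on \<Omega> u u' u''" "\<forall>x\<in>\<Omega>. trace2 u'' x = 0"
  using harmonic_on_iff assms(1,2) by metis
 have "C1_on \<Omega> v u'"
  by (rule C1_on_transform[OF C2_onD1[OF u(1)] assms(1,3)]) auto
 then have "C2_on \<Omega> v u' u''" using u(1) by (simp add: C2_on_def)
 then show ?thesis using u(2) harmonic_on_iff[OF assms(1)] by metis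
qed

section \<open>Radial functions and convolution\<close>

text \<open>Kernels are written in \<open>s = |z|^2\<close> rather than in \<open>|z|\<close>: this
  is smooth at the origin, and their calculus becomes that of one variable.\<close>

lemma C2_on_radial:
 fixes g g1 g2 :: "real => real"
 assumes "\<And>s. (g has_real_derivative g1 s) (at s)" "\<And>s. (g1 has_real_derivative g2 s) (at s)"
  "continuous_on UNIV g2"
 shows "C2_on UNIV (\<lambda>z::'a::euclidean_space. g (z \<bullet> z)) (\<lambda>z h. g1 (z \<bullet> z) * (2 * (z \<bullet> h)))
   (\<lambda>b z h. g1 (z \<bullet> z) * (2 * (h \<bullet> b)) + g2 (z \<bullet> z) * (2 * (z \<bullet> h)) * (2 * (z \<bullet> b)))"
proof -
 have "C2_on UNIV (\<lambda>z::'a. z \<bullet> z) (\<lambda>z h. 2 * (z \<bullet> h)) (\<lambda>b z h. 2 * (h \<bullet> b))"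
  unfolding C2_on_def C1_on_def
  by (auto intro!: derivative_eq_intros continuous_intros simp: inner_commute)
 then show ?thesis
  using assms continuous_on_subset by (intro C2_on_chain) blast+
qed

lemma trace2_radial:
 "trace2 (\<lambda>b z h. g1 z * (2 * (h \<bullet> b)) + g2 z * (2 * (z \<bullet> h)) * (2 * (z \<bullet> b))) (z::'a::euclidean_space)
  = 2 * real DIM('a) * g1 z + 4 * (z \<bullet> z) * g2 z"
proof -
 have "trace2 (\<lambda>b z h. g1 z * (2 * (h \<bullet> b)) + g2 z * (2 * (z \<bullet> h)) * (2 * (z \<bullet> b))) z
  = (\<Sum>b\<in>(Basis::'a set). 2 * g1 z + 4 * g2 z * ((z \<bullet> b) * (z \<bullet> b)))"
  unfolding trace2_def by (intro sum.cong refl) simp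
 also have "\<dots> = 2 * real DIM('a) * g1 z + 4 * g2 z * (\<Sum>b\<in>(Basis::'a set). (z \<bullet> b) * (z \<bullet> b))"
  by (simp add: sum.distrib sum_distrib_left)
 also have "(\<Sum>b\<in>(Basis::'a set). (z \<bullet> b) * (z \<bullet> b)) = z \<bullet> z"
  by (simp add: euclidean_inner[symmetric])
 finally show ?thesis by simp
qed

definition gradient :: "('a::euclidean_space => 'a => real) => 'a => 'a" where
 "gradient f' x = (\<Sum>b\<in>Basis. f' x b *\<^sub>R b)"

lemma C1_on_gradient:
 assumes "C1_on S f f'"
 shows "x \<in> S ==> f' x h = gradient f' x \<bullet> h" "continuous_on S (gradient f')"
proof -
 assume "x \<in> S"
 then have "linear (f' x)" using C1_on_linear[OF assms] bounded_linear.linear by blast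
 then have "f' x (\<Sum>b\<in>Basis. (h \<bullet> b) *\<^sub>R b) = (\<Sum>b\<in>Basis. (h \<bullet> b) *\<^sub>R f' x b)"
  by (simp only: linear_sum linear_scale)
 moreover have "gradient f' x \<bullet> h = (\<Sum>b\<in>Basis. f' x b * (b \<bullet> h))"
  by (simp add: gradient_def inner_sum_left)
 ultimately show "f' x h = gradient f' x \<bullet> h"
  unfolding euclidean_representation by (simp add: inner_commute[of h] mult.commute)
next
 show "continuous_on S (gradient f')"
  unfolding gradient_def[abs_def] by (intro continuous_intros C1_on_cont'[OF assms])
qed

abbreviation gradsq :: "('a::euclidean_space => 'a => real) => 'a => real" where
 "gradsq f' x \<equiv> \<Sum>b\<in>Basis. (f' x b)^2"

lemma norm_gradient_sq: "(norm (gradient f' x))^2 = gradsq f' x"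
proof -
 have "gradient f' x \<bullet> b = f' x b" if "b \<in> Basis" for b
  using that by (simp add: gradient_def inner_sum_left inner_Basis if_distrib cong: if_cong)
 then show ?thesis unfolding power2_norm_eq_inner by (subst euclidean_inner) (simp add: power2_eq_square)
qed

lemma C1_diff_le:
 assumes f: "C1_on S f f'" and xy: "closed_segment y x \<subseteq> S" and L: "\<And>z. z \<in> closed_segment y x ==> norm (gradient f' z) <= L"
 shows "\<bar>f x - f y\<bar> <= L * norm (x - y)"
proof -
 obtain z where z: "z \<in> closed_segment y x" "f x - f y = f' z (x - y)" by (rule C1_mean_value[OF f xy])
 then have "f x - f y = gradient f' z \<bullet> (x - y)" using C1_on_gradient(1)[OF f] xy by auto
 moreover have "norm (gradient f' z) * norm (x - y) <= L * norm (x - y)" by (intro mult_right_mono L z(1)) simp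
 ultimately show ?thesis using Cauchy_Schwarz_ineq2[of "gradient f' z" "x - y"] by linarith
qed

lemma C1_Lipschitz_cball:
 assumes f: "C1_on UNIV f f'"
 obtains L where "L >= 0" "\<And>x y. x \<in> cball c R ==> y \<in> cball c R ==> \<bar>f x - f y\<bar> <= L * norm (x - y)"
proof (rule continuous_on_compact_bound[OF compact_cball])
 show "continuous_on (cball c R) (gradient f')" by (rule continuous_on_subset[OF C1_on_gradient(2)[OF f]]) simp
 fix L assume "L >= 0" and L: "\<And>z. z \<in> cball c R ==> norm (gradient f' z) <= L"
 have "\<bar>f x - f y\<bar> <= L * norm (x - y)" if "x \<in> cball c R" "y \<in> cball c R" for x y
  using closed_segment_subset[OF that(2,1) convex_cball] by (intro C1_diff_le[OF f] L) auto
 then show thesis using \<open>L >= 0\<close> that by blast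
qed

section \<open>Convolution of a compactly supported integrable function with a smooth kernel\<close>

definition convolution :: "('a::euclidean_space => real) => ('a => real) => 'a => real" where
 "convolution v K x = (LINT y|lborel. v y * K (x - y))"

lemma convolution_integrable:
 fixes v K :: "'a::euclidean_space => real"
 assumes v: "integrable lborel v" "{y. v y \<noteq> 0} \<subseteq> cball 0 R" and K: "continuous_on UNIV K"
 shows "integrable lborel (\<lambda>y. v y * K (x - y))"
proof -
 obtain B where "\<And>z. z \<in> cball 0 (R + norm x) ==> norm (K z) <= B"
  by (rule continuous_on_compact_bound[OF compact_cball[of 0 "R + norm x"] continuous_on_subset[OF K]]) auto
 then have B: "\<bar>K z\<bar> <= B" if "norm z <= R + norm x" for z using that by simp
 show ?thesis
 proof (rule Bochner_Integration.integrable_bound[where f = "\<lambda>y. B * v y"])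
  have "\<bar>v y * K (x - y)\<bar> <= \<bar>B * v y\<bar>" for y
  proof (cases "norm y <= R")
   case True
   then have "\<bar>K (x - y)\<bar> <= B" using norm_triangle_ineq4[of x y] by (intro B) linarith
   then have "\<bar>v y\<bar> * \<bar>K (x - y)\<bar> <= \<bar>v y\<bar> * \<bar>B\<bar>" by (intro mult_left_mono) auto
   then show ?thesis unfolding abs_mult by (simp only: mult.commute)
  next
   case False
   then have "v y = 0" using v(2) by (auto simp: subset_iff)
   then show ?thesis by simp
  qed
  then show "AE y in lborel. norm (v y * K (x - y)) <= norm (B * v y)" by simp
  have "K \<in> borel_measurable borel" using K by (rule borel_measurable_continuous_onI)
  then show "(\<lambda>y. v y * K (x - y)) \<in> borel_measurable lborel"
   using v(1) by measurable
 qed (use v(1) in simp)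
qed

text \<open>\<open>v\<close> is merely integrable, so all smoothness comes from \<open>K\<close>.
  Near a fixed \<open>x\<close> only the values on the ball of radius \<open>R + |x| + 1\<close>
  matter, where the gradient of \<open>K\<close> is uniformly continuous; this makes the error of
  differentiation under the integral uniform in \<open>y\<close>.\<close>

lemma convolution_C1:
 fixes v K :: "'a::euclidean_space => real"
 assumes v: "integrable lborel v" "{y. v y \<noteq> 0} \<subseteq> cball 0 R" and K: "C1_on UNIV K K'"
 shows "C1_on UNIV (convolution v K) (\<lambda>x h. convolution v (\<lambda>z. K' z h) x)"
proof -
 note int = convolution_integrable[OF v]
 define A where "A = (LINT y|lborel. \<bar>v y\<bar>)"
 have A: "A >= 0" by (simp add: A_def)
 have unif: "\<exists>d>0. d <= 1 \<and> (\<forall>z z'. norm z <= S --> norm z' <= S --> dist z z' < d --> dist (f z) (f z') < e)"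
  if cf: "continuous_on UNIV f" and e: "e > 0" for f :: "'a => 'b::metric_space" and S e
 proof -
  have "uniformly_continuous_on (cball 0 S) f"
   by (rule compact_uniformly_continuous[OF continuous_on_subset[OF cf]]) auto
  then obtain d where "d > 0" "\<forall>z\<in>cball 0 S. \<forall>z'\<in>cball 0 S. dist z' z < d --> dist (f z') (f z) < e"
   using e unfolding uniformly_continuous_on_def by blast
  then show ?thesis by (intro exI[of _ "min d 1"]) (simp add: dist_commute)
 qed
 have cont: "continuous_on UNIV (convolution v f)" if f: "continuous_on UNIV f" for f
 proof (rule continuous_at_imp_continuous_on, rule ballI)
  fix x :: 'a
  show "isCont (convolution v f) x"
   unfolding continuous_at_eps_delta
  proof (intro allI impI)
   fix e :: real assume e: "e > 0"
   then have "e / (A + 1) > 0" using A by simp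
   from unif[OF f this, of "R + norm x + 1"] obtain d where d: "d > 0" "d <= 1"
    "\<And>z z'. norm z <= R + norm x + 1 ==> norm z' <= R + norm x + 1 ==> dist z z' < d
     ==> dist (f z) (f z') < e / (A + 1)" by blast
   have "dist (convolution v f x') (convolution v f x) < e" if "dist x' x < d" for x'
   proof -
    have b: "\<bar>v y * f (x' - y) - v y * f (x - y)\<bar> <= e / (A + 1) * \<bar>v y\<bar>" for y
    proof (cases "norm y <= R")
     case True
     have "norm (x' - y) <= R + norm x + 1" "norm (x - y) <= R + norm x + 1"
      using True that d(2) norm_triangle_ineq4[of x y] norm_triangle_ineq[of "x' - x" "x - y"]
      by (auto simp: dist_norm)
     then have "dist (f (x' - y)) (f (x - y)) < e / (A + 1)"
      using that by (intro d(3)) (auto simp: dist_norm)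
     then have "\<bar>v y\<bar> * \<bar>f (x' - y) - f (x - y)\<bar> <= \<bar>v y\<bar> * (e / (A + 1))"
      by (intro mult_left_mono) (auto simp: dist_norm)
     then show ?thesis by (simp add: abs_mult[symmetric] algebra_simps)
    next
     case False
     then have "v y = 0" using v(2) by (auto simp: subset_iff)
     then show ?thesis by simp
    qed
    have "\<bar>convolution v f x' - convolution v f x\<bar> = \<bar>LINT y|lborel. v y * f (x' - y) - v y * f (x - y)\<bar>"
     unfolding convolution_def using int[OF f] by (subst Bochner_Integration.integral_diff) auto
    also have "\<dots> <= (LINT y|lborel. e / (A + 1) * \<bar>v y\<bar>)"
     by (rule integral_abs_bound[THEN order_trans], rule integral_mono)
      (use int[OF f] v b in auto)
    also have "\<dots> = e / (A + 1) * A" by (simp add: A_def)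
    also have "\<dots> < e" using e A by (simp add: field_simps)
    finally show ?thesis by (simp add: dist_norm)
   qed
   then show "\<exists>d>0. \<forall>x'. dist x' x < d --> dist (convolution v f x') (convolution v f x) < e"
    using d(1) by blast
  qed
 qed
 have der: "(convolution v K has_derivative (\<lambda>h. convolution v (\<lambda>z. K' z h) x)) (at x)" for x
  unfolding has_derivative_at_alt
 proof (intro conjI allI impI)
  have lin: "linear (K' z)" for z using C1_on_linear[OF K] bounded_linear.linear by blast
  have "linear (\<lambda>h. convolution v (\<lambda>z. K' z h) x)"
  proof
   show "convolution v (\<lambda>z. K' z (h + k)) x = convolution v (\<lambda>z. K' z h) x + convolution v (\<lambda>z. K' z k) x" for h k
    unfolding convolution_def using int[OF C1_on_cont'[OF K]] lin
    by (subst Bochner_Integration.integral_add[symmetric]) (auto simp: linear_add distrib_left)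
   show "convolution v (\<lambda>z. K' z (r *\<^sub>R h)) x = r *\<^sub>R convolution v (\<lambda>z. K' z h) x" for r h
    unfolding convolution_def using lin by (simp add: linear_scale mult.left_commute)
  qed
  then show "bounded_linear (\<lambda>h. convolution v (\<lambda>z. K' z h) x)"
   by (simp add: linear_conv_bounded_linear)
  fix e :: real assume e: "e > 0"
  then have "e / (A + 1) > 0" using A by simp
  from unif[OF C1_on_gradient(2)[OF K] this, of "R + norm x + 1"] obtain d where d: "d > 0" "d <= 1"
   "\<And>z z'. norm z <= R + norm x + 1 ==> norm z' <= R + norm x + 1 ==> dist z z' < d
     ==> dist (gradient K' z) (gradient K' z') < e / (A + 1)" by blast
  have "norm (convolution v K x' - convolution v K x - convolution v (\<lambda>z. K' z (x' - x)) x) <= e * norm (x' - x)"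
   if x': "norm (x' - x) < d" for x'
  proof -
   have b: "\<bar>v y * K (x' - y) - v y * K (x - y) - v y * K' (x - y) (x' - x)\<bar>
     <= e / (A + 1) * norm (x' - x) * \<bar>v y\<bar>" for y
   proof (cases "norm y <= R")
    case True
    obtain z where z: "z \<in> closed_segment (x - y) (x' - y)"
     "K (x' - y) - K (x - y) = K' z ((x' - y) - (x - y))"
     using C1_mean_value[OF K] by blast
    have zd: "dist z (x - y) <= norm (x' - x)"
     using segment_bound1[OF z(1)] by (simp add: dist_norm algebra_simps)
    moreover have "norm (x - y) <= R + norm x"
     using True norm_triangle_ineq4[of x y] by linarith
    moreover have "norm z <= norm (x - y) + dist z (x - y)"
     using norm_triangle_sub[of z "x - y"] by (simp add: dist_norm)
    ultimately have "dist (gradient K' z) (gradient K' (x - y)) < e / (A + 1)"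
     using x' d(2) by (intro d(3)) auto
    moreover have "\<bar>K' z (x' - x) - K' (x - y) (x' - x)\<bar>
      <= norm (gradient K' z - gradient K' (x - y)) * norm (x' - x)"
     using Cauchy_Schwarz_ineq2 by (simp add: C1_on_gradient(1)[OF K] inner_diff_left[symmetric])
    ultimately have "\<bar>K' z (x' - x) - K' (x - y) (x' - x)\<bar> <= e / (A + 1) * norm (x' - x)"
     by (smt (verit) dist_norm mult_right_mono norm_ge_zero)
    then have "\<bar>v y\<bar> * \<bar>K (x' - y) - K (x - y) - K' (x - y) (x' - x)\<bar> <= \<bar>v y\<bar> * (e / (A + 1) * norm (x' - x))"
     using z(2) by (intro mult_left_mono) auto
    then show ?thesis by (simp add: abs_mult[symmetric] algebra_simps)
   next
    case False
    then have "v y = 0" using v(2) by (auto simp: subset_iff)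
    then show ?thesis by simp
   qed
   have "\<bar>convolution v K x' - convolution v K x - convolution v (\<lambda>z. K' z (x' - x)) x\<bar>
    = \<bar>LINT y|lborel. v y * K (x' - y) - v y * K (x - y) - v y * K' (x - y) (x' - x)\<bar>"
    unfolding convolution_def using int[OF C1_on_cont[OF K]] int[OF C1_on_cont'[OF K]]
    by (simp add: Bochner_Integration.integral_diff)
   also have "\<dots> <= (LINT y|lborel. e / (A + 1) * norm (x' - x) * \<bar>v y\<bar>)"
    by (rule integral_abs_bound[THEN order_trans], rule integral_mono)
     (use int[OF C1_on_cont[OF K]] int[OF C1_on_cont'[OF K]] v b in auto)
   also have "\<dots> = e * norm (x' - x) * (A / (A + 1))" by (simp add: A_def)
   also have "\<dots> <= e * norm (x' - x) * 1" using e A by (intro mult_left_mono) auto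
   finally show ?thesis by simp
  qed
  then show "\<exists>d>0. \<forall>y. norm (y - x) < d -->
    norm (convolution v K y - convolution v K x - convolution v (\<lambda>z. K' z (y - x)) x) <= e * norm (y - x)"
   using d(1) by blast
 qed
 show ?thesis
  unfolding C1_on_def using der cont[OF C1_on_cont'[OF K]] by blast
qed

lemma convolution_C2:
 fixes v K :: "'a::euclidean_space => real"
 assumes "integrable lborel v" "{y. v y \<noteq> 0} \<subseteq> cball 0 R" "C2_on UNIV K K' K''"
 shows "C2_on UNIV (convolution v K) (\<lambda>x h. convolution v (\<lambda>z. K' z h) x)
   (\<lambda>b x h. convolution v (\<lambda>z. K'' b z h) x)"
 unfolding C2_on_def
 using convolution_C1[OF assms(1,2) C2_onD1[OF assms(3)]] convolution_C1[OF assms(1,2) C2_onD2[OF assms(3)]]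
 by blast

lemma convolution_trace2:
 fixes v :: "'a::euclidean_space => real"
 assumes "integrable lborel v" "{y. v y \<noteq> 0} \<subseteq> cball 0 R" "C2_on UNIV K K' K''"
 shows "trace2 (\<lambda>b x h. convolution v (\<lambda>z. K'' b z h) x) x = convolution v (trace2 K'') x"
 unfolding trace2_def[abs_def] convolution_def sum_distrib_left
 using convolution_integrable[OF assms(1,2) C2_on_cont''[OF assms(3)]]
 by (subst Bochner_Integration.integral_sum) auto

section \<open>A regularised fundamental solution\<close>

lemma DERIV_glue:
 fixes f g :: "real => real"
 assumes f: "\<And>s. s >= c ==> (f has_real_derivative f' s) (at s)"
  and g: "\<And>s. s <= c ==> (g has_real_derivative g' s) (at s)"
  and eq: "f c = g c" "f' c = g' c"
 shows "((\<lambda>s. if s >= c then f s else g s) has_real_derivative (if s >= c then f' s else g' s)) (at s)"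
proof -
 let ?h = "\<lambda>s. if s >= c then f s else g s"
 consider "s > c" | "s < c" | "s = c" by linarith
 then show ?thesis
 proof cases
  case 1
  have "(?h has_real_derivative f' s) (at s)"
   by (rule has_field_derivative_transform_within_open[where S = "{c<..}" and f = f]) (use f 1 in auto)
  then show ?thesis using 1 by simp
 next
  case 2
  have "(?h has_real_derivative g' s) (at s)"
   by (rule has_field_derivative_transform_within_open[where S = "{..<c}" and f = g]) (use g 2 in auto)
  then show ?thesis using 2 by simp
 next
  case 3
  have "((\<lambda>y. (?h y - ?h c) / (y - c)) \<longlongrightarrow> f' c) (at c)"
  proof (rule filterlim_split_at)
   have "((\<lambda>y. (g y - g c) / (y - c)) \<longlongrightarrow> g' c) (at_left c)"
    using g[of c] filterlim_at_split by (auto simp: has_field_derivative_iff)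
   then show "((\<lambda>y. (?h y - ?h c) / (y - c)) \<longlongrightarrow> f' c) (at_left c)"
    unfolding eq(2) by (rule Lim_transform_eventually)
     (use eq in \<open>auto simp: eventually_at_left_field intro!: exI[of _ "c - 1"]\<close>)
   have "((\<lambda>y. (f y - f c) / (y - c)) \<longlongrightarrow> f' c) (at_right c)"
    using f[of c] filterlim_at_split by (auto simp: has_field_derivative_iff)
   then show "((\<lambda>y. (?h y - ?h c) / (y - c)) \<longlongrightarrow> f' c) (at_right c)"
    by (rule Lim_transform_eventually)
     (auto simp: eventually_at_right_field intro!: exI[of _ "c + 1"])
  qed
  then show ?thesis using 3 by (simp add: has_field_derivative_iff)
 qed
qed

lemma continuous_on_glue:
 fixes f g :: "real => real"
 assumes "continuous_on {c..} f" "continuous_on {..c} g" "f c = g c"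
 shows "continuous_on UNIV (\<lambda>s. if s >= c then f s else g s)"
proof -
 have "continuous_on ({c..} \<union> {..c}) (\<lambda>s. if s >= c then f s else g s)"
  using assms by (intro continuous_on_cases) auto
 moreover have "{c..} \<union> {..c} = UNIV" by auto
 ultimately show ?thesis by simp
qed

lemma DERIV_pos_part_power:
 "((\<lambda>s. (max 0 s) ^ Suc (Suc n)) has_real_derivative real (Suc (Suc n)) * (max 0 s) ^ Suc n) (at s)"
proof -
 have e: "(\<lambda>s::real. max 0 s ^ Suc k) = (\<lambda>s. if s >= 0 then s ^ Suc k else 0)" for k
  by (auto simp: fun_eq_iff max_def)
 have "((\<lambda>s. if s >= 0 then s ^ Suc (Suc n) else 0) has_real_derivative
   (if s >= 0 then real (Suc (Suc n)) * s ^ Suc n else 0)) (at s)"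
  using DERIV_pow[of "Suc (Suc n)"] by (intro DERIV_glue) simp_all
 moreover have "(if s >= 0 then real (Suc (Suc n)) * s ^ Suc n else 0) = real (Suc (Suc n)) * (max 0 s) ^ Suc n"
  by (auto simp: max_def)
 ultimately show ?thesis unfolding e[of "Suc n"] by simp
qed

text \<open>For \<open>s = |z|\<^sup>2\<close> at least \<open>\<rho>\<close> and \<open>a = d / 2\<close>, \<open>kern\<close> is up to a constant the fundamental solution
 of the Laplace equation; below \<open>\<rho>\<close> it is continued by a Taylor polynomial in
 \<open>x = (\<rho> - s) / \<rho>\<close>, with the effect that its Laplacian is a multiple of \<open>x\<^sup>3\<close>. The functions
 \<open>kern1\<close> to \<open>kern3\<close> are the derivatives in \<open>s\<close>.\<close>

definition kern_far :: "real => real => real" where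
 "kern_far a s = (if a = 1 then ln s else s powr (1 - a) / (1 - a))"

definition kern :: "real => real => real => real" where
 "kern a \<rho> s = (if s >= \<rho> then kern_far a s else
   kern_far a \<rho> - \<rho> * \<rho> powr (- a) * (let x = (\<rho> - s) / \<rho> in
    x + a * x ^ 2 / 2 + a * (a + 1) * x ^ 3 / 6 + a * (a + 1) * (a + 2) * x ^ 4 / 24))"

definition kern1 :: "real => real => real => real" where
 "kern1 a \<rho> s = (if s >= \<rho> then s powr (- a) else
   \<rho> powr (- a) * (let x = (\<rho> - s) / \<rho> in
    1 + a * x + a * (a + 1) * x ^ 2 / 2 + a * (a + 1) * (a + 2) * x ^ 3 / 6))"

definition kern2 :: "real => real => real => real" where
 "kern2 a \<rho> s = (if s >= \<rho> then - a * s powr (- a - 1) else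
   - (\<rho> powr (- a) / \<rho>) * (let x = (\<rho> - s) / \<rho> in
    a + a * (a + 1) * x + a * (a + 1) * (a + 2) * x ^ 2 / 2))"

definition kern3 :: "real => real => real => real" where
 "kern3 a \<rho> s = (if s >= \<rho> then a * (a + 1) * s powr (- a - 2) else
   \<rho> powr (- a) / \<rho> ^ 2 * (let x = (\<rho> - s) / \<rho> in
    a * (a + 1) + a * (a + 1) * (a + 2) * x))"

definition bump :: "real => real => real => real" where
 "bump a \<rho> s = 2 / 3 * a * (a + 1) * (a + 2) * (a + 3) * \<rho> powr (- a) * (max 0 (\<rho> - s) / \<rho>) ^ 3"

text \<open>The two branches match at \<open>\<rho>\<close> up to the third derivative. Third
  derivatives occur when the Hessian of the smeared potential is integrated by parts.\<close>

lemma kern_derivs: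
 assumes \<rho>: "\<rho> > 0"
 shows "(kern a \<rho> has_real_derivative kern1 a \<rho> s) (at s)"
  "(kern1 a \<rho> has_real_derivative kern2 a \<rho> s) (at s)"
  "(kern2 a \<rho> has_real_derivative kern3 a \<rho> s) (at s)"
  "continuous_on UNIV (kern3 a \<rho>)"
proof -
 have x: "((\<lambda>s. (\<rho> - s) / \<rho>) has_real_derivative - 1 / \<rho>) (at s)" for s
  using \<rho> by (auto intro!: derivative_eq_intros)
 have p0: "((\<lambda>x. x + a * x ^ 2 / 2 + a * (a + 1) * x ^ 3 / 6 + a * (a + 1) * (a + 2) * x ^ 4 / 24)
   has_real_derivative 1 + a * x + a * (a + 1) * x ^ 2 / 2 + a * (a + 1) * (a + 2) * x ^ 3 / 6) (at x)" for x
  by (auto intro!: derivative_eq_intros simp: field_simps)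
 have p1: "((\<lambda>x. 1 + a * x + a * (a + 1) * x ^ 2 / 2 + a * (a + 1) * (a + 2) * x ^ 3 / 6)
   has_real_derivative a + a * (a + 1) * x + a * (a + 1) * (a + 2) * x ^ 2 / 2) (at x)" for x
  by (auto intro!: derivative_eq_intros simp: field_simps)
 have p2: "((\<lambda>x. a + a * (a + 1) * x + a * (a + 1) * (a + 2) * x ^ 2 / 2)
   has_real_derivative a * (a + 1) + a * (a + 1) * (a + 2) * x) (at x)" for x
  by (auto intro!: derivative_eq_intros simp: field_simps)
 have pm: "\<rho> powr (- a - 1) = \<rho> powr (- a) / \<rho>" "\<rho> powr (- a - 2) = \<rho> powr (- a) / \<rho> ^ 2"
  using \<rho> by (simp_all add: powr_diff)
 show "(kern a \<rho> has_real_derivative kern1 a \<rho> s) (at s)"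
  unfolding kern_def[abs_def] kern1_def[abs_def] Let_def
 proof (rule DERIV_glue)
  fix s assume "\<rho> <= s"
  then have s: "s > 0" using \<rho> by simp
  show "(kern_far a has_real_derivative s powr (- a)) (at s)"
  proof (cases "a = 1")
   case True
   then have "kern_far a = ln" by (simp add: fun_eq_iff kern_far_def)
   then show ?thesis using s True DERIV_ln[of s] by (simp add: powr_minus)
  next
   case False
   then have "kern_far a = (\<lambda>s. s powr (1 - a) / (1 - a))" by (simp add: fun_eq_iff kern_far_def)
   then show ?thesis using s False by (auto intro!: derivative_eq_intros)
  qed
 next
  fix s
  show "((\<lambda>s. kern_far a \<rho> - \<rho> * \<rho> powr (- a) * ((\<rho> - s) / \<rho> + a * ((\<rho> - s) / \<rho>) ^ 2 / 2
    + a * (a + 1) * ((\<rho> - s) / \<rho>) ^ 3 / 6 + a * (a + 1) * (a + 2) * ((\<rho> - s) / \<rho>) ^ 4 / 24))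
   has_real_derivative \<rho> powr (- a) * (1 + a * ((\<rho> - s) / \<rho>) + a * (a + 1) * ((\<rho> - s) / \<rho>) ^ 2 / 2
    + a * (a + 1) * (a + 2) * ((\<rho> - s) / \<rho>) ^ 3 / 6)) (at s)"
   by (rule DERIV_cong, rule DERIV_diff[OF DERIV_const DERIV_cmult[OF DERIV_chain2[OF p0 x]]]) (use \<rho> in simp)
 qed (use \<rho> in auto)
 show "(kern1 a \<rho> has_real_derivative kern2 a \<rho> s) (at s)"
  unfolding kern1_def[abs_def] kern2_def[abs_def] Let_def
 proof (rule DERIV_glue)
  fix s
  show "((\<lambda>s. \<rho> powr (- a) * (1 + a * ((\<rho> - s) / \<rho>) + a * (a + 1) * ((\<rho> - s) / \<rho>) ^ 2 / 2
    + a * (a + 1) * (a + 2) * ((\<rho> - s) / \<rho>) ^ 3 / 6)) has_real_derivative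
   - (\<rho> powr (- a) / \<rho>) * (a + a * (a + 1) * ((\<rho> - s) / \<rho>) + a * (a + 1) * (a + 2) * ((\<rho> - s) / \<rho>) ^ 2 / 2)) (at s)"
   by (rule DERIV_cong, rule DERIV_cmult[OF DERIV_chain2[OF p1 x]]) (use \<rho> in simp)
 qed (use \<rho> in \<open>auto intro!: derivative_eq_intros simp: pm\<close>)
 show "(kern2 a \<rho> has_real_derivative kern3 a \<rho> s) (at s)"
  unfolding kern2_def[abs_def] kern3_def[abs_def] Let_def
 proof (rule DERIV_glue)
  fix s
  show "((\<lambda>s. - (\<rho> powr (- a) / \<rho>) * (a + a * (a + 1) * ((\<rho> - s) / \<rho>) + a * (a + 1) * (a + 2) * ((\<rho> - s) / \<rho>) ^ 2 / 2))
   has_real_derivative \<rho> powr (- a) / \<rho> ^ 2 * (a * (a + 1) + a * (a + 1) * (a + 2) * ((\<rho> - s) / \<rho>))) (at s)"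
   by (rule DERIV_cong, rule DERIV_cmult[OF DERIV_chain2[OF p2 x]]) (use \<rho> in \<open>simp add: power2_eq_square\<close>)
 qed (use \<rho> in \<open>auto intro!: derivative_eq_intros simp: pm algebra_simps\<close>)
 show "continuous_on UNIV (kern3 a \<rho>)"
  unfolding kern3_def[abs_def] Let_def
  by (rule continuous_on_glue) (use \<rho> in \<open>auto intro!: continuous_intros simp: pm\<close>)
qed

text \<open>For \<open>a = d / 2\<close> the left side is the Laplacian of the kernel. Below
  \<open>\<rho>\<close> all powers of \<open>x\<close> under the third cancel, and the coefficient
  that remains is the constant in \<open>bump\<close>.\<close>

lemma kern_laplacian:
 assumes \<rho>: "\<rho> > 0"
 shows "4 * a * kern1 a \<rho> s + 4 * s * kern2 a \<rho> s = bump a \<rho> s"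
proof (cases "s >= \<rho>")
 case True
 then have "s powr (- a - 1) = s powr (- a) / s" using \<rho> by (simp add: powr_diff)
 then show ?thesis using True \<rho> by (simp add: kern1_def kern2_def bump_def)
next
 case False
 define x where "x = (\<rho> - s) / \<rho>"
 have s: "s = \<rho> * (1 - x)" using \<rho> by (simp add: x_def field_simps)
 have m: "max 0 (\<rho> - s) / \<rho> = x" using False by (simp add: x_def)
 define q where "q = \<rho> powr (- a)"
 have "kern1 a \<rho> s = q * (1 + a * x + a * (a + 1) * x ^ 2 / 2 + a * (a + 1) * (a + 2) * x ^ 3 / 6)"
  using False by (simp add: kern1_def Let_def x_def q_def)
 moreover have "s * kern2 a \<rho> s = - q * (1 - x) * (a + a * (a + 1) * x + a * (a + 1) * (a + 2) * x ^ 2 / 2)"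
  using False \<rho> unfolding kern2_def Let_def x_def[symmetric] q_def[symmetric] by (subst s) simp
 moreover have "4 * a * kern1 a \<rho> s + 4 * s * kern2 a \<rho> s = 4 * a * kern1 a \<rho> s + 4 * (s * kern2 a \<rho> s)"
  by simp
 ultimately have "4 * a * kern1 a \<rho> s + 4 * s * kern2 a \<rho> s
   = 4 * a * (q * (1 + a * x + a * (a + 1) * x ^ 2 / 2 + a * (a + 1) * (a + 2) * x ^ 3 / 6))
    + 4 * (- q * (1 - x) * (a + a * (a + 1) * x + a * (a + 1) * (a + 2) * x ^ 2 / 2))"
  by (simp only:)
 also have "\<dots> = 2 / 3 * a * (a + 1) * (a + 2) * (a + 3) * q * x ^ 3"
  by (simp add: field_simps power2_eq_square power3_eq_cube)
 finally show ?thesis unfolding bump_def m q_def[symmetric] by simp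
qed

lemma kern_outside: "s >= \<rho> ==> kern a \<rho> s = kern_far a s"
 by (simp add: kern_def)

lemma bump_nonneg: "a >= 0 ==> \<rho> > 0 ==> 0 <= bump a \<rho> s"
 by (simp add: bump_def)

lemma bump_outside: "s >= \<rho> ==> bump a \<rho> s = 0"
 by (simp add: bump_def)

definition bump1 :: "real => real => real => real" where
 "bump1 a \<rho> s = 2 / 3 * a * (a + 1) * (a + 2) * (a + 3) * \<rho> powr (- a) * (- 3 * (max 0 (\<rho> - s)) ^ 2 / \<rho> ^ 3)"

definition bump2 :: "real => real => real => real" where
 "bump2 a \<rho> s = 2 / 3 * a * (a + 1) * (a + 2) * (a + 3) * \<rho> powr (- a) * (6 * max 0 (\<rho> - s) / \<rho> ^ 3)"

lemma bump_derivs: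
 shows "(bump a \<rho> has_real_derivative bump1 a \<rho> s) (at s)"
  "(bump1 a \<rho> has_real_derivative bump2 a \<rho> s) (at s)"
  "continuous_on UNIV (bump2 a \<rho>)"
proof -
 have 1: "((\<lambda>s. (max 0 (\<rho> - s)) ^ 3) has_real_derivative - 3 * (max 0 (\<rho> - s)) ^ 2) (at s)"
 proof -
  have "((\<lambda>t. (max 0 t) ^ 3) has_real_derivative 3 * (max 0 (\<rho> - s)) ^ 2) (at (\<rho> - s))"
   using DERIV_pos_part_power[of 1 "\<rho> - s"] by (simp add: numeral_3_eq_3 numeral_2_eq_2)
  moreover have "((\<lambda>s. \<rho> - s) has_real_derivative - 1) (at s)" by (auto intro!: derivative_eq_intros)
  ultimately have "((\<lambda>s. (max 0 (\<rho> - s)) ^ 3) has_real_derivative 3 * (max 0 (\<rho> - s)) ^ 2 * - 1) (at s)"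
   by (rule DERIV_chain2[where f = "\<lambda>t. (max 0 t) ^ 3"])
  then show ?thesis by simp
 qed
 have 2: "((\<lambda>s. (max 0 (\<rho> - s)) ^ 2) has_real_derivative - 2 * max 0 (\<rho> - s)) (at s)"
 proof -
  have "((\<lambda>t. (max 0 t) ^ 2) has_real_derivative 2 * max 0 (\<rho> - s)) (at (\<rho> - s))"
   using DERIV_pos_part_power[of 0 "\<rho> - s"] by (simp add: numeral_2_eq_2)
  moreover have "((\<lambda>s. \<rho> - s) has_real_derivative - 1) (at s)" by (auto intro!: derivative_eq_intros)
  ultimately have "((\<lambda>s. (max 0 (\<rho> - s)) ^ 2) has_real_derivative 2 * max 0 (\<rho> - s) * - 1) (at s)"
   by (rule DERIV_chain2[where f = "\<lambda>t. (max 0 t) ^ 2"])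
  then show ?thesis by simp
 qed
 show "(bump a \<rho> has_real_derivative bump1 a \<rho> s) (at s)"
  unfolding bump_def[abs_def] bump1_def power_divide
  by (intro DERIV_cmult DERIV_cdivide 1)
 have "((\<lambda>s. - 3 * (max 0 (\<rho> - s)) ^ 2 / \<rho> ^ 3) has_real_derivative - 3 * (- 2 * max 0 (\<rho> - s)) / \<rho> ^ 3) (at s)"
  by (intro DERIV_cmult DERIV_cdivide 2)
 then show "(bump1 a \<rho> has_real_derivative bump2 a \<rho> s) (at s)"
  unfolding bump1_def[abs_def] bump2_def by (intro DERIV_cmult) simp
 show "continuous_on UNIV (bump2 a \<rho>)"
  unfolding bump2_def[abs_def] divide_inverse by (intro continuous_intros)
qed

text \<open>\<open>\<rho> = r^2\<close> because the variable is the squared norm: the kernel is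
  altered in the ball of radius \<open>r\<close> only.\<close>

definition source :: "real => 'a::euclidean_space => real" where
 "source r z = kern (real DIM('a) / 2) (r^2) (z \<bullet> z)"

definition source' :: "real => 'a::euclidean_space => 'a => real" where
 "source' r z h = kern1 (real DIM('a) / 2) (r^2) (z \<bullet> z) * (2 * (z \<bullet> h))"

definition source'' :: "real => 'a::euclidean_space => 'a => 'a => real" where
 "source'' r b z h = kern1 (real DIM('a) / 2) (r^2) (z \<bullet> z) * (2 * (h \<bullet> b))
   + kern2 (real DIM('a) / 2) (r^2) (z \<bullet> z) * (2 * (z \<bullet> h)) * (2 * (z \<bullet> b))"

definition mollifier :: "real => 'a::euclidean_space => real" where
 "mollifier r z = bump (real DIM('a) / 2) (r^2) (z \<bullet> z)"

definition mollifier' :: "real => 'a::euclidean_space => 'a => real" where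
 "mollifier' r z h = bump1 (real DIM('a) / 2) (r^2) (z \<bullet> z) * (2 * (z \<bullet> h))"

definition mollifier'' :: "real => 'a::euclidean_space => 'a => 'a => real" where
 "mollifier'' r b z h = bump1 (real DIM('a) / 2) (r^2) (z \<bullet> z) * (2 * (h \<bullet> b))
   + bump2 (real DIM('a) / 2) (r^2) (z \<bullet> z) * (2 * (z \<bullet> h)) * (2 * (z \<bullet> b))"

lemma source_C2: "r > 0 ==> C2_on UNIV (source r) (source' r) (source'' r)"
 unfolding source_def[abs_def] source'_def[abs_def] source''_def[abs_def]
 by (rule C2_on_radial[OF kern_derivs(1,2) DERIV_continuous_on[OF kern_derivs(3)]]) simp_all

lemma mollifier_C2: "C2_on UNIV (mollifier r) (mollifier' r) (mollifier'' r)"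
 unfolding mollifier_def[abs_def] mollifier'_def[abs_def] mollifier''_def[abs_def]
 by (rule C2_on_radial[OF bump_derivs])

lemma trace2_source: "r > 0 ==> trace2 (source'' r) z = mollifier r z"
 unfolding source''_def[abs_def] trace2_radial mollifier_def
 by (subst kern_laplacian[symmetric]) auto

lemma mollifier_nonneg: "r > 0 ==> 0 <= mollifier r z"
 unfolding mollifier_def by (intro bump_nonneg) auto

lemma mollifier_outside: "r > 0 ==> norm z >= r ==> mollifier r z = 0"
 unfolding mollifier_def by (intro bump_outside) (simp add: dot_square_norm)

text \<open>Changing the radius changes the source by a compactly supported function, which can
  serve as a test function in Green's identity.\<close>

lemma source_eq_outside:
 fixes z :: "'a::euclidean_space"
 assumes "r > 0" "r' > 0" "norm z >= r" "norm z >= r'"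
 shows "source r z = source r' z"
proof -
 have "z \<bullet> z >= r^2" "z \<bullet> z >= r'^2" using assms by (auto simp: dot_square_norm)
 then show ?thesis by (simp add: source_def kern_outside)
qed

section \<open>The mean value property\<close>

lemma open_measurable_mult:
 fixes u k :: "'a::euclidean_space => real"
 assumes "set_integrable lborel \<Omega> u" "open \<Omega>" "continuous_on \<Omega> k" "\<And>x. x \<in> \<Omega> ==> \<bar>k x\<bar> <= B"
 shows "set_integrable lborel \<Omega> (\<lambda>x. u x * k x)"
proof -
 have m: "(\<lambda>x. indicator \<Omega> x *\<^sub>R k x) \<in> borel_measurable lborel"
  using borel_measurable_continuous_on_indicator[OF _ assms(3)] assms(2) by auto
 have "integrable lborel (\<lambda>x. (indicator \<Omega> x *\<^sub>R u x) * (indicator \<Omega> x *\<^sub>R k x))"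
 proof (rule Bochner_Integration.integrable_bound[where f = "\<lambda>x. B * (indicator \<Omega> x *\<^sub>R u x)"])
  show "integrable lborel (\<lambda>x. B * (indicator \<Omega> x *\<^sub>R u x))"
   using assms(1) unfolding set_integrable_def by (rule integrable_mult_right)
  have "\<bar>u x * k x\<bar> <= \<bar>B * u x\<bar>" if "x \<in> \<Omega>" for x
  proof -
   have "\<bar>u x\<bar> * \<bar>k x\<bar> <= \<bar>u x\<bar> * \<bar>B\<bar>" using assms(4)[OF that] by (intro mult_left_mono) auto
   then show ?thesis unfolding abs_mult by (simp only: mult.commute)
  qed
  then show "AE x in lborel. norm ((indicator \<Omega> x *\<^sub>R u x) * (indicator \<Omega> x *\<^sub>R k x))
    <= norm (B * (indicator \<Omega> x *\<^sub>R u x))"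
   by (auto simp: indicator_def)
  show "(\<lambda>x. (indicator \<Omega> x *\<^sub>R u x) * (indicator \<Omega> x *\<^sub>R k x)) \<in> borel_measurable lborel"
   using assms(1) m unfolding set_integrable_def by measurable
 qed
 moreover have "(\<lambda>x. (indicator \<Omega> x *\<^sub>R u x) * (indicator \<Omega> x *\<^sub>R k x)) = (\<lambda>x. indicator \<Omega> x *\<^sub>R (u x * k x))"
  by (auto simp: fun_eq_iff indicator_def)
 ultimately show ?thesis unfolding set_integrable_def by simp
qed

lemma set_integral_zero:
 fixes f :: "'a => real"
 assumes "\<And>x. x \<in> A ==> f x = 0"
 shows "(LINT x:A|M. f x) = 0"
proof -
 have "(\<lambda>x. indicator A x *\<^sub>R f x) = (\<lambda>x. 0)" using assms by (auto simp: fun_eq_iff indicator_def)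
 then show ?thesis by (simp add: set_lebesgue_integral_def)
qed

lemma trace2_shift:
 "trace2 (\<lambda>b x h. f'' b (c - x) h) x = trace2 f'' (c - x)"
 by (simp add: trace2_def)

lemma mollifier_shift_outside: "r > 0 ==> y \<notin> cball x r ==> mollifier r (x - y) = 0"
 by (intro mollifier_outside) (auto simp: dist_norm)

lemma continuous_mollifier: "continuous_on S (\<lambda>y. mollifier r (x - y))"
 by (intro continuous_on_compose2[OF C2_on_cont[OF mollifier_C2]] continuous_intros) auto

lemma mollifier_mult_integrable:
 fixes u :: "'a::euclidean_space => real"
 assumes "open \<Omega>" "continuous_on \<Omega> u" "r > 0" "cball x r \<subseteq> \<Omega>"
 shows "set_integrable lborel \<Omega> (\<lambda>y. u y * mollifier r (x - y))"
 by (rule integrable_continuous_compact_support_on[OF assms(1) _ _ assms(4)])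
  (use assms mollifier_shift_outside in \<open>auto intro!: continuous_on_mult continuous_mollifier\<close>)

text \<open>The difference of two sources is a test function supported in the larger ball, and its
  Laplacian is the difference of the mollifiers.\<close>

lemma mollifier_average_independent:
 fixes u :: "'a::euclidean_space => real"
 assumes \<Omega>: "open \<Omega>" and u: "harmonic_on \<Omega> u"
  and r: "r > 0" "cball x r \<subseteq> \<Omega>" "r' > 0" "cball x r' \<subseteq> \<Omega>"
 shows "(LINT y:\<Omega>|lborel. u y * mollifier r (x - y)) = (LINT y:\<Omega>|lborel. u y * mollifier r' (x - y))"
proof -
 obtain u' u'' where u2: "C2_on \<Omega> u u' u''" "\<forall>x\<in>\<Omega>. trace2 u'' x = 0"
  using harmonic_on_iff[OF \<Omega>] u by metis
 define s where "s = max r r'"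
 have s: "cball x s \<subseteq> \<Omega>" using r by (simp add: s_def max_def)
 have C: "C2_on \<Omega> (\<lambda>y. source r (x - y) + (- 1) * source r' (x - y))
   (\<lambda>y h. - source' r (x - y) h + (- 1) * - source' r' (x - y) h)
   (\<lambda>b y h. source'' r b (x - y) h + (- 1) * source'' r' b (x - y) h)"
  by (intro C2_on_add C2_on_cmult C2_on_shift source_C2 r)
 have tr: "trace2 (\<lambda>b y h. source'' r b (x - y) h + (- 1) * source'' r' b (x - y) h) y
   = mollifier r (x - y) - mollifier r' (x - y)" for y
  using trace2_source[OF r(1), of "x - y"] trace2_source[OF r(3), of "x - y"]
  unfolding trace2_def by (simp add: sum_subtractf)
 have "(LINT y:\<Omega>|lborel. u y * (mollifier r (x - y) - mollifier r' (x - y)))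
   = (LINT y:\<Omega>|lborel. (source r (x - y) + (- 1) * source r' (x - y)) * trace2 u'' y)"
 proof (rule Green_identity(3)[OF \<Omega> compact_cball s u2(1) C, unfolded tr])
  fix y assume "y \<in> \<Omega> - cball x s"
  then show "source r (x - y) + (- 1) * source r' (x - y) = 0"
   using source_eq_outside[OF r(1,3), of "x - y"] by (auto simp: s_def dist_norm)
 qed
 also have "\<dots> = 0" using u2(2) by (intro set_integral_zero) simp
 finally show ?thesis
  using set_integral_diff(2)[OF mollifier_mult_integrable[OF \<Omega> harmonic_on_continuous[OF \<Omega> u] r(1,2)]
    mollifier_mult_integrable[OF \<Omega> harmonic_on_continuous[OF \<Omega> u] r(3,4)]]
  by (simp add: right_diff_distrib)
qed

text \<open>The mollifiers are not normalised; their common integral enters all formulas as an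
  unspecified positive constant.\<close>

definition mollifier_mass :: "'a::euclidean_space itself => real" where
 "mollifier_mass _ = (LINT z::'a|lborel. mollifier 1 (0 - z))"

text \<open>Independence of the radius is the case of the harmonic function 1 on the whole
  space.\<close>

lemma mollifier_integral:
 fixes x :: "'a::euclidean_space"
 assumes "r > 0"
 shows "(LINT y|lborel. mollifier r (x - y)) = mollifier_mass TYPE('a)"
proof -
 have m: "(\<lambda>y::'a. mollifier r (x - y)) \<in> borel_measurable borel"
  using continuous_mollifier by (rule borel_measurable_continuous_onI)
 have "(LINT y|lborel. mollifier r (x - y)) = (LINT y|lborel. mollifier r (x - (y + x)))"
  by (rule lborel_integral_translate(1)[OF m, symmetric])
 also have "\<dots> = (LINT y::'a:UNIV|lborel. 1 * mollifier r (0 - y))" by (simp add: set_lebesgue_integral_def)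
 also have "\<dots> = (LINT y::'a:UNIV|lborel. 1 * mollifier 1 (0 - y))"
  by (rule mollifier_average_independent) (use assms in \<open>auto intro: harmonic_on_const\<close>)
 also have "\<dots> = mollifier_mass TYPE('a)" by (simp add: mollifier_mass_def set_lebesgue_integral_def)
 finally show ?thesis .
qed

lemma mollifier_integrable: "r > 0 ==> integrable lborel (\<lambda>y. mollifier r (x - y))"
 by (rule integrable_continuous_compact_support[OF continuous_mollifier compact_cball])
  (rule mollifier_shift_outside)

lemma mollifier_mass_pos: "0 < mollifier_mass TYPE('a::euclidean_space)"
proof -
 define a where "a = real DIM('a) / 2"
 have a: "a > 0" by (simp add: a_def)
 define m where "m = bump a 1 (1/4)"
 have m: "m > 0" using a by (simp add: m_def bump_def)
 have "m * measure lborel (ball (0::'a) (1/2)) = (LINT y::'a|lborel. m * indicator (ball 0 (1/2)) y)"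
  by (simp add: measure_def)
 also have "\<dots> <= (LINT y::'a|lborel. mollifier 1 (0 - y))"
 proof (rule integral_mono)
  show "integrable lborel (\<lambda>y::'a. m * indicator (ball 0 (1/2)) y)"
   by (intro integrable_mult_right integrable_real_indicator emeasure_bounded_finite) auto
  show "integrable lborel (\<lambda>y::'a. mollifier 1 (0 - y))" by (rule mollifier_integrable) simp
  fix y :: 'a
  show "m * indicator (ball 0 (1/2)) y <= mollifier 1 (0 - y)"
  proof (cases "norm y < 1/2")
   case True
   then have "(norm y)^2 <= (1/2)^2" by (intro power_mono) auto
   then have "y \<bullet> y <= 1/4" by (simp add: dot_square_norm power2_eq_square)
   then have "m <= bump a 1 (y \<bullet> y)"
    unfolding m_def bump_def using a by (intro mult_left_mono power_mono divide_right_mono) auto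
   then show ?thesis using True by (simp add: mollifier_def a_def indicator_def)
  next
   case False
   then show ?thesis using mollifier_nonneg[of 1 "- y"] by simp
  qed
 qed
 finally show ?thesis
  using mult_pos_pos[OF m content_ball_pos[OF half_gt_zero[OF zero_less_one], of "0::'a"]]
  unfolding mollifier_mass_def by linarith
qed

text \<open>The weighted average is the same for all radii, and by continuity of \<open>u\<close> it
  is as close to the asserted value as desired for a small one.\<close>

theorem mean_value_property:
 fixes u :: "'a::euclidean_space => real"
 assumes \<Omega>: "open \<Omega>" and u: "harmonic_on \<Omega> u" and r: "r > 0" "cball x r \<subseteq> \<Omega>"
 shows "(LINT y:\<Omega>|lborel. u y * mollifier r (x - y)) = mollifier_mass TYPE('a) * u x"
proof -
 let ?C = "\<lambda>r. LINT y:\<Omega>|lborel. u y * mollifier r (x - y)"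
 let ?M = "mollifier_mass TYPE('a)"
 have x: "x \<in> \<Omega>" using r by auto
 have "\<bar>(?C r) - ?M * u x\<bar> <= e * ?M" if e: "e > 0" for e
 proof -
  have "isCont u x" using harmonic_on_continuous[OF \<Omega> u] \<Omega> x by (simp add: continuous_on_eq_continuous_at)
  then obtain d where d: "d > 0" "\<And>y. dist y x < d ==> dist (u y) (u x) < e"
   using e unfolding continuous_at_eps_delta by blast
  define s where "s = min r (d/2)"
  have s: "s > 0" "s < d" "cball x s \<subseteq> \<Omega>" using r d(1) by (auto simp: s_def)
  have i1: "set_integrable lborel \<Omega> (\<lambda>y. u y * mollifier s (x - y))"
   by (rule mollifier_mult_integrable[OF \<Omega> harmonic_on_continuous[OF \<Omega> u] s(1,3)])
  have eq: "indicator \<Omega> y *\<^sub>R mollifier s (x - y) = mollifier s (x - y)" for y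
   using mollifier_shift_outside[OF s(1), of y x] s(3) by (cases "y \<in> cball x s") auto
  have i2: "set_integrable lborel \<Omega> (\<lambda>y. u x * mollifier s (x - y))"
  proof -
   have "integrable lborel (\<lambda>y. u x * (indicator \<Omega> y *\<^sub>R mollifier s (x - y)))"
    unfolding eq using mollifier_integrable[OF s(1)] by (rule integrable_mult_right)
   then show ?thesis unfolding set_integrable_def by (simp add: mult.left_commute)
  qed
  have I: "(LINT y:\<Omega>|lborel. c * mollifier s (x - y)) = c * ?M" for c
  proof -
   have "(LINT y:\<Omega>|lborel. c * mollifier s (x - y)) = (LINT y|lborel. c * (indicator \<Omega> y *\<^sub>R mollifier s (x - y)))"
    by (simp add: set_lebesgue_integral_def mult.left_commute)
   then show ?thesis unfolding eq using mollifier_integral[OF s(1), of x] by simp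
  qed
  have "(?C r) - ?M * u x
    = (?C s) - (LINT y:\<Omega>|lborel. u x * mollifier s (x - y))"
   unfolding mollifier_average_independent[OF \<Omega> u r s(1,3)] I[of "u x"] by (simp only: mult.commute)
  also have "\<dots> = (LINT y:\<Omega>|lborel. u y * mollifier s (x - y) - u x * mollifier s (x - y))"
   using set_integral_diff(2)[OF i1 i2] by simp
  also have "\<bar>\<dots>\<bar> <= (LINT y:\<Omega>|lborel. e * mollifier s (x - y))"
   unfolding set_lebesgue_integral_def
  proof (rule integral_abs_bound[THEN order_trans], rule integral_mono)
   show "integrable lborel (\<lambda>y. \<bar>indicator \<Omega> y *\<^sub>R (u y * mollifier s (x - y) - u x * mollifier s (x - y))\<bar>)"
    using set_integral_diff(1)[OF i1 i2] unfolding set_integrable_def by (rule integrable_abs)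
   have "integrable lborel (\<lambda>y. e * (indicator \<Omega> y *\<^sub>R mollifier s (x - y)))"
    unfolding eq using mollifier_integrable[OF s(1)] by (rule integrable_mult_right)
   then show "integrable lborel (\<lambda>y. indicator \<Omega> y *\<^sub>R (e * mollifier s (x - y)))"
    by (simp add: mult.left_commute)
   fix y
   show "\<bar>indicator \<Omega> y *\<^sub>R (u y * mollifier s (x - y) - u x * mollifier s (x - y))\<bar>
     <= indicator \<Omega> y *\<^sub>R (e * mollifier s (x - y))"
   proof (cases "y \<in> cball x s")
    case True
    then have "\<bar>u y - u x\<bar> <= e"
     using d(2)[of y] s(2) by (auto simp: dist_norm norm_minus_commute)
    then have "\<bar>u y - u x\<bar> * mollifier s (x - y) <= e * mollifier s (x - y)"
     using mollifier_nonneg[OF s(1)] by (rule mult_right_mono)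
    moreover have "\<bar>u y * mollifier s (x - y) - u x * mollifier s (x - y)\<bar> = \<bar>u y - u x\<bar> * mollifier s (x - y)"
     using mollifier_nonneg[OF s(1), of "x - y"] by (simp add: abs_mult left_diff_distrib[symmetric])
    ultimately show ?thesis by (simp add: indicator_def)
   next
    case False
    then have "mollifier s (x - y) = 0" by (rule mollifier_shift_outside[OF s(1)])
    then show ?thesis by simp
   qed
  qed
  also have "\<dots> = e * ?M" by (rule I)
  finally show ?thesis .
 qed
 then have bd: "\<And>e. e > 0 ==> \<bar>(?C r) - ?M * u x\<bar> <= e * ?M" .
 have "\<bar>(?C r) - ?M * u x\<bar> <= 0 + e" if "e > 0" for e
  using bd[of "e / ?M"] that mollifier_mass_pos[where 'a = 'a] by simp
 then have "\<bar>(?C r) - ?M * u x\<bar> <= 0"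
  by (rule field_le_epsilon)
 then show ?thesis by simp
qed

text \<open>Convergence in the mean and the mean value property give pointwise convergence, and near
  each point the limit is a multiple of the convolution of \<open>u\<close> with a fixed mollifier,
  hence twice differentiable. Its Laplacian pairs \<open>u\<close> with the Laplacian of the
  mollifier, against which every \<open>un n\<close> integrates to zero.\<close>

theorem harmonic_L1_limit:
 fixes u :: "'a::euclidean_space => real"
 assumes \<Omega>: "open \<Omega>" "bounded \<Omega>" and un: "\<And>n. harmonic_on \<Omega> (un n)"
  and int: "\<And>n. set_integrable lborel \<Omega> (un n)" "set_integrable lborel \<Omega> u"
  and lim: "(\<lambda>n. LINT x:\<Omega>|lborel. \<bar>un n x - u x\<bar>) \<longlonglongrightarrow> 0"
 obtains h where "harmonic_on \<Omega> h" "AE x in lborel. x \<in> \<Omega> --> u x = h x"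
proof -
 let ?I = "\<lambda>n. LINT x:\<Omega>|lborel. \<bar>un n x - u x\<bar>" and ?J = "\<lambda>u k. LINT x:\<Omega>|lborel. u x * k x :: real"
 let ?M = "mollifier_mass TYPE('a)"
 have M: "?M > 0" by (rule mollifier_mass_pos)
 have bk: "\<exists>B. \<forall>x\<in>\<Omega>. \<bar>k x\<bar> <= B" if k: "continuous_on UNIV k" for k :: "'a => real"
 proof -
  obtain B where "\<And>x. x \<in> closure \<Omega> ==> norm (k x) <= B"
   by (rule continuous_on_compact_bound[OF _ continuous_on_subset[OF k], of "closure \<Omega>"]) (use \<Omega>(2) in auto)
  then show ?thesis using closure_subset by (intro exI[of _ B]) auto
 qed
 have wk: "(\<lambda>n. ?J (un n) k) \<longlonglongrightarrow> (?J u k)"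
  if k: "continuous_on UNIV k" for k
 proof -
  obtain B where B: "\<And>x. x \<in> \<Omega> ==> \<bar>k x\<bar> <= B" using bk[OF k] by blast
  have kO: "continuous_on \<Omega> k" using k continuous_on_subset by blast
  note i1 = open_measurable_mult[OF int(1) \<Omega>(1) kO B] and i2 = open_measurable_mult[OF int(2) \<Omega>(1) kO B]
  have le: "\<bar>(?J (un n) k) - (?J u k)\<bar>
    <= B * (?I n)" for n
  proof -
   have "(?J (un n) k) - (?J u k)
     = (LINT x:\<Omega>|lborel. un n x * k x - u x * k x)"
    using set_integral_diff(2)[OF i1 i2] by simp
   also have "\<bar>\<dots>\<bar> <= (LINT x:\<Omega>|lborel. B * \<bar>un n x - u x\<bar>)"
    unfolding set_lebesgue_integral_def
   proof (rule integral_abs_bound[THEN order_trans], rule integral_mono)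
    show "integrable lborel (\<lambda>x. \<bar>indicator \<Omega> x *\<^sub>R (un n x * k x - u x * k x)\<bar>)"
     using set_integral_diff(1)[OF i1 i2] unfolding set_integrable_def by (rule integrable_abs)
    have "integrable lborel (\<lambda>x. B * \<bar>indicator \<Omega> x *\<^sub>R (un n x - u x)\<bar>)"
     using set_integral_diff(1)[OF int] unfolding set_integrable_def by (intro integrable_mult_right integrable_abs)
    then show "integrable lborel (\<lambda>x. indicator \<Omega> x *\<^sub>R (B * \<bar>un n x - u x\<bar>))"
     by (simp add: abs_mult mult.left_commute)
    fix x
    show "\<bar>indicator \<Omega> x *\<^sub>R (un n x * k x - u x * k x)\<bar> <= indicator \<Omega> x *\<^sub>R (B * \<bar>un n x - u x\<bar>)"
    proof (cases "x \<in> \<Omega>")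
     case True
     have "\<bar>un n x * k x - u x * k x\<bar> = \<bar>k x\<bar> * \<bar>un n x - u x\<bar>"
      by (simp add: abs_mult[symmetric] algebra_simps)
     also have "\<dots> <= B * \<bar>un n x - u x\<bar>" using B[OF True] by (intro mult_right_mono) auto
     finally show ?thesis using True by simp
    qed simp
   qed
   finally show ?thesis by simp
  qed
  have lim0: "(\<lambda>n. B * (?I n)) \<longlonglongrightarrow> 0"
   using tendsto_mult[OF tendsto_const[of B] lim] by simp
  have "(\<lambda>n. \<bar>(?J (un n) k) - (?J u k)\<bar>) \<longlonglongrightarrow> 0"
  proof (rule tendsto_sandwich[OF _ _ tendsto_const lim0])
   show "\<forall>\<^sub>F n in sequentially. \<bar>(?J (un n) k) - (?J u k)\<bar>
     <= B * (?I n)"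
    by (intro always_eventually allI le)
  qed simp
  then have "(\<lambda>n. (?J (un n) k) - (?J u k)) \<longlonglongrightarrow> 0"
   by (rule tendsto_rabs_zero_cancel)
  then show ?thesis by (rule LIM_zero_cancel)
 qed
 define v where "v y = indicator \<Omega> y * u y" for y
 obtain R where R: "\<Omega> \<subseteq> cball 0 R" using \<Omega>(2) bounded_subset_ballD[of \<Omega> 0] by (meson ball_subset_cball order_trans)
 have v: "integrable lborel v" "{y. v y \<noteq> 0} \<subseteq> cball 0 R"
  using int(2) R by (auto simp: v_def[abs_def] set_integrable_def indicator_def)
 have conv: "convolution v k x = (LINT y:\<Omega>|lborel. u y * k (x - y))" for k x
  by (simp add: convolution_def v_def set_lebesgue_integral_def mult.assoc)
 have ptw: "(\<lambda>n. un n x) \<longlonglongrightarrow> convolution v (mollifier r) x / ?M"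
  if "r > 0" "cball x r \<subseteq> \<Omega>" for x r
 proof -
  have "(\<lambda>n. (LINT y:\<Omega>|lborel. un n y * mollifier r (x - y)) / ?M) \<longlonglongrightarrow> convolution v (mollifier r) x / ?M"
   unfolding conv using M by (intro tendsto_divide wk tendsto_const continuous_mollifier) auto
  then show ?thesis using mean_value_property[OF \<Omega>(1) un that] M by simp
 qed
 define h where "h x = lim (\<lambda>n. un n x)" for x
 have hl: "(\<lambda>n. un n x) \<longlonglongrightarrow> h x" and hc: "r > 0 ==> cball x r \<subseteq> \<Omega> ==> h x = convolution v (mollifier r) x / ?M"
  if x: "x \<in> \<Omega>" for x r
 proof -
  obtain s where "s > 0" "cball x s \<subseteq> \<Omega>" using \<Omega>(1) x open_contains_cball by blast
  then show "(\<lambda>n. un n x) \<longlonglongrightarrow> h x" using ptw unfolding h_def by (metis convergent_LIMSEQ_iff convergentI)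
  then show "h x = convolution v (mollifier r) x / ?M" if "r > 0" "cball x r \<subseteq> \<Omega>"
   using ptw[OF that] LIMSEQ_unique by blast
 qed
 have harm: "harmonic_on \<Omega> h"
 proof (rule harmonic_on_local)
  fix x0 assume x0: "x0 \<in> \<Omega>"
  then obtain s where s: "s > 0" "cball x0 s \<subseteq> \<Omega>" using \<Omega>(1) open_contains_cball by blast
  \<comment> \<open>Half the radius, so that one mollifier serves all points of the ball around
    \<open>x0\<close>.\<close>
  define r where "r = s / 2"
  have r: "r > 0" using s by (simp add: r_def)
  have sub: "cball x r \<subseteq> \<Omega>" if "x \<in> ball x0 r" for x
  proof -
   have "cball x r \<subseteq> cball x0 s"
    using that by (intro cball_subset_cball_iff[THEN iffD2]) (auto simp: r_def dist_commute)
   then show ?thesis using s by blast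
  qed
  have "trace2 (\<lambda>b x h. convolution v (\<lambda>z. mollifier'' r b z h) x) x = 0" if x: "x \<in> ball x0 r" for x
  proof -
   have k: "continuous_on UNIV (\<lambda>y. trace2 (mollifier'' r) (x - y))"
    by (intro continuous_on_compose2[OF C2_on_cont_trace[OF mollifier_C2]] continuous_intros) auto
   have "(LINT y:\<Omega>|lborel. un n y * trace2 (mollifier'' r) (x - y)) = 0" for n
   proof -
    obtain u' u'' where u2: "C2_on \<Omega> (un n) u' u''" "\<forall>x\<in>\<Omega>. trace2 u'' x = 0"
     using harmonic_on_iff[OF \<Omega>(1)] un by metis
    have "(LINT y:\<Omega>|lborel. un n y * trace2 (\<lambda>b y h. mollifier'' r b (x - y) h) y)
      = (LINT y:\<Omega>|lborel. mollifier r (x - y) * trace2 u'' y)"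
     by (rule Green_identity(3)[OF \<Omega>(1) compact_cball sub[OF x] u2(1) C2_on_shift[OF mollifier_C2]])
      (use mollifier_shift_outside[OF r] in auto)
    also have "\<dots> = 0" using u2(2) by (intro set_integral_zero) simp
    finally show ?thesis by (simp add: trace2_shift)
   qed
   then have "convolution v (trace2 (mollifier'' r)) x = 0"
    unfolding conv using wk[OF k] LIMSEQ_unique[OF _ tendsto_const] by simp
   then show ?thesis using convolution_trace2[OF v mollifier_C2] by simp
  qed
  then have "harmonic_on (ball x0 r) (convolution v (mollifier r))"
   using C2_on_subset[OF convolution_C2[OF v mollifier_C2] subset_UNIV]
   by (subst harmonic_on_iff) blast+
  then have "harmonic_on (ball x0 r) (\<lambda>x. (1 / ?M) * convolution v (mollifier r) x)"
   by (intro harmonic_on_bounded_linear[OF _ bounded_linear_mult_right]) auto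
  moreover have "h x = (1 / ?M) * convolution v (mollifier r) x" if "x \<in> ball x0 r" for x
   using hc[OF _ r sub[OF that]] subsetD[OF sub[OF that], of x] r by simp
  ultimately have "harmonic_on (ball x0 r) h"
   by (intro harmonic_on_cong[of "ball x0 r" _ h]) auto
  then show "\<exists>N. open N \<and> x0 \<in> N \<and> harmonic_on N h" using r by (intro exI[of _ "ball x0 r"]) auto
 qed
 \<comment> \<open>Fatou's lemma identifies the pointwise limit \<open>h\<close> with the limit
   \<open>u\<close> in the mean.\<close>
 let ?d = "\<lambda>v x. \<bar>indicator \<Omega> x *\<^sub>R v x - indicator \<Omega> x *\<^sub>R u x\<bar>"
 have m1: "(\<lambda>x. indicator \<Omega> x *\<^sub>R un n x) \<in> borel_measurable lborel"
  and m2: "(\<lambda>x. indicator \<Omega> x *\<^sub>R u x) \<in> borel_measurable lborel" for n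
  using int unfolding set_integrable_def by auto
 have m3: "(\<lambda>x. indicator \<Omega> x *\<^sub>R h x) \<in> borel_measurable lborel"
  using borel_measurable_continuous_on_indicator[OF _ harmonic_on_continuous[OF \<Omega>(1) harm]] \<Omega>(1) by auto
 have "(\<integral>\<^sup>+x. ennreal (?d h x) \<partial>lborel)
   <= (\<integral>\<^sup>+x. liminf (\<lambda>n. ennreal (?d (un n) x)) \<partial>lborel)"
 proof (rule nn_integral_mono)
  fix x
  have "(\<lambda>n. indicator \<Omega> x *\<^sub>R un n x) \<longlonglongrightarrow> indicator \<Omega> x *\<^sub>R h x"
   using hl by (cases "x \<in> \<Omega>") auto
  then have "(\<lambda>n. ennreal (?d (un n) x))
    \<longlonglongrightarrow> ennreal (?d h x)"
   by (intro tendsto_ennrealI tendsto_rabs tendsto_diff tendsto_const)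
  then have "liminf (\<lambda>n. ennreal (?d (un n) x))
    = ennreal (?d h x)"
   by (rule lim_imp_Liminf[rotated]) simp
  then show "ennreal (?d h x)
   <= liminf (\<lambda>n. ennreal (?d (un n) x))" by simp
 qed
 also have "\<dots> <= liminf (\<lambda>n. \<integral>\<^sup>+x. ennreal (?d (un n) x) \<partial>lborel)"
  using m1 m2 by (intro nn_integral_liminf) auto
 also have "(\<lambda>n. \<integral>\<^sup>+x. ennreal (?d (un n) x) \<partial>lborel)
   = (\<lambda>n. ennreal (?I n))"
 proof
  fix n
  have e: "(\<lambda>x. indicator \<Omega> x *\<^sub>R \<bar>un n x - u x\<bar>) = (\<lambda>x. (?d (un n) x))"
   by (auto simp: fun_eq_iff indicator_def)
  show "(\<integral>\<^sup>+x. ennreal (?d (un n) x) \<partial>lborel)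
   = ennreal (?I n)"
   unfolding set_lebesgue_integral_def e
   using int unfolding set_integrable_def by (intro nn_integral_eq_integral) auto
 qed
 also have "liminf (\<lambda>n. ennreal (?I n)) = 0"
 proof -
  have "(\<lambda>n. ennreal (?I n)) \<longlonglongrightarrow> ennreal 0"
   using lim by (rule tendsto_ennrealI)
  then show ?thesis using lim_imp_Liminf[OF sequentially_bot] by fastforce
 qed
 finally have "(\<integral>\<^sup>+x. ennreal (?d h x) \<partial>lborel) = 0" by simp
 then have "AE x in lborel. ennreal (?d h x) = 0"
  using m2 m3 by (subst (asm) nn_integral_0_iff_AE) auto
 then have "AE x in lborel. x \<in> \<Omega> --> u x = h x"
  by eventually_elim (auto simp: indicator_def)
 with harm that show ?thesis by blast
qed

section \<open>Density of harmonic functions with sources outside the domain\<close>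

text \<open>A twice continuously differentiable \<open>max 0 s\<close>: \<open>ramp2\<close> is the
  hat function on \<open>[0, 1]\<close> of height 2, hence of integral 1, so that
  \<open>ramp1\<close> rises from 0 to 1 and \<open>ramp\<close> continues as
  \<open>s - 1/2\<close>.\<close>

definition ramp :: "real => real" where
 "ramp s = (2/3) * (max 0 s ^ 3 - 2 * max 0 (s - 1/2) ^ 3 + max 0 (s - 1) ^ 3)"

definition ramp1 :: "real => real" where
 "ramp1 s = 2 * (max 0 s ^ 2 - 2 * max 0 (s - 1/2) ^ 2 + max 0 (s - 1) ^ 2)"

definition ramp2 :: "real => real" where
 "ramp2 s = 4 * (max 0 s - 2 * max 0 (s - 1/2) + max 0 (s - 1))"

lemma ramp:
 "(ramp has_real_derivative ramp1 s) (at s)" "(ramp1 has_real_derivative ramp2 s) (at s)"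
 "continuous_on UNIV ramp2" "s <= 0 ==> ramp s = 0" "s <= 0 ==> ramp1 s = 0"
 "s >= 1 ==> ramp s = s - 1/2" "s >= 1 ==> ramp1 s = 1" "s >= 1 ==> ramp2 s = 0"
 "0 <= ramp s" "s <= 1 ==> ramp s <= 1/2" "0 <= ramp1 s" "ramp1 s <= 1" "0 <= ramp2 s" "ramp2 s <= 2"
 "s <= 0 ==> ramp2 s = 0" and ramp_mono: "s <= t ==> ramp s <= ramp t"
proof -
 have p3: "((\<lambda>s. max 0 (s - c) ^ 3) has_real_derivative 3 * max 0 (s - c) ^ 2) (at s)"
  and p2: "((\<lambda>s. max 0 (s - c) ^ 2) has_real_derivative 2 * max 0 (s - c)) (at s)" for s c :: real
  using DERIV_shift[of "\<lambda>s. max 0 s ^ 3" "3 * max 0 (s - c) ^ 2" s "- c"] DERIV_shift[of "\<lambda>s. max 0 s ^ 2" "2 * max 0 (s - c)" s "- c"]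
   DERIV_pos_part_power[of 1 "s - c"] DERIV_pos_part_power[of 0 "s - c"]
  by (simp_all add: numeral_3_eq_3 numeral_2_eq_2)
 have d0: "(ramp has_real_derivative ramp1 s) (at s)" for s
  unfolding ramp_def[abs_def]
  by (rule DERIV_cong[OF DERIV_cmult[OF DERIV_add[OF DERIV_diff[OF p3[of 0, unfolded diff_zero] DERIV_cmult[OF p3]] p3]]]) (simp add: ramp1_def)
 have d1: "(ramp1 has_real_derivative ramp2 s) (at s)" for s
  unfolding ramp1_def[abs_def]
  by (rule DERIV_cong[OF DERIV_cmult[OF DERIV_add[OF DERIV_diff[OF p2[of 0, unfolded diff_zero] DERIV_cmult[OF p2]] p2]]]) (simp add: ramp2_def)
 show "(ramp has_real_derivative ramp1 s) (at s)" "(ramp1 has_real_derivative ramp2 s) (at s)" by (rule d0 d1)+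
 show "continuous_on UNIV ramp2" unfolding ramp2_def by (intro continuous_intros)
 have g: "0 <= ramp2 s" "ramp2 s <= 2" for s by (auto simp: ramp2_def max_def)
 have l: "ramp s = 0" "ramp1 s = 0" "ramp2 s = 0" if "s <= 0" for s using that by (simp_all add: ramp_def ramp1_def ramp2_def)
 have u: "ramp s = s - 1/2" "ramp1 s = 1" "ramp2 s = 0" if "s >= 1" for s
  using that by (simp_all add: ramp_def ramp1_def ramp2_def field_simps power2_eq_square power3_eq_cube)
 have m1: "ramp1 s <= ramp1 t" if "s <= t" for s t
  using DERIV_nonneg_imp_nondecreasing[OF that] d1 g(1) by blast
 have b1: "0 <= ramp1 s" "ramp1 s <= 1" for s
  using m1[of s "max s 1"] m1[of "min s 0" s] l(2)[of "min s 0"] u(2)[of "max s 1"] by auto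
 have m0: "ramp s <= ramp t" if "s <= t" for s t
  using DERIV_nonneg_imp_nondecreasing[OF that] d0 b1(1) by blast
 show "0 <= ramp s" using m0[of "min s 0" s] l(1)[of "min s 0"] by simp
 show "ramp s <= 1/2" if "s <= 1" using m0[OF that] u(1)[of 1] by simp
 show "ramp s = 0" "ramp1 s = 0" "ramp2 s = 0" if "s <= 0" by (rule l[OF that])+
 show "ramp s = s - 1/2" "ramp1 s = 1" "ramp2 s = 0" if "s >= 1" by (rule u[OF that])+
 show "0 <= ramp1 s" "ramp1 s <= 1" "0 <= ramp2 s" "ramp2 s <= 2" by (rule b1 g)+
 show "ramp s <= ramp t" if "s <= t" by (rule m0[OF that])
qed

text \<open>A difference of two ramps whose arguments differ by one: for \<open>s >= 1\<close> both
  are in their affine range and differ by exactly one.\<close>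

lemma smooth_step:
 obtains st st1 st2 :: "real => real" and C where
  "\<And>s. (st has_real_derivative st1 s) (at s)" "\<And>s. (st1 has_real_derivative st2 s) (at s)"
  "continuous_on UNIV st2" "\<And>s. s <= 0 ==> st s = 0" "\<And>s. s >= 1 ==> st s = 1"
  "\<And>s. s >= 1 ==> st1 s = 0" "\<And>s. s >= 1 ==> st2 s = 0" "\<And>s. 0 <= st s"
  "\<And>s. \<bar>st1 s\<bar> <= C" "\<And>s. \<bar>st2 s\<bar> <= C"
proof (rule that[of "\<lambda>s. ramp (2 * s) - ramp (2 * s - 1)" "\<lambda>s. 2 * ramp1 (2 * s) - 2 * ramp1 (2 * s - 1)"
   "\<lambda>s. 4 * ramp2 (2 * s) - 4 * ramp2 (2 * s - 1)" 8])
 have i: "((\<lambda>s. 2 * s) has_real_derivative 2) (at s)" "((\<lambda>s. 2 * s - 1) has_real_derivative 2) (at s)" for s :: real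
  by (auto intro!: derivative_eq_intros)
 show "((\<lambda>s. ramp (2 * s) - ramp (2 * s - 1)) has_real_derivative 2 * ramp1 (2 * s) - 2 * ramp1 (2 * s - 1)) (at s)" for s
  by (rule DERIV_cong[OF DERIV_diff[OF DERIV_chain2[OF ramp(1) i(1)] DERIV_chain2[OF ramp(1) i(2)]]]) simp
 show "((\<lambda>s. 2 * ramp1 (2 * s) - 2 * ramp1 (2 * s - 1)) has_real_derivative 4 * ramp2 (2 * s) - 4 * ramp2 (2 * s - 1)) (at s)" for s
  by (rule DERIV_cong[OF DERIV_diff[OF DERIV_cmult[OF DERIV_chain2[OF ramp(2) i(1)]] DERIV_cmult[OF DERIV_chain2[OF ramp(2) i(2)]]]]) simp
 show "continuous_on UNIV (\<lambda>s. 4 * ramp2 (2 * s) - 4 * ramp2 (2 * s - 1))"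
  by (intro continuous_intros continuous_on_compose2[OF ramp(3)]) auto
 show "\<bar>2 * ramp1 (2 * s) - 2 * ramp1 (2 * s - 1)\<bar> <= 8" "\<bar>4 * ramp2 (2 * s) - 4 * ramp2 (2 * s - 1)\<bar> <= 8" for s
  using ramp(11,12)[of "2 * s"] ramp(11,12)[of "2 * s - 1"] ramp(13,14)[of "2 * s"] ramp(13,14)[of "2 * s - 1"] by auto
qed (use ramp(4,6-8) ramp_mono in auto)

text \<open>Two integrations by parts turn the square of each mixed derivative into the product of
  two pure ones.\<close>

lemma hessian_norm_eq_laplacian_norm:
 fixes w :: "'a::euclidean_space => real"
 assumes w: "C2_on UNIV w w' w''" and w3: "\<And>b c. C1_on UNIV (\<lambda>x. w'' b x c) (w3 b c)"
  and sym: "\<And>b c x. w3 b c x c = w3 c c x b"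
  and K: "compact K" "\<And>x. x \<notin> K ==> w x = 0"
 shows "(LINT x|lborel. (\<Sum>b\<in>Basis. \<Sum>c\<in>Basis. (w'' b x c)^2)) = (LINT x|lborel. (trace2 w'' x)^2)"
  "\<And>x b. x \<notin> K ==> w' x b = 0" "\<And>x b c. x \<notin> K ==> w'' b x c = 0"
proof -
 have op: "open (- K)" using K(1) compact_imp_closed by blast
 show z1: "w' x b = 0" if "x \<notin> K" for x b
  by (rule C1_on_deriv_zero[OF C2_onD1[OF w] op]) (use that K in auto)
 show z2: "w'' b x c = 0" if "x \<notin> K" for x b c
  by (rule C1_on_deriv_zero[OF C2_onD2[OF w] op]) (use that z1 in auto)
 have bc: "(LINT x|lborel. (w'' b x c)^2 - w'' b x b * w'' c x c) = 0"
  and bci: "integrable lborel (\<lambda>x. (w'' b x c)^2 - w'' b x b * w'' c x c)" for b c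
 proof -
  have 1: "C1_on UNIV (\<lambda>x. w' x b * w'' b x c) (\<lambda>x h. w' x b * w3 b c x h + w'' b x h * w'' b x c)"
   and 2: "C1_on UNIV (\<lambda>x. w' x b * w'' c x c) (\<lambda>x h. w' x b * w3 c c x h + w'' b x h * w'' c x c)"
   by (intro C1_on_mult C2_onD2[OF w] w3)+
  have z: "x \<notin> K ==> w' x b * w'' b x c = 0" "x \<notin> K ==> w' x b * w'' c x c = 0" for x
   using z1 by auto
  note I1 = integral_deriv_compact_support[OF 1 K(1) z(1), of c]
   and I2 = integral_deriv_compact_support[OF 2 K(1) z(2), of b]
  \<comment> \<open>The derivative of \<open>w_b w_bc\<close> in the direction \<open>c\<close> and
    that of \<open>w_b w_cc\<close> in the direction \<open>b\<close> share their third order term,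
    by the symmetry \<open>sym\<close>.\<close>
  have e: "(w'' b x c)^2 - w'' b x b * w'' c x c
    = (w' x b * w3 b c x c + w'' b x c * w'' b x c) - (w' x b * w3 c c x b + w'' b x b * w'' c x c)" for x
   unfolding sym[of b c x] by (simp add: power2_eq_square)
  show "(LINT x|lborel. (w'' b x c)^2 - w'' b x b * w'' c x c) = 0"
   unfolding e using I1 I2 by (subst Bochner_Integration.integral_diff) auto
  show "integrable lborel (\<lambda>x. (w'' b x c)^2 - w'' b x b * w'' c x c)"
   unfolding e using I1(1) I2(1) by (rule Bochner_Integration.integrable_diff)
 qed
 have i1: "integrable lborel (\<lambda>x. \<Sum>b\<in>Basis. \<Sum>c\<in>Basis. (w'' b x c)^2)"
  by (rule integrable_continuous_compact_support[OF _ K(1)])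
   (auto intro!: continuous_intros C2_on_cont''[OF w] simp: z2)
 have i2: "integrable lborel (\<lambda>x. (trace2 w'' x)^2)"
  by (rule integrable_continuous_compact_support[OF continuous_on_power[OF C2_on_cont_trace[OF w]] K(1)])
   (simp add: z2 trace2_def)
 have "(LINT x|lborel. (\<Sum>b\<in>Basis. \<Sum>c\<in>Basis. (w'' b x c)^2)) - (LINT x|lborel. (trace2 w'' x)^2)
   = (LINT x|lborel. (\<Sum>b\<in>Basis. \<Sum>c\<in>Basis. (w'' b x c)^2) - (trace2 w'' x)^2)"
  using i1 i2 by simp
 also have "\<dots> = (LINT x|lborel. (\<Sum>b\<in>Basis. \<Sum>c\<in>Basis. (w'' b x c)^2 - w'' b x b * w'' c x c))"
  unfolding trace2_def power2_eq_square sum_product by (simp add: sum_subtractf)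
 also have "\<dots> = (\<Sum>b\<in>Basis. \<Sum>c\<in>Basis. (LINT x|lborel. (w'' b x c)^2 - w'' b x b * w'' c x c))"
  using bci by (subst Bochner_Integration.integral_sum)
   (auto intro!: Bochner_Integration.integrable_sum sum.cong Bochner_Integration.integral_sum)
 also have "\<dots> = 0" using bc by simp
 finally show "(LINT x|lborel. (\<Sum>b\<in>Basis. \<Sum>c\<in>Basis. (w'' b x c)^2)) = (LINT x|lborel. (trace2 w'' x)^2)"
  by simp
qed

text \<open>Integrate the divergence of \<open>m\<^sup>2 g\<^sup>2 \<nabla>F\<close>, where \<open>m\<close> is the positive part of \<open>2\<epsilon> - F\<close>.\<close>

lemma Hardy_boundary_layer:
 fixes F g :: "'a::euclidean_space => real"
 assumes F: "C2_on UNIV F F' F''" and g: "C1_on UNIV g g'"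
  and K: "compact K" "\<And>x. x \<notin> K ==> g x = 0" and e: "\<epsilon> > 0"
  and low: "\<And>x. x \<in> K ==> - \<epsilon> <= F x"
  and grad: "\<And>x. x \<in> K ==> F x < 2 * \<epsilon> ==> 1/2 <= (gradsq F' x)"
  and gradL: "\<And>x. x \<in> K ==> (gradsq F' x) <= L^2"
  and lap: "\<And>x. x \<in> K ==> \<bar>trace2 F'' x\<bar> <= D" and D: "12 * \<epsilon> * D <= 1" and L: "L >= 0"
 shows "(LINT x|lborel. indicator {x. F x <= \<epsilon>} x * (g x)^2)
  <= 216 * L^2 * \<epsilon>^2 * (LINT x|lborel. indicator {x. F x <= 2 * \<epsilon>} x * (gradsq g' x))"
proof -
 define m where "m x = max 0 (2 * \<epsilon> - F x)" for x
 have op: "open (- K)" using K(1) compact_imp_closed by blast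
 have g0: "g' x b = 0" if "x \<notin> K" for x b
  by (rule C1_on_deriv_zero[OF g op]) (use that K in auto)
 have dm: "((\<lambda>s. (max 0 (2 * \<epsilon> - s)) ^ 2) has_real_derivative - 2 * max 0 (2 * \<epsilon> - s)) (at s)" for s
 proof -
  have "((\<lambda>t. (max 0 t) ^ 2) has_real_derivative 2 * max 0 (2 * \<epsilon> - s)) (at (2 * \<epsilon> - s))"
   using DERIV_pos_part_power[of 0 "2 * \<epsilon> - s"] by (simp add: numeral_2_eq_2)
  moreover have "((\<lambda>s. 2 * \<epsilon> - s) has_real_derivative - 1) (at s)" by (auto intro!: derivative_eq_intros)
  ultimately have "((\<lambda>s. (max 0 (2 * \<epsilon> - s)) ^ 2) has_real_derivative 2 * max 0 (2 * \<epsilon> - s) * - 1) (at s)"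
   by (rule DERIV_chain2[where f = "\<lambda>t. (max 0 t) ^ 2"])
  then show ?thesis by simp
 qed
 have "C1_on UNIV (\<lambda>x. (m x)^2) (\<lambda>x h. (- 2 * m x) * F' x h)"
  unfolding m_def by (intro C1_on_chain[OF C2_onD1[OF F]] dm continuous_intros)
 then have C: "C1_on UNIV (\<lambda>x. ((m x)^2 * F' x b) * (g x * g x))
   (\<lambda>x h. ((m x)^2 * F' x b) * (g x * g' x h + g' x h * g x)
    + ((m x)^2 * F'' b x h + (- 2 * m x) * F' x h * F' x b) * (g x * g x))" for b
  by (intro C1_on_mult C2_onD2[OF F] g)
 define I where "I b x = ((m x)^2 * F' x b) * (g x * g' x b + g' x b * g x)
    + ((m x)^2 * F'' b x b + (- 2 * m x) * F' x b * F' x b) * (g x * g x)" for b x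
 have z: "x \<notin> K ==> ((m x)^2 * F' x b) * (g x * g x) = 0" for x b using K by simp
 have I: "integrable lborel (I b)" "(LINT x|lborel. I b x) = 0" for b
  using integral_deriv_compact_support[OF C K(1) z, of b b] unfolding I_def[abs_def] by auto
 define P where "P x = indicator {x. F x <= \<epsilon>} x * (g x)^2" for x
 define Q where "Q x = indicator {x. F x <= 2 * \<epsilon>} x * (gradsq g' x)" for x
 have cF: "continuous_on UNIV F" using C2_on_cont[OF F] .
 have ind: "integrable lborel (\<lambda>x. indicator {x. F x <= t} x * f x)" if "integrable lborel f" for t and f :: "'a => real"
 proof -
  have "closed {x. F x <= t}" using closed_Collect_le[OF cF continuous_on_const] .
  then show ?thesis using integrable_mult_indicator[OF _ that, of "{x. F x <= t}"] by simp
 qed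
 have iP: "integrable lborel P"
  unfolding P_def[abs_def]
  by (intro ind integrable_continuous_compact_support[OF _ K(1)] continuous_intros C1_on_cont[OF g]) (simp add: K)
 have iQ: "integrable lborel Q"
  unfolding Q_def[abs_def]
  by (intro ind integrable_continuous_compact_support[OF _ K(1)] continuous_intros C1_on_cont'[OF g]) (simp add: g0)
 \<comment> \<open>The divergence is
   \<open>2 m^2 g T + m^2 g^2 \<Delta>F - 2 m g^2 |\<nabla>F|^2\<close>, and its last term is at
   most \<open>- m g^2\<close>. A quarter of \<open>m g^2\<close> absorbs the first term by Young's
   inequality, another quarter the second because \<open>\<epsilon> D\<close> is small; the
   remaining half is at least \<open>\<epsilon> g^2 / 2\<close> where
   \<open>F <= \<epsilon>\<close>. On \<open>K\<close> one has \<open>m <= 3 \<epsilon>\<close>, so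
   Young's inequality costs \<open>4 * 27 = 108\<close>.\<close>
 have key: "\<epsilon> / 2 * P x <= 108 * L^2 * \<epsilon> ^ 3 * Q x - (\<Sum>b\<in>Basis. I b x)" for x
 proof (cases "x \<in> K")
  case False
  then show ?thesis by (simp add: P_def Q_def I_def K g0)
 next
  case True
  define S where "S = (gradsq F' x)"
  define T where "T = (\<Sum>b\<in>Basis. F' x b * g' x b)"
  define N where "N = (gradsq g' x)"
  have "(\<Sum>b\<in>Basis. I b x) = (\<Sum>b\<in>Basis. 2 * (m x)^2 * g x * (F' x b * g' x b)
    + (m x)^2 * (g x)^2 * F'' b x b - 2 * m x * (g x)^2 * (F' x b)^2)"
   unfolding I_def by (intro sum.cong refl) (simp add: power2_eq_square algebra_simps)
  then have sI: "(\<Sum>b\<in>Basis. I b x) = 2 * (m x)^2 * g x * T + (m x)^2 * (g x)^2 * trace2 F'' x - 2 * m x * (g x)^2 * S"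
   by (simp add: sum.distrib sum_subtractf sum_distrib_left S_def T_def trace2_def)
  have m0: "0 <= m x" and m3: "m x <= 3 * \<epsilon>" using low[OF True] e by (auto simp: m_def)
  have T: "T^2 <= L^2 * N"
  proof -
   have "T^2 <= S * N"
    unfolding T_def S_def N_def by (rule Cauchy_Schwarz_ineq_sum)
   also have "\<dots> <= L^2 * N"
    using gradL[OF True] by (intro mult_right_mono) (auto simp: S_def N_def sum_nonneg)
   finally show ?thesis .
  qed
  have N0: "N >= 0" by (simp add: N_def sum_nonneg)
  have a1: "2 * (m x)^2 * g x * T <= m x * (g x)^2 / 4 + 4 * L^2 * (m x) ^ 3 * N"
  proof -
   have "0 <= m x * (g x / 2 - 2 * m x * T)^2" using m0 by simp
   then have "2 * (m x)^2 * g x * T <= m x * (g x)^2 / 4 + 4 * (m x) ^ 3 * T^2"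
    by (simp add: power2_eq_square power3_eq_cube algebra_simps)
   also have "4 * (m x) ^ 3 * T^2 <= 4 * (m x) ^ 3 * (L^2 * N)"
    using T m0 by (intro mult_left_mono) auto
   finally show ?thesis by (simp add: mult_ac)
  qed
  have a2: "(m x)^2 * (g x)^2 * trace2 F'' x <= m x * (g x)^2 / 4"
  proof -
   have "m x * trace2 F'' x <= 3 * \<epsilon> * D"
   proof -
    have "m x * trace2 F'' x <= m x * \<bar>trace2 F'' x\<bar>" using m0 by (intro mult_left_mono) auto
    also have "\<dots> <= 3 * \<epsilon> * D" using m3 lap[OF True] e m0 by (intro mult_mono) auto
    finally show ?thesis .
   qed
   then have "m x * trace2 F'' x <= 1/4" using D by linarith
   then have "(m x * (g x)^2) * (m x * trace2 F'' x) <= (m x * (g x)^2) * (1/4)"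
    using m0 by (intro mult_left_mono) auto
   then show ?thesis by (simp add: power2_eq_square mult_ac)
  qed
  have a3: "m x * (g x)^2 <= 2 * m x * (g x)^2 * S"
  proof (cases "F x < 2 * \<epsilon>")
   case True
   then have "m x * (g x)^2 * 1 <= m x * (g x)^2 * (2 * S)"
    using grad[OF \<open>x \<in> K\<close>] m0 by (intro mult_left_mono) (auto simp: S_def)
   then show ?thesis by (simp add: mult_ac)
  qed (simp add: m_def)
  have a4: "\<epsilon> / 2 * P x <= m x * (g x)^2 / 2"
  proof (cases "F x <= \<epsilon>")
   case True
   then have "\<epsilon> * (g x)^2 <= m x * (g x)^2" by (intro mult_right_mono) (auto simp: m_def)
   then show ?thesis using True by (simp add: P_def)
  qed (use m0 in \<open>simp add: P_def\<close>)
  have a5: "4 * L^2 * (m x) ^ 3 * N <= 108 * L^2 * \<epsilon> ^ 3 * Q x"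
  proof (cases "F x <= 2 * \<epsilon>")
   case True
   have "(m x) ^ 3 <= (3 * \<epsilon>) ^ 3" using m0 m3 by (intro power_mono)
   then have "(m x) ^ 3 * (4 * L^2 * N) <= (27 * \<epsilon> ^ 3) * (4 * L^2 * N)"
    using N0 by (intro mult_right_mono) (auto simp: power_mult_distrib)
   then show ?thesis using True by (simp add: Q_def N_def mult_ac)
  qed (simp add: m_def Q_def)
  show ?thesis using sI a1 a2 a3 a4 a5 by linarith
 qed
 have "\<epsilon> / 2 * (LINT x|lborel. P x) = (LINT x|lborel. \<epsilon> / 2 * P x)" by simp
 also have "\<dots> <= (LINT x|lborel. 108 * L^2 * \<epsilon> ^ 3 * Q x - (\<Sum>b\<in>Basis. I b x))"
  using iP iQ I(1) by (intro integral_mono key) auto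
 also have "\<dots> = 108 * L^2 * \<epsilon> ^ 3 * (LINT x|lborel. Q x) - (\<Sum>b\<in>Basis. LINT x|lborel. I b x)"
  using iQ I(1) by (subst Bochner_Integration.integral_diff) (auto simp: Bochner_Integration.integral_sum)
 also have "\<dots> = \<epsilon> / 2 * (216 * L^2 * \<epsilon>^2 * (LINT x|lborel. Q x))"
  by (simp add: I(2) power2_eq_square power3_eq_cube)
 finally have "\<epsilon> / 2 * (LINT x|lborel. P x) <= \<epsilon> / 2 * (216 * L^2 * \<epsilon>^2 * (LINT x|lborel. Q x))" .
 then show ?thesis
  using e unfolding P_def[symmetric] Q_def[symmetric] by (simp only: mult_le_cancel_left_pos half_gt_zero)
qed

text \<open>Pointwise this is Cauchy-Schwarz for the measure whose density is the mollifier, in the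
  form that the variance around the average \<open>c\<close> is nonnegative; then Tonelli's
  theorem.\<close>

lemma mollified_norm_le:
 fixes v :: "'a::euclidean_space => real"
 assumes v: "integrable lborel v" "{y. v y \<noteq> 0} \<subseteq> cball 0 R" and v2: "integrable lborel (\<lambda>y. (v y)^2)"
  and r: "r > 0"
 shows "(\<integral>\<^sup>+x. ennreal ((convolution v (mollifier r) x)^2) \<partial>lborel)
   <= ennreal ((mollifier_mass TYPE('a))^2 * (LINT y|lborel. (v y)^2))"
proof -
 let ?M = "mollifier_mass TYPE('a)" and ?m = "mollifier r :: 'a => real"
 have M: "?M > 0" by (rule mollifier_mass_pos)
 have cm: "continuous_on UNIV ?m" by (rule C2_on_cont[OF mollifier_C2])
 then have [measurable]: "?m \<in> borel_measurable borel" by (rule borel_measurable_continuous_onI)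
 have [measurable]: "v \<in> borel_measurable borel" using v(1) by auto
 have s2: "{y. (v y)^2 \<noteq> 0} \<subseteq> cball 0 R" using v(2) by auto
 note i1 = convolution_integrable[OF v cm] and i2 = convolution_integrable[OF v2 s2 cm]
  and i0 = mollifier_integrable[OF r]
 have ptw: "(convolution v ?m x)^2 <= ?M * (LINT y|lborel. (v y)^2 * ?m (x - y))" for x
 proof -
  define c where "c = convolution v ?m x / ?M"
  have "0 <= (LINT y|lborel. (v y - c)^2 * ?m (x - y))"
   using mollifier_nonneg[OF r] by (intro integral_nonneg_AE AE_I2 mult_nonneg_nonneg) auto
  also have "\<dots> = (LINT y|lborel. (v y)^2 * ?m (x - y) - 2 * c * (v y * ?m (x - y)) + c^2 * ?m (x - y))"
   by (intro Bochner_Integration.integral_cong refl) (simp add: power2_eq_square algebra_simps)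
  also have "\<dots> = (LINT y|lborel. (v y)^2 * ?m (x - y)) - 2 * c * convolution v ?m x + c^2 * ?M"
  proof -
   have "integrable lborel (\<lambda>y. 2 * c * (v y * ?m (x - y)))" "integrable lborel (\<lambda>y. c^2 * ?m (x - y))"
    using i0 i1 by (intro integrable_mult_right; blast)+
   then have "(LINT y|lborel. (v y)^2 * ?m (x - y) - 2 * c * (v y * ?m (x - y)) + c^2 * ?m (x - y))
    = (LINT y|lborel. (v y)^2 * ?m (x - y)) - (LINT y|lborel. 2 * c * (v y * ?m (x - y)))
     + (LINT y|lborel. c^2 * ?m (x - y))"
    using i2[of x] by (simp only: Bochner_Integration.integral_add Bochner_Integration.integral_diff
      Bochner_Integration.integrable_diff)
   then show ?thesis
    by (simp only: integral_mult_right_zero mollifier_integral[OF r] convolution_def)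
  qed
  also have "\<dots> = (LINT y|lborel. (v y)^2 * ?m (x - y)) - (convolution v ?m x)^2 / ?M"
   using M by (simp add: c_def power2_eq_square)
  finally show ?thesis using M by (simp add: field_simps)
 qed
 have "(\<integral>\<^sup>+x. ennreal ((convolution v ?m x)^2) \<partial>lborel)
   <= (\<integral>\<^sup>+x. ennreal ?M * (\<integral>\<^sup>+y. ennreal ((v y)^2 * ?m (x - y)) \<partial>lborel) \<partial>lborel)"
 proof (rule nn_integral_mono)
  fix x
  have "(\<integral>\<^sup>+y. ennreal ((v y)^2 * ?m (x - y)) \<partial>lborel) = ennreal (LINT y|lborel. (v y)^2 * ?m (x - y))"
   using i2 mollifier_nonneg[OF r] by (intro nn_integral_eq_integral AE_I2 mult_nonneg_nonneg) auto
  then show "ennreal ((convolution v ?m x)^2) <= ennreal ?M * (\<integral>\<^sup>+y. ennreal ((v y)^2 * ?m (x - y)) \<partial>lborel)"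
   using ennreal_leI[OF ptw[of x]] M by (simp add: ennreal_mult')
 qed
 also have "\<dots> = ennreal ?M * (\<integral>\<^sup>+x. \<integral>\<^sup>+y. ennreal ((v y)^2 * ?m (x - y)) \<partial>lborel \<partial>lborel)"
  by (subst nn_integral_cmult) auto
 also have "(\<integral>\<^sup>+x. \<integral>\<^sup>+y. ennreal ((v y)^2 * ?m (x - y)) \<partial>lborel \<partial>lborel)
   = (\<integral>\<^sup>+y. \<integral>\<^sup>+x. ennreal ((v y)^2 * ?m (x - y)) \<partial>lborel \<partial>lborel)"
  by (rule lborel_pair.Fubini'[symmetric]) measurable
 also have "\<dots> = (\<integral>\<^sup>+y. ennreal ((v y)^2) * ennreal ?M \<partial>lborel)"
 proof (rule nn_integral_cong)
  fix y
  have "?m z = ?m (- z)" for z by (simp add: mollifier_def)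
  then have sh: "(\<lambda>x. ?m (x - y)) = (\<lambda>x. mollifier r (y - x))" by (metis minus_diff_eq)
  have "(\<integral>\<^sup>+x. ennreal (?m (x - y)) \<partial>lborel) = ennreal ?M"
   unfolding fun_cong[OF sh] mollifier_integral[OF r, of y, symmetric]
   by (rule nn_integral_eq_integral[OF i0 AE_I2]) (rule mollifier_nonneg[OF r])
  moreover have "ennreal ((v y)^2 * ?m (x - y)) = ennreal ((v y)^2) * ennreal (?m (x - y))" for x
   by (rule ennreal_mult) (simp_all add: mollifier_nonneg[OF r])
  ultimately show "(\<integral>\<^sup>+x. ennreal ((v y)^2 * ?m (x - y)) \<partial>lborel) = ennreal ((v y)^2) * ennreal ?M"
   by (simp add: nn_integral_cmult)
 qed
 also have "\<dots> = ennreal (LINT y|lborel. (v y)^2) * ennreal ?M"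
  using v2 by (simp add: nn_integral_multc nn_integral_eq_integral)
 also have "ennreal ?M * \<dots> = ennreal (?M^2 * (LINT y|lborel. (v y)^2))"
  using M by (simp add: ennreal_mult[symmetric] power2_eq_square mult_ac)
 finally show ?thesis .
qed

definition source3 :: "real => 'a::euclidean_space => 'a => 'a => 'a => real" where
 "source3 r b c z h =
   kern2 (real DIM('a) / 2) (r^2) (z \<bullet> z) * (2 * (z \<bullet> h)) * (2 * (c \<bullet> b))
   + (kern2 (real DIM('a) / 2) (r^2) (z \<bullet> z) * (2 * (z \<bullet> c)) * (2 * (h \<bullet> b))
    + (kern2 (real DIM('a) / 2) (r^2) (z \<bullet> z) * (2 * (h \<bullet> c))
     + kern3 (real DIM('a) / 2) (r^2) (z \<bullet> z) * (2 * (z \<bullet> h)) * (2 * (z \<bullet> c))) * (2 * (z \<bullet> b)))"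

lemma source3_C1:
 assumes "r > 0"
 shows "C1_on UNIV (\<lambda>z::'a::euclidean_space. source'' r b z c) (source3 r b c)"
proof -
 have \<rho>: "r^2 > 0" using assms by simp
 have q: "C1_on UNIV (\<lambda>z::'a. z \<bullet> z) (\<lambda>z h. 2 * (z \<bullet> h))"
  unfolding C1_on_def by (auto intro!: derivative_eq_intros continuous_intros simp: inner_commute)
 have l: "C1_on UNIV (\<lambda>z::'a. 2 * (z \<bullet> c)) (\<lambda>z h. 2 * (h \<bullet> c))" for c
  unfolding C1_on_def by (auto intro!: derivative_eq_intros continuous_intros)
 have k: "C1_on UNIV (\<lambda>z::'a. t (z \<bullet> z)) (\<lambda>z h. t' (z \<bullet> z) * (2 * (z \<bullet> h)))"
  if "\<And>s. (t has_real_derivative t' s) (at s)" "continuous_on UNIV t'" for t t'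
  by (rule C1_on_chain[OF q that(1) continuous_on_subset[OF that(2)]]) auto
 note k1 = k[OF kern_derivs(2)[OF \<rho>] DERIV_continuous_on[OF kern_derivs(3)[OF \<rho>]]]
  and k2 = k[OF kern_derivs(3,4)[OF \<rho>]]
 show ?thesis
  unfolding source''_def[abs_def] source3_def[abs_def]
  by (intro C1_on_add C1_on_mult l k2 C1_on_bounded_linear[OF bounded_linear_mult_left k1])
qed

text \<open>This instance of the symmetry of third derivatives feeds the hypothesis
  \<open>sym\<close> of the Hessian identity, applied to the smeared potential.\<close>

lemma source3_sym: "source3 r b c z c = source3 r c c z b"
 by (simp add: source3_def inner_commute algebra_simps)

lemma continuous_AE_zero_imp_zero:
 fixes f :: "'a::euclidean_space => 'b::real_normed_vector"
 assumes "open U" "continuous_on U f" "AE x in lborel. x \<in> U --> f x = 0" "x \<in> U"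
 shows "f x = 0"
proof (rule ccontr)
 assume "f x \<noteq> 0"
 have "open (U \<inter> f -` (- {0}))"
  using assms(1,2) by (intro continuous_open_preimage) auto
 moreover have "x \<in> U \<inter> f -` (- {0})" using assms(4) \<open>f x \<noteq> 0\<close> by simp
 ultimately obtain e where e: "e > 0" "ball x e \<subseteq> U \<inter> f -` (- {0})"
  using openE by blast
 have "AE y in lborel. y \<notin> ball x e" using assms(3) by eventually_elim (use e in auto)
 then have "ball x e \<in> null_sets lborel" by (subst AE_iff_null_sets) auto
 then have "measure lborel (ball x e) = 0" by (simp add: measure_def null_setsD1)
 then show False using content_ball_pos[OF e(1), of x] by simp
qed

lemma infdist_attained_closure:
 fixes S :: "'a::euclidean_space set"
 assumes "S \<noteq> {}"
 obtains y where "y \<in> closure S" "dist x y = infdist x S"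
proof -
 obtain y where "y \<in> closure S" "infdist x (closure S) = dist x y"
  using infdist_attains_inf[of "closure S" x] assms by auto
 then show ?thesis using that by (simp add: infdist_eq_setdist)
qed

text \<open>Here \<open>w\<close> is the potential of \<open>v\<close>, smeared out at scale \<open>r = e / (4 L)\<close>: it vanishes away from \<open>\<Omega>\<close>,
 and \<open>\<Delta>w\<close> is a multiple of \<open>v\<close> on the part of \<open>\<Omega>\<close> where the cutoff \<open>\<chi>\<close> lives. Hardy's inequality
 makes the terms with derivatives of \<open>\<chi>\<close> small in \<open>\<int> v \<Delta>(\<chi> w) = 0\<close>.\<close>

theorem harmonic_orthogonal_to_exterior_sources:
 fixes v F :: "'a::euclidean_space => real"
 assumes \<Omega>: "open \<Omega>" "bounded \<Omega>" "\<Omega> \<noteq> {}"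
  and F: "C2_on UNIV F F' F''" and Fpos: "\<And>x. x \<in> \<Omega> ==> F x > 0"
  and F0: "\<And>x. x \<in> frontier \<Omega> ==> F x = 0"
  and Fgrad: "\<eta> > 0" "\<And>x. infdist x \<Omega> <= \<eta> ==> F x < \<eta> ==> 1/2 <= (gradsq F' x)"
  and v: "harmonic_on \<Omega> v" "set_integrable lborel \<Omega> (\<lambda>x. (v x)^2)"
  and orth: "\<And>r x. r > 0 ==> infdist x \<Omega> > r ==> (LINT y:\<Omega>|lborel. v y * source r (x - y)) = 0"
  and x0: "x0 \<in> \<Omega>"
 shows "v x0 = 0"
proof -
 let ?M = "mollifier_mass TYPE('a)"
 have M: "?M > 0" by (rule mollifier_mass_pos)
 obtain R where R: "\<Omega> \<subseteq> cball 0 R" using \<Omega>(2) bounded_subset_ballD[of \<Omega> 0] by (meson ball_subset_cball order_trans)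
 \<comment> \<open>A convex neighbourhood of the closure, so that bounds for the derivatives of
   \<open>F\<close> become Lipschitz bounds; the margin 1 is at least as large as every radius
   \<open>r\<close> below.\<close>
 define B where "B = cball (0::'a) (R + 1)"
 have B: "compact B" "convex B" by (simp_all add: B_def)
 have near: "x \<in> B" if "infdist x \<Omega> <= 1" for x
 proof -
  obtain y where "y \<in> closure \<Omega>" "dist x y = infdist x \<Omega>"
   using infdist_attained_closure[OF \<Omega>(3)] by blast
  then have "norm y <= R" "dist x y <= 1"
   using closure_mono[OF R] that by auto
  then show ?thesis using norm_triangle_ineq2[of x y] by (simp add: B_def dist_norm)
 qed
 have cbd: "\<exists>C\<ge>1. \<forall>x\<in>B. \<bar>f x\<bar> <= C" if f: "continuous_on UNIV f" for f :: "'a => real"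
 proof -
  obtain C where "\<And>x. x \<in> B ==> norm (f x) <= C"
   by (rule continuous_on_compact_bound[OF B(1) continuous_on_subset[OF f]]) auto
  then show ?thesis by (intro exI[of _ "max C 1"]) (auto simp: le_max_iff_disj)
 qed
 have "continuous_on UNIV (\<lambda>x. \<Sum>b\<in>Basis. (F' x b)^2)"
  by (intro continuous_intros C2_on_cont'[OF F])
 from cbd[OF this] obtain C where C: "C >= 1" "\<And>x. x \<in> B ==> \<bar>gradsq F' x\<bar> <= C" by blast
 define L where "L = sqrt C"
 have L: "L >= 1" "L^2 = C" using C(1) by (auto simp: L_def)
 have gradL: "(gradsq F' x) <= L^2" if "x \<in> B" for x using C(2)[OF that] L(2) by simp
 obtain D where D: "D >= 1" "\<And>x. x \<in> B ==> \<bar>trace2 F'' x\<bar> <= D"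
  using cbd[OF C2_on_cont_trace[OF F]] by blast
 have lip: "\<bar>F x - F y\<bar> <= L * norm (x - y)" if "x \<in> B" "y \<in> B" for x y
 proof (rule C1_diff_le[OF C2_onD1[OF F] subset_UNIV])
  fix z assume "z \<in> closed_segment y x"
  then have "z \<in> B" using closed_segment_subset[OF that(2,1) B(2)] by blast
  then have "(norm (gradient F' z))^2 <= L^2" unfolding norm_gradient_sq by (rule gradL)
  then show "norm (gradient F' z) <= L" by (rule power2_le_imp_le) (use L(1) in simp)
 qed
 define vt where "vt y = indicator \<Omega> y * v y" for y
 have cv: "continuous_on \<Omega> v" using harmonic_on_continuous[OF \<Omega>(1) v(1)] .
 have vtm: "vt \<in> borel_measurable lborel"
  using borel_measurable_continuous_on_indicator[OF _ cv] \<Omega>(1) unfolding vt_def[abs_def] by auto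
 have vt2: "(vt y)^2 = indicator \<Omega> y *\<^sub>R (v y)\<^sup>2" for y by (simp add: vt_def indicator_def)
 have vti2: "integrable lborel (\<lambda>y. (vt y)^2)" using v(2) unfolding vt2 set_integrable_def .
 have vti: "integrable lborel vt"
 proof (rule Bochner_Integration.integrable_bound[where f = "\<lambda>y. indicator \<Omega> y + (vt y)^2"])
  have "integrable lborel (indicator \<Omega> :: 'a => real)"
   using \<Omega> by (intro integrable_real_indicator emeasure_bounded_finite) auto
  then show "integrable lborel (\<lambda>y. indicator \<Omega> y + (vt y)^2)" using vti2 by (rule Bochner_Integration.integrable_add)
  have "\<bar>t\<bar> <= 1 + t^2" for t :: real
  proof -
   have "0 <= (\<bar>t\<bar> - 1)^2" by simp
   then have "2 * \<bar>t\<bar> <= 1 + t^2" by (simp add: power2_diff)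
   then show ?thesis using abs_ge_zero[of t] by linarith
  qed
  then show "AE y in lborel. norm (vt y) <= norm (indicator \<Omega> y + (vt y)^2)"
   by (intro AE_I2) (auto simp: vt_def indicator_def)
 qed (rule vtm)
 have vts: "{y. vt y \<noteq> 0} \<subseteq> cball 0 R" using R by (auto simp: vt_def indicator_def)
 define V where "V = (LINT y|lborel. (vt y)^2)"
 have V: "V >= 0" by (simp add: V_def)
 obtain st st1 st2 :: "real => real" and S where
  st: "\<And>s. (st has_real_derivative st1 s) (at s)" "\<And>s. (st1 has_real_derivative st2 s) (at s)"
  "continuous_on UNIV st2" and st0: "\<And>s. s <= 0 ==> st s = 0" and sto: "\<And>s. s >= 1 ==> st s = 1"
  "\<And>s. s >= 1 ==> st1 s = 0" "\<And>s. s >= 1 ==> st2 s = 0" and stn: "\<And>s. 0 <= st s"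
  and stC: "\<And>s. \<bar>st1 s\<bar> <= S" "\<And>s. \<bar>st2 s\<bar> <= S"
  using smooth_step by blast
 have S: "S >= 0" using stC(1)[of 0] by (meson abs_ge_zero order_trans)
 \<comment> \<open>\<open>H\<close> is the constant of Hardy's inequality; \<open>c1 / e\<close> and
   \<open>c2 / e^2\<close> bound the coefficients of the gradient of \<open>w\<close> and of
   \<open>w\<close> in the error \<open>E\<close>; \<open>A\<close> bounds the integral of
   \<open>E^2\<close> over the layer, independently of \<open>e\<close>.\<close>
 define H where "H = 216 * L^2"
 define c1 where "c1 = 4 * S * L"
 define c2 where "c2 = 4 * S * L^2 + 2 * S * D"
 define A where "A = (8 * c1^2 * H + 8 * c2^2 * H^2) * (?M^2 * V)"
 \<comment> \<open>Hardy's inequality is used at width \<open>2 e\<close>, so it needs the gradient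
   bound for \<open>F < 4 e\<close> and \<open>24 e D <= 1\<close>; the bound \<open>1/4\<close>
   keeps \<open>e\<close> and \<open>r\<close> below one.\<close>
 define e0 where "e0 = min (\<eta> / 4) (min (1 / (24 * D)) (1/4))"
 have e0: "e0 > 0" using Fgrad(1) D(1) by (simp add: e0_def)
 define del where "del e = (LINT y|lborel. indicator {x. F x <= e} y * (vt y)^2)" for e
 \<comment> \<open>\<open>l\<close> is the parameter of Young's inequality. It stays free because
   \<open>del e\<close> becomes small with \<open>e\<close> while \<open>A\<close> is fixed:
   \<open>e\<close> goes to zero first, then \<open>l\<close> to infinity.\<close>
 have main: "?M * (LINT y|lborel. indicator {x. e <= F x} y * (vt y)^2) <= l / 2 * del e + A / (2 * l)"
  if e: "e > 0" "e <= e0" and l: "l > 0" for e l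
 proof -
  have e1: "e <= \<eta> / 4" "e <= 1 / (24 * D)" "e <= 1/4" using e(2) by (auto simp: e0_def)
  have eD: "24 * e * D <= 1" using e1(2) D(1) by (simp add: field_simps)
  \<comment> \<open>Over the distance \<open>r\<close> the function \<open>F\<close> varies by at
    most \<open>e / 4\<close>. So \<open>F >= - e\<close> on \<open>K\<close>, and a ball of radius
    \<open>r\<close> around a point of \<open>K\<close> with \<open>F >= e / 2\<close> does not
    reach the boundary.\<close>
  define r where "r = e / (4 * L)"
  have r: "r > 0" "L * r = e / 4" using e L by (auto simp: r_def)
  have rle: "r <= e" using e L(1) by (simp add: r_def field_simps)
  have r1: "r <= 1" "r <= \<eta>" using rle e1 Fgrad(1) by auto
  define w where "w = convolution vt (source r)"
  define w' where "w' x h = convolution vt (\<lambda>z. source' r z h) x" for x h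
  define w'' where "w'' b x h = convolution vt (\<lambda>z. source'' r b z h) x" for b x h
  define w3 where "w3 b c x h = convolution vt (\<lambda>z. source3 r b c z h) x" for b c x h
  have Cw: "C2_on UNIV w w' w''"
   unfolding w_def w'_def[abs_def] w''_def[abs_def] by (rule convolution_C2[OF vti vts source_C2[OF r(1)]])
  have tw: "trace2 w'' x = convolution vt (mollifier r) x" for x
   unfolding w''_def[abs_def] convolution_trace2[OF vti vts source_C2[OF r(1)]]
   by (simp add: trace2_source[OF r(1), abs_def])
  have C3: "C1_on UNIV (\<lambda>x. w'' b x c) (w3 b c)" for b c
   unfolding w''_def w3_def[abs_def] by (rule convolution_C1[OF vti vts source3_C1[OF r(1)]])
  have sy: "w3 b c x c = w3 c c x b" for b c x
   unfolding w3_def by (simp only: source3_sym[of r b c])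
  define K where "K = {x. infdist x \<Omega> <= r}"
  have KB: "K \<subseteq> B" using near r1(1) by (auto simp: K_def)
  have Kcl: "closed K" unfolding K_def by (intro closed_Collect_le continuous_intros)
  have K: "compact K" using Kcl KB B(1) compact_Int_closed[of B K] by (simp add: Int_absorb1)
  have w0: "w x = 0" if "x \<notin> K" for x
   using orth[OF r(1), of x] that
   by (simp add: w_def convolution_def vt_def K_def set_lebesgue_integral_def mult.assoc)
  note hess = hessian_norm_eq_laplacian_norm[OF Cw C3 sy K]
  have hes: "(LINT x|lborel. (\<Sum>b\<in>Basis. \<Sum>c\<in>Basis. (w'' b x c)^2)) = (LINT x|lborel. (trace2 w'' x)^2)"
   "\<And>x b. x \<notin> K ==> w' x b = 0" "\<And>x b c. x \<notin> K ==> w'' b x c = 0"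
   by (rule hess(1), erule w0) (rule hess(2), erule w0, assumption, rule hess(3), erule w0, assumption)
  define Q2 where "Q2 = (LINT x|lborel. (\<Sum>b\<in>Basis. \<Sum>c\<in>Basis. (w'' b x c)^2))"
  have it: "integrable lborel (\<lambda>x. (trace2 w'' x)^2)"
   by (rule integrable_continuous_compact_support[OF continuous_on_power[OF C2_on_cont_trace[OF Cw]] K])
    (simp add: trace2_def hes(3))
  have "ennreal Q2 = (\<integral>\<^sup>+x. ennreal ((trace2 w'' x)^2) \<partial>lborel)"
   unfolding Q2_def hes(1) using it by (intro nn_integral_eq_integral[symmetric]) auto
  also have "\<dots> <= ennreal (?M^2 * V)"
   unfolding tw V_def by (rule mollified_norm_le[OF vti vts vti2 r(1)])
  finally have Q2: "Q2 <= ?M^2 * V" using M V by (simp add: ennreal_le_iff)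
  have Q20: "0 <= Q2" unfolding Q2_def by (intro integral_nonneg_AE AE_I2 sum_nonneg) simp
  have Kpt: "\<exists>y\<in>closure \<Omega>. dist x y <= r" if "x \<in> K" for x
   using infdist_attained_closure[OF \<Omega>(3), of x] that unfolding K_def by (metis mem_Collect_eq)
  have cl: "y \<in> B" "0 <= F y" if "y \<in> closure \<Omega>" for y
  proof -
   show "y \<in> B" using near[of y] that \<Omega>(3) in_closure_iff_infdist_zero[of \<Omega> y] by simp
   show "0 <= F y" using that Fpos[of y] F0[of y] \<Omega>(1) by (cases "y \<in> \<Omega>") (auto simp: frontier_def interior_open)
  qed
  have low: "- e <= F x" if x: "x \<in> K" for x
  proof -
   obtain y where y: "y \<in> closure \<Omega>" "dist x y <= r" using Kpt[OF x] by blast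
   have "\<bar>F x - F y\<bar> <= L * norm (x - y)" using lip cl(1)[OF y(1)] KB x by blast
   also have "\<dots> <= L * r" using y(2) L(1) by (intro mult_left_mono) (auto simp: dist_norm)
   finally show ?thesis using cl(2)[OF y(1)] r(2) e(1) by linarith
  qed
  have gradK: "1/2 <= (gradsq F' x)" if "x \<in> K" "F x < 2 * (2 * e)" for x
   using that r1(2) e1(1) by (intro Fgrad(2)) (auto simp: K_def)
  have H1: "(LINT x|lborel. indicator {x. F x <= e} x * (w x)^2)
    <= H * e^2 * (LINT x|lborel. indicator {x. F x <= 2 * e} x * (gradsq w' x))"
   unfolding H_def
  proof (rule Hardy_boundary_layer[OF F C2_onD1[OF Cw] K w0 e(1)])
   show "12 * e * D <= 1" using eD mult_nonneg_nonneg[of e D] e D(1) by (simp add: mult.assoc)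
  qed (use low gradK gradL D(2) KB L(1) e in auto)
  have ind: "integrable lborel (\<lambda>x. indicator {x. F x <= t} x * f x)" if "integrable lborel f" for t and f :: "'a => real"
  proof -
   have "closed {x. F x <= t}" using closed_Collect_le[OF C2_on_cont[OF F] continuous_on_const] .
   then show ?thesis using integrable_mult_indicator[OF _ that, of "{x. F x <= t}"] by simp
  qed
  have iw': "integrable lborel (\<lambda>x. (w' x b)^2)" for b
   by (rule integrable_continuous_compact_support[OF continuous_on_power[OF C2_on_cont'[OF Cw]] K])
    (simp add: hes(2))
  have iw: "integrable lborel (\<lambda>x. (w x)^2)"
   by (rule integrable_continuous_compact_support[OF continuous_on_power[OF C2_on_cont[OF Cw]] K])
    (simp add: w0)
  have iw'': "integrable lborel (\<lambda>x. \<Sum>c\<in>Basis. (w'' b x c)^2)" for b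
   by (intro Bochner_Integration.integrable_sum
     integrable_continuous_compact_support[OF continuous_on_power[OF C2_on_cont''[OF Cw]] K])
    (simp add: hes(3))
  \<comment> \<open>Hardy's inequality once more, for each first derivative and at twice the width;
    with \<open>H1\<close> it gives the factor \<open>e^4\<close> for \<open>w^2\<close> and
    \<open>e^2\<close> for the squared gradient.\<close>
  have H2: "(LINT x|lborel. indicator {x. F x <= 2 * e} x * (w' x b)^2)
    <= 4 * H * e^2 * (LINT x|lborel. (\<Sum>c\<in>Basis. (w'' b x c)^2))" for b
  proof -
   have "(LINT x|lborel. indicator {x. F x <= 2 * e} x * (w' x b)^2)
    <= 216 * L^2 * (2 * e)^2 * (LINT x|lborel. indicator {x. F x <= 2 * (2 * e)} x * (\<Sum>c\<in>Basis. (w'' b x c)^2))"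
   proof (rule Hardy_boundary_layer[OF F C2_onD2[OF Cw] K])
    show "12 * (2 * e) * D <= 1" using eD by simp
    show "- (2 * e) <= F x" if "x \<in> K" for x using low[OF that] e by simp
   qed (use gradK gradL D(2) KB L(1) e hes(2) in auto)
   also have "\<dots> <= 216 * L^2 * (2 * e)^2 * (LINT x|lborel. (\<Sum>c\<in>Basis. (w'' b x c)^2))"
    by (intro mult_left_mono integral_mono ind iw'') (auto simp: indicator_def sum_nonneg)
   finally show ?thesis by (simp add: H_def power_mult_distrib mult_ac)
  qed
  define G2 where "G2 = (LINT x|lborel. indicator {x. F x <= 2 * e} x * (gradsq w' x))"
  have "G2 = (\<Sum>b\<in>Basis. LINT x|lborel. indicator {x. F x <= 2 * e} x * (w' x b)^2)"
   unfolding G2_def sum_distrib_left by (intro Bochner_Integration.integral_sum ind iw')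
  also have "\<dots> <= (\<Sum>b\<in>Basis. 4 * H * e^2 * (LINT x|lborel. (\<Sum>c\<in>Basis. (w'' b x c)^2)))"
   by (intro sum_mono H2)
  also have "\<dots> = 4 * H * e^2 * Q2"
   unfolding Q2_def sum_distrib_left[symmetric]
   using iw'' by (simp only: Bochner_Integration.integral_sum[symmetric])
  finally have G2: "G2 <= 4 * H * e^2 * Q2" .
  have H0: "H >= 0" by (simp add: H_def)
  have W2: "(LINT x|lborel. indicator {x. F x <= e} x * (w x)^2) <= 4 * H^2 * e ^ 4 * Q2"
  proof -
   have "H * e^2 * G2 <= H * e^2 * (4 * H * e^2 * Q2)" using G2 H0 by (intro mult_left_mono) auto
   also have "\<dots> = 4 * H^2 * e ^ 4 * Q2" by (simp add: power2_eq_square power4_eq_xxxx mult_ac)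
   finally show ?thesis using H1 unfolding G2_def[symmetric] by linarith
  qed
  have G1: "(LINT x|lborel. indicator {x. F x <= e} x * (gradsq w' x)) <= 4 * H * e^2 * Q2"
  proof -
   have "(LINT x|lborel. indicator {x. F x <= e} x * (gradsq w' x)) <= G2"
    unfolding G2_def using e
    by (intro integral_mono ind Bochner_Integration.integrable_sum iw') (auto simp: indicator_def sum_nonneg)
   then show ?thesis using G2 by simp
  qed
  \<comment> \<open>The cutoff \<open>t (F x)\<close> rises from 0 to 1 between the levels
    \<open>e / 2\<close> and \<open>e\<close> of \<open>F\<close>.\<close>
  define t where "t s = st ((2 / e) * s - 1)" for s
  define t1 where "t1 s = (2 / e) * st1 ((2 / e) * s - 1)" for s
  define t2 where "t2 s = (2 / e) * ((2 / e) * st2 ((2 / e) * s - 1))" for s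
  have lin: "((\<lambda>s. (2 / e) * s - 1) has_real_derivative 2 / e) (at s)" for s
   by (rule DERIV_cong[OF DERIV_diff[OF DERIV_cmult[OF DERIV_ident] DERIV_const]]) simp
  have td1: "(t has_real_derivative t1 s) (at s)" for s
   unfolding t_def[abs_def] t1_def by (rule DERIV_cong[OF DERIV_chain2[OF st(1) lin]]) (rule mult.commute)
  have td2: "(t1 has_real_derivative t2 s) (at s)" for s
   unfolding t1_def[abs_def] t2_def
   by (rule DERIV_cong[OF DERIV_cmult[OF DERIV_chain2[OF st(2) lin]]]) (simp only: mult.commute)
  have tc: "continuous_on X t2" for X
   unfolding t2_def[abs_def] by (intro continuous_intros continuous_on_compose2[OF st(3)]) auto
  have tb: "\<bar>t1 s\<bar> <= 2 * S / e" "\<bar>t2 s\<bar> <= 4 * S / e^2" for s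
   using stC e by (auto simp: t1_def t2_def abs_mult power2_eq_square divide_right_mono)
  have tz: "t s = 0" if "s <= e / 2" for s
   using that e by (simp add: t_def st0 field_simps)
  have to: "t s = 1" "t1 s = 0" "t2 s = 0" if "s >= e" for s
  proof -
   have "(2 / e) * s - 1 >= 1" using that e by (simp add: field_simps)
   then show "t s = 1" "t1 s = 0" "t2 s = 0" by (simp_all add: t_def t1_def t2_def sto)
  qed
  have tn: "0 <= t s" for s by (simp add: t_def stn)
  have Cc: "C2_on UNIV (\<lambda>x. t (F x)) (\<lambda>x h. t1 (F x) * F' x h)
    (\<lambda>b x h. t1 (F x) * F'' b x h + t2 (F x) * F' x h * F' x b)"
   by (rule C2_on_chain[OF F td1 td2 tc])
  note Cp = C2_on_mult[OF Cc Cw]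
  \<comment> \<open>All terms of \<open>\<Delta>(t(F) w)\<close> that contain a derivative of the
    cutoff.\<close>
  define E where "E x = 2 * t1 (F x) * (\<Sum>b\<in>Basis. F' x b * w' x b)
    + (t1 (F x) * trace2 F'' x + t2 (F x) * (gradsq F' x)) * w x" for x
  have tr: "trace2 (\<lambda>b x h. t (F x) * w'' b x h + t1 (F x) * F' x h * w' x b + t1 (F x) * F' x b * w' x h
    + (t1 (F x) * F'' b x h + t2 (F x) * F' x h * F' x b) * w x) x = t (F x) * trace2 w'' x + E x" for x
  proof -
   have "trace2 (\<lambda>b x h. t (F x) * w'' b x h + t1 (F x) * F' x h * w' x b + t1 (F x) * F' x b * w' x h
    + (t1 (F x) * F'' b x h + t2 (F x) * F' x h * F' x b) * w x) x
    = (\<Sum>b\<in>Basis. t (F x) * w'' b x b + (2 * t1 (F x)) * (F' x b * w' x b)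
     + (t1 (F x) * w x) * F'' b x b + (t2 (F x) * w x) * (F' x b)^2)"
    unfolding trace2_def by (intro sum.cong refl) (simp add: power2_eq_square algebra_simps)
   also have "\<dots> = t (F x) * trace2 w'' x + E x"
    unfolding sum.distrib sum_distrib_left[symmetric] E_def trace2_def by (simp add: distrib_right)
   finally show ?thesis .
  qed
  define K' where "K' = K \<inter> {x. e / 2 <= F x}"
  have K'c: "compact K'"
   unfolding K'_def using closed_Collect_le[OF continuous_on_const C2_on_cont[OF F]] K by (intro compact_Int_closed)
  have K'b: "cball x r \<subseteq> \<Omega>" if x: "x \<in> K'" for x
  proof (rule ccontr)
   assume n: "\<not> cball x r \<subseteq> \<Omega>"
   obtain y where y: "y \<in> closure \<Omega>" "dist x y <= r" using Kpt x by (auto simp: K'_def)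
   have "cball x r \<inter> frontier \<Omega> \<noteq> {}"
   proof (cases "cball x r \<inter> \<Omega> = {}")
    case True
    then have "y \<in> frontier \<Omega>" using y \<Omega>(1) by (auto simp: frontier_def interior_open)
    then show ?thesis using y by auto
   next
    case False
    then show ?thesis using n by (intro connected_Int_frontier) auto
   qed
   then obtain p where p: "p \<in> frontier \<Omega>" "dist x p <= r" by auto
   have "p \<in> B" using cl(1)[of p] p(1) by (auto simp: frontier_def)
   then have "\<bar>F x - F p\<bar> <= L * norm (x - p)" using lip KB x by (auto simp: K'_def)
   also have "\<dots> <= L * r" using p(2) L(1) by (intro mult_left_mono) (auto simp: dist_norm)
   finally show False using F0[OF p(1)] r(2) e x by (auto simp: K'_def)
  qed
  have K's: "K' \<subseteq> \<Omega>" using K'b r(1) by (meson centre_in_cball less_imp_le subset_eq)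
  have \<Omega>K: "x \<in> K" if "x \<in> \<Omega>" for x using that r(1) by (simp add: K_def)
  obtain v' v'' where v2: "C2_on \<Omega> v v' v''" "\<forall>x\<in>\<Omega>. trace2 v'' x = 0"
   using harmonic_on_iff[OF \<Omega>(1)] v(1) by metis
  have p0: "t (F x) * w x = 0" if "x \<in> \<Omega> - K'" for x
   using that \<Omega>K[of x] tz[of "F x"] by (auto simp: K'_def)
  note Gr = Green_identity[OF \<Omega>(1) K'c K's v2(1) C2_on_subset[OF Cp subset_UNIV], unfolded tr, OF p0]
  define X where "X x = indicator \<Omega> x *\<^sub>R (v x * (t (F x) * trace2 w'' x + E x))" for x
  have Xi: "integrable lborel X" using Gr(1) unfolding set_integrable_def X_def[abs_def] by blast
  have "(LINT x:\<Omega>|lborel. t (F x) * w x * trace2 v'' x) = 0" using v2(2) by (intro set_integral_zero) simp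
  then have X0: "(LINT x|lborel. X x) = 0"
   using Gr(3) unfolding set_lebesgue_integral_def X_def[abs_def] by simp
  \<comment> \<open>Where the cutoff is nonzero, the ball of radius \<open>r\<close> lies in
    \<Omega> and the mean value property makes the Laplacian of \<open>w\<close> equal to
    \<open>?M * v\<close>.\<close>
  have mv: "t (F x) * trace2 w'' x = ?M * t (F x) * v x" if "x \<in> \<Omega>" for x
  proof (cases "x \<in> K'")
   case True
   have "trace2 w'' x = (LINT y:\<Omega>|lborel. v y * mollifier r (x - y))"
    by (simp add: tw convolution_def vt_def set_lebesgue_integral_def mult.assoc)
   then show ?thesis using mean_value_property[OF \<Omega>(1) v(1) r(1) K'b[OF True]] by simp
  next
   case False
   then show ?thesis using \<Omega>K[OF that] tz[of "F x"] by (simp add: K'_def)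
  qed
  have Xeq: "X x = ?M * t (F x) * (vt x)^2 + vt x * E x" for x
   using mv[of x] by (cases "x \<in> \<Omega>") (auto simp: X_def vt_def power2_eq_square algebra_simps)
  have Ez: "E x = 0" if "F x > e" for x using to[of "F x"] that by (simp add: E_def)
  have EK: "E x = 0" if "x \<notin> K" for x using that w0 hes(2) by (simp add: E_def)
  have E2: "(E x)^2 <= 2 * c1^2 / e^2 * (gradsq w' x) + 2 * c2^2 / e ^ 4 * (w x)^2" for x
  proof (cases "x \<in> K")
   case False
   then show ?thesis using EK by (simp add: sum_nonneg)
  next
   case True
   then have xB: "x \<in> B" using KB by blast
   define N where "N = (gradsq w' x)"
   define P where "P = 2 * t1 (F x) * (\<Sum>b\<in>Basis. F' x b * w' x b)"
   define q where "q = t1 (F x) * trace2 F'' x + t2 (F x) * (gradsq F' x)"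
   have P: "P^2 <= c1^2 / e^2 * N"
   proof -
    have "(\<Sum>b\<in>Basis. F' x b * w' x b)^2 <= (gradsq F' x) * N"
     unfolding N_def by (rule Cauchy_Schwarz_ineq_sum)
    also have "\<dots> <= L^2 * N" using gradL[OF xB] by (intro mult_right_mono) (auto simp: N_def sum_nonneg)
    finally have a: "(\<Sum>b\<in>Basis. F' x b * w' x b)^2 <= L^2 * N" .
    have "(t1 (F x))^2 <= (2 * S / e)^2" using tb(1)[of "F x"] abs_le_square_iff[of "t1 (F x)" "2 * S / e"] S e by simp
    then have "(t1 (F x))^2 * (\<Sum>b\<in>Basis. F' x b * w' x b)^2 <= (2 * S / e)^2 * (L^2 * N)"
     using a by (intro mult_mono) auto
    then show ?thesis by (simp add: P_def c1_def power_mult_distrib power_divide)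
   qed
   have q: "\<bar>q\<bar> <= c2 / e^2"
   proof -
    have "\<bar>t1 (F x) * trace2 F'' x\<bar> <= 2 * S / e * D"
     unfolding abs_mult using tb(1) D xB S e by (intro mult_mono) auto
    also have "\<dots> <= 2 * S * D / e^2"
    proof -
     have "e * (2 * S * D) <= 1 * (2 * S * D)" using e1(3) S D(1) by (intro mult_right_mono) auto
     then show ?thesis using e by (simp add: field_simps power2_eq_square)
    qed
    finally have "\<bar>t1 (F x) * trace2 F'' x\<bar> <= 2 * S * D / e^2" .
    moreover have "\<bar>t2 (F x) * (gradsq F' x)\<bar> <= 4 * S / e^2 * L^2"
     unfolding abs_mult using tb(2) gradL[OF xB] S e by (intro mult_mono) (auto simp: sum_nonneg)
    ultimately show ?thesis
     unfolding q_def c2_def add_divide_distrib using abs_triangle_ineq[of "t1 (F x) * trace2 F'' x" "t2 (F x) * (gradsq F' x)"]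
     by simp
   qed
   have q2: "q^2 <= c2^2 / e ^ 4"
   proof -
    have "\<bar>q\<bar>\<^sup>2 <= (c2 / e^2)^2" using q by (intro power_mono) auto
    then show ?thesis by (simp add: power_divide power2_eq_square power4_eq_xxxx)
   qed
   have "(E x)^2 = (P + q * w x)^2" by (simp add: E_def P_def q_def)
   also have "\<dots> <= 2 * P^2 + 2 * (q^2 * (w x)^2)"
    using zero_le_power2[of "P - q * w x"] by (simp add: power2_sum power2_diff power_mult_distrib)
   also have "\<dots> <= 2 * (c1^2 / e^2 * N) + 2 * (c2^2 / e ^ 4 * (w x)^2)"
    using P q2 by (intro add_mono mult_left_mono mult_right_mono) auto
   finally show ?thesis by (simp add: N_def)
  qed
  have ct1: "continuous_on UNIV t1" by (rule DERIV_continuous_on) (use td2 in blast)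
  have cE: "continuous_on UNIV E"
   unfolding E_def[abs_def]
   by (intro continuous_intros continuous_on_compose2[OF ct1] continuous_on_compose2[OF tc, of UNIV]
     C2_on_cont[OF F] C2_on_cont[OF Cw] C2_on_cont'[OF F] C2_on_cont'[OF Cw] C2_on_cont_trace[OF F]) auto
  have iE: "integrable lborel (\<lambda>x. (E x)^2)"
   by (rule integrable_continuous_compact_support[OF continuous_on_power[OF cE] K]) (simp add: EK)
  have IE: "(LINT x|lborel. indicator {x. F x <= e} x * (E x)^2) <= A"
  proof -
   have ip: "integrable lborel (\<lambda>x. 2 * c1^2 / e^2 * (indicator {x. F x <= e} x * (gradsq w' x)))"
    "integrable lborel (\<lambda>x. 2 * c2^2 / e ^ 4 * (indicator {x. F x <= e} x * (w x)^2))"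
    by (intro integrable_mult_right ind Bochner_Integration.integrable_sum iw' iw)+
   have "(LINT x|lborel. indicator {x. F x <= e} x * (E x)^2)
    <= (LINT x|lborel. 2 * c1^2 / e^2 * (indicator {x. F x <= e} x * (gradsq w' x))
      + 2 * c2^2 / e ^ 4 * (indicator {x. F x <= e} x * (w x)^2))"
    using E2 by (intro integral_mono ind iE Bochner_Integration.integrable_add ip) (auto simp: indicator_def)
   also have "\<dots> = 2 * c1^2 / e^2 * (LINT x|lborel. indicator {x. F x <= e} x * (gradsq w' x))
      + 2 * c2^2 / e ^ 4 * (LINT x|lborel. indicator {x. F x <= e} x * (w x)^2)"
    using ip by (simp only: Bochner_Integration.integral_add integral_mult_right_zero)
   also have "\<dots> <= 2 * c1^2 / e^2 * (4 * H * e^2 * Q2) + 2 * c2^2 / e ^ 4 * (4 * H^2 * e ^ 4 * Q2)"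
    using G1 W2 by (intro add_mono mult_left_mono) auto
   also have "\<dots> = (8 * c1^2 * H + 8 * c2^2 * H^2) * Q2" using e by (simp add: field_simps)
   also have "\<dots> <= A" unfolding A_def using Q2 H0 by (intro mult_left_mono) auto
   finally show ?thesis .
  qed
  \<comment> \<open>\<open>X\<close> has integral zero; its mixed term \<open>vt * E\<close> is
    split by Young's inequality on the layer \<open>F <= e\<close>, outside of which
    \<open>E\<close> vanishes.\<close>
  have pw: "?M * (indicator {x. e <= F x} x * (vt x)^2)
    <= X x + l / 2 * (indicator {x. F x <= e} x * (vt x)^2) + 1 / (2 * l) * (indicator {x. F x <= e} x * (E x)^2)" for x
  proof -
   have "indicator {x. e <= F x} x * (vt x)^2 <= t (F x) * (vt x)^2"
    using to(1)[of "F x"] tn[of "F x"] by (auto simp: indicator_def)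
   then have 1: "?M * (indicator {x. e <= F x} x * (vt x)^2) <= ?M * t (F x) * (vt x)^2"
    using M by (simp add: mult.assoc)
   have 2: "- (vt x * E x) <= l / 2 * (indicator {x. F x <= e} x * (vt x)^2) + 1 / (2 * l) * (indicator {x. F x <= e} x * (E x)^2)"
   proof (cases "F x <= e")
    case True
    have "0 <= (l * vt x + E x)^2 / (2 * l)" using l by simp
    also have "\<dots> = l / 2 * (vt x)^2 + vt x * E x + 1 / (2 * l) * (E x)^2"
     using l by (simp add: power2_sum field_simps power2_eq_square)
    finally show ?thesis using True by simp
   qed (use Ez[of x] in simp)
   show ?thesis using 1 2 Xeq[of x] by linarith
  qed
  have iv: "integrable lborel (\<lambda>x. indicator {x. e <= F x} x * (vt x)^2)"
  proof -
   have "closed {x. e <= F x}" using closed_Collect_le[OF continuous_on_const C2_on_cont[OF F]] .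
   then show ?thesis using integrable_mult_indicator[OF _ vti2, of "{x. e <= F x}"] by simp
  qed
  have i2: "integrable lborel (\<lambda>x. l / 2 * (indicator {x. F x <= e} x * (vt x)^2))"
   and i3: "integrable lborel (\<lambda>x. 1 / (2 * l) * (indicator {x. F x <= e} x * (E x)^2))"
   by (intro integrable_mult_right ind vti2 iE)+
  have "?M * (LINT y|lborel. indicator {x. e <= F x} y * (vt y)^2)
    = (LINT y|lborel. ?M * (indicator {x. e <= F x} y * (vt y)^2))" by simp
  also have "\<dots> <= (LINT x|lborel. X x + l / 2 * (indicator {x. F x <= e} x * (vt x)^2)
    + 1 / (2 * l) * (indicator {x. F x <= e} x * (E x)^2))"
   by (intro integral_mono integrable_mult_right iv Bochner_Integration.integrable_add Xi i2 i3 pw)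
  also have "\<dots> = l / 2 * del e + 1 / (2 * l) * (LINT x|lborel. indicator {x. F x <= e} x * (E x)^2)"
   unfolding del_def using Xi i2 i3 X0
   by (simp only: Bochner_Integration.integral_add Bochner_Integration.integrable_add integral_mult_right_zero add_0)
  also have "\<dots> <= l / 2 * del e + 1 / (2 * l) * A"
   using IE l by (intro add_left_mono mult_left_mono) auto
  finally show ?thesis by simp
 qed
 define T where "T = F x0 / 2"
 have T: "T > 0" using Fpos[OF x0] by (simp add: T_def)
 have dl: "(\<lambda>n. del (1 / real (Suc n))) \<longlonglongrightarrow> 0"
 proof -
  have "(\<lambda>n. LINT y|lborel. indicator {x. F x <= 1 / real (Suc n)} y * (vt y)^2) \<longlonglongrightarrow> (LINT y::'a|lborel. 0)"
  proof (rule integral_dominated_convergence[where w = "\<lambda>y. (vt y)^2"])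
   show "AE x in lborel. (\<lambda>n. indicator {x. F x <= 1 / real (Suc n)} x * (vt x)^2) \<longlonglongrightarrow> 0"
   proof (rule AE_I2)
    fix x
    show "(\<lambda>n. indicator {x. F x <= 1 / real (Suc n)} x * (vt x)^2) \<longlonglongrightarrow> 0"
    proof (cases "x \<in> \<Omega>")
     case True
     have "eventually (\<lambda>n. 1 / real (Suc n) < F x) sequentially"
      using LIMSEQ_inverse_real_of_nat[unfolded inverse_eq_divide] Fpos[OF True] by (rule order_tendstoD)
     then show ?thesis by (intro tendsto_eventually) (auto elim!: eventually_mono)
    qed (simp add: vt_def)
   qed
   have "closed {x. F x <= s}" for s using closed_Collect_le[OF C2_on_cont[OF F] continuous_on_const] .
   then show "(\<lambda>y. indicator {x. F x <= 1 / real (Suc n)} y * (vt y)^2) \<in> borel_measurable lborel" for n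
    using vtm by (intro borel_measurable_times borel_measurable_indicator borel_measurable_power) auto
  qed (use vti2 in \<open>auto simp: indicator_def\<close>)
  then show ?thesis by (simp add: del_def)
 qed
 define IT where "IT = (LINT y|lborel. indicator {x. T <= F x} y * (vt y)^2)"
 have iv: "integrable lborel (\<lambda>x. indicator {x. s <= F x} x * (vt x)^2)" for s
 proof -
  have "closed {x. s <= F x}" using closed_Collect_le[OF continuous_on_const C2_on_cont[OF F]] .
  then show ?thesis using integrable_mult_indicator[OF _ vti2, of "{x. s <= F x}"] by simp
 qed
 have bl: "?M * IT <= A / (2 * l)" if l: "l > 0" for l
 proof -
  have "eventually (\<lambda>n. 1 / real (Suc n) < min T e0) sequentially"
   using LIMSEQ_inverse_real_of_nat[unfolded inverse_eq_divide] T e0 by (intro order_tendstoD) auto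
  then have "eventually (\<lambda>n. ?M * IT <= l / 2 * del (1 / real (Suc n)) + A / (2 * l)) sequentially"
  proof eventually_elim
   case (elim n)
   let ?e = "1 / real (Suc n)"
   have "IT <= (LINT y|lborel. indicator {x. ?e <= F x} y * (vt y)^2)"
    unfolding IT_def using elim by (intro integral_mono iv) (auto simp: indicator_def)
   then have "?M * IT <= ?M * (LINT y|lborel. indicator {x. ?e <= F x} y * (vt y)^2)"
    using M by (intro mult_left_mono) auto
   also have "\<dots> <= l / 2 * del ?e + A / (2 * l)" using elim l by (intro main) auto
   finally show ?case .
  qed
  moreover have "(\<lambda>n. l / 2 * del (1 / real (Suc n)) + A / (2 * l)) \<longlonglongrightarrow> l / 2 * 0 + A / (2 * l)"
   by (intro tendsto_intros dl)
  ultimately have "?M * IT <= l / 2 * 0 + A / (2 * l)"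
   by (intro tendsto_lowerbound[OF _ _ trivial_limit_sequentially])
  then show ?thesis by simp
 qed
 have "IT = 0"
 proof (rule ccontr)
  assume "IT \<noteq> 0"
  moreover have "IT >= 0" unfolding IT_def by (intro integral_nonneg_AE AE_I2) (simp add: indicator_def)
  ultimately have p: "?M * IT > 0" using M by simp
  have "A >= 0" using p bl[of 1] by simp
  \<comment> \<open>Chosen so that \<open>bl\<close> would give
    \<open>2 (A + 1) <= A\<close>.\<close>
  define l where "l = (A + 1) / (?M * IT)"
  have l: "l > 0" using p \<open>A >= 0\<close> by (simp add: l_def)
  then have "?M * IT * (2 * l) <= A" using bl[OF l] by (simp add: field_simps)
  moreover have "P * (2 * ((A + 1) / P)) = 2 * (A + 1)" if "P > 0" for P :: real
   using that by simp
  then have "?M * IT * (2 * l) = 2 * (A + 1)" using p unfolding l_def by blast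
  ultimately show False using \<open>A >= 0\<close> by simp
 qed
 then have "AE y in lborel. indicator {x. T <= F x} y * (vt y)^2 = 0"
  unfolding IT_def using iv
  by (subst (asm) integral_nonneg_eq_0_iff_AE) (auto simp: indicator_def)
 then have ae: "AE y in lborel. y \<in> \<Omega> \<inter> {x. T < F x} --> v y = 0"
  by eventually_elim (auto simp: vt_def)
 have "open {x. T < F x}" using open_Collect_less[OF continuous_on_const C2_on_cont[OF F]] .
 then have "open (\<Omega> \<inter> {x. T < F x})" using \<Omega>(1) by blast
 then show ?thesis
  using x0 T by (intro continuous_AE_zero_imp_zero[OF _ continuous_on_subset[OF cv] ae]) (auto simp: T_def)
qed

section \<open>The boundary and the distance function\<close>

lemma ray_derivative:
 fixes f :: "'a::euclidean_space => real"
 assumes "(f has_derivative (\<lambda>h. g \<bullet> h)) (at x)"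
 shows "((\<lambda>s. f (x + s *\<^sub>R v)) has_real_derivative g \<bullet> v) (at 0)"
proof -
 have "((\<lambda>s. x + s *\<^sub>R v) has_derivative (\<lambda>s. s *\<^sub>R v)) (at 0)" by (auto intro!: derivative_eq_intros)
 from has_derivative_compose[OF this, of f "\<lambda>h. g \<bullet> h"]
 have "((\<lambda>s. f (x + s *\<^sub>R v)) has_derivative (\<lambda>s. g \<bullet> (s *\<^sub>R v))) (at 0)" using assms by simp
 moreover have "(\<lambda>s. g \<bullet> (s *\<^sub>R v)) = (*) (g \<bullet> v)" by (simp add: fun_eq_iff)
 ultimately show ?thesis by (simp add: has_field_derivative_def)
qed

text \<open>\<open>F\<close> will be a smooth extension of \<open>\<tau>\<close> to the whole space.
  It is tied to the distance on the inner side of the boundary, so facts at boundary points come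
  from one-sided derivatives and from limits taken inside.\<close>

locale collar_domain =
 fixes \<Omega> :: "'a::euclidean_space set" and F :: "'a => real" and F' F'' and \<epsilon>0 :: real
 assumes op: "open \<Omega>" and bd: "bounded \<Omega>" and ne: "\<Omega> \<noteq> {}" and sm: "smooth_boundary \<Omega>"
  and F2: "C2_on UNIV F F' F''" and Fpos: "x \<in> \<Omega> ==> F x > 0" and e0: "\<epsilon>0 > 0"
  and Fdist: "x \<in> closure \<Omega> ==> infdist x (frontier \<Omega>) < \<epsilon>0 ==> F x = infdist x (frontier \<Omega>)"
begin

abbreviation bdist :: "'a => real" where
 "bdist x \<equiv> infdist x (frontier \<Omega>)"

text \<open>At boundary points this will turn out to be the inner unit normal. Defining it
  everywhere as the gradient of \<open>F\<close> makes continuity and Lipschitz bounds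
  immediate.\<close>

definition \<nu> :: "'a => 'a" where
 "\<nu> = gradient F'"

lemma F'_eq: "F' x h = \<nu> x \<bullet> h"
 unfolding \<nu>_def by (rule C1_on_gradient(1)[OF C2_onD1[OF F2] UNIV_I])

lemma F_deriv: "(F has_derivative (\<lambda>h. \<nu> x \<bullet> h)) (at x)"
proof -
 have "F' x = (\<lambda>h. \<nu> x \<bullet> h)" by (rule ext) (rule F'_eq)
 then show ?thesis using C1_onD[OF C2_onD1[OF F2] UNIV_I, of x] by simp
qed

lemma inner_normal_continuous: "continuous_on S \<nu>"
 unfolding \<nu>_def using C1_on_gradient(2)[OF C2_onD1[OF F2]] continuous_on_subset by blast

lemma frontier_nonempty: "frontier \<Omega> \<noteq> {}"
 using ne bd not_bounded_UNIV frontier_not_empty by metis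

lemma frontier_compact: "compact (frontier \<Omega>)"
 using bd compact_frontier_bounded by blast

lemma frontier_iff: "x \<in> frontier \<Omega> \<longleftrightarrow> x \<in> closure \<Omega> \<and> x \<notin> \<Omega>"
 using op by (auto simp: frontier_def interior_open)

lemma F_frontier: "x \<in> frontier \<Omega> ==> F x = 0"
 using Fdist[of x] e0 by (simp add: frontier_iff)

text \<open>The open ball of radius \<open>t\<close> around \<open>y\<close> lies in \<Omega>, so
  the segment to the nearest boundary point stays in the closure, and along it the distance drops at
  unit speed.\<close>

lemma segment_to_frontier:
 assumes y: "y \<in> \<Omega>" and x: "x \<in> frontier \<Omega>" and t: "dist y x = t" "bdist y = t" "t < \<epsilon>0"
  and s: "0 <= s" "s <= t"
 shows "F (y + (s / t) *\<^sub>R (x - y)) = t - s"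
proof -
 have tp: "t > 0" using y x t(1) op by (auto simp: frontier_def interior_open)
 have b: "ball y t \<subseteq> \<Omega>"
 proof (rule ccontr)
  assume "\<not> ball y t \<subseteq> \<Omega>"
  moreover have "y \<in> ball y t \<inter> \<Omega>" using y tp by simp
  ultimately have "ball y t \<inter> frontier \<Omega> \<noteq> {}"
   by (intro connected_Int_frontier connected_ball) blast+
  then obtain z where "z \<in> frontier \<Omega>" "dist y z < t" by auto
  then show False using infdist_le[of z "frontier \<Omega>" y] t(2) by simp
 qed
 let ?p = "y + (s / t) *\<^sub>R (x - y)"
 have dy: "dist y ?p = s" using s tp t(1) by (simp add: dist_norm norm_minus_commute)
 have "?p - x = (1 - s / t) *\<^sub>R (y - x)" by (simp add: algebra_simps)
 then have "dist ?p x = \<bar>1 - s / t\<bar> * t" using t(1) by (simp add: dist_norm)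
 moreover have "0 <= 1 - s / t" "(1 - s / t) * t = t - s" using s tp by (simp_all add: left_diff_distrib)
 ultimately have dx: "dist ?p x = t - s" by (simp only: abs_of_nonneg)
 have "?p \<in> closure \<Omega>"
 proof (cases "s = t")
  case True then show ?thesis using x tp by (simp add: frontier_def)
 next
  case False
  then have "?p \<in> ball y t" using dy s by simp
  then show ?thesis using b closure_subset by blast
 qed
 moreover have "bdist ?p = t - s"
  using infdist_le[OF x, of ?p] dx dy infdist_triangle[of y "frontier \<Omega>" ?p] t(2) by linarith
 ultimately show ?thesis using Fdist[of ?p] s t(3) by simp
qed

text \<open>Differentiate \<open>F = t - s\<close> along the segment. The derivative is taken within
  the closed interval so that the end points are included: \<open>s = 0\<close> serves interior
  points and \<open>s = t\<close> the boundary point.\<close>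

lemma directional_derivative_to_frontier:
 assumes y: "y \<in> \<Omega>" and x: "x \<in> frontier \<Omega>" and t: "dist y x = t" "bdist y = t" "t < \<epsilon>0"
  and s: "0 <= s" "s <= t"
 shows "\<nu> (y + (s / t) *\<^sub>R (x - y)) \<bullet> (x - y) = - t"
proof -
 have tp: "t > 0" using y x t(1) op by (auto simp: frontier_def interior_open)
 let ?p = "\<lambda>s. y + (s / t) *\<^sub>R (x - y)"
 have "(?p has_derivative (\<lambda>r. (r / t) *\<^sub>R (x - y))) (at s within {0..t})"
  by (auto intro!: derivative_eq_intros simp: divide_inverse)
 from has_derivative_compose[OF this F_deriv]
 have "((\<lambda>s. F (?p s)) has_derivative (\<lambda>r. \<nu> (?p s) \<bullet> ((r / t) *\<^sub>R (x - y)))) (at s within {0..t})" .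
 moreover have "((\<lambda>s. F (?p s)) has_derivative (\<lambda>r. - r)) (at s within {0..t})"
 proof (rule has_derivative_transform[of s "{0..t}" "\<lambda>s. F (?p s)" "\<lambda>s. t - s"])
  show "((\<lambda>s. t - s) has_derivative (\<lambda>r. - r)) (at s within {0..t})"
   by (auto intro!: derivative_eq_intros)
 qed (use s segment_to_frontier[OF y x t] in auto)
 ultimately have "(\<lambda>r. \<nu> (?p s) \<bullet> ((r / t) *\<^sub>R (x - y))) = (\<lambda>r. - r)"
  using s tp frechet_derivative_unique_within_closed_interval[of 0 t s "\<lambda>s. F (?p s)"] by (auto simp: cbox_interval)
 then have "\<nu> (?p s) \<bullet> ((t / t) *\<^sub>R (x - y)) = - t" by metis
 then show ?thesis using tp by simp
qed

text \<open>At least one because \<open>F\<close> drops at unit speed towards the nearest boundary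
  point, at most one because the distance is 1-Lipschitz.\<close>

lemma norm_inner_normal_interior:
 assumes y: "y \<in> \<Omega>" "bdist y < \<epsilon>0"
 shows "norm (\<nu> y) = 1"
proof (rule antisym)
 obtain x where x: "x \<in> frontier \<Omega>" "bdist y = dist y x"
  using infdist_attains_inf[OF frontier_closed frontier_nonempty] by blast
 define t where "t = dist y x"
 have tp: "t > 0" using y x op by (auto simp: t_def frontier_def interior_open)
 have "\<nu> y \<bullet> (x - y) = - t"
  using directional_derivative_to_frontier[OF y(1) x(1), of t 0] x y(2) tp by (simp add: t_def)
 then have "t <= norm (\<nu> y) * norm (x - y)"
  using Cauchy_Schwarz_ineq2[of "\<nu> y" "x - y"] by linarith
 then show "1 <= norm (\<nu> y)" using tp by (simp add: t_def dist_norm norm_minus_commute)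
next
 have "open (\<Omega> \<inter> {z. bdist z < \<epsilon>0})"
  using op by (intro open_Int open_Collect_less continuous_intros)
 then obtain d where d: "d > 0" "ball y d \<subseteq> \<Omega> \<inter> {z. bdist z < \<epsilon>0}"
  using y openE by blast
 have lip: "F z - F y <= dist z y" if "z \<in> ball y d" for z
  using Fdist[of z] Fdist[of y] that d y closure_subset[of \<Omega>] infdist_triangle[of z "frontier \<Omega>" y]
  by (auto simp: subset_iff)
 let ?n = "\<nu> y"
 have "((\<lambda>s. (F (y + s *\<^sub>R ?n) - F y) / s) \<longlongrightarrow> ?n \<bullet> ?n) (at_right 0)"
  using ray_derivative[OF F_deriv, of y ?n] filterlim_at_split by (auto simp: has_field_derivative_iff)
 moreover have "eventually (\<lambda>s. (F (y + s *\<^sub>R ?n) - F y) / s <= norm ?n) (at_right 0)"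
 proof -
  have "eventually (\<lambda>s. s \<in> {0<..<d / (norm ?n + 1)}) (at_right 0)"
   using d(1) by (intro eventually_at_right_real) (simp add: add_nonneg_pos)
  then show ?thesis
  proof eventually_elim
   case (elim s)
   then have s: "s > 0" "s * (norm ?n + 1) < d" by (auto simp: pos_less_divide_eq add_nonneg_pos)
   then have "s * norm ?n < d" by (simp add: distrib_left)
   then have "F (y + s *\<^sub>R ?n) - F y <= s * norm ?n"
    using lip[of "y + s *\<^sub>R ?n"] s by (simp add: dist_norm)
   then show ?case using s by (simp add: divide_le_eq mult.commute)
  qed
 qed
 ultimately have "?n \<bullet> ?n <= norm ?n" by (intro tendsto_upperbound) auto
 then have "norm ?n * norm ?n <= norm ?n * 1" by (simp add: dot_square_norm power2_eq_square)
 then show "norm ?n <= 1" using norm_ge_zero[of ?n] by (metis mult_le_cancel_left_pos norm_zero order_less_le zero_le_one)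
qed

lemma norm_inner_normal:
 assumes x: "x \<in> frontier \<Omega>"
 shows "norm (\<nu> x) = 1"
proof -
 have "x \<in> closure (ball x \<epsilon>0 \<inter> \<Omega>)"
  using open_Int_closure_subset[OF open_ball, of x \<epsilon>0 \<Omega>] x e0 by (auto simp: frontier_iff)
 moreover have "ball x \<epsilon>0 \<inter> \<Omega> \<subseteq> {z. norm (\<nu> z) = 1}"
 proof
  fix z assume "z \<in> ball x \<epsilon>0 \<inter> \<Omega>"
  then show "z \<in> {z. norm (\<nu> z) = 1}"
   using norm_inner_normal_interior[of z] infdist_le[OF x, of z] by (simp add: dist_commute)
 qed
 moreover have "closed {z. norm (\<nu> z) = 1}"
  by (intro closed_Collect_eq continuous_intros inner_normal_continuous)
 ultimately show ?thesis by (metis (mono_tags, lifting) closure_minimal mem_Collect_eq subsetD)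
qed

text \<open>Equality in Cauchy-Schwarz: the gradient at the nearest boundary point \<open>x\<close>
  is a unit vector whose pairing with \<open>y - x\<close> is \<open>|y - x|\<close>.\<close>

lemma collar_representation:
 assumes y: "y \<in> \<Omega>" "bdist y < \<epsilon>0"
 obtains x where "x \<in> frontier \<Omega>" "y = x + bdist y *\<^sub>R \<nu> x"
proof -
 obtain x where x: "x \<in> frontier \<Omega>" "bdist y = dist y x"
  using infdist_attains_inf[OF frontier_closed frontier_nonempty] by blast
 define t where "t = dist y x"
 have tp: "t > 0" using y x op by (auto simp: t_def frontier_def interior_open)
 have a: "\<nu> x \<bullet> (x - y) = - t"
  using directional_derivative_to_frontier[OF y(1) x(1), of t t] x y(2) tp by (simp add: t_def)
 have "(norm (x - y + t *\<^sub>R \<nu> x))^2 = (norm (x - y))^2 + 2 * (t * (\<nu> x \<bullet> (x - y))) + t^2 * (norm (\<nu> x))^2"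
  unfolding power2_norm_eq_inner
  by (simp add: inner_add_left inner_add_right inner_commute power2_eq_square)
 also have "\<dots> = 0"
  using a norm_inner_normal[OF x(1)] by (simp add: t_def dist_norm norm_minus_commute power2_eq_square)
 finally have "x - y + t *\<^sub>R \<nu> x = 0" by simp
 then have "y = x + t *\<^sub>R \<nu> x" by (simp add: algebra_simps)
 then show ?thesis using that x by (simp add: t_def)
qed

text \<open>A direction \<open>v\<close> with \<open>g \<bullet> v < 0\<close> enters \<Omega>,
  where \<open>F\<close> is positive, so \<open>\<nu> x \<bullet> v >= 0\<close>. This forces
  \<open>\<nu> x\<close> to be a nonnegative multiple of \<open>- g\<close>, and it has norm one.
  Hence the normal is the same for all defining functions.\<close>

lemma defining_function_gradient:
 assumes x: "x \<in> frontier \<Omega>" "x \<in> W" and l: "local_defining_function \<Omega> W \<rho>" and g: "GDERIV \<rho> x :> g"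
 shows "sgn g = - \<nu> x" "g \<noteq> 0"
  "\<And>v. g \<bullet> v < 0 ==> \<exists>d>0. \<forall>s. 0 < s \<and> s < d --> x + s *\<^sub>R v \<in> \<Omega>"
proof -
 have W: "open W" "\<Omega> \<inter> W = {x \<in> W. \<rho> x < 0}" using l by (auto simp: local_defining_function_def)
 have der: "(\<rho> has_derivative (\<lambda>h. g \<bullet> h)) (at x)" using g by (simp add: gderiv_def inner_commute)
 obtain g' where "GDERIV \<rho> x :> g'" "g' \<noteq> 0" using l x(2) by (auto simp: local_defining_function_def)
 then have "(\<lambda>h. h \<bullet> g') = (\<lambda>h. h \<bullet> g)" using g has_derivative_unique unfolding gderiv_def by blast
 then have "\<forall>h. h \<bullet> g' = h \<bullet> g" by (simp add: fun_eq_iff)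
 then have "g' = g" by (rule vector_eq_ldot[THEN iffD1])
 then show g0: "g \<noteq> 0" using \<open>g' \<noteq> 0\<close> by simp
 have cont: "isCont \<rho> x" using der has_derivative_continuous by blast
 have "\<rho> x = 0"
 proof (rule antisym)
  show "\<rho> x <= 0"
  proof (rule ccontr)
   assume "\<not> \<rho> x <= 0"
   then have "eventually (\<lambda>z. \<rho> z > 0) (nhds x)"
    using cont by (intro order_tendstoD(1)[of \<rho> "\<rho> x"]) (auto simp: isCont_def tendsto_nhds_iff)
   then have "eventually (\<lambda>z. \<rho> z > 0 \<and> z \<in> W) (nhds x)"
    using eventually_nhds_in_open[OF W(1) x(2)] by (rule eventually_conj)
   then obtain U where U: "open U" "x \<in> U" "\<And>z. z \<in> U ==> \<rho> z > 0 \<and> z \<in> W"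
    unfolding eventually_nhds by blast
   have "x \<in> U \<inter> closure \<Omega>" using x(1) U(2) by (simp add: frontier_iff)
   then have "U \<inter> \<Omega> \<noteq> {}" using open_Int_closure_eq_empty[OF U(1), of \<Omega>] by blast
   then obtain z where z: "z \<in> U" "z \<in> \<Omega>" by blast
   then have "z \<in> {x \<in> W. \<rho> x < 0}" using U(3)[OF z(1)] W(2) by blast
   then show False using U(3)[OF z(1)] by simp
  qed
  have "x \<notin> \<Omega> \<inter> W" using x(1) by (simp add: frontier_iff)
  then have "x \<notin> {x \<in> W. \<rho> x < 0}" using W(2) by blast
  then show "0 <= \<rho> x" using x(2) by simp
 qed
 show small: "\<exists>d>0. \<forall>s. 0 < s \<and> s < d --> x + s *\<^sub>R v \<in> \<Omega>" if v: "g \<bullet> v < 0" for v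
 proof -
  have p: "((\<lambda>s. x + s *\<^sub>R v) has_derivative (\<lambda>s. s *\<^sub>R v)) (at 0)" by (auto intro!: derivative_eq_intros)
  from DERIV_neg_dec_right[OF ray_derivative[OF der] v] obtain d1 where d1: "d1 > 0" "\<And>s. 0 < s ==> s < d1 ==> \<rho> (x + s *\<^sub>R v) < 0"
   using \<open>\<rho> x = 0\<close> by auto
  have "isCont (\<lambda>s. x + s *\<^sub>R v) 0" using p has_derivative_continuous by blast
  then have "eventually (\<lambda>s. x + s *\<^sub>R v \<in> W) (nhds 0)"
   using W(1) x(2) by (intro topological_tendstoD[of "\<lambda>s. x + s *\<^sub>R v" x]) (auto simp: isCont_def tendsto_nhds_iff)
  then obtain d2 where d2: "d2 > 0" "\<And>s. dist s 0 < d2 ==> x + s *\<^sub>R v \<in> W"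
   unfolding eventually_nhds_metric by blast
  show ?thesis
   using d1 d2 W(2) by (intro exI[of _ "min d1 d2"]) (auto simp: dist_real_def)
 qed
 have dir: "\<nu> x \<bullet> v >= 0" if v: "g \<bullet> v < 0" for v
 proof (rule ccontr)
  assume "\<not> \<nu> x \<bullet> v >= 0"
  then have n: "\<nu> x \<bullet> v < 0" by simp
  from DERIV_neg_dec_right[OF ray_derivative[OF F_deriv] n] obtain d1 where d1: "d1 > 0" "\<And>s. 0 < s ==> s < d1 ==> F (x + s *\<^sub>R v) < 0"
   using F_frontier[OF x(1)] by auto
  obtain d where d: "d > 0" "\<And>s. 0 < s ==> s < d ==> x + s *\<^sub>R v \<in> \<Omega>" using small[OF v] by blast
  define s where "s = min d d1 / 2"
  have "0 < s" "s < d" "s < d1" using d d1 by (auto simp: s_def)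
  then show False using d(2)[of s] d1(2)[of s] Fpos[of "x + s *\<^sub>R v"] by simp
 qed
 define u where "u = sgn g"
 have u: "norm u = 1" "u \<bullet> u = 1" "g = norm g *\<^sub>R u"
  using g0 by (auto simp: u_def norm_sgn sgn_div_norm dot_square_norm)
 have gu: "g \<bullet> v = norm g * (u \<bullet> v)" for v by (subst u(3)) simp
 define c where "c = \<nu> x \<bullet> u"
 define m where "m = \<nu> x - c *\<^sub>R u"
 have mu: "u \<bullet> m = 0" using u(2) by (simp add: m_def inner_diff_right c_def inner_commute)
 have nm: "\<nu> x \<bullet> m = (norm m)^2"
  using mu by (simp add: m_def power2_norm_eq_inner inner_diff_left inner_diff_right inner_commute)
 \<comment> \<open>\<open>m\<close> is the component of \<open>\<nu> x\<close> orthogonal to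
   \<open>g\<close>. The direction \<open>- m\<close> is tangential, so it is tilted inwards by
   \<open>- k u\<close> with a small \<open>k\<close> before \<open>dir\<close> is applied.\<close>
 have "(norm m)^2 <= 0 + \<delta>" if "\<delta> > 0" for \<delta>
 proof -
  define k where "k = \<delta> / (\<bar>c\<bar> + 1)"
  have k: "k > 0" using that by (simp add: k_def add_nonneg_pos)
  have "g \<bullet> (- k *\<^sub>R u - m) < 0"
   unfolding gu using g0 k u(2) mu by (simp add: inner_diff_right)
  then have "0 <= \<nu> x \<bullet> (- k *\<^sub>R u - m)" by (rule dir)
  then have "(norm m)^2 <= - k * c" using nm by (simp add: inner_diff_right c_def)
  also have "\<dots> <= k * (\<bar>c\<bar> + 1)" using k by (auto simp: algebra_simps abs_if mult_le_cancel_left_pos)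
  also have "\<dots> = \<delta>" by (simp add: k_def)
  finally show ?thesis by simp
 qed
 then have "(norm m)^2 <= 0" by (rule field_le_epsilon)
 then have "\<nu> x = c *\<^sub>R u" by (simp add: m_def)
 moreover have "c <= 0"
 proof -
  have "g \<bullet> (- u) < 0" unfolding gu using g0 u(2) by simp
  then show ?thesis using dir[of "- u"] by (simp add: c_def)
 qed
 moreover have "\<bar>c\<bar> = 1" using norm_inner_normal[OF x(1)] calculation(1) u(1) by simp
 ultimately have "\<nu> x = - u" by simp
 then show "sgn g = - \<nu> x" by (simp add: u_def)
qed

lemma defining_function_exists:
 assumes "x \<in> frontier \<Omega>"
 obtains W \<rho> g where "x \<in> W" "local_defining_function \<Omega> W \<rho>" "GDERIV \<rho> x :> g"
 using sm assms unfolding smooth_boundary_def local_defining_function_def by metis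

lemma outward_normal_eq:
 assumes x: "x \<in> frontier \<Omega>"
 shows "outward_normal \<Omega> x = - \<nu> x"
 unfolding outward_normal_def
proof (rule the_equality)
 show "\<exists>W \<rho> g. x \<in> W \<and> local_defining_function \<Omega> W \<rho> \<and> GDERIV \<rho> x :> g \<and> - \<nu> x = sgn g"
  using defining_function_exists[OF x] defining_function_gradient(1)[OF x] by metis
 show "n = - \<nu> x"
  if "\<exists>W \<rho> g. x \<in> W \<and> local_defining_function \<Omega> W \<rho> \<and> GDERIV \<rho> x :> g \<and> n = sgn g" for n
  using that defining_function_gradient(1)[OF x] by metis
qed

lemma closure_in_ball: obtains R where "closure \<Omega> \<subseteq> cball 0 R" "R >= 0"
proof -
 obtain R where "\<forall>x\<in>closure \<Omega>. norm x <= R" using bd bounded_closure bounded_iff by metis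
 then have "closure \<Omega> \<subseteq> cball 0 (max R 0)" by (auto simp: le_max_iff_disj)
 then show ?thesis using that[of "max R 0"] by simp
qed

text \<open>The margin 1 around the closure leaves room for points displaced along the
  normals.\<close>

lemma inner_normal_Lipschitz:
 obtains R \<Lambda> where "closure \<Omega> \<subseteq> cball 0 R" "R >= 0" "\<Lambda> >= 0"
  "\<And>x y. x \<in> cball 0 (R + 1) ==> y \<in> cball 0 (R + 1) ==> norm (\<nu> x - \<nu> y) <= \<Lambda> * norm (x - y)"
proof -
 obtain R where R: "closure \<Omega> \<subseteq> cball 0 R" "R >= 0" by (rule closure_in_ball)
 let ?B = "cball (0::'a) (R + 1)"
 have "\<exists>C\<ge>0. \<forall>x\<in>?B. \<forall>y\<in>?B. \<bar>F' x b - F' y b\<bar> <= C * norm (x - y)" for b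
  by (rule C1_Lipschitz_cball[OF C2_onD2[OF F2, of b], of 0 "R + 1"]) blast
 then obtain C where C: "\<And>b. C b >= 0" "\<And>b x y. x \<in> ?B ==> y \<in> ?B ==> \<bar>F' x b - F' y b\<bar> <= C b * norm (x - y)"
  by metis
 have "norm (\<nu> x - \<nu> y) <= (\<Sum>b\<in>Basis. C b) * norm (x - y)" if "x \<in> ?B" "y \<in> ?B" for x y
 proof -
  have "norm (\<nu> x - \<nu> y) <= (\<Sum>b\<in>Basis. \<bar>(\<nu> x - \<nu> y) \<bullet> b\<bar>)"
   by (rule norm_le_l1)
  also have "\<dots> = (\<Sum>b\<in>Basis. \<bar>F' x b - F' y b\<bar>)" by (simp only: inner_diff_left F'_eq[symmetric])
  also have "\<dots> <= (\<Sum>b\<in>Basis. C b * norm (x - y))" using C(2) that by (intro sum_mono) auto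
  finally show ?thesis by (simp add: sum_distrib_right)
 qed
 then show ?thesis using R C(1) by (intro that[of R "\<Sum>b\<in>Basis. C b"]) (auto intro: sum_nonneg)
qed

lemma F_bounded_below:
 assumes d: "d > 0"
 obtains c where "c > 0" "\<And>x. x \<in> closure \<Omega> ==> d <= bdist x ==> c <= F x"
proof -
 define Z where "Z = closure \<Omega> \<inter> {x. d <= bdist x}"
 have Z: "compact Z" unfolding Z_def
  using bd by (intro compact_Int_closed closed_Collect_le continuous_intros) auto
 have "\<exists>c>0. \<forall>x\<in>Z. c <= F x"
 proof (cases "Z = {}")
  case False
  obtain z where z: "z \<in> Z" "\<And>x. x \<in> Z ==> F z <= F x"
   using continuous_attains_inf[OF Z False continuous_on_subset[OF C2_on_cont[OF F2] subset_UNIV]] by blast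
  have "z \<in> \<Omega>" using z(1) d frontier_iff[of z] by (force simp: Z_def)
  then show ?thesis using z Fpos by blast
 qed (auto intro: exI[of _ 1])
 then show ?thesis using that by (auto simp: Z_def)
qed

text \<open>A defining function shows that the ray enters \<Omega>. While \<open>\<nu>\<close> has
  changed by at most one half, \<open>F\<close> grows along the ray at rate at least one half, so
  the ray cannot meet the frontier again, where \<open>F\<close> vanishes.\<close>

lemma inward_segment_in_domain:
 "\<exists>t0>0. t0 <= \<epsilon>0 \<and> (\<forall>x\<in>frontier \<Omega>. \<forall>t. 0 < t \<and> t < t0 --> x + t *\<^sub>R \<nu> x \<in> \<Omega>)"
proof -
 obtain R \<Lambda> where R: "closure \<Omega> \<subseteq> cball 0 R" "R >= 0" and \<Lambda>: "\<Lambda> >= 0" "\<And>x y. x \<in> cball 0 (R + 1) ==> y \<in> cball 0 (R + 1) ==>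
   norm (\<nu> x - \<nu> y) <= \<Lambda> * norm (x - y)"
  by (rule inner_normal_Lipschitz) (rule that)
 define t0 where "t0 = min \<epsilon>0 (min 1 (1 / (2 * (\<Lambda> + 1))))"
 have t0: "t0 > 0" "t0 <= \<epsilon>0" "t0 <= 1" "\<Lambda> * t0 <= 1/2"
 proof -
  show "t0 > 0" using e0 \<Lambda>(1) by (simp add: t0_def)
  show "t0 <= \<epsilon>0" unfolding t0_def by (rule min.cobounded1)
  show "t0 <= 1" unfolding t0_def by (rule min.coboundedI2[OF min.cobounded1])
  have "\<Lambda> * t0 <= \<Lambda> * (1 / (2 * (\<Lambda> + 1)))" using \<Lambda>(1) by (intro mult_left_mono) (auto simp: t0_def)
  also have "\<dots> <= 1/2" using \<Lambda>(1) by (simp add: field_simps)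
  finally show "\<Lambda> * t0 <= 1/2" .
 qed
 have "x + t *\<^sub>R \<nu> x \<in> \<Omega>" if x: "x \<in> frontier \<Omega>" and t: "0 < t" "t < t0" for x t
 proof (rule ccontr)
  let ?n = "\<nu> x"
  let ?p = "\<lambda>s. x + s *\<^sub>R ?n"
  assume nt: "?p t \<notin> \<Omega>"
  have xb: "x \<in> cball 0 R" using x R by (auto simp: frontier_iff)
  have Fp: "F (?p s) >= s / 2" if s: "0 < s" "s <= t" for s
  proof -
   obtain z where z: "z \<in> closed_segment x (?p s)" "F (?p s) - F x = F' z (?p s - x)"
    using C1_mean_value[OF C2_onD1[OF F2], of x "?p s"] by auto
   have zx: "norm (z - x) <= s"
    using segment_bound1[OF z(1)] norm_inner_normal[OF x] s by simp
   have "norm z <= R + 1" using norm_triangle_sub[of z x] xb zx s t t0 by simp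
   then have "norm (\<nu> z - ?n) <= \<Lambda> * norm (z - x)" using \<Lambda>(2) xb by auto
   also have "\<dots> <= \<Lambda> * t0" using zx s t \<Lambda>(1) by (intro mult_left_mono) auto
   also have "\<dots> <= 1/2" by (rule t0)
   finally have "\<bar>(\<nu> z - ?n) \<bullet> ?n\<bar> <= 1/2"
    using Cauchy_Schwarz_ineq2[of "\<nu> z - ?n" ?n] norm_inner_normal[OF x] by simp
   then have "\<bar>\<nu> z \<bullet> ?n - 1\<bar> <= 1/2"
    using norm_inner_normal[OF x] by (simp add: inner_diff_left dot_square_norm)
   then have "\<nu> z \<bullet> ?n >= 1/2" by linarith
   then have "s * (\<nu> z \<bullet> ?n) >= s * (1/2)" using s by (intro mult_left_mono) auto
   then show ?thesis using z(2) F_frontier[OF x] by (simp add: F'_eq)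
  qed
  obtain W \<rho> g where W: "x \<in> W" "local_defining_function \<Omega> W \<rho>" "GDERIV \<rho> x :> g"
   using defining_function_exists[OF x] .
  have "g = norm g *\<^sub>R sgn g" using defining_function_gradient(2)[OF x W] by (simp add: sgn_div_norm)
  then have "g \<bullet> ?n = norm g * (- ?n \<bullet> ?n)"
   using defining_function_gradient(1)[OF x W] by (metis inner_scaleR_left)
  then have "g \<bullet> ?n < 0"
   using defining_function_gradient(2)[OF x W] norm_inner_normal[OF x] by (simp add: dot_square_norm)
  then obtain d where d: "d > 0" "\<And>s. 0 < s ==> s < d ==> ?p s \<in> \<Omega>"
   using defining_function_gradient(3)[OF x W] by blast
  define s1 where "s1 = min d t / 2"
  have s1: "0 < s1" "s1 < d" "s1 <= t" using d t by (auto simp: s1_def)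
  have "connected (?p ` {s1..t})"
   by (intro connected_continuous_image continuous_intros) simp
  moreover have "?p s1 \<in> ?p ` {s1..t} \<inter> \<Omega>" using d(2)[OF s1(1,2)] s1 by auto
  moreover have "?p t \<in> ?p ` {s1..t} - \<Omega>" using nt s1 by auto
  ultimately have "?p ` {s1..t} \<inter> frontier \<Omega> \<noteq> {}" by (intro connected_Int_frontier) blast+
  then obtain s where "s1 <= s" "s <= t" "?p s \<in> frontier \<Omega>" by auto
  then show False using Fp[of s] F_frontier[of "?p s"] s1 by simp
 qed
 then show ?thesis using t0 by blast
qed

lemma infdist_frontier_le:
 assumes "x \<notin> \<Omega>"
 shows "bdist x <= infdist x \<Omega>"
proof -
 obtain y where y: "y \<in> closure \<Omega>" "dist x y = infdist x \<Omega>" using infdist_attained_closure[OF ne] .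
 show ?thesis
 proof (cases "y \<in> \<Omega>")
  case True
  have "closed_segment x y \<inter> frontier \<Omega> \<noteq> {}"
   using True assms by (intro connected_Int_frontier) auto
  then obtain z where "z \<in> closed_segment x y" "z \<in> frontier \<Omega>" by blast
  then show ?thesis
   using infdist_le[of z "frontier \<Omega>" x] segment_bound1[of z x y] y(2) by (simp add: dist_norm norm_minus_commute)
 next
  case False
  then show ?thesis using y infdist_le[of y "frontier \<Omega>" x] by (simp add: frontier_iff)
 qed
qed

text \<open>Near the boundary, on either side, \<open>\<nu>\<close> is close to a unit vector, and
  by compactness points of \<Omega> with small \<open>F\<close> are near the boundary. Hardy's
  inequality uses the bound outside \<Omega> too, where the smeared potential spreads.\<close>

lemma gradient_lower_bound:
 "\<exists>\<eta>>0. \<forall>x. infdist x \<Omega> <= \<eta> --> F x < \<eta> --> 1/2 <= (gradsq F' x)"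
proof -
 obtain R \<Lambda> where R: "closure \<Omega> \<subseteq> cball 0 R" "R >= 0" and \<Lambda>: "\<Lambda> >= 0" "\<And>x y. x \<in> cball 0 (R + 1) ==> y \<in> cball 0 (R + 1) ==>
   norm (\<nu> x - \<nu> y) <= \<Lambda> * norm (x - y)"
  by (rule inner_normal_Lipschitz) (rule that)
 define d where "d = min 1 (1 / (4 * (\<Lambda> + 1)))"
 have d: "d > 0" "d <= 1" "\<Lambda> * d <= 1/4"
 proof -
  show "d > 0" "d <= 1" using \<Lambda>(1) by (auto simp: d_def)
  have "\<Lambda> * d <= \<Lambda> * (1 / (4 * (\<Lambda> + 1)))" using \<Lambda>(1) by (intro mult_left_mono) (auto simp: d_def)
  also have "\<dots> <= 1/4" using \<Lambda>(1) by (simp add: field_simps)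
  finally show "\<Lambda> * d <= 1/4" .
 qed
 have near: "1/2 <= (gradsq F' x)" if "bdist x <= d" for x
 proof -
  obtain y where y: "y \<in> frontier \<Omega>" "bdist x = dist x y"
   using infdist_attains_inf[OF frontier_closed frontier_nonempty] by blast
  have "y \<in> cball 0 R" using y(1) R by (auto simp: frontier_iff)
  moreover then have "x \<in> cball 0 (R + 1)"
   using norm_triangle_sub[of x y] that y(2) d(2) by (simp add: dist_norm)
  ultimately have "norm (\<nu> y - \<nu> x) <= \<Lambda> * norm (y - x)" using \<Lambda>(2) by auto
  also have "\<dots> <= \<Lambda> * d" using that y(2) \<Lambda>(1) by (intro mult_left_mono) (auto simp: dist_norm norm_minus_commute)
  finally have "norm (\<nu> x) >= 3/4"
   using norm_triangle_ineq2[of "\<nu> y" "\<nu> x"] norm_inner_normal[OF y(1)] d(3) by linarith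
  then have "(3/4)^2 <= (norm (\<nu> x))^2" by (intro power_mono) auto
  then show ?thesis unfolding norm_gradient_sq[symmetric] \<nu>_def[symmetric] by (simp add: power2_eq_square)
 qed
 obtain c where c: "c > 0" "\<And>x. x \<in> closure \<Omega> ==> d <= bdist x ==> c <= F x"
  by (rule F_bounded_below[OF d(1)]) (rule that)
 have "1/2 <= (gradsq F' x)" if "infdist x \<Omega> <= min c d" "F x < min c d" for x
 proof (rule near, cases "x \<in> \<Omega>")
  case True
  then show "bdist x <= d"
   using c(2)[of x] that closure_subset[of \<Omega>] by fastforce
 next
  case False
  then show "bdist x <= d" using infdist_frontier_le[OF False] that by simp
 qed
 then show ?thesis using c(1) d(1) by (intro exI[of _ "min c d"]) auto
qed

end

section \<open>Surface measure\<close>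

text \<open>Cut the graph by a grid of mesh \<open>1 / N\<close> in the remaining
  \<open>d - 1\<close> coordinates: the number of cells grows like \<open>N^(d-1)\<close> while
  their diameters shrink like \<open>1 / N\<close>.\<close>

lemma hausdorff_outer_Lipschitz_graph:
 fixes P :: "'a::euclidean_space set"
 assumes dim: "DIM('a) >= 2" and P: "P \<subseteq> cball 0 R" and R: "R >= 0" and b0: "b0 \<in> Basis" and K: "K >= 0"
  and graph: "\<And>x y. x \<in> P ==> y \<in> P ==> \<bar>(x - y) \<bullet> b0\<bar> <= K * (\<Sum>b\<in>Basis - {b0}. \<bar>(x - y) \<bullet> b\<bar>)"
 shows "hausdorff_outer (DIM('a) - 1) P < \<infinity>"
proof -
 let ?s = "DIM('a) - 1" and ?B = "Basis - {b0} :: 'a set"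
 have s: "?s >= 1" "card ?B = ?s" using dim b0 by auto
 \<comment> \<open>\<open>N (2 R + 5)\<close> bounds the number of cells per coordinate and
   \<open>(K + 1) (d - 1) / (2 N)\<close> half their diameter; \<open>N\<close> cancels in the
   product.\<close>
 define Q where "Q = (2 * R + 5) * ((K + 1) * ?s / 2)"
 define bound where "bound = unit_ball_vol (real ?s) * Q ^ ?s"
 have "(INF C\<in>{C :: nat => 'a set. P \<subseteq> (\<Union>i. C i) \<and> (\<forall>i. bounded (C i) \<and> diameter (C i) <= \<delta>)}.
     \<Sum>i. ennreal (unit_ball_vol (real ?s) * (diameter (C i) / 2) ^ ?s)) <= ennreal bound" if \<delta>: "\<delta> > 0" for \<delta>
 proof -
  obtain N0 :: nat where N0: "(K + 1) * ?s / \<delta> < N0" using reals_Archimedean2 by blast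
  define N where "N = N0 + 1"
  have N: "real N >= 1" "(K + 1) * ?s / N <= \<delta>"
  proof -
   show "real N >= 1" by (simp add: N_def)
   have "(K + 1) * ?s / \<delta> < N" using N0 by (simp add: N_def)
   then show "(K + 1) * ?s / N <= \<delta>" using \<delta> \<open>real N >= 1\<close> by (simp add: field_simps)
  qed
  define M where "M = nat \<lceil>N * R\<rceil> + 1"
  define T where "T = PiE ?B (\<lambda>_. {- int M..int M})"
  define idx where "idx x = restrict (\<lambda>b. \<lfloor>real N * (x \<bullet> b)\<rfloor>) ?B" for x :: 'a
  have fT: "finite T" unfolding T_def by (intro finite_PiE) auto
  have cT: "card T = (2 * M + 1) ^ ?s"
  proof -
   have "card {- int M..int M} = 2 * M + 1" by simp
   then show ?thesis unfolding T_def using s(2) by (subst card_PiE) (simp_all only: finite_Diff finite_Basis prod_constant)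
  qed
  have idxT: "idx x \<in> T" if x: "x \<in> P" for x
  proof -
   have "\<lfloor>real N * (x \<bullet> b)\<rfloor> \<in> {- int M..int M}" if b: "b \<in> ?B" for b
   proof -
    have "\<bar>x \<bullet> b\<bar> <= R" using Basis_le_norm[of b x] b x P by auto
    then have "real N * \<bar>x \<bullet> b\<bar> <= real N * R" by (intro mult_left_mono) auto
    moreover have "real N * \<bar>x \<bullet> b\<bar> = \<bar>real N * (x \<bullet> b)\<bar>" by (simp add: abs_mult)
    moreover have "real N * R <= real M - 1" unfolding M_def using R by (simp add: of_nat_nat)
    ultimately have "real N * (x \<bullet> b) <= real M - 1" "- (real M - 1) <= real N * (x \<bullet> b)" by linarith+
    then show ?thesis by (auto simp: floor_le_iff le_floor_iff)
   qed
   then show ?thesis by (auto simp: T_def idx_def)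
  qed
  obtain h where h: "bij_betw h {0..<card T} T" using ex_bij_betw_nat_finite[OF fT] by blast
  define C where "C i = (if i < card T then {x \<in> P. idx x = h i} else {})" for i
  have cov: "P \<subseteq> (\<Union>i. C i)"
  proof
   fix x assume x: "x \<in> P"
   then obtain i where "i < card T" "h i = idx x"
    using idxT[OF x] h by (metis atLeastLessThan_iff bij_betw_imp_surj_on imageE)
   then show "x \<in> (\<Union>i. C i)" using x by (intro UN_I[of i]) (auto simp: C_def)
  qed
  have bC: "bounded (C i)" for i
   by (rule bounded_subset[of "cball 0 R"]) (use P in \<open>auto simp: C_def\<close>)
  have dC: "diameter (C i) <= (K + 1) * ?s / N" for i
  proof (rule diameter_le)
   show "C i \<noteq> {} \<or> 0 <= (K + 1) * ?s / N" using K N by simp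
   fix x y assume "x \<in> C i" "y \<in> C i"
   then have xy: "x \<in> P" "y \<in> P" "idx x = idx y" by (auto simp: C_def split: if_splits)
   have c: "\<bar>(x - y) \<bullet> b\<bar> <= 1 / N" if b: "b \<in> ?B" for b
   proof -
    have "\<lfloor>real N * (x \<bullet> b)\<rfloor> = \<lfloor>real N * (y \<bullet> b)\<rfloor>"
     using fun_cong[OF xy(3), of b] b by (simp add: idx_def)
    then have "\<bar>real N * (x \<bullet> b) - real N * (y \<bullet> b)\<bar> <= 1" by linarith
    then have "real N * \<bar>(x - y) \<bullet> b\<bar> <= 1"
     by (simp add: inner_diff_left right_diff_distrib[symmetric] abs_mult)
    then show ?thesis using N(1) by (simp add: field_simps)
   qed
   have S: "(\<Sum>b\<in>?B. \<bar>(x - y) \<bullet> b\<bar>) <= ?s / N"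
    using sum_bounded_above[of ?B "\<lambda>b. \<bar>(x - y) \<bullet> b\<bar>" "1 / N"] c s(2) by simp
   have "norm (x - y) <= (\<Sum>b\<in>Basis. \<bar>(x - y) \<bullet> b\<bar>)" by (rule norm_le_l1)
   also have "\<dots> = \<bar>(x - y) \<bullet> b0\<bar> + (\<Sum>b\<in>?B. \<bar>(x - y) \<bullet> b\<bar>)" using b0 by (intro sum.remove) auto
   also have "\<dots> <= K * (\<Sum>b\<in>?B. \<bar>(x - y) \<bullet> b\<bar>) + (\<Sum>b\<in>?B. \<bar>(x - y) \<bullet> b\<bar>)"
    using graph[OF xy(1,2)] by simp
   also have "\<dots> <= K * (?s / N) + ?s / N" using S K by (intro add_mono mult_left_mono)
   also have "K * (?s / N) + ?s / N = (K + 1) * ?s / N"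
    by (simp only: distrib_right add_divide_distrib mult_1 times_divide_eq_right)
   finally show "norm (x - y) <= (K + 1) * ?s / N" .
  qed
  have d0: "0 <= diameter (C i)" for i by (rule diameter_ge_0[OF bC])
  \<comment> \<open>The surplus indices carry the empty set, of diameter 0, and the exponent is at
    least one.\<close>
  have "(\<Sum>i. ennreal (unit_ball_vol (real ?s) * (diameter (C i) / 2) ^ ?s))
    = (\<Sum>i<card T. ennreal (unit_ball_vol (real ?s) * (diameter (C i) / 2) ^ ?s))"
   using s(1) by (intro suminf_finite) (auto simp: C_def diameter_def)
  also have "\<dots> <= (\<Sum>i<card T. ennreal (unit_ball_vol (real ?s) * ((K + 1) * ?s / N / 2) ^ ?s))"
   using dC d0 by (intro sum_mono ennreal_leI mult_left_mono power_mono divide_right_mono) auto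
  also have "\<dots> = ennreal (real (card T) * (unit_ball_vol (real ?s) * ((K + 1) * ?s / N / 2) ^ ?s))"
   using K by (simp add: ennreal_of_nat_eq_real_of_nat ennreal_mult)
  also have "\<dots> <= ennreal bound"
  proof (rule ennreal_leI)
   have "real M <= N * R + 2" unfolding M_def using R by (simp add: of_nat_nat) linarith
   also have "\<dots> <= N * R + 2 * N" using N(1) by simp
   finally have "real (2 * M + 1) <= N * (2 * R + 5)" using N(1) by (simp add: algebra_simps)
   then have "real (2 * M + 1) ^ ?s <= (N * (2 * R + 5)) ^ ?s" by (intro power_mono) auto
   then have "real (card T) <= (N * (2 * R + 5)) ^ ?s" unfolding cT by simp
   then have "real (card T) * (unit_ball_vol (real ?s) * ((K + 1) * ?s / N / 2) ^ ?s)
    <= (N * (2 * R + 5)) ^ ?s * (unit_ball_vol (real ?s) * ((K + 1) * ?s / N / 2) ^ ?s)"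
    using K by (intro mult_right_mono) auto
   also have "\<dots> = unit_ball_vol (real ?s) * ((N * (2 * R + 5)) * ((K + 1) * ?s / N / 2)) ^ ?s"
    by (simp only: power_mult_distrib mult_ac)
   also have "(N * (2 * R + 5)) * ((K + 1) * ?s / N / 2) = Q" using N(1) by (simp add: Q_def)
   finally show "real (card T) * (unit_ball_vol (real ?s) * ((K + 1) * ?s / N / 2) ^ ?s) <= bound"
    by (simp add: bound_def)
  qed
  finally have "(\<Sum>i. ennreal (unit_ball_vol (real ?s) * (diameter (C i) / 2) ^ ?s)) <= ennreal bound" .
  moreover have "C \<in> {C. P \<subseteq> (\<Union>i. C i) \<and> (\<forall>i. bounded (C i) \<and> diameter (C i) <= \<delta>)}"
   using cov bC dC N(2) order_trans by blast
  ultimately show ?thesis by (rule INF_lower2[rotated])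
 qed
 then have "hausdorff_outer ?s P <= ennreal bound"
  unfolding hausdorff_outer_def by (intro SUP_least) auto
 then show ?thesis by (auto simp: le_less_trans)
qed

text \<open>Covering sets may have diameter zero; this replaces their diameters by positive radii.\<close>

lemma exists_larger_radius:
 fixes x :: real
 assumes "x >= 0" "e > 0" "\<delta> > x"
 shows "\<exists>y>x. y <= \<delta> \<and> y ^ n <= x ^ n + e"
proof -
 have "((\<lambda>y. y ^ n) \<longlongrightarrow> x ^ n) (at_right x)" by (intro tendsto_intros)
 then have "eventually (\<lambda>y. y ^ n < x ^ n + e) (at_right x)" using assms(2) by (intro order_tendstoD) auto
 moreover have "eventually (\<lambda>y. y \<in> {x<..<\<delta>}) (at_right x)" using assms(3) by (rule eventually_at_right_real)
 ultimately have "eventually (\<lambda>y. y > x \<and> y <= \<delta> \<and> y ^ n <= x ^ n + e) (at_right x)"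
  by eventually_elim auto
 then show ?thesis using eventually_happens'[OF trivial_limit_at_right_real] by blast
qed

lemma sets_hausdorff_measure [simp, measurable_cong]: "sets (hausdorff_measure s) = sets borel"
 unfolding hausdorff_measure_def using sets.sigma_sets_eq[of borel] by (simp add: sets_measure_of_conv)

lemma space_hausdorff_measure [simp]: "space (hausdorff_measure s) = UNIV"
 using sets_eq_imp_space_eq[OF sets_hausdorff_measure[of s]] by simp

text \<open>\<open>ms\<close> guarantees that \<open>hausdorff_measure\<close> takes the values of
  the outer measure on Borel sets; otherwise \<open>measure_of\<close> yields the null measure. It
  is discharged at the end from the existence of the Poisson operator.\<close>

locale collar_domain_surface = collar_domain +
 assumes dim: "DIM('a::euclidean_space) >= 2"
  and ms: "measure_space (UNIV :: 'a set) (sets borel) (hausdorff_outer (DIM('a) - 1))"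
begin

abbreviation surf :: "'a measure" where
 "surf \<equiv> hausdorff_measure (DIM('a) - 1)"

abbreviation S :: "'a measure" where
 "S \<equiv> surface_measure \<Omega>"

lemma emeasure_surf: "A \<in> sets borel ==> emeasure surf A = hausdorff_outer (DIM('a) - 1) A"
 unfolding hausdorff_measure_def emeasure_measure_of_conv
 using ms sets.sigma_sets_eq[of "borel :: 'a measure"] by simp

lemma frontier_borel [measurable]: "frontier \<Omega> \<in> sets borel"
 by (simp add: borel_closed)

lemma sets_S: "sets S = sets (restrict_space borel (frontier \<Omega>))"
 unfolding surface_measure_def by (rule sets_restrict_space_cong) simp

lemma space_S: "space S = frontier \<Omega>"
 unfolding surface_measure_def by (simp add: space_restrict_space)

text \<open>Near a boundary point some coordinate of the gradient of \<open>F\<close> is bounded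
  away from zero, and the mean value theorem on the zero set of \<open>F\<close> bounds differences
  in this coordinate by those in the others. So the frontier is locally a Lipschitz graph, and
  compactness reduces to finitely many pieces.\<close>

lemma surf_frontier_finite: "emeasure surf (frontier \<Omega>) < \<infinity>"
proof -
 obtain R where R: "closure \<Omega> \<subseteq> cball 0 R" "R >= 0" by (rule closure_in_ball)
 have fr: "frontier \<Omega> \<subseteq> cball 0 R" using R(1) by (auto simp: frontier_iff)
 have loc: "\<exists>d>0. emeasure surf (frontier \<Omega> \<inter> ball x0 d) < \<infinity>" if x0: "x0 \<in> frontier \<Omega>" for x0
 proof -
  have "\<nu> x0 \<noteq> 0" using norm_inner_normal[OF x0] by auto
  then obtain b0 where b0: "b0 \<in> Basis" "\<nu> x0 \<bullet> b0 \<noteq> 0"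
   using euclidean_all_zero_iff by blast
  define c where "c = \<bar>\<nu> x0 \<bullet> b0\<bar> / 2"
  have c: "c > 0" using b0 by (simp add: c_def)
  have "isCont \<nu> x0"
   using inner_normal_continuous[of UNIV] by (simp add: continuous_on_eq_continuous_at)
  then obtain d where d: "d > 0" "\<And>z. dist z x0 < d ==> dist (\<nu> z) (\<nu> x0) < min c 1"
   using c unfolding continuous_at_eps_delta by (metis min_less_iff_conj zero_less_one)
  have g: "\<bar>(x - y) \<bullet> b0\<bar> <= (2 / c) * (\<Sum>b\<in>Basis - {b0}. \<bar>(x - y) \<bullet> b\<bar>)"
   if x: "x \<in> frontier \<Omega> \<inter> ball x0 d" and y: "y \<in> frontier \<Omega> \<inter> ball x0 d" for x y
  proof -
   obtain z where z: "z \<in> closed_segment y x" "F x - F y = F' z (x - y)"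
    using C1_mean_value[OF C2_onD1[OF F2], of y x] by auto
   have "z \<in> ball x0 d" using z(1) x y closed_segment_subset[OF _ _ convex_ball] by blast
   then have dz: "norm (\<nu> z - \<nu> x0) < min c 1"
    using d(2)[of z] by (simp add: dist_norm norm_minus_commute)
   have nb: "\<bar>\<nu> z \<bullet> b\<bar> <= 2" if "b \<in> Basis" for b
   proof -
    have "norm (\<nu> z) <= 2"
     using dz norm_triangle_sub[of "\<nu> z" "\<nu> x0"] norm_inner_normal[OF x0] by simp
    then show ?thesis using Basis_le_norm[OF that, of "\<nu> z"] by linarith
   qed
   have nb0: "c <= \<bar>\<nu> z \<bullet> b0\<bar>"
    using Basis_le_norm[OF b0(1), of "\<nu> z - \<nu> x0"] dz
    by (simp add: c_def inner_diff_left) linarith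
   have "0 = \<nu> z \<bullet> (x - y)" using z(2) F_frontier[of x] F_frontier[of y] x y F'_eq[of z "x - y"] by simp
   also have "\<dots> = (\<Sum>b\<in>Basis. (\<nu> z \<bullet> b) * ((x - y) \<bullet> b))" by (rule euclidean_inner)
   also have "\<dots> = (\<nu> z \<bullet> b0) * ((x - y) \<bullet> b0) + (\<Sum>b\<in>Basis - {b0}. (\<nu> z \<bullet> b) * ((x - y) \<bullet> b))"
    using b0(1) by (intro sum.remove) auto
   finally have "(\<nu> z \<bullet> b0) * ((x - y) \<bullet> b0) = - (\<Sum>b\<in>Basis - {b0}. (\<nu> z \<bullet> b) * ((x - y) \<bullet> b))"
    by simp
   then have "\<bar>\<nu> z \<bullet> b0\<bar> * \<bar>(x - y) \<bullet> b0\<bar> = \<bar>\<Sum>b\<in>Basis - {b0}. (\<nu> z \<bullet> b) * ((x - y) \<bullet> b)\<bar>"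
    by (metis abs_minus_cancel abs_mult)
   also have "\<dots> <= (\<Sum>b\<in>Basis - {b0}. \<bar>(\<nu> z \<bullet> b) * ((x - y) \<bullet> b)\<bar>)" by (rule sum_abs)
   also have "\<dots> <= (\<Sum>b\<in>Basis - {b0}. 2 * \<bar>(x - y) \<bullet> b\<bar>)"
    unfolding abs_mult using nb by (intro sum_mono mult_right_mono) auto
   also have "\<dots> = 2 * (\<Sum>b\<in>Basis - {b0}. \<bar>(x - y) \<bullet> b\<bar>)" by (simp add: sum_distrib_left)
   finally have "\<bar>\<nu> z \<bullet> b0\<bar> * \<bar>(x - y) \<bullet> b0\<bar> <= 2 * (\<Sum>b\<in>Basis - {b0}. \<bar>(x - y) \<bullet> b\<bar>)" .
   moreover have "c * \<bar>(x - y) \<bullet> b0\<bar> <= \<bar>\<nu> z \<bullet> b0\<bar> * \<bar>(x - y) \<bullet> b0\<bar>"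
    using nb0 by (intro mult_right_mono) auto
   ultimately show ?thesis using c by (simp add: field_simps)
  qed
  have "hausdorff_outer (DIM('a) - 1) (frontier \<Omega> \<inter> ball x0 d) < \<infinity>"
   by (rule hausdorff_outer_Lipschitz_graph[OF dim _ R(2) b0(1) _ g]) (use fr c in auto)
  then show ?thesis using d(1) emeasure_surf[of "frontier \<Omega> \<inter> ball x0 d"] by auto
 qed
 then obtain d where d: "\<And>x0. x0 \<in> frontier \<Omega> ==> d x0 > 0"
  "\<And>x0. x0 \<in> frontier \<Omega> ==> emeasure surf (frontier \<Omega> \<inter> ball x0 (d x0)) < \<infinity>" by metis
 obtain D where D: "D \<subseteq> frontier \<Omega>" "finite D" "frontier \<Omega> \<subseteq> (\<Union>x\<in>D. ball x (d x))"
 proof (rule compactE_image[OF frontier_compact, of "frontier \<Omega>" "\<lambda>x. ball x (d x)"])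
  show "frontier \<Omega> \<subseteq> (\<Union>x\<in>frontier \<Omega>. ball x (d x))" using d(1) by fastforce
 qed auto
 have "emeasure surf (frontier \<Omega>) <= emeasure surf (\<Union>x\<in>D. frontier \<Omega> \<inter> ball x (d x))"
  using D(2,3) by (intro emeasure_mono) (auto intro!: sets.finite_UN)
 also have "\<dots> <= (\<Sum>x\<in>D. emeasure surf (frontier \<Omega> \<inter> ball x (d x)))"
  using D(2) by (intro emeasure_subadditive_finite) auto
 also have "\<dots> < \<infinity>"
 proof -
  have "(\<Sum>x\<in>E. emeasure surf (frontier \<Omega> \<inter> ball x (d x))) < \<infinity>" if "finite E" "E \<subseteq> frontier \<Omega>" for E
   using that d(2) by (induction E rule: finite_induct) auto
  then show ?thesis using D by blast
 qed
 finally show ?thesis .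
qed

lemma emeasure_S: "A \<in> sets borel ==> A \<subseteq> frontier \<Omega> ==> emeasure S A = emeasure surf A"
 unfolding surface_measure_def by (intro emeasure_restrict_space) auto

lemma finite_measure_S: "finite_measure S"
proof
 show "emeasure S (space S) \<noteq> \<infinity>"
  using surf_frontier_finite by (simp add: space_S emeasure_S)
qed

text \<open>Each piece of a cover of \<open>A\<close> of diameter less than \<open>r\<close> contributes about \<open>(b - a) / r\<close> balls of
 radius comparable to \<open>r\<close>.\<close>

lemma collar_volume_bound:
 "\<exists>C\<ge>0. \<forall>A a b. A \<in> sets borel --> A \<subseteq> frontier \<Omega> --> 0 <= a --> a < b --> b <= 1 -->
   (\<exists>Z\<in>sets lborel. (\<forall>x\<in>A. \<forall>t\<in>{a..b}. x + t *\<^sub>R \<nu> x \<in> Z) \<and>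
    emeasure lborel Z <= ennreal (C * (b - a)) * emeasure surf A)"
proof -
 let ?s = "DIM('a) - 1"
 obtain R \<Lambda> where R: "closure \<Omega> \<subseteq> cball 0 R" "R >= 0" and \<Lambda>: "\<Lambda> >= 0" "\<And>x y. x \<in> cball 0 (R + 1) ==> y \<in> cball 0 (R + 1) ==>
   norm (\<nu> x - \<nu> y) <= \<Lambda> * norm (x - y)"
  by (rule inner_normal_Lipschitz) (rule that)
 define \<Phi> where "\<Phi> x t = x + t *\<^sub>R \<nu> x" for x t
 define L where "L = 1 + \<Lambda>"
 have L: "L >= 1" using \<Lambda>(1) by (simp add: L_def)
 have norm_add3: "norm (x + y + z) <= norm x + norm y + norm z" for x y z :: 'a
  using norm_triangle_ineq[of "x + y" z] norm_triangle_ineq[of x y] by linarith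
 have lip: "norm (\<Phi> x t - \<Phi> y u) <= L * norm (x - y) + \<bar>t - u\<bar>"
  if "x \<in> frontier \<Omega>" "y \<in> frontier \<Omega>" "0 <= t" "t <= 1" for x y t u
 proof -
  have "x \<in> cball 0 (R + 1)" "y \<in> cball 0 (R + 1)"
   using subsetD[OF R(1), of x] subsetD[OF R(1), of y] that(1,2) by (auto simp: frontier_iff)
  then have n: "norm (\<nu> x - \<nu> y) <= \<Lambda> * norm (x - y)" by (rule \<Lambda>(2))
  have "\<Phi> x t - \<Phi> y u = (x - y) + t *\<^sub>R (\<nu> x - \<nu> y) + (t - u) *\<^sub>R \<nu> y"
   by (simp add: \<Phi>_def algebra_simps)
  then have "norm (\<Phi> x t - \<Phi> y u) <= norm (x - y) + norm (t *\<^sub>R (\<nu> x - \<nu> y)) + norm ((t - u) *\<^sub>R \<nu> y)"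
   by (metis norm_add3)
  also have "\<dots> <= norm (x - y) + 1 * (\<Lambda> * norm (x - y)) + \<bar>t - u\<bar>"
  proof (intro add_mono order_refl)
   have "norm (t *\<^sub>R (\<nu> x - \<nu> y)) = t * norm (\<nu> x - \<nu> y)" using that by simp
   also have "\<dots> <= 1 * (\<Lambda> * norm (x - y))" using n that by (intro mult_mono) auto
   finally show "norm (t *\<^sub>R (\<nu> x - \<nu> y)) <= 1 * (\<Lambda> * norm (x - y))" .
   show "norm ((t - u) *\<^sub>R \<nu> y) <= \<bar>t - u\<bar>" using norm_inner_normal[OF that(2)] by simp
  qed
  finally show ?thesis by (simp add: L_def algebra_simps)
 qed
 \<comment> \<open>\<open>W r^d\<close> is the volume of a ball of radius \<open>(L + 1) r\<close>,
   and \<open>\<kappa> D^(d-1)\<close> is the Hausdorff term of a set of diameter \<open>D\<close>;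
   the factor 2 in \<open>C\<close> comes from rounding up \<open>l / r\<close>.\<close>
 define W where "W = unit_ball_vol (real DIM('a)) * (L + 1) ^ DIM('a)"
 have W: "W >= 0" using L by (simp add: W_def)
 define \<kappa> where "\<kappa> = unit_ball_vol (real ?s) / 2 ^ ?s"
 have \<kappa>: "\<kappa> > 0" by (simp add: \<kappa>_def)
 define C where "C = 2 * W / \<kappa>"
 have C: "C >= 0" using W \<kappa> by (simp add: C_def)
 have "\<exists>Z\<in>sets lborel. (\<forall>x\<in>A. \<forall>t\<in>{a..b}. \<Phi> x t \<in> Z) \<and> emeasure lborel Z <= ennreal (C * (b - a)) * emeasure surf A"
  if A: "A \<in> sets borel" "A \<subseteq> frontier \<Omega>" and ab: "0 <= a" "a < b" "b <= 1" for A a b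
 proof -
  let ?H = "emeasure surf A"
  define l where "l = b - a"
  have l: "l > 0" using ab by (simp add: l_def)
  have Hfin: "?H < \<infinity>"
   using emeasure_mono[OF A(2), of surf] surf_frontier_finite by (auto intro: le_less_trans)
  have step: "\<exists>Z\<in>sets lborel. (\<forall>x\<in>A. \<forall>t\<in>{a..b}. \<Phi> x t \<in> Z) \<and>
    emeasure lborel Z <= ennreal (C * l) * ?H + ennreal (2 * W * l * (1 / \<kappa> + 2) * e)" if e: "e > 0" for e
  proof -
   let ?val = "\<lambda>C :: nat => 'a set. \<Sum>i. ennreal (unit_ball_vol (real ?s) * (diameter (C i) / 2) ^ ?s)"
   \<comment> \<open>Diameters of at most \<open>l / 2\<close> leave room for the enlarged radii,
     which must not exceed \<open>l\<close>.\<close>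
   let ?adm = "{C :: nat => 'a set. A \<subseteq> (\<Union>i. C i) \<and> (\<forall>i. bounded (C i) \<and> diameter (C i) <= l / 2)}"
   have "(INF C\<in>?adm. ?val C) <= ?H"
    unfolding emeasure_surf[OF A(1)] hausdorff_outer_def using l by (intro SUP_upper) simp
   also have "\<dots> < ?H + ennreal e" using Hfin e by (cases ?H) (auto simp: ennreal_plus[symmetric] simp del: ennreal_plus intro!: ennreal_lessI)
   finally obtain Cv where Cv: "Cv \<in> ?adm" "?val Cv < ?H + ennreal e"
    unfolding INF_less_iff by blast
   have cov: "A \<subseteq> (\<Union>i. Cv i)" and bC: "\<And>i. bounded (Cv i)" and dC: "\<And>i. diameter (Cv i) <= l / 2"
    using Cv(1) by auto
   have d0: "0 <= diameter (Cv i)" for i by (rule diameter_ge_0[OF bC])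
   have "\<exists>y>diameter (Cv i). y <= l \<and> y ^ ?s <= diameter (Cv i) ^ ?s + e * (1/2) ^ i" for i
    using dC[of i] d0[of i] l e by (intro exists_larger_radius) auto
   then obtain r where r: "\<And>i. r i > diameter (Cv i)" "\<And>i. r i <= l"
    "\<And>i. r i ^ ?s <= diameter (Cv i) ^ ?s + e * (1/2) ^ i" by metis
   have r0: "r i > 0" for i using r(1)[of i] d0[of i] by simp
   define p where "p i = (SOME x. x \<in> Cv i \<inter> A)" for i
   have p: "p i \<in> Cv i \<inter> A" if "Cv i \<inter> A \<noteq> {}" for i
    unfolding p_def using that some_in_eq[of "Cv i \<inter> A"] by blast
   define n where "n i = nat \<lceil>l / r i\<rceil>" for i
   have n: "l / r i <= real (n i)" "real (n i) <= 2 * l / r i" for i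
   proof -
    have q: "1 <= l / r i" using r(2)[of i] r0[of i] by simp
    show "l / r i <= real (n i)" unfolding n_def by linarith
    have "real (n i) <= l / r i + 1" unfolding n_def using q by linarith
    then show "real (n i) <= 2 * l / r i" using q by simp
   qed
   \<comment> \<open>The part of the collar over one piece is covered by balls around a single
     chosen point of the piece, displaced along its normal in steps of \<open>r i\<close>.\<close>
   define Y where "Y i = (if Cv i \<inter> A = {} then {} else (\<Union>j<n i. cball (\<Phi> (p i) (a + j * r i)) ((L + 1) * r i)))" for i
   have Ym: "Y i \<in> sets lborel" for i by (auto simp: Y_def)
   have inY: "\<Phi> x t \<in> (\<Union>i. Y i)" if x: "x \<in> A" and t: "t \<in> {a..b}" for x t
   proof -
    obtain i where i: "x \<in> Cv i" using cov x by blast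
    have ne: "Cv i \<inter> A \<noteq> {}" using i x by blast
    have pi: "p i \<in> Cv i" "p i \<in> A" using p[OF ne] by auto
    define j where "j = nat \<lfloor>(t - a) / r i\<rfloor>"
    \<comment> \<open>At the far end of the interval the floor can reach \<open>n i\<close>; it is
      then replaced by the last index.\<close>
    define j' where "j' = (if j < n i then j else n i - 1)"
    have q0: "0 <= (t - a) / r i" "(t - a) / r i <= l / r i"
     using t r0[of i] by (auto simp: l_def divide_right_mono)
    have n1: "n i >= 1"
     using n(1)[of i] r(2)[of i] r0[of i] by (metis One_nat_def Suc_leI divide_pos_pos gr0I l not_le of_nat_0)
    have "\<bar>(t - a) / r i - real j'\<bar> <= 1"
    proof (cases "j < n i")
     case True
     have "real j = of_int \<lfloor>(t - a) / r i\<rfloor>" using q0(1) by (simp add: j_def)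
     then show ?thesis using True by (simp add: j'_def) linarith
    next
     case False
     have "real j <= (t - a) / r i" using q0(1) by (simp add: j_def)
     moreover have "real (n i) <= real j" using False by simp
     ultimately have "(t - a) / r i = real (n i)" using q0(2) n(1)[of i] by linarith
     then show ?thesis using False n1 by (simp add: j'_def of_nat_diff)
    qed
    then have "\<bar>(t - a) / r i - real j'\<bar> * r i <= 1 * r i" using r0[of i] by (intro mult_right_mono) auto
    moreover have "\<bar>(t - a) / r i - real j'\<bar> * r i = \<bar>t - (a + j' * r i)\<bar>"
    proof -
     have "\<bar>(t - a) / r i - real j'\<bar> * r i = \<bar>((t - a) / r i - real j') * r i\<bar>"
      using r0[of i] by (simp add: abs_mult)
     also have "((t - a) / r i - real j') * r i = t - (a + j' * r i)"
     proof -
      have "(t - a) / r i * r i = t - a" using r0[of i] by simp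
      then show ?thesis by (simp only: left_diff_distrib diff_diff_eq)
     qed
     finally show ?thesis .
    qed
    ultimately have tj: "\<bar>t - (a + j' * r i)\<bar> <= r i" by simp
    have "norm (x - p i) <= r i"
     using diameter_bounded_bound[OF bC i pi(1)] r(1)[of i] by (simp add: dist_norm)
    then have "L * norm (x - p i) <= L * r i" using L by (intro mult_left_mono) auto
    then have "norm (\<Phi> x t - \<Phi> (p i) (a + j' * r i)) <= (L + 1) * r i"
     using lip[of x "p i" t "a + j' * r i"] x pi(2) A(2) t ab tj by (fastforce simp: distrib_right)
    then have "\<Phi> x t \<in> cball (\<Phi> (p i) (a + j' * r i)) ((L + 1) * r i)"
     by (simp add: dist_norm norm_minus_commute)
    moreover have "j' < n i" using n1 by (auto simp: j'_def)
    ultimately show ?thesis using ne by (intro UN_I[of i]) (auto simp: Y_def)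
   qed
   have eY: "emeasure lborel (Y i) <= ennreal (2 * W * l) * (ennreal (diameter (Cv i) ^ ?s) + ennreal (e * (1/2) ^ i))" for i
   proof -
    have "emeasure lborel (Y i) <= (\<Sum>j<n i. emeasure lborel (cball (\<Phi> (p i) (a + j * r i)) ((L + 1) * r i)))"
     unfolding Y_def by (auto intro!: emeasure_subadditive_finite)
    also have "\<dots> = (\<Sum>j<n i. ennreal (W * r i ^ DIM('a)))"
     using L r0[of i] by (intro sum.cong refl) (simp add: emeasure_cball W_def power_mult_distrib mult.assoc)
    also have "\<dots> = ennreal (real (n i) * (W * r i ^ DIM('a)))"
     using W r0[of i] by (simp add: ennreal_of_nat_eq_real_of_nat ennreal_mult)
    also have "\<dots> <= ennreal (2 * W * l * r i ^ ?s)"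
    proof (rule ennreal_leI)
     have "real (n i) * (W * r i ^ DIM('a)) <= 2 * l / r i * (W * r i ^ DIM('a))"
      using n(2) W r0[of i] by (intro mult_right_mono) auto
     also have "\<dots> = 2 * W * l * r i ^ ?s"
     proof -
      have "r i ^ DIM('a) = r i * r i ^ ?s" using DIM_positive by (metis power_Suc Suc_pred')
      then show ?thesis using r0[of i] by simp
     qed
     finally show "real (n i) * (W * r i ^ DIM('a)) <= 2 * W * l * r i ^ ?s" .
    qed
    also have "\<dots> <= ennreal (2 * W * l * (diameter (Cv i) ^ ?s + e * (1/2) ^ i))"
     using r(3)[of i] W l by (intro ennreal_leI mult_left_mono) auto
    also have "\<dots> = ennreal (2 * W * l) * (ennreal (diameter (Cv i) ^ ?s) + ennreal (e * (1/2) ^ i))"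
     using W l d0 e by (simp add: ennreal_mult)
    finally show ?thesis .
   qed
   have sd: "(\<Sum>i. ennreal (diameter (Cv i) ^ ?s)) <= ennreal (1 / \<kappa>) * (?H + ennreal e)"
   proof -
    have "ennreal (diameter (Cv i) ^ ?s) = ennreal (1 / \<kappa>) * ennreal (unit_ball_vol (real ?s) * (diameter (Cv i) / 2) ^ ?s)" for i
    proof -
     have "diameter (Cv i) ^ ?s = 1 / \<kappa> * (unit_ball_vol (real ?s) * (diameter (Cv i) / 2) ^ ?s)"
     proof -
      have "D ^ k = 1 / (u / 2 ^ k) * (u * (D / 2) ^ k)" if "u > 0" for u D :: real and k
       using that by (simp add: power_divide)
      then show ?thesis unfolding \<kappa>_def by (metis of_nat_0_le_iff unit_ball_vol_pos)
     qed
     then show ?thesis using \<kappa> d0 by (simp add: ennreal_mult[symmetric])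
    qed
    then have "(\<Sum>i. ennreal (diameter (Cv i) ^ ?s)) = ennreal (1 / \<kappa>) * ?val Cv" by (simp add: ennreal_suminf_cmult)
    also have "\<dots> <= ennreal (1 / \<kappa>) * (?H + ennreal e)" using Cv(2) by (intro mult_left_mono) auto
    finally show ?thesis .
   qed
   have se: "(\<Sum>i. ennreal (e * (1/2) ^ i)) = ennreal (2 * e)"
   proof -
    have "(\<lambda>i. e * (1/2::real) ^ i) sums (e * (1 / (1 - 1/2)))" by (intro sums_mult geometric_sums) simp
    then show ?thesis using e by (intro suminf_ennreal_eq) (auto simp: mult.commute)
   qed
   have "emeasure lborel (\<Union>i. Y i) <= (\<Sum>i. emeasure lborel (Y i))"
    using Ym by (intro emeasure_subadditive_countably) auto
   also have "\<dots> <= (\<Sum>i. ennreal (2 * W * l) * (ennreal (diameter (Cv i) ^ ?s) + ennreal (e * (1/2) ^ i)))"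
    by (intro suminf_le eY) auto
   also have "\<dots> = ennreal (2 * W * l) * ((\<Sum>i. ennreal (diameter (Cv i) ^ ?s)) + ennreal (2 * e))"
    unfolding se[symmetric] ennreal_suminf_cmult
    by (intro arg_cong2[where f = "(*)"] refl suminf_add[symmetric] summableI)
   also have "\<dots> <= ennreal (2 * W * l) * (ennreal (1 / \<kappa>) * (?H + ennreal e) + ennreal (2 * e))"
    using sd by (intro mult_left_mono add_right_mono) auto
   also have "\<dots> = ennreal (C * l) * ?H + ennreal (2 * W * l * (1 / \<kappa> + 2) * e)"
   proof -
    have k: "0 <= 1 / \<kappa>" "0 <= 2 * W * l" "0 <= e" using \<kappa> W l e by auto
    have "ennreal (2 * W * l) * (ennreal (1 / \<kappa>) * (?H + ennreal e) + ennreal (2 * e))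
     = ennreal (2 * W * l) * ennreal (1 / \<kappa>) * ?H + ennreal (2 * W * l) * (ennreal (1 / \<kappa>) * ennreal e + ennreal (2 * e))"
     by (simp add: distrib_left mult.assoc add.assoc)
    also have "ennreal (2 * W * l) * ennreal (1 / \<kappa>) = ennreal (C * l)"
     using k by (simp add: ennreal_mult[symmetric] C_def mult_ac)
    also have "ennreal (2 * W * l) * (ennreal (1 / \<kappa>) * ennreal e + ennreal (2 * e)) = ennreal (2 * W * l * (1 / \<kappa> + 2) * e)"
    proof -
     have "ennreal (1 / \<kappa>) * ennreal e + ennreal (2 * e) = ennreal (1 / \<kappa> * e + 2 * e)"
      using k by (simp only: ennreal_mult[symmetric] ennreal_plus[symmetric] mult_nonneg_nonneg zero_le_numeral)
     also have "ennreal (2 * W * l) * ennreal (1 / \<kappa> * e + 2 * e) = ennreal (2 * W * l * (1 / \<kappa> * e + 2 * e))"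
      using k by (simp only: ennreal_mult[symmetric] mult_nonneg_nonneg add_nonneg_nonneg zero_le_numeral)
     also have "2 * W * l * (1 / \<kappa> * e + 2 * e) = 2 * W * l * (1 / \<kappa> + 2) * e" by (simp add: algebra_simps)
     finally show ?thesis by simp
    qed
    finally show ?thesis .
   qed
   finally show ?thesis using inY Ym by (intro bexI[of _ "\<Union>i. Y i"]) auto
  qed
  let ?err = "\<lambda>k. 2 * W * l * (1 / \<kappa> + 2) * (1 / real (Suc k))"
  have "\<exists>Z. \<forall>k::nat. Z k \<in> sets lborel \<and> (\<forall>x\<in>A. \<forall>t\<in>{a..b}. \<Phi> x t \<in> Z k) \<and>
    emeasure lborel (Z k) <= ennreal (C * l) * ?H + ennreal (?err k)"
   using step[of "1 / real (Suc k)" for k] by (intro choice allI) (metis of_nat_0_less_iff zero_less_Suc zero_less_divide_1_iff)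
  then obtain Z where Z: "\<And>k::nat. Z k \<in> sets lborel" "\<And>k x t. x \<in> A ==> t \<in> {a..b} ==> \<Phi> x t \<in> Z k"
   "\<And>k. emeasure lborel (Z k) <= ennreal (C * l) * ?H + ennreal (?err k)"
   by metis
  \<comment> \<open>The intersection removes the error terms of the single covers.\<close>
  define Z' where "Z' = (\<Inter>k. Z k)"
  have Z'm: "Z' \<in> sets lborel" unfolding Z'_def using Z(1) by auto
  have "emeasure lborel Z' <= ennreal (C * l) * ?H"
  proof (rule tendsto_lowerbound)
   show "(\<lambda>k. ennreal (C * l) * ?H + ennreal (?err k)) \<longlonglongrightarrow> ennreal (C * l) * ?H"
   proof -
    have "?err \<longlonglongrightarrow> 2 * W * l * (1 / \<kappa> + 2) * 0"
     by (intro tendsto_mult tendsto_const LIMSEQ_inverse_real_of_nat[unfolded inverse_eq_divide])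
    then have "(\<lambda>k. ennreal (?err k)) \<longlonglongrightarrow> ennreal 0"
     by (intro tendsto_ennrealI) simp
    from tendsto_add[OF tendsto_const this] show ?thesis by simp
   qed
   show "\<forall>\<^sub>F k in sequentially. emeasure lborel Z' <= ennreal (C * l) * ?H + ennreal (?err k)"
   proof (intro always_eventually allI)
    fix k
    have "emeasure lborel Z' <= emeasure lborel (Z k)" using Z(1) by (intro emeasure_mono) (auto simp: Z'_def)
    then show "emeasure lborel Z' <= ennreal (C * l) * ?H + ennreal (?err k)"
     using Z(3) order_trans by blast
   qed
  qed simp
  then show ?thesis using Z'm Z(2) unfolding l_def by (intro bexI[of _ Z']) (auto simp: Z'_def)
 qed
 then show ?thesis using C unfolding \<Phi>_def by blast
qed

section \<open>Integrals over layers parallel to the boundary\<close>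

definition layer :: "real => real => 'a set" where
 "layer a b = {y \<in> \<Omega>. a <= bdist y \<and> bdist y <= b}"

lemma layer_compact: "a > 0 ==> compact (layer a b)"
proof -
 assume a: "a > 0"
 have "layer a b = closure \<Omega> \<inter> ({y. a <= bdist y} \<inter> {y. bdist y <= b})"
  using a closure_subset[of \<Omega>] by (auto simp: layer_def frontier_iff) (metis frontier_iff infdist_zero not_le)
 moreover have "closed ({y. a <= bdist y} \<inter> {y. bdist y <= b})"
  by (intro closed_Int closed_Collect_le continuous_intros)
 ultimately show ?thesis using bd by (metis compact_Int_closed compact_closure)
qed

lemma nn_integral_S: "(\<integral>\<^sup>+x. f x \<partial>S) = (\<integral>\<^sup>+x. f x * indicator (frontier \<Omega>) x \<partial>surf)"
 unfolding surface_measure_def by (intro nn_integral_restrict_space) simp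

abbreviation layer_integral :: "('a => real) => real => real => ennreal" where
 "layer_integral h a b \<equiv> \<integral>\<^sup>+y. ennreal (h y) * indicator (layer a b) y \<partial>lborel"

abbreviation slice_integral :: "('a => real) => real => ennreal" where
 "slice_integral h t \<equiv> \<integral>\<^sup>+x. ennreal (h (x + t *\<^sub>R \<nu> x)) \<partial>S"

text \<open>Split the boundary into the level sets \<open>A i\<close>, with step
  \<open>\<eta>\<close>, of \<open>h\<close> on the slice at depth \<open>a\<close>. The volume over
  \<open>A i\<close> is controlled by the area of \<open>A i\<close>, and there \<open>h\<close> is
  at most \<open>(i + 2) \<eta>\<close>: one \<open>\<eta>\<close> for the rounding and one for the
  oscillation.\<close>

lemma layer_bound_short:
 assumes C: "\<forall>A a b. A \<in> sets borel --> A \<subseteq> frontier \<Omega> --> 0 <= a --> a < b --> b <= 1 -->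
   (\<exists>Z\<in>sets lborel. (\<forall>x\<in>A. \<forall>t\<in>{a..b}. x + t *\<^sub>R \<nu> x \<in> Z) \<and>
    emeasure lborel Z <= ennreal (C * (b - a)) * emeasure surf A)"
  and h: "continuous_on \<Omega> h" "\<And>y. y \<in> \<Omega> ==> 0 <= h y"
  and ab: "0 < a" "a < b" "b <= 1" "b < \<epsilon>0"
  and inO: "\<And>x t. x \<in> frontier \<Omega> ==> t \<in> {a..b} ==> x + t *\<^sub>R \<nu> x \<in> \<Omega>"
  and \<eta>: "\<eta> > 0"
  and osc: "\<And>x t. x \<in> frontier \<Omega> ==> t \<in> {a..b} ==>
    h (x + t *\<^sub>R \<nu> x) <= h (x + a *\<^sub>R \<nu> x) + \<eta>"
 shows "layer_integral h a b
  <= ennreal (C * (b - a)) * (slice_integral h a + ennreal (2 * \<eta>) * emeasure surf (frontier \<Omega>))"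
proof -
 define k where "k x = h (x + a *\<^sub>R \<nu> x)" for x
 have k0: "0 <= k x" if "x \<in> frontier \<Omega>" for x using h(2) inO[OF that, of a] ab by (simp add: k_def)
 have kc: "continuous_on (frontier \<Omega>) k"
  unfolding k_def
  by (rule continuous_on_compose2[OF h(1)]) (use inO[of _ a] ab in \<open>auto intro!: continuous_intros inner_normal_continuous\<close>)
 obtain B where B: "\<And>x. x \<in> frontier \<Omega> ==> k x <= B"
  by (rule continuous_on_compact_bound[OF frontier_compact kc]) (auto dest: abs_le_D1)
 define n where "n = nat \<lceil>B / \<eta>\<rceil> + 1"
 define A where "A i = {x \<in> frontier \<Omega>. \<lfloor>k x / \<eta>\<rfloor> = int i}" for i
 have Ai: "x \<in> A i ==> real i * \<eta> <= k x \<and> k x < (real i + 1) * \<eta>" for x i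
  using \<eta> by (auto simp: A_def floor_eq_iff field_simps)
 have km: "k \<in> borel_measurable (restrict_space borel (frontier \<Omega>))"
  using kc by (rule borel_measurable_continuous_on_restrict)
 have Ab: "A i \<in> sets borel" for i
 proof -
  have "A i = {x \<in> space (restrict_space borel (frontier \<Omega>)). \<lfloor>k x / \<eta>\<rfloor> = int i}"
   by (simp add: A_def space_restrict_space)
  also have "\<dots> \<in> sets (restrict_space borel (frontier \<Omega>))" using km by measurable
  finally show ?thesis by (simp add: sets_restrict_space_iff)
 qed
 have "\<exists>Z\<in>sets lborel. (\<forall>x\<in>A i. \<forall>t\<in>{a..b}. x + t *\<^sub>R \<nu> x \<in> Z) \<and>
    emeasure lborel Z <= ennreal (C * (b - a)) * emeasure surf (A i)" for i
  using C Ab[of i] ab by (auto simp: A_def)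
 then obtain Z where Z: "\<And>i. Z i \<in> sets lborel"
  "\<And>i x t. x \<in> A i ==> t \<in> {a..b} ==> x + t *\<^sub>R \<nu> x \<in> Z i"
  "\<And>i. emeasure lborel (Z i) <= ennreal (C * (b - a)) * emeasure surf (A i)" by metis
 have ptw: "ennreal (h y) * indicator (layer a b) y <= (\<Sum>i<n. ennreal ((real i + 2) * \<eta>) * indicator (Z i \<inter> {y \<in> \<Omega>. h y <= (real i + 2) * \<eta>}) y)" for y
 proof (cases "y \<in> layer a b")
  case True
  then have y: "y \<in> \<Omega>" "bdist y \<in> {a..b}" by (auto simp: layer_def)
  then obtain x where x: "x \<in> frontier \<Omega>" "y = x + bdist y *\<^sub>R \<nu> x"
   using collar_representation[of y] ab by auto
  define i where "i = nat \<lfloor>k x / \<eta>\<rfloor>"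
  have xi: "x \<in> A i" using x(1) k0[OF x(1)] \<eta> by (simp add: A_def i_def)
  have "k x / \<eta> <= B / \<eta>" using B[OF x(1)] \<eta> by (simp add: divide_right_mono)
  then have "i < n" unfolding i_def n_def by linarith
  have "h y <= k x + \<eta>" using osc[OF x(1) y(2)] x(2) by (simp add: k_def)
  also have "\<dots> <= (real i + 2) * \<eta>" using Ai[OF xi] by (simp add: algebra_simps)
  finally have hy: "h y <= (real i + 2) * \<eta>" .
  have "y \<in> Z i" using Z(2)[OF xi y(2)] x(2) by simp
  then have "ennreal (h y) * indicator (layer a b) y <= ennreal ((real i + 2) * \<eta>) * indicator (Z i \<inter> {y \<in> \<Omega>. h y <= (real i + 2) * \<eta>}) y"
   using hy y True by (simp add: ennreal_leI)
  also have "\<dots> <= (\<Sum>i<n. ennreal ((real i + 2) * \<eta>) * indicator (Z i \<inter> {y \<in> \<Omega>. h y <= (real i + 2) * \<eta>}) y)"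
   using \<open>i < n\<close> by (intro member_le_sum) auto
  finally show ?thesis .
 qed simp
 have hm: "{y \<in> \<Omega>. h y <= c} \<in> sets lborel" for c
 proof -
  have "{y \<in> \<Omega>. h y <= c} = \<Omega> - (\<Omega> \<inter> h -` {c<..})" by auto
  moreover have "open (\<Omega> \<inter> h -` {c<..})" using h(1) op by (intro continuous_open_preimage) auto
  ultimately show ?thesis using op by auto
 qed
 have "layer_integral h a b
   <= (\<integral>\<^sup>+y. (\<Sum>i<n. ennreal ((real i + 2) * \<eta>) * indicator (Z i \<inter> {y \<in> \<Omega>. h y <= (real i + 2) * \<eta>}) y) \<partial>lborel)"
  by (intro nn_integral_mono ptw)
 also have "\<dots> = (\<Sum>i<n. ennreal ((real i + 2) * \<eta>) * emeasure lborel (Z i \<inter> {y \<in> \<Omega>. h y <= (real i + 2) * \<eta>}))"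
  using Z(1) hm by (subst nn_integral_sum) (auto intro!: sum.cong nn_integral_cmult_indicator)
 also have "\<dots> <= (\<Sum>i<n. ennreal ((real i + 2) * \<eta>) * (ennreal (C * (b - a)) * emeasure surf (A i)))"
  using Z(1) by (intro sum_mono mult_left_mono order_trans[OF emeasure_mono Z(3)]) auto
 also have "\<dots> = ennreal (C * (b - a)) * (\<Sum>i<n. ennreal ((real i + 2) * \<eta>) * emeasure surf (A i))"
  by (simp add: sum_distrib_left mult.left_commute)
 also have "(\<Sum>i<n. ennreal ((real i + 2) * \<eta>) * emeasure surf (A i))
   = (\<integral>\<^sup>+x. (\<Sum>i<n. ennreal ((real i + 2) * \<eta>) * indicator (A i) x) \<partial>surf)"
  using Ab by (subst nn_integral_sum) (auto intro!: sum.cong nn_integral_cmult_indicator[symmetric])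
 also have "\<dots> <= (\<integral>\<^sup>+x. (ennreal (k x) + ennreal (2 * \<eta>)) * indicator (frontier \<Omega>) x \<partial>surf)"
 proof (rule nn_integral_mono)
  fix x
  show "(\<Sum>i<n. ennreal ((real i + 2) * \<eta>) * indicator (A i) x) <= (ennreal (k x) + ennreal (2 * \<eta>)) * indicator (frontier \<Omega>) x"
  proof (cases "\<exists>i<n. x \<in> A i")
   case True
   then obtain i where i: "i < n" "x \<in> A i" by blast
   have "x \<notin> A j" if "j \<noteq> i" for j using i(2) that by (auto simp: A_def)
   then have "(\<Sum>i<n. ennreal ((real i + 2) * \<eta>) * indicator (A i) x) = (\<Sum>j\<in>{i}. ennreal ((real j + 2) * \<eta>) * indicator (A j) x)"
    using i by (intro sum.mono_neutral_right) (auto simp: indicator_def)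
   also have "\<dots> = ennreal ((real i + 2) * \<eta>)" using i by simp
   also have "\<dots> <= ennreal (k x + 2 * \<eta>)" using Ai[OF i(2)] by (intro ennreal_leI) (simp add: algebra_simps)
   also have "\<dots> = ennreal (k x) + ennreal (2 * \<eta>)" using i(2) k0 \<eta> by (simp add: A_def)
   finally show ?thesis using i(2) by (simp add: A_def)
  next
   case False
   then have "(\<Sum>i<n. ennreal ((real i + 2) * \<eta>) * indicator (A i) x) = 0" by (intro sum.neutral) auto
   then show ?thesis by simp
  qed
 qed
 also have "\<dots> = (\<integral>\<^sup>+x. ennreal (k x) + ennreal (2 * \<eta>) \<partial>S)" unfolding nn_integral_S ..
 also have "\<dots> = (\<integral>\<^sup>+x. ennreal (k x) \<partial>S) + (\<integral>\<^sup>+x. ennreal (2 * \<eta>) \<partial>S)"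
 proof (intro nn_integral_add)
  have "k \<in> borel_measurable S" using km by (subst measurable_cong_sets[OF sets_S refl])
  then show "(\<lambda>x. ennreal (k x)) \<in> borel_measurable S" by measurable
 qed simp
 also have "(\<integral>\<^sup>+x. ennreal (2 * \<eta>) \<partial>S) = ennreal (2 * \<eta>) * emeasure surf (frontier \<Omega>)"
  by (simp add: space_S emeasure_S)
 finally show ?thesis unfolding k_def by (simp add: mult_left_mono)
qed

text \<open>The one-sided coarea estimate. Uniform continuity of \<open>h\<close> along the normals
  allows a subdivision into short layers, after which the oscillation \<open>\<eta>\<close> is sent
  to zero.\<close>

lemma layer_bound:
 "\<exists>C\<ge>0. \<exists>t0>0. t0 <= 1 \<and> t0 <= \<epsilon>0 \<and>
  (\<forall>x\<in>frontier \<Omega>. \<forall>t. 0 < t \<and> t < t0 --> x + t *\<^sub>R \<nu> x \<in> \<Omega>) \<and>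
  (\<forall>h a b B. continuous_on \<Omega> h --> (\<forall>y\<in>\<Omega>. 0 <= h y) --> 0 < a --> a < b --> b < t0 --> 0 <= B -->
   (\<forall>t\<in>{a..b}. slice_integral h t <= ennreal B) -->
   layer_integral h a b <= ennreal (C * (b - a) * B))"
proof -
 obtain C where C0: "C >= 0" and C: "\<forall>A a b. A \<in> sets borel --> A \<subseteq> frontier \<Omega> --> 0 <= a --> a < b --> b <= 1 -->
   (\<exists>Z\<in>sets lborel. (\<forall>x\<in>A. \<forall>t\<in>{a..b}. x + t *\<^sub>R \<nu> x \<in> Z) \<and>
    emeasure lborel Z <= ennreal (C * (b - a)) * emeasure surf A)"
  using collar_volume_bound by blast
 obtain t1 where t1: "t1 > 0" "t1 <= \<epsilon>0" "\<And>x t. x \<in> frontier \<Omega> ==> 0 < t ==> t < t1 ==> x + t *\<^sub>R \<nu> x \<in> \<Omega>"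
  using inward_segment_in_domain by blast
 define t0 where "t0 = min t1 1"
 have t0: "t0 > 0" "t0 <= 1" "t0 <= \<epsilon>0" "t0 <= t1" using t1 by (auto simp: t0_def)
 define H where "H = measure surf (frontier \<Omega>)"
 have H0: "H >= 0" by (simp add: H_def)
 have H: "emeasure surf (frontier \<Omega>) = ennreal H"
  unfolding H_def using surf_frontier_finite by (intro emeasure_eq_ennreal_measure) auto
 have main: "layer_integral h a b <= ennreal (C * (b - a) * B)"
  if h: "continuous_on \<Omega> h" "\<forall>y\<in>\<Omega>. 0 <= h y" and ab: "0 < a" "a < b" "b < t0" and B: "0 <= B"
   and bnd: "\<forall>t\<in>{a..b}. slice_integral h t <= ennreal B" for h a b B
 proof -
  define I where "I = layer_integral h a b"
  define g where "g = (\<lambda>(x, t). h (x + t *\<^sub>R \<nu> x))"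
  have gc: "continuous_on (frontier \<Omega> \<times> {a..b}) g"
   unfolding g_def case_prod_unfold
   by (rule continuous_on_compose2[OF h(1)])
    (use t1(3) ab t0 in \<open>auto intro!: continuous_intros continuous_on_compose2[OF inner_normal_continuous[of UNIV]]\<close>)
  have gu: "uniformly_continuous_on (frontier \<Omega> \<times> {a..b}) g"
   by (rule compact_uniformly_continuous[OF gc compact_Times[OF frontier_compact compact_Icc]])
  have est: "I <= ennreal (C * (b - a) * (B + 2 * \<eta> * H))" if \<eta>: "\<eta> > 0" for \<eta>
  proof -
   obtain d where d: "d > 0" "\<forall>p\<in>frontier \<Omega> \<times> {a..b}. \<forall>q\<in>frontier \<Omega> \<times> {a..b}. dist q p < d --> dist (g q) (g p) < \<eta>"
    using gu \<eta> unfolding uniformly_continuous_on_def by blast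
   obtain N0 :: nat where N0: "(b - a) / d < N0" using reals_Archimedean2 by blast
   define N where "N = Suc N0"
   have N: "N >= 1" "(b - a) / d < N" using N0 by (simp_all add: N_def)
   define l where "l = (b - a) / N"
   have l: "l > 0" "l < d" using N ab d(1) by (auto simp: l_def field_simps)
   have Nl: "N * l = b - a" using N by (simp add: l_def)
   define c where "c j = a + real j * l" for j
   have cj: "a <= c j" "c j < c (Suc j)" "c (Suc j) <= b" if "j < N" for j
   proof -
    show "a <= c j" "c j < c (Suc j)" using l by (auto simp: c_def algebra_simps)
    have "real (Suc j) * l <= N * l" using that l by (intro mult_right_mono) auto
    then show "c (Suc j) <= b" using Nl by (simp add: c_def)
   qed
   have pc: "layer_integral h (c j) (c (Suc j)) <= ennreal (C * l * (B + 2 * \<eta> * H))"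
    if j: "j < N" for j
   proof -
    have "layer_integral h (c j) (c (Suc j))
     <= ennreal (C * (c (Suc j) - c j)) * (slice_integral h (c j) + ennreal (2 * \<eta>) * emeasure surf (frontier \<Omega>))"
    proof (rule layer_bound_short[OF C h(1)])
     show "h (x + t *\<^sub>R \<nu> x) <= h (x + c j *\<^sub>R \<nu> x) + \<eta>"
      if "x \<in> frontier \<Omega>" "t \<in> {c j..c (Suc j)}" for x t
     proof -
      have "dist (x, t) (x, c j) < d" using that l by (auto simp: dist_Pair_Pair c_def dist_real_def algebra_simps)
      moreover have "(x, t) \<in> frontier \<Omega> \<times> {a..b}" "(x, c j) \<in> frontier \<Omega> \<times> {a..b}" using that cj[OF j] by auto
      ultimately have "dist (g (x, t)) (g (x, c j)) < \<eta>" using d(2) by blast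
      then show ?thesis by (simp add: g_def dist_real_def)
     qed
    qed (use h(2) cj[OF j] ab t0 \<eta> t1(3) in auto)
    also have "\<dots> <= ennreal (C * l) * (ennreal B + ennreal (2 * \<eta>) * ennreal H)"
    proof -
     have "c (Suc j) - c j = l" by (simp add: c_def algebra_simps)
     moreover have "slice_integral h (c j) <= ennreal B" using bnd cj[OF j] by simp
     ultimately show ?thesis unfolding H by (simp add: mult_left_mono add_mono)
    qed
    also have "ennreal B + ennreal (2 * \<eta>) * ennreal H = ennreal (B + 2 * \<eta> * H)"
     using B \<eta> H0 by (simp add: ennreal_mult)
    also have "ennreal (C * l) * ennreal (B + 2 * \<eta> * H) = ennreal (C * l * (B + 2 * \<eta> * H))"
     using B \<eta> C0 l H0 by (intro ennreal_mult[symmetric]) auto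
    finally show ?thesis .
   qed
   have "ennreal (h y) * indicator (layer a b) y <= (\<Sum>j<N. ennreal (h y) * indicator (layer (c j) (c (Suc j))) y)" for y
   proof (cases "y \<in> layer a b")
    case True
    define t where "t = bdist y"
    have t: "a <= t" "t <= b" using True by (auto simp: layer_def t_def)
    \<comment> \<open>The minimum takes care of the end point \<open>t = b\<close>.\<close>
    define j where "j = min (nat \<lfloor>(t - a) / l\<rfloor>) (N - 1)"
    have j: "j < N" using N(1) by (auto simp: j_def)
    have "c j <= t \<and> t <= c (Suc j)"
    proof -
     have q: "0 <= (t - a) / l" "(t - a) / l <= N" using t l Nl by (auto simp: divide_le_eq)
     have "real j <= (t - a) / l" "(t - a) / l <= real j + 1"
     proof -
      have "real (nat \<lfloor>(t - a) / l\<rfloor>) = of_int \<lfloor>(t - a) / l\<rfloor>" using q(1) by simp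
      then show "real j <= (t - a) / l" "(t - a) / l <= real j + 1"
       using q(2) N(1) unfolding j_def by (auto simp: min_def of_nat_diff) linarith+
     qed
     then have "real j * l <= t - a" "t - a <= (real j + 1) * l" using l by (auto simp: field_simps)
     then show ?thesis by (simp add: c_def algebra_simps)
    qed
    then have "y \<in> layer (c j) (c (Suc j))" using True by (auto simp: layer_def t_def)
    then have "ennreal (h y) * indicator (layer a b) y = ennreal (h y) * indicator (layer (c j) (c (Suc j))) y" using True by simp
    also have "\<dots> <= (\<Sum>j<N. ennreal (h y) * indicator (layer (c j) (c (Suc j))) y)"
     using j by (intro member_le_sum) auto
    finally show ?thesis .
   qed simp
   then have "I <= (\<integral>\<^sup>+y. (\<Sum>j<N. ennreal (h y) * indicator (layer (c j) (c (Suc j))) y) \<partial>lborel)"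
    unfolding I_def by (intro nn_integral_mono)
   also have "\<dots> = (\<Sum>j<N. \<integral>\<^sup>+y. ennreal (h y) * indicator (layer (c j) (c (Suc j))) y \<partial>lborel)"
   proof (intro nn_integral_sum)
    fix j assume "j \<in> {..<N}"
    then have cp: "compact (layer (c j) (c (Suc j)))" using cj(1)[of j] ab by (intro layer_compact) auto
    have "(\<lambda>y. indicator (layer (c j) (c (Suc j))) y *\<^sub>R h y) \<in> borel_measurable borel"
     using cp continuous_on_subset[OF h(1)] by (intro borel_measurable_continuous_on_indicator) (auto simp: layer_def borel_compact)
    then have "(\<lambda>y. ennreal (indicator (layer (c j) (c (Suc j))) y *\<^sub>R h y)) \<in> borel_measurable lborel" by measurable
    moreover have "ennreal (indicator (layer (c j) (c (Suc j))) y *\<^sub>R h y) = ennreal (h y) * indicator (layer (c j) (c (Suc j))) y" for y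
     by (simp add: indicator_def)
    ultimately show "(\<lambda>y. ennreal (h y) * indicator (layer (c j) (c (Suc j))) y) \<in> borel_measurable lborel" by simp
   qed
   also have "\<dots> <= (\<Sum>j<N. ennreal (C * l * (B + 2 * \<eta> * H)))" using pc by (intro sum_mono) auto
   also have "\<dots> = ennreal (real N * (C * l * (B + 2 * \<eta> * H)))"
    using B \<eta> C0 l H0 by (simp add: ennreal_of_nat_eq_real_of_nat ennreal_mult)
   also have "real N * (C * l * (B + 2 * \<eta> * H)) = C * (real N * l) * (B + 2 * \<eta> * H)" by (simp only: mult_ac)
   also have "\<dots> = C * (b - a) * (B + 2 * \<eta> * H)" by (simp only: Nl)
   finally show ?thesis .
  qed
  have "I <= ennreal (C * (b - a) * B)"
  proof (rule tendsto_lowerbound)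
   have "(\<lambda>k. C * (b - a) * (B + 2 * (1 / real (Suc k)) * H)) \<longlonglongrightarrow> C * (b - a) * (B + 2 * 0 * H)"
    by (intro tendsto_intros LIMSEQ_inverse_real_of_nat[unfolded inverse_eq_divide])
   then show "(\<lambda>k. ennreal (C * (b - a) * (B + 2 * (1 / real (Suc k)) * H))) \<longlonglongrightarrow> ennreal (C * (b - a) * B)"
    by (intro tendsto_ennrealI) simp
   show "\<forall>\<^sub>F k in sequentially. I <= ennreal (C * (b - a) * (B + 2 * (1 / real (Suc k)) * H))"
    by (intro always_eventually allI est) simp
  qed simp
  then show ?thesis by (simp add: I_def)
 qed
 show ?thesis
  using C0 t0 t1(3) main by (intro exI[of _ C] conjI exI[of _ t0]) (auto simp del: ex_simps)
qed

end

section \<open>A superharmonic barrier, and the bound of harmonic functions by boundary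
  slices\<close>

lemma trace2_chain:
 "trace2 (\<lambda>b x h. t1 x * f'' b x h + t2 x * f' x h * f' x b) x = t1 x * trace2 f'' x + t2 x * (gradsq f' x)"
 for f' :: "'a::euclidean_space => 'a => real"
 by (simp add: trace2_def sum.distrib sum_distrib_left power2_eq_square mult.assoc)

lemma C2_on_paraboloid:
 "C2_on UNIV (\<lambda>z::'a::euclidean_space. c - z \<bullet> z) (\<lambda>z h. - 2 * (z \<bullet> h)) (\<lambda>b z h. - 2 * (h \<bullet> b))"
 unfolding C2_on_def C1_on_def
 by (auto intro!: derivative_eq_intros continuous_intros simp: inner_commute)

context collar_domain
begin

lemma closure_bound:
 assumes "continuous_on UNIV (f :: 'a => real)"
 obtains C where "C > 0" "\<And>x. x \<in> closure \<Omega> ==> \<bar>f x\<bar> <= C"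
proof -
 obtain C where "\<And>x. x \<in> closure \<Omega> ==> norm (f x) <= C"
  by (rule continuous_on_compact_bound[OF _ continuous_on_subset[OF assms], of "closure \<Omega>"]) (use bd in auto)
 then show ?thesis using that[of "max C 1"] by (simp add: le_max_iff_disj)
qed

text \<open>\<open>w\<close> is, up to a constant, a smoothed minimum of \<open>A (1 - exp (- k F))\<close>, which is superharmonic near the boundary,
 and \<open>const - \<bar>x\<bar>\<^sup>2\<close>; the former is the smaller one precisely near the boundary.\<close>

lemma superharmonic_defining_function:
 "\<exists>w w' w'' c m1 m2. C2_on UNIV w w' w'' \<and> c > 0 \<and> m1 > 0 \<and> m2 > 0 \<and> (\<forall>x\<in>frontier \<Omega>. w x = 0) \<and>
   (\<forall>x\<in>\<Omega>. w x > 0 \<and> trace2 w'' x <= - c \<and>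
    (w x < 1 --> m1 * w x <= bdist x \<and> bdist x <= m2 * w x))"
proof -
 note th = ramp
 obtain R where R: "closure \<Omega> \<subseteq> cball 0 R" "R >= 0" by (rule closure_in_ball)
 \<comment> \<open>The constant makes \<open>2 <= b <= R^2 + 2\<close> on the closure; the lower
   bound 2 later ensures \<open>w >= 1\<close> wherever \<open>b - a < 1\<close>.\<close>
 define b where "b x = (R^2 + 2) - x \<bullet> x" for x :: 'a
 have b: "2 <= b x" "b x <= R^2 + 2" if "x \<in> closure \<Omega>" for x
 proof -
  have "norm x <= R" using that R by auto
  then have "x \<bullet> x <= R^2" using R(2) by (simp add: power2_norm_eq_inner[symmetric] power_mono)
  then show "2 <= b x" "b x <= R^2 + 2" by (simp_all add: b_def)
 qed
 obtain D where D: "D > 0" "\<And>x. x \<in> closure \<Omega> ==> \<bar>trace2 F'' x\<bar> <= D"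
  using closure_bound[OF C2_on_cont_trace[OF F2]] by blast
 obtain M where M: "M > 0" "\<And>x. x \<in> closure \<Omega> ==> \<bar>F x\<bar> <= M"
  using closure_bound[OF C2_on_cont[OF F2]] by blast
 \<comment> \<open>Where the gradient of \<open>F\<close> has norm one, the Laplacian of
   \<open>1 - exp (- k F)\<close> is \<open>k exp (- k F) (\<Delta>F - k)\<close>, and this
   \<open>k\<close> makes the bracket at most \<open>- 1\<close>.\<close>
 define k where "k = D + 1"
 have k: "k > 0" using D(1) by (simp add: k_def)
 obtain c0 where c0: "c0 > 0" "\<And>x. x \<in> closure \<Omega> ==> \<epsilon>0 / 2 <= bdist x ==> c0 <= F x"
  by (rule F_bounded_below[of "\<epsilon>0 / 2"]) (use e0 in simp, rule that)
 have ek: "0 < 1 - exp (- k * c0)" using k c0(1) by simp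
 \<comment> \<open>Large enough that \<open>a >= b\<close> at distance at least
   \<open>\<epsilon>0 / 2\<close> from the boundary: the branch \<open>a\<close> influences the
   minimum only in the collar, where the gradient of \<open>F\<close> has norm one.\<close>
 define A where "A = (R^2 + 2) / (1 - exp (- k * c0))"
 have A: "A > 0" unfolding A_def using ek by (simp add: add_nonneg_pos)
 define a where "a x = A * (1 - exp (- k * F x))" for x
 have near: "bdist x < \<epsilon>0 / 2" if x: "x \<in> \<Omega>" "a x < b x" for x
 proof (rule ccontr)
  assume "\<not> bdist x < \<epsilon>0 / 2"
  then have "c0 <= F x" using c0(2)[of x] x closure_subset[of \<Omega>] by auto
  then have "1 - exp (- k * c0) <= 1 - exp (- k * F x)" using k by simp
  then have "A * (1 - exp (- k * c0)) <= a x" unfolding a_def using A by (intro mult_left_mono) auto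
  moreover have "A * (1 - exp (- k * c0)) = R^2 + 2"
   by (rule iffD1[OF nonzero_eq_divide_eq A_def]) (use ek in linarith)
  ultimately show False using b(2)[of x] x closure_subset[of \<Omega>] by auto
 qed
 define a' where "a' x h = (A * k * exp (- k * F x)) * F' x h" for x h
 define a'' where "a'' b x h = (A * k * exp (- k * F x)) * F'' b x h + (- (A * k * k * exp (- k * F x))) * F' x h * F' x b" for b x h
 have a2: "C2_on UNIV a a' a''"
  unfolding a_def[abs_def] a'_def[abs_def] a''_def[abs_def]
  by (rule C2_on_chain[OF F2]) (auto intro!: derivative_eq_intros continuous_intros)
 define b' where "b' z h = - 2 * (z \<bullet> h)" for z h :: 'a
 define b'' where "b'' b z h = - 2 * (h \<bullet> b)" for b z h :: 'a
 have b2: "C2_on UNIV b b' b''"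
  unfolding b_def[abs_def] b'_def[abs_def] b''_def[abs_def] by (rule C2_on_paraboloid)
 define s where "s x = b x + - 1 * a x" for x
 define s' where "s' x h = b' x h + - 1 * a' x h" for x h
 define s'' where "s'' c x h = b'' c x h + - 1 * a'' c x h" for c x h
 have s2: "C2_on UNIV s s' s''"
  unfolding s_def[abs_def] s'_def[abs_def] s''_def[abs_def] by (intro C2_on_add b2 C2_on_cmult a2)
 \<comment> \<open>The smoothed minimum of \<open>a\<close> and \<open>b\<close> is
   \<open>b - ramp (b - a)\<close>; the shift by \<open>1/2\<close> makes \<open>w = a\<close> where
   \<open>b - a >= 1\<close>.\<close>
 define w where "w x = (b x + - 1 * ramp (s x)) + (- 1/2)" for x
 define w' where "w' x h = (b' x h + - 1 * (ramp1 (s x) * s' x h)) + 0" for x h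
 define w'' where "w'' c x h = (b'' c x h + - 1 * (ramp1 (s x) * s'' c x h + ramp2 (s x) * s' x h * s' x c)) + 0" for c x h
 have w2: "C2_on UNIV w w' w''"
  unfolding w_def[abs_def] w'_def[abs_def] w''_def[abs_def]
  by (intro C2_on_add C2_on_const b2 C2_on_cmult C2_on_chain[OF s2] th continuous_on_subset[OF th(3)]) auto
 define c where "c = min 2 (A * k * exp (- k * M))"
 have c: "c > 0" using A k by (simp add: c_def)
 have wa: "w x = a x" if "1 <= s x" for x using th(6)[OF that] by (simp add: w_def s_def)
 have wl: "1 <= w x" if "x \<in> closure \<Omega>" "\<not> 1 <= s x" for x
  using th(10)[of "s x"] b[OF that(1)] that(2) by (simp add: w_def)
 have w0: "w x = 0" if x: "x \<in> frontier \<Omega>" for x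
 proof -
  have "a x = 0" using F_frontier[OF x] by (simp add: a_def)
  then show ?thesis using wa[of x] b[of x] x by (simp add: s_def frontier_iff)
 qed
 have ap: "0 < a x" if "x \<in> \<Omega>" for x using Fpos[OF that] A k by (simp add: a_def)
 have tb: "trace2 b'' x = - 2 * real DIM('a)" for x
  by (simp add: trace2_def b''_def)
 have tw: "trace2 w'' x <= - c" if x: "x \<in> \<Omega>" for x
 proof -
  have xc: "x \<in> closure \<Omega>" using x closure_subset by blast
  define T where "T = (gradsq s' x)"
  have "trace2 w'' x = trace2 b'' x - (ramp1 (s x) * (trace2 b'' x - trace2 a'' x) + ramp2 (s x) * T)"
   by (simp add: trace2_def w''_def s''_def T_def sum.distrib sum_distrib_left sum_subtractf sum_negf power2_eq_square mult.assoc right_diff_distrib)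
  \<comment> \<open>Concavity of the smoothed minimum: the term with \<open>ramp2\<close> has the
    good sign, and what remains is a convex combination of the two Laplacians.\<close>
  also have "\<dots> <= trace2 b'' x - ramp1 (s x) * (trace2 b'' x - trace2 a'' x)"
   using th(13)[of "s x"] by (simp add: T_def sum_nonneg)
  also have "\<dots> = (1 - ramp1 (s x)) * trace2 b'' x + ramp1 (s x) * trace2 a'' x" by (simp add: algebra_simps)
  also have "\<dots> <= (1 - ramp1 (s x)) * (- c) + ramp1 (s x) * (- c)"
  proof (rule add_mono)
   have "c <= 2 * real DIM('a)" unfolding c_def using DIM_positive[where 'a='a] by (intro order_trans[OF min.cobounded1]) simp
   then show "(1 - ramp1 (s x)) * trace2 b'' x <= (1 - ramp1 (s x)) * (- c)"
    unfolding tb using th(12)[of "s x"] by (intro mult_left_mono) auto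
   show "ramp1 (s x) * trace2 a'' x <= ramp1 (s x) * (- c)"
   proof (cases "s x <= 0")
    case False
    then have "bdist x < \<epsilon>0 / 2" using near[OF x] by (simp add: s_def)
    then have n1: "norm (\<nu> x) = 1" using norm_inner_normal_interior[OF x] e0 by auto
    have "trace2 a'' x = A * k * exp (- k * F x) * trace2 F'' x - A * k * k * exp (- k * F x)"
     unfolding a''_def trace2_chain norm_gradient_sq[symmetric] n1[unfolded \<nu>_def] by simp
    also have "\<dots> = A * k * exp (- k * F x) * (trace2 F'' x - k)" by (simp add: algebra_simps)
    also have "\<dots> <= A * k * exp (- k * F x) * (- 1)"
     using D(2)[OF xc] A k by (intro mult_left_mono) (auto simp: k_def)
    also have "\<dots> <= - (A * k * exp (- k * M))" using M(2)[OF xc] A k by simp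
    also have "\<dots> <= - c" by (simp add: c_def)
    finally show ?thesis using th(11)[of "s x"] by (rule mult_left_mono)
   qed (simp add: th(5))
  qed
  also have "\<dots> = - c" by (simp add: algebra_simps)
  finally show ?thesis .
 qed
 have cmp: "(1 / (A * k)) * w x <= bdist x \<and> bdist x <= (exp (k * M) / (A * k)) * w x"
  if x: "x \<in> \<Omega>" and w1: "w x < 1" for x
 proof -
  have xc: "x \<in> closure \<Omega>" using x closure_subset by blast
  have s1: "1 <= s x" using wl[OF xc] w1 by fastforce
  then have "bdist x < \<epsilon>0" using near[OF x] e0 by (simp add: s_def)
  then have Fd: "F x = bdist x" by (rule Fdist[OF xc])
  have wx: "w x = A * (1 - exp (- k * F x))" using wa[OF s1] by (simp add: a_def)
  have "1 - exp (- k * F x) <= k * F x" using exp_ge_add_one_self[of "- k * F x"] by simp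
  then have "w x <= A * (k * F x)" unfolding wx using A by (intro mult_left_mono) auto
  then have 1: "(1 / (A * k)) * w x <= F x" using A k by (simp add: field_simps)
  have "k * F x <= exp (k * F x) - 1" using exp_ge_add_one_self[of "k * F x"] by linarith
  also have "\<dots> = exp (k * F x) * (1 - exp (- k * F x))" by (simp add: algebra_simps exp_minus)
  also have "\<dots> <= exp (k * M) * (1 - exp (- k * F x))"
   using M(2)[OF xc] k Fpos[OF x] by (intro mult_right_mono) auto
  finally have "A * (k * F x) <= A * (exp (k * M) * (1 - exp (- k * F x)))" using A by (intro mult_left_mono) auto
  then have "A * (k * F x) <= exp (k * M) * w x" by (simp add: wx mult_ac)
  then have 2: "F x <= (exp (k * M) / (A * k)) * w x" using A k by (simp add: field_simps)
  show ?thesis using 1 2 Fd by simp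
 qed
 have wp: "0 < w x" if x: "x \<in> \<Omega>" for x
  using wl[of x] wa[of x] ap[OF x] x closure_subset[of \<Omega>] by (cases "1 <= s x") auto
 show ?thesis
  using w2 c A k w0 wp tw cmp
  by (intro exI[of _ w] exI[of _ w'] exI[of _ w''] exI[of _ c] exI[of _ "1 / (A * k)"] exI[of _ "exp (k * M) / (A * k)"]) simp
qed

end

context collar_domain_surface
begin

text \<open>Green's formula for \<open>u\<^sup>2\<close>, which is subharmonic, and a truncation of \<open>w\<close> at height \<open>e\<close>.\<close>

lemma harmonic_L2_bound:
 "\<exists>C\<ge>0. \<forall>u B t1. harmonic_on \<Omega> u --> 0 <= B --> 0 < t1 -->
   (\<forall>t. 0 < t --> t < t1 --> slice_integral (\<lambda>x. (u x)^2) t <= ennreal B) -->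
   (\<integral>\<^sup>+x. ennreal ((u x)^2) * indicator \<Omega> x \<partial>lborel) <= ennreal (C * B)"
proof -
 obtain w w' w'' c m1 m2 where w: "C2_on UNIV w w' w''" and c: "c > 0" and m: "m1 > 0" "m2 > 0"
  and w0: "\<And>x. x \<in> frontier \<Omega> ==> w x = 0" and wp: "\<And>x. x \<in> \<Omega> ==> w x > 0"
  and wt: "\<And>x. x \<in> \<Omega> ==> trace2 w'' x <= - c"
  and wm: "\<And>x. x \<in> \<Omega> ==> w x < 1 ==> m1 * w x <= bdist x \<and> bdist x <= m2 * w x"
  using superharmonic_defining_function by metis
 obtain CL t0 where L: "CL >= 0" "t0 > 0"
  and lay0: "\<forall>h a b B. continuous_on \<Omega> h --> (\<forall>y\<in>\<Omega>. 0 <= h y) --> 0 < a --> a < b --> b < t0 --> 0 <= B -->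
   (\<forall>t\<in>{a..b}. slice_integral h t <= ennreal B) -->
   layer_integral h a b <= ennreal (CL * (b - a) * B)"
  using layer_bound by (elim exE conjE) (rule that)
 note lay = lay0[rule_format]
 note th = ramp(1-5,7-9,11,13-15)
 define T where "T x = (gradsq w' x)" for x
 have Tc: "continuous_on UNIV T" unfolding T_def by (intro continuous_intros C2_on_cont'[OF w])
 obtain D where D: "D > 0" "\<And>x. x \<in> closure \<Omega> ==> \<bar>T x\<bar> <= D" using closure_bound[OF Tc] by blast
 have T0: "0 <= T x" for x by (simp add: T_def sum_nonneg)
 \<comment> \<open>\<open>M e\<close> is the deeper end of a layer that contains the set
   \<open>e <= w < 2 e\<close>; the summand \<open>m1\<close> keeps the layer nondegenerate.\<close>
 define M where "M = 2 * m2 + m1"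
 define C where "C = 2 * D * CL * M / c"
 have C: "C >= 0" using D(1) L c m by (simp add: C_def M_def)
 have "(\<integral>\<^sup>+x. ennreal ((u x)^2) * indicator \<Omega> x \<partial>lborel) <= ennreal (C * B)"
  if u: "harmonic_on \<Omega> u" and B: "0 <= B" and t1: "0 < t1"
   and bd1: "\<forall>t. 0 < t --> t < t1 --> slice_integral (\<lambda>x. (u x)^2) t <= ennreal B" for u B t1
 proof -
  obtain u' u'' where u2: "C2_on \<Omega> u u' u''" and ut: "\<And>x. x \<in> \<Omega> ==> trace2 u'' x = 0"
   using u harmonic_on_iff[OF op] by blast
  have uc: "continuous_on \<Omega> (\<lambda>x. (u x)^2)" by (intro continuous_intros C2_on_cont[OF u2])
  define q'' where "q'' b x h = (2 * u x) * u'' b x h + 2 * u' x h * u' x b" for b x h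
  define q' where "q' x h = (2 * u x) * u' x h" for x h
  have q2: "C2_on \<Omega> (\<lambda>x. (u x)^2) q' q''"
   unfolding q'_def[abs_def] q''_def[abs_def]
   by (rule C2_on_chain[OF u2, where t = "\<lambda>s. s^2"]) (auto intro!: derivative_eq_intros continuous_intros)
  have qt: "0 <= trace2 q'' x" if "x \<in> \<Omega>" for x
   unfolding q''_def trace2_chain using ut[OF that] by (simp add: sum_nonneg)
  have est: "(\<integral>\<^sup>+x. ennreal ((u x)^2) * indicator {x \<in> \<Omega>. 2 * e <= w x} x \<partial>lborel) <= ennreal (C * B)"
   if e: "0 < e" "2 * e < 1" "M * e < t0" "M * e < t1" for e
  proof -
   define K where "K = closure \<Omega> \<inter> {x. e <= w x}"
   have K: "compact K" unfolding K_def using bd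
    by (intro compact_Int_closed closed_Collect_le continuous_intros C2_on_cont[OF w]) (auto simp: compact_closure)
   have KO: "K \<subseteq> \<Omega>" using w0 e(1) by (force simp: K_def frontier_iff)
   \<comment> \<open>\<open>p\<close> vanishes up to height \<open>e\<close> and has slope one from
     \<open>2 e\<close> on; in between its second derivative is at most
     \<open>2 / e\<close>.\<close>
   define p where "p s = e * ramp (s / e - 1)" for s
   define p' where "p' s = ramp1 (s / e - 1)" for s
   define p'' where "p'' s = ramp2 (s / e - 1) / e" for s
   have i: "((\<lambda>s. s / e - 1) has_real_derivative 1 / e) (at s)" for s
    using e(1) by (auto intro!: derivative_eq_intros)
   have dp: "(p has_real_derivative p' s) (at s)" "(p' has_real_derivative p'' s) (at s)" for s
    unfolding p_def[abs_def] p'_def[abs_def]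
    by (rule DERIV_cong[OF DERIV_cmult[OF DERIV_chain2[OF th(1) i]]] DERIV_cong[OF DERIV_chain2[OF th(2) i]];
      use e(1) in \<open>simp add: p'_def p''_def\<close>)+
   have dc: "continuous_on X p''" for X
    unfolding p''_def[abs_def] using e(1)
    by (intro continuous_intros continuous_on_compose2[OF th(3)]) auto
   define f' where "f' x h = p' (w x) * w' x h" for x h
   define f'' where "f'' b x h = p' (w x) * w'' b x h + p'' (w x) * w' x h * w' x b" for b x h
   have f2: "C2_on UNIV (\<lambda>x. p (w x)) f' f''"
    unfolding f'_def[abs_def] f''_def[abs_def] by (intro C2_on_chain[OF w] dp dc)
   have p0: "p (w x) = 0" if "x \<in> \<Omega> - K" for x
    using that closure_subset[of \<Omega>] e(1) unfolding p_def by (subst th(4)) (auto simp: K_def field_simps)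
   have ft: "trace2 f'' x = p' (w x) * trace2 w'' x + p'' (w x) * T x" for x
    unfolding f''_def trace2_chain T_def ..
   define Y where "Y = layer (m1 * e) (m2 * (2 * e) + m1 * e)"
   have Yc: "compact Y" unfolding Y_def using m e(1) by (intro layer_compact) simp
   have bnd: "trace2 f'' x <= - c * indicator {x. 2 * e <= w x} x + (2 * D / e) * indicator Y x" if x: "x \<in> \<Omega>" for x
   proof -
    have xc: "x \<in> closure \<Omega>" using x closure_subset by blast
    consider "w x <= e" | "e <= w x" "w x < 2 * e" | "2 * e <= w x" by linarith
    then show ?thesis
    proof cases
     case 1
     then have "trace2 f'' x = 0" unfolding ft p'_def p''_def using e(1) th(5,12)[of "w x / e - 1"] by simp
     then show ?thesis using 1 e(1) D(1) by simp
    next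
     case 2
     have "m1 * e <= m1 * w x" "m2 * w x <= m2 * (2 * e)" using 2 m by (auto intro!: mult_left_mono)
     moreover have "0 < m1 * e" using m e by simp
     ultimately have "x \<in> Y" using wm[OF x] 2 e x by (auto simp: Y_def layer_def)
     moreover have "p' (w x) * trace2 w'' x <= 0"
      unfolding p'_def using wt[OF x] c th(9) by (intro mult_nonneg_nonpos) auto
     moreover have "p'' (w x) * T x <= (2 / e) * D"
      unfolding p''_def using th(10,11) e(1) D(2)[OF xc] T0[of x] by (intro mult_mono divide_right_mono) auto
     ultimately show ?thesis using 2 by (simp add: ft)
    next
     case 3
     then have "1 <= w x / e - 1" using e(1) by (simp add: le_divide_eq)
     then have "trace2 f'' x = trace2 w'' x" unfolding ft p'_def p''_def using e(1) by (simp add: th(6,7))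
     moreover have "0 <= (2 * D / e) * indicator Y x" using e(1) D(1) by simp
     ultimately show ?thesis using 3 wt[OF x] by simp
    qed
   qed
   note G = Green_identity[OF op K KO q2 C2_on_subset[OF f2 subset_UNIV] p0]
   have i1: "set_integrable lborel \<Omega> (\<lambda>x. indicator {x. 2 * e <= w x} x * (u x)^2)"
   proof -
    have cp: "compact (closure \<Omega> \<inter> {x. 2 * e <= w x})" using bd
     by (intro compact_Int_closed closed_Collect_le continuous_intros C2_on_cont[OF w]) (auto simp: compact_closure)
    have sub: "closure \<Omega> \<inter> {x. 2 * e <= w x} \<subseteq> \<Omega>" using KO e(1) by (auto simp: K_def)
    have "integrable lborel (\<lambda>x. indicator (closure \<Omega> \<inter> {x. 2 * e <= w x}) x *\<^sub>R (u x)\<^sup>2)"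
     by (intro borel_integrable_compact cp continuous_on_subset[OF uc sub])
    moreover have "indicator (closure \<Omega> \<inter> {x. 2 * e <= w x}) x *\<^sub>R (u x)\<^sup>2 = indicator \<Omega> x *\<^sub>R (indicator {x. 2 * e <= w x} x * (u x)^2)" for x
     using sub closure_subset[of \<Omega>] by (auto simp: indicator_def)
    ultimately show ?thesis by (simp only: set_integrable_def)
   qed
   have i2: "set_integrable lborel \<Omega> (\<lambda>x. indicator Y x * (u x)^2)"
   proof -
    have sub: "Y \<subseteq> \<Omega>" by (auto simp: Y_def layer_def)
    have "integrable lborel (\<lambda>x. indicator Y x *\<^sub>R (u x)\<^sup>2)"
     by (intro borel_integrable_compact Yc continuous_on_subset[OF uc sub])
    moreover have "indicator Y x *\<^sub>R (u x)\<^sup>2 = indicator \<Omega> x *\<^sub>R (indicator Y x * (u x)^2)" for x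
     using sub by (auto simp: indicator_def)
    ultimately show ?thesis by (simp only: set_integrable_def)
   qed
   define I1 where "I1 = (LINT x:\<Omega>|lborel. indicator {x. 2 * e <= w x} x * (u x)^2)"
   define I2 where "I2 = (LINT x:\<Omega>|lborel. indicator Y x * (u x)^2)"
   have "0 <= (LINT x:\<Omega>|lborel. p (w x) * trace2 q'' x)"
    unfolding set_lebesgue_integral_def
    using qt th(8) e(1) by (intro integral_nonneg_AE AE_I2) (auto simp: indicator_def p_def)
   also have "\<dots> = (LINT x:\<Omega>|lborel. (u x)^2 * trace2 f'' x)" using G(3) by simp
   also have "\<dots> <= (LINT x:\<Omega>|lborel. - c * (indicator {x. 2 * e <= w x} x * (u x)^2) + (2 * D / e) * (indicator Y x * (u x)^2))"
   proof (rule set_integral_mono[OF G(1)])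
    show "set_integrable lborel \<Omega> (\<lambda>x. - c * (indicator {x. 2 * e <= w x} x * (u x)^2) + (2 * D / e) * (indicator Y x * (u x)^2))"
     by (intro set_integral_add set_integrable_mult_right i1 i2)
    fix x assume "x \<in> \<Omega>"
    from mult_left_mono[OF bnd[OF this], of "(u x)^2"]
    show "(u x)^2 * trace2 f'' x <= - c * (indicator {x. 2 * e <= w x} x * (u x)^2) + (2 * D / e) * (indicator Y x * (u x)^2)"
     by (simp add: algebra_simps)
   qed
   also have "\<dots> = - c * I1 + (2 * D / e) * I2"
    unfolding I1_def I2_def set_integral_mult_right[symmetric]
    by (intro set_integral_add(2) set_integrable_mult_right i1 i2)
   finally have le: "c * I1 <= (2 * D / e) * I2" by simp
   have nnI: "(\<integral>\<^sup>+x. ennreal ((u x)^2) * indicator {x \<in> \<Omega>. x \<in> P} x \<partial>lborel) = ennreal (LINT x:\<Omega>|lborel. indicator P x * (u x)^2)"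
    if "set_integrable lborel \<Omega> (\<lambda>x. indicator P x * (u x)^2)" for P
   proof -
    have "(\<integral>\<^sup>+x. ennreal (indicator \<Omega> x *\<^sub>R (indicator P x * (u x)^2)) \<partial>lborel) = ennreal (LINT x:\<Omega>|lborel. indicator P x * (u x)^2)"
     unfolding set_lebesgue_integral_def
     by (rule nn_integral_eq_integral[OF that[unfolded set_integrable_def]]) auto
    moreover have "ennreal (indicator \<Omega> x *\<^sub>R (indicator P x * (u x)^2)) = ennreal ((u x)^2) * indicator {x \<in> \<Omega>. x \<in> P} x" for x
     by (auto simp: indicator_def)
    ultimately show ?thesis by simp
   qed
   have "ennreal I2 = (\<integral>\<^sup>+x. ennreal ((u x)^2) * indicator Y x \<partial>lborel)"
   proof -
    have "{x \<in> \<Omega>. x \<in> Y} = Y" by (auto simp: Y_def layer_def)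
    then show ?thesis using nnI[OF i2] by (simp add: I2_def)
   qed
   also have "\<dots> <= ennreal (CL * ((m2 * (2 * e) + m1 * e) - m1 * e) * B)"
    unfolding Y_def
   proof (rule lay[OF uc])
    fix t assume t: "t \<in> {m1 * e..m2 * (2 * e) + m1 * e}"
    have "0 < m1 * e" using m e by simp
    moreover have "m2 * (2 * e) + m1 * e < t1" using e(4) by (simp add: M_def algebra_simps)
    ultimately show "slice_integral (\<lambda>x. (u x)^2) t <= ennreal B" using t bd1 by auto
   qed (use m e B in \<open>simp_all add: M_def algebra_simps\<close>)
   finally have "I2 <= CL * (m2 * (2 * e)) * B" using L m e B by (simp add: ennreal_le_iff)
   also have "\<dots> <= CL * (M * e) * B"
    using L m e B by (intro mult_right_mono mult_left_mono) (auto simp: M_def algebra_simps)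
   \<comment> \<open>The width of the layer, of order \<open>e\<close>, cancels the factor
     \<open>1 / e\<close> of the second derivative.\<close>
   finally have "(2 * D / e) * I2 <= (2 * D / e) * (CL * (M * e) * B)" using D(1) e(1) by (intro mult_left_mono) auto
   also have "\<dots> = 2 * D * CL * M * B" using e(1) by simp
   finally have "I1 <= C * B" using le c by (simp add: C_def field_simps)
   then show ?thesis using nnI[OF i1] by (simp add: I1_def ennreal_leI)
  qed
  define e where "e n = min (1/4) (min (t0 / (2 * M)) (t1 / (2 * M))) / real (Suc n)" for n
  have M: "M > 0" using m by (simp add: M_def)
  define e' where "e' = min (1/4) (min (t0 / (2 * M)) (t1 / (2 * M)))"
  have e': "e' > 0" "e' <= 1/4" "M * e' < t0" "M * e' < t1"
  proof -
   show "e' > 0" "e' <= 1/4" using M L t1 by (auto simp: e'_def)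
   have "e' <= t0 / (2 * M)" "e' <= t1 / (2 * M)" by (auto simp: e'_def)
   then show "M * e' < t0" "M * e' < t1" using M L t1 by (auto simp: field_simps)
  qed
  have e: "0 < e n" "2 * e n < 1" "M * e n < t0" "M * e n < t1" for n
  proof -
   have "e n = e' / real (Suc n)" by (simp add: e_def e'_def)
   then show 0: "0 < e n" using e' by simp
   have le: "e n <= e'" using \<open>e n = e' / real (Suc n)\<close> e'(1) by (simp add: divide_le_eq)
   have "M * e n <= M * e'" using le M by (intro mult_left_mono) auto
   then show "2 * e n < 1" "M * e n < t0" "M * e n < t1" using e' le by linarith+
  qed
  have elim: "e \<longlonglongrightarrow> 0"
   unfolding e_def by (rule LIMSEQ_Suc[OF lim_const_over_n])
  define g where "g n x = ennreal ((u x)^2) * indicator {x \<in> \<Omega>. 2 * e n <= w x} x" for n x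
  have gl: "(\<lambda>n. g n x) \<longlonglongrightarrow> ennreal ((u x)^2) * indicator \<Omega> x" for x
  proof (cases "x \<in> \<Omega>")
   case True
   have "eventually (\<lambda>n. e n < w x / 2) sequentially"
    by (rule order_tendstoD(2)[OF elim]) (use wp[OF True] in simp)
   then have "eventually (\<lambda>n. g n x = ennreal ((u x)^2) * indicator \<Omega> x) sequentially"
    by eventually_elim (use True in \<open>simp add: g_def\<close>)
   then show ?thesis by (rule tendsto_eventually)
  qed (simp add: g_def)
  have gm: "g n \<in> borel_measurable lborel" for n
  proof -
   have "(\<lambda>x. indicator \<Omega> x *\<^sub>R (u x)\<^sup>2) \<in> borel_measurable borel"
    by (rule borel_measurable_continuous_on_indicator[OF _ uc]) (use op in auto)
   moreover have "{x. 2 * e n <= w x} \<in> sets borel"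
    by (intro borel_closed closed_Collect_le continuous_intros C2_on_cont[OF w])
   ultimately have "(\<lambda>x. ennreal (indicator \<Omega> x *\<^sub>R (u x)\<^sup>2) * indicator {x. 2 * e n <= w x} x) \<in> borel_measurable lborel" by measurable
   moreover have "ennreal (indicator \<Omega> x *\<^sub>R (u x)\<^sup>2) * indicator {x. 2 * e n <= w x} x = g n x" for x
    by (auto simp: g_def indicator_def)
   ultimately show ?thesis by simp
  qed
  have "(\<integral>\<^sup>+x. ennreal ((u x)^2) * indicator \<Omega> x \<partial>lborel) = (\<integral>\<^sup>+x. liminf (\<lambda>n. g n x) \<partial>lborel)"
   using lim_imp_Liminf[OF _ gl] by simp
  also have "\<dots> <= liminf (\<lambda>n. \<integral>\<^sup>+x. g n x \<partial>lborel)" by (rule nn_integral_liminf[OF gm])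
  also have "\<dots> <= ennreal (C * B)"
   using est[OF e] by (intro Liminf_le always_eventually allI) (auto simp: g_def)
  finally show ?thesis .
 qed
 then show ?thesis using C by blast
qed

end

section \<open>The Poisson operator\<close>

lemma finite_measure_volume_on: "open \<Omega> ==> bounded \<Omega> ==> finite_measure (volume_on \<Omega>)"
proof
 assume "open \<Omega>" "bounded \<Omega>"
 then show "emeasure (volume_on \<Omega>) (space (volume_on \<Omega>)) \<noteq> \<infinity>"
  using emeasure_bounded_finite[of \<Omega>] by (simp add: volume_on_def emeasure_restrict_space space_restrict_space)
qed

lemma nn_integral_volume_on: "open \<Omega> ==> (\<integral>\<^sup>+x. f x \<partial>volume_on \<Omega>) = (\<integral>\<^sup>+x. f x * indicator \<Omega> x \<partial>lborel)"
 unfolding volume_on_def by (intro nn_integral_restrict_space) simp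

lemma AE_volume_on: "open \<Omega> ==> (AE x in volume_on \<Omega>. P x) \<longleftrightarrow> (AE x in lborel. x \<in> \<Omega> --> P x)"
 unfolding volume_on_def by (intro AE_restrict_space_iff) simp

lemma space_volume_on [simp]: "space (volume_on \<Omega>) = \<Omega>"
 by (simp add: volume_on_def space_restrict_space)

lemma measurable_volume_on_id: "(\<lambda>x. x) \<in> borel_measurable (volume_on \<Omega>)"
 unfolding volume_on_def by (rule measurable_restrict_space1) simp

lemma measurable_volume_on_continuous:
 "continuous_on \<Omega> u ==> u \<in> borel_measurable (volume_on \<Omega>)"
 unfolding volume_on_def using borel_measurable_continuous_on_restrict[of \<Omega> u]
 by (simp add: measurable_cong_sets[OF sets_restrict_space_cong[of lborel borel]])

lemma cmod_lincomb_sq_le: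
 "(cmod ((a + c * b) - (a' + c * b')))^2 <= 2 * (cmod (a - a'))^2 + 2 * (cmod c)^2 * (cmod (b - b'))^2"
proof -
 have "(a + c * b) - (a' + c * b') = (a - a') + c * (b - b')" by (simp add: algebra_simps)
 then show ?thesis using cmod_add_sq_le[of "a - a'" "c * (b - b')"] by (simp only: norm_mult power_mult_distrib mult.assoc)
qed

lemma ennreal_lincomb: "0 <= a ==> 0 <= b ==> 0 <= k ==> ennreal (2 * a + k * b) = 2 * ennreal a + ennreal k * ennreal b"
 by (simp add: ennreal_mult)

lemma sobolev_half_add_cmult:
 assumes \<Omega>: "open \<Omega>" "bounded \<Omega>" and u: "u \<in> sobolev_half \<Omega>" and v: "v \<in> sobolev_half \<Omega>"
 shows "(\<lambda>x. u x + c * v x) \<in> sobolev_half (\<Omega> :: 'a::euclidean_space set)"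
proof -
 let ?N = "volume_on \<Omega>"
 interpret finite_measure ?N by (rule finite_measure_volume_on[OF \<Omega>])
 define g where "g w x y = ennreal ((cmod (w x - w y))^2 / dist x y ^ (DIM('a) + 1))" for w :: "'a => complex" and x y
 have L: "u \<in> L2 ?N" "v \<in> L2 ?N" using u v by (auto simp: sobolev_half_def)
 note [measurable] = L[THEN L2_measurable] measurable_volume_on_id
 have ptw: "g (\<lambda>x. u x + c * v x) x y <= 2 * g u x y + ennreal (2 * (cmod c)^2) * g v x y" for x y
 proof -
  have "(cmod ((u x + c * v x) - (u y + c * v y)))^2 / dist x y ^ (DIM('a) + 1)
   <= (2 * (cmod (u x - u y))^2 + 2 * (cmod c)^2 * (cmod (v x - v y))^2) / dist x y ^ (DIM('a) + 1)"
   by (intro divide_right_mono cmod_lincomb_sq_le) simp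
  also have "\<dots> = 2 * ((cmod (u x - u y))^2 / dist x y ^ (DIM('a) + 1)) + 2 * (cmod c)^2 * ((cmod (v x - v y))^2 / dist x y ^ (DIM('a) + 1))"
   by (simp only: add_divide_distrib times_divide_eq_right)
  finally show ?thesis unfolding g_def
   by (subst ennreal_lincomb[symmetric]) (simp_all add: ennreal_leI del: ennreal_plus)
 qed
 have [measurable]: "(\<lambda>(x, y). g u x y) \<in> borel_measurable (?N \<Otimes>\<^sub>M ?N)" "(\<lambda>(x, y). g v x y) \<in> borel_measurable (?N \<Otimes>\<^sub>M ?N)"
  unfolding g_def by measurable
 have [measurable]: "\<And>x. x \<in> \<Omega> ==> g u x \<in> borel_measurable ?N" "\<And>x. x \<in> \<Omega> ==> g v x \<in> borel_measurable ?N"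
  unfolding g_def by measurable
 have "(\<integral>\<^sup>+x. \<integral>\<^sup>+y. g (\<lambda>x. u x + c * v x) x y \<partial>?N \<partial>?N) <= (\<integral>\<^sup>+x. \<integral>\<^sup>+y. 2 * g u x y + ennreal (2 * (cmod c)^2) * g v x y \<partial>?N \<partial>?N)"
  by (intro nn_integral_mono ptw)
 also have "\<dots> = (\<integral>\<^sup>+x. 2 * (\<integral>\<^sup>+y. g u x y \<partial>?N) + ennreal (2 * (cmod c)^2) * (\<integral>\<^sup>+y. g v x y \<partial>?N) \<partial>?N)"
  by (intro nn_integral_cong) (simp add: nn_integral_add nn_integral_cmult)
 also have "\<dots> = 2 * (\<integral>\<^sup>+x. \<integral>\<^sup>+y. g u x y \<partial>?N \<partial>?N) + ennreal (2 * (cmod c)^2) * (\<integral>\<^sup>+x. \<integral>\<^sup>+y. g v x y \<partial>?N \<partial>?N)"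
  by (subst nn_integral_add) (auto simp: nn_integral_cmult)
 also have "\<dots> < \<infinity>" using u v by (auto simp: sobolev_half_def g_def ennreal_mult_less_top)
 finally show ?thesis
  using L2_add[OF L(1) L2_cmult[OF L(2), of c]] by (simp add: sobolev_half_def g_def)
qed

section \<open>Linearity of the Dirichlet problem\<close>

context collar_domain_surface
begin

abbreviation N :: "'a measure" where
 "N \<equiv> volume_on \<Omega>"

abbreviation boundary_error :: "('a => complex) => ('a => complex) => real => ennreal" where
 "boundary_error u f t \<equiv> \<integral>\<^sup>+x. ennreal ((cmod (u (x + t *\<^sub>R \<nu> x) - f x))^2) \<partial>S"

lemma has_boundary_values_iff:
 "has_boundary_values \<Omega> u f \<longleftrightarrow> (boundary_error u f \<longlongrightarrow> 0) (at_right 0)"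
proof -
 have "(\<integral>\<^sup>+x. ennreal ((cmod (u (x - t *\<^sub>R outward_normal \<Omega> x) - f x))^2) \<partial>S)
  = boundary_error u f t" for t
  by (intro nn_integral_cong) (simp add: space_S outward_normal_eq)
 then show ?thesis unfolding has_boundary_values_def by simp
qed

lemma measurable_S_shifted:
 obtains t0 where "t0 > 0" "\<And>x t. x \<in> frontier \<Omega> ==> 0 < t ==> t < t0 ==> x + t *\<^sub>R \<nu> x \<in> \<Omega>"
  "\<And>(u :: 'a => complex) t. continuous_on \<Omega> u ==> 0 < t ==> t < t0 ==> (\<lambda>x. u (x + t *\<^sub>R \<nu> x)) \<in> borel_measurable S"
proof -
 obtain t0 where t0: "t0 > 0" "\<And>x t. x \<in> frontier \<Omega> ==> 0 < t ==> t < t0 ==> x + t *\<^sub>R \<nu> x \<in> \<Omega>"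
  using inward_segment_in_domain by blast
 have "(\<lambda>x. u (x + t *\<^sub>R \<nu> x)) \<in> borel_measurable S"
  if u: "continuous_on \<Omega> u" and t: "0 < t" "t < t0" for u :: "'a => complex" and t
 proof -
  have "continuous_on (frontier \<Omega>) (\<lambda>x. u (x + t *\<^sub>R \<nu> x))"
   by (rule continuous_on_compose2[OF u]) (use t0(2) t in \<open>auto intro!: continuous_intros inner_normal_continuous\<close>)
  then show ?thesis
   by (subst measurable_cong_sets[OF sets_S refl]) (rule borel_measurable_continuous_on_restrict)
 qed
 then show ?thesis using that t0 by blast
qed

lemma has_boundary_values_add_cmult:
 assumes u: "continuous_on \<Omega> u" "has_boundary_values \<Omega> u f" and f: "f \<in> borel_measurable S"
  and v: "continuous_on \<Omega> v" "has_boundary_values \<Omega> v g" and g: "g \<in> borel_measurable S"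
 shows "has_boundary_values \<Omega> (\<lambda>x. u x + c * v x) (\<lambda>x. f x + c * g x)"
proof -
 obtain t0 where t0: "t0 > 0"
  and m: "\<And>(u :: 'a => complex) t. continuous_on \<Omega> u ==> 0 < t ==> t < t0 ==> (\<lambda>x. u (x + t *\<^sub>R \<nu> x)) \<in> borel_measurable S"
  by (rule measurable_S_shifted) blast
 have le: "boundary_error (\<lambda>x. u x + c * v x) (\<lambda>x. f x + c * g x) t <= 2 * boundary_error u f t + ennreal (2 * (cmod c)^2) * boundary_error v g t" if t: "0 < t" "t < t0" for t
 proof -
  note [measurable] = m[OF u(1) t] m[OF v(1) t] f g
  have "boundary_error (\<lambda>x. u x + c * v x) (\<lambda>x. f x + c * g x) t
   <= (\<integral>\<^sup>+x. 2 * ennreal ((cmod (u (x + t *\<^sub>R \<nu> x) - f x))^2) + ennreal (2 * (cmod c)^2) * ennreal ((cmod (v (x + t *\<^sub>R \<nu> x) - g x))^2) \<partial>S)"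
  proof (rule nn_integral_mono)
   fix x
   let ?a = "u (x + t *\<^sub>R \<nu> x) - f x" and ?b = "v (x + t *\<^sub>R \<nu> x) - g x"
   show "ennreal ((cmod ((u (x + t *\<^sub>R \<nu> x) + c * v (x + t *\<^sub>R \<nu> x)) - (f x + c * g x)))^2)
    <= 2 * ennreal ((cmod ?a)^2) + ennreal (2 * (cmod c)^2) * ennreal ((cmod ?b)^2)"
    by (subst ennreal_lincomb[symmetric]) (simp_all only: ennreal_leI cmod_lincomb_sq_le zero_le_power2 mult_nonneg_nonneg zero_le_numeral)
  qed
  also have "\<dots> = 2 * boundary_error u f t + ennreal (2 * (cmod c)^2) * boundary_error v g t"
   by (simp add: nn_integral_add nn_integral_cmult)
  finally show ?thesis .
 qed
 have ev: "\<forall>\<^sub>F t in at_right 0. boundary_error (\<lambda>x. u x + c * v x) (\<lambda>x. f x + c * g x) t <= 2 * boundary_error u f t + ennreal (2 * (cmod c)^2) * boundary_error v g t"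
  using le t0 unfolding eventually_at_right_field by blast
 have "((\<lambda>t. 2 * boundary_error u f t + ennreal (2 * (cmod c)^2) * boundary_error v g t) \<longlongrightarrow> 2 * 0 + ennreal (2 * (cmod c)^2) * 0) (at_right 0)"
  using u(2) v(2) unfolding has_boundary_values_iff by (intro tendsto_add ennreal_tendsto_cmult) auto
 then have "(boundary_error (\<lambda>x. u x + c * v x) (\<lambda>x. f x + c * g x) \<longlongrightarrow> 0) (at_right 0)"
  by (intro tendsto_sandwich[OF _ ev tendsto_const]) simp_all
 then show ?thesis unfolding has_boundary_values_iff .
qed

lemma dirichlet_solution_add_cmult:
 assumes "dirichlet_solution \<Omega> f u" "dirichlet_solution \<Omega> g v" "f \<in> L2 S" "g \<in> L2 S"
 shows "dirichlet_solution \<Omega> (\<lambda>x. f x + c * g x) (\<lambda>x. u x + c * v x)"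
 using assms unfolding dirichlet_solution_def
 by (auto intro!: sobolev_half_add_cmult harmonic_on_add harmonic_on_cmult has_boundary_values_add_cmult
   harmonic_on_continuous op bd L2_measurable)

end

locale poisson_domain = collar_domain_surface +
 fixes G :: "('a => complex) => 'a => complex"
 assumes G: "poisson_operator \<Omega> G"
begin

lemma G_solution: "f \<in> L2 S ==> dirichlet_solution \<Omega> f (G f)"
 and G_unique: "f \<in> L2 S ==> dirichlet_solution \<Omega> f u ==> x \<in> \<Omega> ==> u x = G f x"
 using G by (auto simp: poisson_operator_def)

lemma G_harmonic: "f \<in> L2 S ==> harmonic_on \<Omega> (G f)"
 and G_L2: "f \<in> L2 S ==> G f \<in> L2 N"
 and G_boundary: "f \<in> L2 S ==> has_boundary_values \<Omega> (G f) f"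
 using G_solution[of f] by (auto simp: dirichlet_solution_def sobolev_half_def)

lemma G_continuous: "f \<in> L2 S ==> continuous_on \<Omega> (G f)"
 by (intro harmonic_on_continuous op G_harmonic)

lemma G_add_cmult: "f \<in> L2 S ==> g \<in> L2 S ==> x \<in> \<Omega> ==> G (\<lambda>x. f x + c * g x) x = G f x + c * G g x"
 by (intro G_unique[symmetric] dirichlet_solution_add_cmult G_solution L2_add L2_cmult)

text \<open>Near the boundary the slices of \<open>G f\<close> have squared norm at most twice that
  of \<open>f\<close> plus a small error, by the definition of boundary values;
  \<open>harmonic_L2_bound\<close> then applies to the real and to the imaginary part. These two
  factors 2 make up the 4 in the constant.\<close>

lemma G_bounded: "\<exists>C>0. \<forall>f\<in>L2 S. (L2.nrm N (G f))^2 <= C * (L2.nrm S f)^2"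
proof -
 obtain C where C: "C >= 0" and est: "\<And>u B t1. harmonic_on \<Omega> u ==> 0 <= B ==> 0 < t1 ==>
   (\<And>t. 0 < t ==> t < t1 ==> (\<integral>\<^sup>+x. ennreal ((u (x + t *\<^sub>R \<nu> x))^2) \<partial>S) <= ennreal B) ==>
   (\<integral>\<^sup>+x. ennreal ((u x)^2) * indicator \<Omega> x \<partial>lborel) <= ennreal (C * B)"
  using harmonic_L2_bound by (elim exE conjE) (rule that, assumption, blast)
 obtain t0 where t0: "t0 > 0"
  and m: "\<And>(u :: 'a => complex) t. continuous_on \<Omega> u ==> 0 < t ==> t < t0 ==> (\<lambda>x. u (x + t *\<^sub>R \<nu> x)) \<in> borel_measurable S"
  by (rule measurable_S_shifted) blast
 have "(L2.nrm N (G f))^2 <= (4 * C + 1) * (L2.nrm S f)^2" if f: "f \<in> L2 S" for f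
 proof (rule field_le_epsilon)
  fix d :: real assume d: "d > 0"
  define u where "u = G f"
  define \<delta> where "\<delta> = d / (4 * C + 1)"
  have \<delta>: "\<delta> > 0" "4 * C * \<delta> <= d" using d C by (auto simp: \<delta>_def field_simps)
  define B where "B = 2 * \<delta> + 2 * (L2.nrm S f)^2"
  have B: "B >= 0" using \<delta> by (simp add: B_def)
  have uc: "continuous_on \<Omega> u" unfolding u_def by (rule G_continuous[OF f])
  have "\<forall>\<^sub>F t in at_right 0. boundary_error u f t < ennreal \<delta>"
   using G_boundary[OF f] \<delta>(1) unfolding has_boundary_values_iff u_def by (intro order_tendstoD) auto
  then obtain t2 where t2: "t2 > 0" "\<And>t. 0 < t ==> t < t2 ==> boundary_error u f t < ennreal \<delta>"
   unfolding eventually_at_right_field by auto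
  define t1 where "t1 = min t0 t2"
  have t1: "t1 > 0" using t0 t2 by (simp add: t1_def)
  have bd1: "(\<integral>\<^sup>+x. ennreal ((cmod (u (x + t *\<^sub>R \<nu> x)))^2) \<partial>S) <= ennreal B" if t: "0 < t" "t < t1" for t
  proof -
   have [measurable]: "(\<lambda>x. u (x + t *\<^sub>R \<nu> x)) \<in> borel_measurable S" using t by (intro m[OF uc]) (auto simp: t1_def)
   note [measurable] = L2_measurable[OF f]
   have "(\<integral>\<^sup>+x. ennreal ((cmod (u (x + t *\<^sub>R \<nu> x)))^2) \<partial>S)
    <= (\<integral>\<^sup>+x. 2 * ennreal ((cmod (u (x + t *\<^sub>R \<nu> x) - f x))^2) + 2 * ennreal ((cmod (f x))^2) \<partial>S)"
   proof (rule nn_integral_mono)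
    fix x
    have "ennreal ((cmod (u (x + t *\<^sub>R \<nu> x)))^2) <= ennreal (2 * (cmod (u (x + t *\<^sub>R \<nu> x) - f x))^2 + 2 * (cmod (f x))^2)"
     using cmod_add_sq_le[of "u (x + t *\<^sub>R \<nu> x) - f x" "f x"] by (intro ennreal_leI) simp
    then show "ennreal ((cmod (u (x + t *\<^sub>R \<nu> x)))^2) <= 2 * ennreal ((cmod (u (x + t *\<^sub>R \<nu> x) - f x))^2) + 2 * ennreal ((cmod (f x))^2)"
     using ennreal_lincomb[of "(cmod (u (x + t *\<^sub>R \<nu> x) - f x))^2" "(cmod (f x))^2" 2]
     by (simp del: ennreal_plus)
   qed
   also have "\<dots> = 2 * boundary_error u f t + 2 * (\<integral>\<^sup>+x. ennreal ((cmod (f x))^2) \<partial>S)"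
    by (simp add: nn_integral_add nn_integral_cmult)
   also have "\<dots> <= 2 * ennreal \<delta> + 2 * ennreal ((L2.nrm S f)^2)"
    using t2(2)[of t] t by (intro add_mono mult_left_mono) (auto simp: L2_nn_integral[OF f] t1_def)
   also have "\<dots> = ennreal B" using \<delta> ennreal_lincomb[of \<delta> "(L2.nrm S f)^2" 2]
    by (simp add: B_def del: ennreal_plus)
   finally show ?thesis .
  qed
  have half: "(\<integral>\<^sup>+x. ennreal ((p (u x))^2) * indicator \<Omega> x \<partial>lborel) <= ennreal (C * B)"
   if p: "harmonic_on \<Omega> (\<lambda>x. p (u x))" "\<And>z. (p z)^2 <= (cmod z)^2" for p :: "complex => real"
   by (rule est[OF p(1) B t1 order_trans[OF nn_integral_mono bd1]]) (auto intro: ennreal_leI p(2))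
  have um: "u \<in> borel_measurable N" unfolding u_def by (rule L2_measurable[OF G_L2[OF f]])
  have "ennreal ((L2.nrm N u)^2) = (\<integral>\<^sup>+x. ennreal ((Re (u x))^2) + ennreal ((Im (u x))^2) \<partial>N)"
   using L2_nn_integral[OF G_L2[OF f]] by (simp add: u_def cmod_power2)
  also have "\<dots> = (\<integral>\<^sup>+x. ennreal ((Re (u x))^2) \<partial>N) + (\<integral>\<^sup>+x. ennreal ((Im (u x))^2) \<partial>N)"
   using um by (intro nn_integral_add) auto
  also have "\<dots> <= ennreal (C * B) + ennreal (C * B)"
   unfolding nn_integral_volume_on[OF op] u_def
   by (intro add_mono half[unfolded u_def] harmonic_on_Re harmonic_on_Im op G_harmonic f) (auto simp: cmod_power2)
  also have "\<dots> = ennreal (2 * (C * B))" using C B by (simp add: ennreal_plus[symmetric] del: ennreal_plus)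
  finally have "(L2.nrm N u)^2 <= 2 * (C * B)" using C B by (simp add: ennreal_le_iff)
  also have "\<dots> = 4 * C * \<delta> + 4 * C * (L2.nrm S f)^2" by (simp add: B_def algebra_simps)
  also have "\<dots> <= (4 * C + 1) * (L2.nrm S f)^2 + d" using \<delta>(2) zero_le_power2[of "L2.nrm S f"] unfolding distrib_right by linarith
  finally show "(L2.nrm N (G f))^2 <= (4 * C + 1) * (L2.nrm S f)^2 + d" by (simp add: u_def)
 qed
 then show ?thesis using C by (intro exI[of _ "4 * C + 1"]) auto
qed

text \<open>If \<open>G f\<close> vanishes, its boundary error is constantly the squared norm of
  \<open>f\<close>, and it tends to zero.\<close>

lemma G_injective:
 assumes f: "f \<in> L2 S" and 0: "AE x in N. G f x = 0"
 shows "AE x in S. f x = 0"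
proof -
 have G0: "G f x = 0" if "x \<in> \<Omega>" for x
  using continuous_AE_zero_imp_zero[OF op G_continuous[OF f] _ that] 0 by (simp add: AE_volume_on op)
 obtain t0 where t0: "t0 > 0" "\<And>x t. x \<in> frontier \<Omega> ==> 0 < t ==> t < t0 ==> x + t *\<^sub>R \<nu> x \<in> \<Omega>"
  by (rule measurable_S_shifted) blast
 define c where "c = (\<integral>\<^sup>+x. ennreal ((cmod (f x))^2) \<partial>S)"
 have "boundary_error (G f) f t = c" if "0 < t" "t < t0" for t
  unfolding c_def by (intro nn_integral_cong) (use that t0(2) G0 in \<open>auto simp: space_S\<close>)
 then have "\<forall>\<^sub>F t in at_right 0. boundary_error (G f) f t = c"
  using t0(1) unfolding eventually_at_right_field by blast
 from tendsto_cong[OF this, of 0] have "((\<lambda>t::real. c) \<longlongrightarrow> 0) (at_right 0)"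
  using G_boundary[OF f] unfolding has_boundary_values_iff by blast
 then have "c = 0" by (simp add: tendsto_const_iff)
 then show ?thesis unfolding c_def using L2_measurable[OF f] by (subst (asm) nn_integral_0_iff_AE) auto
qed

end

text \<open>Cover the punctured ball by the dyadic balls of radius \<open>\<rho> / 2\<^sup>k\<close>.\<close>

lemma nn_integral_riesz_kernel_finite:
 assumes \<rho>: "\<rho> > 0" and d: "DIM('a::euclidean_space) = Suc m"
 shows "\<exists>C::real. \<forall>x. (\<integral>\<^sup>+y. ennreal (1 / dist x y ^ m) * indicator (cball x \<rho> - {x}) y \<partial>(lborel :: 'a measure)) <= ennreal C"
proof -
 define w where "w = unit_ball_vol (real (Suc m))"
 have w: "w >= 0" by (simp add: w_def)
 define r where "r k = \<rho> / 2 ^ k" for k :: nat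
 have r: "r k > 0" for k using \<rho> by (simp add: r_def)
 define a where "a k = w * 2 ^ m * r k" for k
 have rh: "\<rho> / 2 ^ Suc k = r k / 2" for k by (simp add: r_def)
 have "summable a"
 proof -
  have "summable (\<lambda>k. w * 2 ^ m * \<rho> * (1/2) ^ k)" by (intro summable_mult summable_geometric) simp
  moreover have "(\<lambda>k. w * 2 ^ m * \<rho> * (1/2) ^ k) = a" by (simp add: a_def r_def power_divide fun_eq_iff)
  ultimately show ?thesis by simp
 qed
 have "(\<integral>\<^sup>+y. ennreal (1 / dist x y ^ m) * indicator (cball x \<rho> - {x}) y \<partial>lborel) <= ennreal (suminf a)" for x :: 'a
 proof -
  have "ennreal (1 / dist x y ^ m) * indicator (cball x \<rho> - {x}) y <= (\<Sum>k. ennreal (1 / (r k / 2) ^ m) * indicator (cball x (r k)) y)" for y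
  proof (cases "y \<in> cball x \<rho> - {x}")
   case True
   define s where "s = dist x y"
   have s: "0 < s" "s <= \<rho>" using True by (auto simp: s_def)
   \<comment> \<open>The dyadic shell containing \<open>y\<close>:
     \<open>r (k + 1) < s <= r k\<close>.\<close>
   define k where "k = (LEAST k. r (Suc k) < s)"
   have "r \<longlonglongrightarrow> 0" unfolding r_def by (rule LIMSEQ_divide_realpow_zero) simp
   then have "eventually (\<lambda>n. r n < s) sequentially" using s(1) by (rule order_tendstoD)
   then have ex: "\<exists>k. r (Suc k) < s" unfolding eventually_sequentially by (meson le_SucI order_refl)
   have k1: "r (Suc k) < s" unfolding k_def by (rule LeastI_ex[OF ex])
   have k2: "s <= r k"
   proof (cases k)
    case (Suc j)
    then have "\<not> r (Suc j) < s" using not_less_Least[of j "\<lambda>k. r (Suc k) < s"] by (simp add: k_def)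
    then show ?thesis using Suc by simp
   qed (use s in \<open>simp add: r_def\<close>)
   have "1 / s ^ m <= 1 / (r k / 2) ^ m"
    using k1 r[of k] s(1) unfolding r_def rh by (intro divide_left_mono power_mono mult_pos_pos zero_less_power) (auto simp: r_def)
   then have "ennreal (1 / dist x y ^ m) * indicator (cball x \<rho> - {x}) y <= ennreal (1 / (r k / 2) ^ m) * indicator (cball x (r k)) y"
    using True k2 by (simp add: s_def ennreal_leI)
   also have "\<dots> <= (\<Sum>k. ennreal (1 / (r k / 2) ^ m) * indicator (cball x (r k)) y)"
   proof -
    define q where "q k = ennreal (1 / (r k / 2) ^ m) * indicator (cball x (r k)) y" for k
    have "q k <= suminf q" using sum_le_suminf[OF summableI, of "{k}" q] by simp
    then show ?thesis unfolding q_def .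
   qed
   finally show ?thesis .
  qed simp
  then have "(\<integral>\<^sup>+y. ennreal (1 / dist x y ^ m) * indicator (cball x \<rho> - {x}) y \<partial>lborel)
   <= (\<integral>\<^sup>+y. (\<Sum>k. ennreal (1 / (r k / 2) ^ m) * indicator (cball x (r k)) y) \<partial>lborel)"
   by (rule nn_integral_mono)
  also have "\<dots> = (\<Sum>k. \<integral>\<^sup>+y. ennreal (1 / (r k / 2) ^ m) * indicator (cball x (r k)) y \<partial>lborel)"
  proof (rule nn_integral_suminf)
   fix k
   have "indicator (cball x (r k)) \<in> borel_measurable lborel" by (rule borel_measurable_indicator) auto
   then show "(\<lambda>y. ennreal (1 / (r k / 2) ^ m) * indicator (cball x (r k)) y) \<in> borel_measurable lborel" by measurable
  qed
  also have "\<dots> = (\<Sum>k. ennreal (a k))"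
  proof (rule suminf_cong)
   fix k
   have "(\<integral>\<^sup>+y. ennreal (1 / (r k / 2) ^ m) * indicator (cball x (r k)) y \<partial>lborel) = ennreal (1 / (r k / 2) ^ m) * ennreal (w * r k ^ Suc m)"
    using r[of k] by (simp add: nn_integral_cmult_indicator emeasure_cball d w_def less_imp_le)
   also have "\<dots> = ennreal (1 / (r k / 2) ^ m * (w * r k ^ Suc m))" using r[of k] w by (intro ennreal_mult[symmetric]) auto
   also have "1 / (r k / 2) ^ m * (w * r k ^ Suc m) = a k" using r[of k] by (simp add: a_def power_divide)
   finally show "(\<integral>\<^sup>+y. ennreal (1 / (r k / 2) ^ m) * indicator (cball x (r k)) y \<partial>lborel) = ennreal (a k)" .
  qed
  also have "\<dots> = ennreal (suminf a)"
   by (rule suminf_ennreal2[OF _ \<open>summable a\<close>]) (use w r[THEN less_imp_le] in \<open>simp add: a_def\<close>)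
  finally show ?thesis .
 qed
 then show ?thesis by blast
qed

text \<open>The Lipschitz bound cancels two powers of the distance and leaves the integrable kernel
  \<open>|x - y|^(1-d)\<close>.\<close>

lemma sobolev_half_Lipschitz:
 fixes \<Omega> :: "'a::euclidean_space set" and u :: "'a => complex"
 assumes \<Omega>: "open \<Omega>" "bounded \<Omega>" "\<Omega> \<noteq> {}" and u: "\<And>x y. x \<in> \<Omega> ==> y \<in> \<Omega> ==> cmod (u x - u y) <= L * dist x y"
 shows "u \<in> sobolev_half \<Omega>"
proof -
 let ?q = "\<lambda>x y. (cmod (u x - u y))^2 / dist x y ^ (DIM('a) + 1)"
 interpret finite_measure "volume_on \<Omega>" by (rule finite_measure_volume_on[OF \<Omega>(1,2)])
 obtain \<rho> where \<rho>: "\<rho> > 0" "\<And>x y. x \<in> \<Omega> ==> y \<in> \<Omega> ==> dist x y <= \<rho>"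
 proof -
  have "dist x y <= diameter \<Omega> + 1" if "x \<in> \<Omega>" "y \<in> \<Omega>" for x y
   using diameter_bounded_bound[OF \<Omega>(2) that] by simp
  then show ?thesis using that[of "diameter \<Omega> + 1"] diameter_ge_0[OF \<Omega>(2)] by auto
 qed
 have uc: "continuous_on \<Omega> u"
 proof (rule lipschitz_on_continuous_on[OF lipschitz_onI])
  show "dist (u x) (u y) <= \<bar>L\<bar> * dist x y" if "x \<in> \<Omega>" "y \<in> \<Omega>" for x y
   using order_trans[OF u[OF that] mult_right_mono[OF abs_ge_self]] by (simp add: dist_norm)
 qed simp
 obtain m where m: "DIM('a) = Suc m" using DIM_positive gr0_implies_Suc by blast
 obtain C where C: "\<And>x::'a. (\<integral>\<^sup>+y. ennreal (1 / dist x y ^ m) * indicator (cball x \<rho> - {x}) y \<partial>lborel) <= ennreal C"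
  using nn_integral_riesz_kernel_finite[OF \<rho>(1) m] by blast
 have ptw: "ennreal (?q x y) * indicator \<Omega> y
  <= ennreal (L^2) * (ennreal (1 / dist x y ^ m) * indicator (cball x \<rho> - {x}) y)" if x: "x \<in> \<Omega>" for x y
 proof (cases "y \<in> \<Omega> \<and> y \<noteq> x")
  case True
  then have dp: "dist x y > 0" by auto
  have "(cmod (u x - u y))^2 <= (L * dist x y)^2" using u[OF x, of y] True by (intro power_mono) auto
  then have "(cmod (u x - u y))^2 / dist x y ^ (DIM('a) + 1) <= (L * dist x y)^2 / dist x y ^ (DIM('a) + 1)"
   by (intro divide_right_mono) auto
  also have "\<dots> = L^2 * (1 / dist x y ^ m)" using dp by (simp add: m power_mult_distrib power2_eq_square)
  finally have "ennreal (?q x y) <= ennreal (L^2 * (1 / dist x y ^ m))" by (rule ennreal_leI)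
  also have "\<dots> = ennreal (L^2) * ennreal (1 / dist x y ^ m)" by (rule ennreal_mult) auto
  finally show ?thesis using True \<rho>(2)[OF x, of y] by simp
 qed (auto simp: indicator_def)
 have "(\<integral>\<^sup>+x. \<integral>\<^sup>+y. ennreal (?q x y) \<partial>volume_on \<Omega> \<partial>volume_on \<Omega>)
  <= (\<integral>\<^sup>+x. ennreal (L^2) * ennreal C \<partial>volume_on \<Omega>)"
 proof (rule nn_integral_mono)
  fix x assume "x \<in> space (volume_on \<Omega>)"
  then have x: "x \<in> \<Omega>" by simp
  have [measurable]: "cball x \<rho> - {x} \<in> sets lborel" by auto
  have "(\<integral>\<^sup>+y. ennreal (?q x y) \<partial>volume_on \<Omega>)
   <= (\<integral>\<^sup>+y. ennreal (L^2) * (ennreal (1 / dist x y ^ m) * indicator (cball x \<rho> - {x}) y) \<partial>lborel)"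
   unfolding nn_integral_volume_on[OF \<Omega>(1)] by (intro nn_integral_mono ptw x)
  also have "\<dots> = ennreal (L^2) * (\<integral>\<^sup>+y. ennreal (1 / dist x y ^ m) * indicator (cball x \<rho> - {x}) y \<partial>lborel)"
   by (rule nn_integral_cmult) measurable
  also have "\<dots> <= ennreal (L^2) * ennreal C" by (intro mult_left_mono C) simp
  finally show "(\<integral>\<^sup>+y. ennreal (?q x y) \<partial>volume_on \<Omega>) <= ennreal (L^2) * ennreal C" .
 qed
 also have "\<dots> < \<infinity>" by (simp add: emeasure_eq_measure ennreal_mult_less_top)
 finally have fin: "(\<integral>\<^sup>+x. \<integral>\<^sup>+y. ennreal (?q x y) \<partial>volume_on \<Omega> \<partial>volume_on \<Omega>) < \<infinity>" .
 have "u \<in> L2 (volume_on \<Omega>)"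
 proof -
  obtain x0 where x0: "x0 \<in> \<Omega>" using \<Omega>(3) by blast
  have bnd: "cmod (u x) <= cmod (u x0) + \<bar>L\<bar> * \<rho>" if "x \<in> \<Omega>" for x
  proof -
   have "cmod (u x - u x0) <= L * dist x x0" using u that x0 by blast
   also have "\<dots> <= \<bar>L\<bar> * \<rho>" using \<rho>(2)[OF that x0] by (intro mult_mono) auto
   finally show ?thesis using norm_triangle_ineq2[of "u x" "u x0"] by simp
  qed
  show ?thesis
   by (rule L2_dominated[where g = "\<lambda>x. (cmod (u x0) + \<bar>L\<bar> * \<rho>)^2"])
    (auto intro!: AE_I2 power_mono bnd measurable_volume_on_continuous[OF uc])
 qed
 then show ?thesis using fin by (simp add: sobolev_half_def)
qed

section \<open>Closedness of the harmonic space, and density of the range of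
  \<open>G\<close>\<close>

context poisson_domain
begin

abbreviation point_source :: "real => 'a => 'a => complex" where
 "point_source r z \<equiv> \<lambda>x. complex_of_real (source r (z - x))"

text \<open>The source kernels with poles outside \<open>\<Omega>\<close> are globally smooth, so that they attain their boundary values uniformly.\<close>

lemma source_in_range:
 assumes r: "r > 0" "infdist z \<Omega> > r"
 defines "k \<equiv> point_source r z"
 shows "k \<in> L2 S" "x \<in> \<Omega> ==> G k x = k x"
proof -
 have C2: "C2_on UNIV (\<lambda>x. source r (z - x)) (\<lambda>x h. - source' r (z - x) h) (\<lambda>b x h. source'' r b (z - x) h)"
  by (rule C2_on_shift[OF source_C2[OF r(1)]])
 obtain R where R: "closure \<Omega> \<subseteq> cball 0 R" "R >= 0" by (rule closure_in_ball)
 obtain L where L: "L >= 0" "\<And>x y. x \<in> cball 0 R ==> y \<in> cball 0 R ==> \<bar>source r (z - x) - source r (z - y)\<bar> <= L * norm (x - y)"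
  by (rule C1_Lipschitz_cball[OF C2_onD1[OF C2]]) (rule that)
 have kl: "cmod (k x - k y) <= L * dist x y" if "x \<in> closure \<Omega>" "y \<in> closure \<Omega>" for x y
  using L(2)[of x y] subsetD[OF R(1) that(1)] subsetD[OF R(1) that(2)] by (simp add: k_def dist_norm of_real_diff[symmetric] del: of_real_diff)
 have sob: "k \<in> sobolev_half \<Omega>" using closure_subset[of \<Omega>] by (intro sobolev_half_Lipschitz[of _ _ L] op bd ne kl) auto
 have hr: "harmonic_on \<Omega> (\<lambda>x. source r (z - x))"
  unfolding harmonic_on_iff[OF op]
 proof (intro exI conjI ballI)
  show "C2_on \<Omega> (\<lambda>x. source r (z - x)) (\<lambda>x h. - source' r (z - x) h) (\<lambda>b x h. source'' r b (z - x) h)"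
   by (rule C2_on_subset[OF C2]) simp
  fix x assume x: "x \<in> \<Omega>"
  have "r < norm (z - x)" using r(2) infdist_le[OF x, of z] by (simp add: dist_norm)
  then show "trace2 (\<lambda>b x h. source'' r b (z - x) h) x = 0"
   using mollifier_outside[of r "z - x"] r(1) by (simp add: trace2_shift trace2_source)
 qed
 have har: "harmonic_on \<Omega> k" unfolding k_def by (rule harmonic_on_bounded_linear[OF op bounded_linear_of_real hr])
 interpret S: finite_measure S by (rule finite_measure_S)
 obtain t0 where t0: "t0 > 0" "\<And>x t. x \<in> frontier \<Omega> ==> 0 < t ==> t < t0 ==> x + t *\<^sub>R \<nu> x \<in> \<Omega>"
  by (rule measurable_S_shifted) blast
 have bv: "has_boundary_values \<Omega> k k"
  unfolding has_boundary_values_iff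
 proof (rule tendsto_sandwich[OF _ _ tendsto_const])
  have "((\<lambda>t. (L * t)^2 * measure S (space S)) \<longlongrightarrow> (L * 0)^2 * measure S (space S)) (at_right 0)" by (intro tendsto_intros)
  then show "((\<lambda>t. ennreal ((L * t)^2 * measure S (space S))) \<longlongrightarrow> 0) (at_right 0)" using tendsto_ennrealI by fastforce
  have "boundary_error k k t <= ennreal ((L * t)^2 * measure S (space S))"
   if t: "0 < t" "t < t0" for t
  proof -
   have "boundary_error k k t <= (\<integral>\<^sup>+x. ennreal ((L * t)^2) \<partial>S)"
   proof (intro nn_integral_mono ennreal_leI power_mono)
    fix x assume "x \<in> space S"
    then have x: "x \<in> frontier \<Omega>" by (simp add: space_S)
    then have "cmod (k (x + t *\<^sub>R \<nu> x) - k x) <= L * dist (x + t *\<^sub>R \<nu> x) x"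
     using t0(2)[OF x t] closure_subset[of \<Omega>] by (intro kl) (auto simp: frontier_iff)
    then show "cmod (k (x + t *\<^sub>R \<nu> x) - k x) <= L * t"
     using norm_inner_normal[OF x] t by (simp add: dist_norm)
   qed simp
   also have "\<dots> = ennreal ((L * t)^2 * measure S (space S))"
    by (simp add: S.emeasure_eq_measure ennreal_mult)
   finally show ?thesis .
  qed
  then show "\<forall>\<^sub>F t in at_right 0. boundary_error k k t <= ennreal ((L * t)^2 * measure S (space S))"
   using t0(1) unfolding eventually_at_right_field by blast
 qed simp
 show kS: "k \<in> L2 S"
 proof -
  have kc: "continuous_on UNIV k" unfolding k_def by (intro continuous_intros C2_on_cont[OF C2])
  have km: "k \<in> borel_measurable S"
   by (subst measurable_cong_sets[OF sets_S refl]) (intro borel_measurable_continuous_on_restrict continuous_on_subset[OF kc] subset_UNIV)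
  obtain B where B: "\<And>x. x \<in> frontier \<Omega> ==> norm (k x) <= B"
   by (rule continuous_on_compact_bound[OF frontier_compact continuous_on_subset[OF kc]]) auto
  show ?thesis
   by (rule L2_dominated[OF km, where g = "\<lambda>x. B^2"]) (use B in \<open>auto intro!: AE_I2 power_mono simp: space_S\<close>)
 qed
 show "G k x = k x" if "x \<in> \<Omega>"
  by (rule G_unique[OF kS _ that, symmetric]) (simp add: dirichlet_solution_def sob har bv)
qed

abbreviation K :: "('a => complex) set" where
 "K \<equiv> harmonic_L2 \<Omega>"

lemma K_L2: "v \<in> K ==> v \<in> L2 N"
 by (simp add: harmonic_L2_def)

lemma K_add_cmult: "u \<in> K ==> v \<in> K ==> (\<lambda>x. u x + c * v x) \<in> K"
proof -
 assume u: "u \<in> K" and v: "v \<in> K"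
 then obtain hu hv where h: "harmonic_on \<Omega> hu" "AE x in N. u x = hu x" "harmonic_on \<Omega> hv" "AE x in N. v x = hv x"
  by (auto simp: harmonic_L2_def)
 have "harmonic_on \<Omega> (\<lambda>x. hu x + c * hv x)" by (intro harmonic_on_add harmonic_on_cmult op h)
 moreover have "AE x in N. u x + c * v x = hu x + c * hv x" using h(2,4) by eventually_elim simp
 ultimately show ?thesis using L2_add[OF K_L2[OF u] L2_cmult[OF K_L2[OF v], of c]] by (auto simp: harmonic_L2_def)
qed

lemma K_zero: "(\<lambda>x. 0) \<in> K"
 using L2_zero[of N] harmonic_on_const[OF op, of "0::complex"] by (auto simp: harmonic_L2_def)

lemma K_add: "u \<in> K ==> v \<in> K ==> (\<lambda>x. u x + v x) \<in> K"
 and K_cmult: "v \<in> K ==> (\<lambda>x. c * v x) \<in> K"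
 using K_add_cmult[of u v 1] K_add_cmult[OF K_zero, of v c] by auto

lemma G_K: "f \<in> L2 S ==> G f \<in> K"
 using G_L2[of f] G_harmonic[of f] by (auto simp: harmonic_L2_def)

lemma L2_imp_integrable:
 assumes f: "f \<in> L2 N"
 shows "integrable N f"
proof -
 interpret finite_measure N by (rule finite_measure_volume_on[OF op bd])
 have "(\<lambda>x. 1) \<in> L2 N" by (simp add: L2_def)
 from L2_inner_integrable[OF f this] show ?thesis by simp
qed

lemma integral_cmod_le:
 assumes f: "f \<in> L2 N"
 shows "(LINT x|N. cmod (f x)) <= sqrt (measure N \<Omega>) * L2.nrm N f"
proof -
 interpret finite_measure N by (rule finite_measure_volume_on[OF op bd])
 define g where "g x = complex_of_real (cmod (f x))" for x
 have m[measurable]: "f \<in> borel_measurable N" by (rule L2_measurable[OF f])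
 have "g \<in> borel_measurable N" unfolding g_def by measurable
 then have g: "g \<in> L2 N" using L2_integrable[OF f] by (simp add: g_def L2_def)
 have 1: "(\<lambda>x. 1) \<in> L2 N" by (simp add: L2_def)
 have "l2_inner N g (\<lambda>x. 1) = complex_of_real (LINT x|N. cmod (f x))" by (simp add: l2_inner_def g_def)
 moreover have "0 <= (LINT x|N. cmod (f x))" by simp
 ultimately have "(LINT x|N. cmod (f x)) = cmod (l2_inner N g (\<lambda>x. 1))" by (simp add: norm_of_real)
 also have "\<dots> <= L2.nrm N g * L2.nrm N (\<lambda>x. 1)" by (rule L2.Cauchy_Schwarz[OF g 1])
 also have "L2.nrm N g = L2.nrm N f" unfolding L2_nrm_eq[OF g] L2_nrm_eq[OF f] by (simp add: l2_norm_def g_def)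
 also have "L2.nrm N (\<lambda>x. 1) = sqrt (measure N \<Omega>)" unfolding L2_nrm_eq[OF 1] by (simp add: l2_norm_def)
 finally show ?thesis by (simp add: mult.commute)
qed

lemma set_integrable_N: "set_integrable lborel \<Omega> f \<longleftrightarrow> integrable N f"
 and set_integral_N: "(LINT x:\<Omega>|lborel. f x) = integral\<^sup>L N f" for f :: "'a => real"
 using op by (simp_all add: volume_on_def set_integrable_def set_lebesgue_integral_def integrable_restrict_space integral_restrict_space)

text \<open>On a bounded domain convergence in the square mean implies convergence in the mean, to
  which \<open>harmonic_L1_limit\<close> applies for the real and imaginary parts.\<close>

lemma K_closed:
 assumes s: "\<And>n::nat. s n \<in> K" and l: "l \<in> L2 N" and lim: "(\<lambda>n. L2.nrm N (s n - l)) \<longlonglongrightarrow> 0"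
 shows "l \<in> K"
proof -
 obtain h where h: "\<And>n. harmonic_on \<Omega> (h n)" "\<And>n. AE x in N. s n x = h n x"
 proof -
  have "\<forall>n. \<exists>h. harmonic_on \<Omega> h \<and> (AE x in N. s n x = h x)" using s by (simp add: harmonic_L2_def)
  from choice[OF this] show ?thesis using that by blast
 qed
 have part: "\<exists>g. harmonic_on \<Omega> g \<and> (AE x in N. p (l x) = g x)"
  if p: "bounded_linear p" "\<And>z. \<bar>p z\<bar> <= cmod z" for p :: "complex => real"
 proof -
  have hp: "\<And>n. harmonic_on \<Omega> (\<lambda>x. p (h n x))" by (rule harmonic_on_bounded_linear[OF op p(1) h(1)])
  have hm: "h n \<in> borel_measurable N" for n by (rule measurable_volume_on_continuous[OF harmonic_on_continuous[OF op h(1)]])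
  have hL: "h n \<in> L2 N" for n by (rule L2_cong_AE[OF K_L2[OF s] hm h(2)])
  have int: "integrable N (\<lambda>x. p (f x))" if "f \<in> L2 N" for f
   by (rule integrable_bounded_linear[OF p(1) L2_imp_integrable[OF that]])
  have le: "(LINT x|N. \<bar>p (h n x) - p (l x)\<bar>) <= sqrt (measure N \<Omega>) * L2.nrm N (s n - l)" for n
  proof -
   have d: "(\<lambda>x. s n x - l x) \<in> L2 N" by (rule L2_diff[OF K_L2[OF s] l])
   have "(LINT x|N. \<bar>p (h n x) - p (l x)\<bar>) <= (LINT x|N. cmod (s n x - l x))"
   proof (rule integral_mono_AE)
    show "integrable N (\<lambda>x. \<bar>p (h n x) - p (l x)\<bar>)" by (intro integrable_abs Bochner_Integration.integrable_diff int hL l)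
    show "integrable N (\<lambda>x. cmod (s n x - l x))" by (intro integrable_norm L2_imp_integrable d)
    show "AE x in N. \<bar>p (h n x) - p (l x)\<bar> <= cmod (s n x - l x)"
     using h(2)[of n] by eventually_elim (simp add: p(2) linear_diff[OF bounded_linear.linear[OF p(1)], symmetric])
   qed
   also have "\<dots> <= sqrt (measure N \<Omega>) * L2.nrm N (\<lambda>x. s n x - l x)" by (rule integral_cmod_le[OF d])
   finally show ?thesis by (simp add: fun_diff_def)
  qed
  have "(\<lambda>n. sqrt (measure N \<Omega>) * L2.nrm N (s n - l)) \<longlonglongrightarrow> sqrt (measure N \<Omega>) * 0" by (intro tendsto_intros lim)
  then have "(\<lambda>n. LINT x|N. \<bar>p (h n x) - p (l x)\<bar>) \<longlonglongrightarrow> 0"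
   by (intro tendsto_sandwich[OF _ _ tendsto_const, of _ "\<lambda>n. LINT x|N. \<bar>p (h n x) - p (l x)\<bar>" _ "\<lambda>n. sqrt (measure N \<Omega>) * L2.nrm N (s n - l)"])
    (auto intro!: always_eventually le)
  then have "(\<lambda>n. LINT x:\<Omega>|lborel. \<bar>p (h n x) - p (l x)\<bar>) \<longlonglongrightarrow> 0" unfolding set_integral_N .
  from harmonic_L1_limit[OF op bd hp _ _ this] obtain g where "harmonic_on \<Omega> g" "AE x in lborel. x \<in> \<Omega> --> p (l x) = g x"
   unfolding set_integrable_N using int hL l by blast
  then show ?thesis by (auto simp: AE_volume_on op)
 qed
 obtain g where g: "harmonic_on \<Omega> g" "AE x in N. Re (l x) = g x" using part[OF bounded_linear_Re abs_Re_le_cmod] by blast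
 obtain k where k: "harmonic_on \<Omega> k" "AE x in N. Im (l x) = k x" using part[OF bounded_linear_Im abs_Im_le_cmod] by blast
 have "AE x in N. l x = Complex (g x) (k x)" using g(2) k(2) by eventually_elim (simp add: complex_eq_iff)
 then show ?thesis using l harmonic_on_complex[OF op g(1) k(1)] by (auto simp: harmonic_L2_def)
qed

lemma semi_hilbert_K: "semi_hilbert K L2_scale (l2_inner N)"
proof (rule semi_hilbert_L2_closed_subspace)
 show "K \<subseteq> L2 N" by (auto intro: K_L2)
 show "l \<in> K" if "\<And>n::nat. s n \<in> K" "l \<in> L2 N" "(\<lambda>n. L2.nrm N (s n - l)) \<longlonglongrightarrow> 0" for s l
  by (rule K_closed[OF that])
qed (rule K_zero, erule (1) K_add, erule K_cmult)

sublocale K: semi_hilbert K L2_scale "l2_inner N"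
 by (rule semi_hilbert_K)

text \<open>The sources are real valued, so orthogonality passes to the real and imaginary parts of
  the harmonic representative \<open>h\<close>, and
  \<open>harmonic_orthogonal_to_exterior_sources\<close> applies to each.\<close>

lemma orthogonal_to_range_imp_zero:
 assumes v: "v \<in> K" and orth: "\<And>f. f \<in> L2 S ==> l2_inner N (G f) v = 0"
 shows "AE x in N. v x = 0"
proof -
 obtain h where h: "harmonic_on \<Omega> h" "AE x in N. v x = h x" using v by (auto simp: harmonic_L2_def)
 have hm: "h \<in> borel_measurable N" by (rule measurable_volume_on_continuous[OF harmonic_on_continuous[OF op h(1)]])
 have hL: "h \<in> L2 N" by (rule L2_cong_AE[OF K_L2[OF v] hm h(2)])
 obtain \<eta> where \<eta>: "\<eta> > 0" "\<And>x. infdist x \<Omega> <= \<eta> ==> F x < \<eta> ==> 1/2 <= (gradsq F' x)"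
  using gradient_lower_bound by blast
 have ker: "l2_inner N (point_source r z) h = 0"
  and kL: "(point_source r z) \<in> L2 N" if r: "r > 0" "infdist z \<Omega> > r" for r z
 proof -
  note k = source_in_range[OF r]
  have km: "(point_source r z) \<in> borel_measurable N"
   by (intro measurable_volume_on_continuous continuous_intros C2_on_cont[OF C2_on_shift[OF source_C2[OF r(1)]]])
  have ae: "AE x in N. G (point_source r z) x = complex_of_real (source r (z - x))"
   using k(2) by (intro AE_I2) simp
  show "(point_source r z) \<in> L2 N" by (rule L2_cong_AE[OF G_L2[OF k(1)] km ae])
  have "l2_inner N (G (point_source r z)) v = l2_inner N (point_source r z) h"
   by (rule l2_inner_cong_AE[OF ae h(2) _ km _ hm]) (use L2_measurable[OF G_L2[OF k(1)]] L2_measurable[OF K_L2[OF v]] in auto)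
  then show "l2_inner N (point_source r z) h = 0" using orth[OF k(1)] by simp
 qed
 have i0: "integrable N (\<lambda>x. complex_of_real (source r (z - x)) * cnj (h x))" if "r > 0" "infdist z \<Omega> > r" for r z
  by (rule L2_inner_integrable[OF kL[OF that] hL])
 have part: "p (h x) = 0" if x: "x \<in> \<Omega>" and p: "bounded_linear p" "\<And>z. \<bar>p z\<bar> <= cmod z" "\<And>a z. p (a *\<^sub>R z) = a * p z" for p :: "complex => real" and x
 proof (rule harmonic_orthogonal_to_exterior_sources[OF op bd ne F2 Fpos F_frontier \<eta> _ _ _ x])
  show "harmonic_on \<Omega> (\<lambda>x. p (h x))" by (rule harmonic_on_bounded_linear[OF op p(1) h(1)])
  have "integrable N (\<lambda>x. (p (h x))^2)"
  proof (rule Bochner_Integration.integrable_bound[OF L2_integrable[OF hL]])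
   show "(\<lambda>x. (p (h x))^2) \<in> borel_measurable N"
    using measurable_compose[OF hm borel_measurable_continuous_onI[OF bounded_linear.continuous_on[OF p(1) continuous_on_id]]] by simp
   show "AE x in N. norm ((p (h x))^2) <= norm ((cmod (h x))^2)"
    using p(2) abs_le_square_iff[of "p z" "cmod z" for z] by (intro AE_I2) simp
  qed
  then show "set_integrable lborel \<Omega> (\<lambda>x. (p (h x))^2)" unfolding set_integrable_N .
  fix r z assume r: "r > 0" "infdist z \<Omega> > r"
  have ic: "integrable N (\<lambda>x. source r (z - x) *\<^sub>R h x)"
   using i0[OF r, THEN integrable_cnj] by (simp add: scaleR_conv_of_real)
  have "(LINT x|N. source r (z - x) *\<^sub>R h x) = cnj (l2_inner N (point_source r z) h)"
   unfolding l2_inner_def by (subst Bochner_Integration.integral_cnj[symmetric]) (simp add: scaleR_conv_of_real)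
  also have "\<dots> = 0" using ker[OF r] by simp
  finally have "0 = p (LINT x|N. source r (z - x) *\<^sub>R h x)" using p(3)[of 0 0] by simp
  also have "\<dots> = (LINT x|N. p (source r (z - x) *\<^sub>R h x))" by (rule integral_bounded_linear[OF p(1) ic, symmetric])
  also have "\<dots> = (LINT x:\<Omega>|lborel. p (h x) * source r (z - x))" unfolding set_integral_N p(3) by (simp add: mult.commute)
  finally show "(LINT x:\<Omega>|lborel. p (h x) * source r (z - x)) = 0" ..
 qed
 have "h x = 0" if "x \<in> \<Omega>" for x
  using part[OF that bounded_linear_Re abs_Re_le_cmod] part[OF that bounded_linear_Im abs_Im_le_cmod] by (simp add: complex_eq_iff)
 then have "AE x in N. h x = 0" by (intro AE_I2) simp
 then show ?thesis using h(2) by eventually_elim simp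
qed

end

section \<open>Polar decomposition and unitary equivalence\<close>

lemma L2_eq_AE_iff:
 assumes f: "f \<in> L2 M" and g: "g \<in> L2 M"
 shows "(AE x in M. f x = g x) \<longleftrightarrow> (\<forall>h\<in>L2 M. l2_inner M h f = l2_inner M h g)"
proof
 assume "AE x in M. f x = g x"
 then show "\<forall>h\<in>L2 M. l2_inner M h f = l2_inner M h g"
  using f g by (auto intro!: l2_inner_cong_AE L2_measurable)
next
 assume *: "\<forall>h\<in>L2 M. l2_inner M h f = l2_inner M h g"
 have d: "f - g \<in> L2 M" by (rule L2.diff_mem[OF f g])
 have "l2_inner M (f - g) (f - g) = 0" using * d by (simp add: L2.ip_diff_right f g)
 then have "L2.nrm M (f - g) = 0" by (simp add: L2.nrm_def)
 then have "AE x in M. (f - g) x = 0" using L2_nrm_zero_iff[OF d] by simp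
 then show "AE x in M. f x = g x" by eventually_elim simp
qed

lemma l2_inner_cong:
 assumes "AE x in M. f x = f' x" "AE x in M. g x = g' x" "f \<in> L2 M" "f' \<in> L2 M" "g \<in> L2 M" "g' \<in> L2 M"
 shows "l2_inner M f g = l2_inner M f' g'"
 using assms by (intro l2_inner_cong_AE L2_measurable)

context poisson_domain
begin

lemma G_ip_add: "f \<in> L2 S ==> g \<in> L2 S ==> v \<in> L2 N ==> l2_inner N (G (f + g)) v = l2_inner N (G f) v + l2_inner N (G g) v"
proof -
 assume f: "f \<in> L2 S" and g: "g \<in> L2 S" and v: "v \<in> L2 N"
 have "AE x in N. G (f + g) x = (G f + G g) x"
  using G_add_cmult[OF f g, of _ 1] by (intro AE_I2) (simp add: plus_fun_def)
 then have "l2_inner N (G (f + g)) v = l2_inner N (G f + G g) v"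
  by (intro l2_inner_cong) (use f g v in \<open>auto intro: G_L2 L2.mems\<close>)
 then show ?thesis by (simp add: L2.ip_simps G_L2 f g v)
qed

lemma G_ip_cmult: "f \<in> L2 S ==> v \<in> L2 N ==> l2_inner N (G (\<lambda>x. c * f x)) v = c * l2_inner N (G f) v"
proof -
 assume f: "f \<in> L2 S" and v: "v \<in> L2 N"
 have z: "G (\<lambda>x. 0) x = 0" if "x \<in> \<Omega>" for x using G_add_cmult[OF f f that, of "- 1"] by simp
 have "AE x in N. G (\<lambda>x. c * f x) x = c * G f x"
  using G_add_cmult[OF L2_zero f, of _ c] z by (intro AE_I2) simp
 then have "l2_inner N (G (\<lambda>x. c * f x)) v = l2_inner N (\<lambda>x. c * G f x) v"
  by (intro l2_inner_cong) (use f v in \<open>auto intro: G_L2 L2_cmult\<close>)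
 then show ?thesis by (simp add: L2.ip_simps G_L2 f v)
qed

lemma op_adjoint_poisson_graph:
 "op_adjoint S N (poisson_graph \<Omega> G) = {(v, w). v \<in> L2 N \<and> w \<in> L2 S \<and> (\<forall>f\<in>L2 S. l2_inner N (G f) v = l2_inner S f w)}"
proof -
 have "(\<forall>(f, u)\<in>poisson_graph \<Omega> G. l2_inner N u v = l2_inner S f w) \<longleftrightarrow> (\<forall>f\<in>L2 S. l2_inner N (G f) v = l2_inner S f w)"
  if v: "v \<in> L2 N" for v w
 proof
  assume "\<forall>f\<in>L2 S. l2_inner N (G f) v = l2_inner S f w"
  moreover have "l2_inner N u v = l2_inner N (G f) v" if "(f, u) \<in> poisson_graph \<Omega> G" for f u
   by (rule l2_inner_cong) (use that v G_L2 in \<open>auto simp: poisson_graph_def op_graph_def\<close>)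
  ultimately show "\<forall>(f, u)\<in>poisson_graph \<Omega> G. l2_inner N u v = l2_inner S f w"
   by (auto simp: poisson_graph_def op_graph_def)
 qed (use G_L2 in \<open>auto simp: poisson_graph_def op_graph_def\<close>)
 then show ?thesis unfolding op_adjoint_def by blast
qed

text \<open>Testing against all \<open>g\<close> eliminates the intermediate representative hidden
  in the composition of graphs.\<close>

lemma J_op_eq:
 "J_op \<Omega> G = {(f, w). f \<in> L2 S \<and> w \<in> L2 S \<and> (\<forall>g\<in>L2 S. l2_inner S g w = l2_inner N (G g) (G f))}" (is "_ = ?R")
proof (intro set_eqI iffI; clarify)
 fix f w assume "(f, w) \<in> J_op \<Omega> G"
 then obtain u where u: "f \<in> L2 S" "u \<in> L2 N" "AE x in N. u x = G f x" "w \<in> L2 S" "\<And>g. g \<in> L2 S ==> l2_inner N (G g) u = l2_inner S g w"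
  unfolding J_op_def op_adjoint_poisson_graph by (auto simp: poisson_graph_def op_graph_def)
 have "l2_inner N (G g) u = l2_inner N (G g) (G f)" if "g \<in> L2 S" for g
  by (rule l2_inner_cong) (use u that G_L2 in auto)
 then show "f \<in> L2 S \<and> w \<in> L2 S \<and> (\<forall>g\<in>L2 S. l2_inner S g w = l2_inner N (G g) (G f))" using u by simp
next
 fix f w assume "f \<in> L2 S" "w \<in> L2 S" "\<forall>g\<in>L2 S. l2_inner S g w = l2_inner N (G g) (G f)"
 then show "(f, w) \<in> J_op \<Omega> G"
  unfolding J_op_def op_adjoint_poisson_graph
  by (intro relcompI[of f "G f"]) (auto simp: poisson_graph_def op_graph_def G_L2)
qed

text \<open>The description \<open>op_sqrt\<close> ranges over all graphs. A competing root
  \<open>R\<close> may a priori be unbounded, but \<open>J\<close> is everywhere defined, which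
  forces \<open>R\<close> to be so; a choice of representatives then makes
  \<open>positive_sqrt_unique\<close> applicable.\<close>

lemma op_sqrt_J:
 obtains Q where "\<And>f. f \<in> L2 S ==> Q f \<in> L2 S"
  "\<And>f g. f \<in> L2 S ==> g \<in> L2 S ==> l2_inner S (Q f) g = l2_inner S f (Q g)"
  "\<And>f g. f \<in> L2 S ==> g \<in> L2 S ==> l2_inner S (Q f) (Q g) = l2_inner N (G f) (G g)"
  "op_sqrt S (J_op \<Omega> G) = op_graph (L2 S) S (L2 S) Q"
proof -
 obtain C where C: "C > 0" "\<And>f. f \<in> L2 S ==> (L2.nrm N (G f))^2 <= C * (L2.nrm S f)^2" using G_bounded by blast
 have Gn: "L2.nrm N (G f) <= sqrt C * L2.nrm S f" if "f \<in> L2 S" for f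
  using real_sqrt_le_mono[OF C(2)[OF that]] L2.nrm_nonneg[OF G_L2[OF that]] L2.nrm_nonneg[OF that] by (simp add: real_sqrt_mult)
 have "\<exists>p\<in>L2 S. \<forall>g\<in>L2 S. l2_inner S g p = l2_inner N (G g) (G f)" if f: "f \<in> L2 S" for f
 proof (rule L2.Riesz)
  show "cmod (l2_inner N (G g) (G f)) <= (sqrt C * L2.nrm N (G f)) * L2.nrm S g" if g: "g \<in> L2 S" for g
  proof -
   have "cmod (l2_inner N (G g) (G f)) <= L2.nrm N (G g) * L2.nrm N (G f)" by (rule L2.Cauchy_Schwarz[OF G_L2[OF g] G_L2[OF f]])
   also have "\<dots> <= (sqrt C * L2.nrm S g) * L2.nrm N (G f)" by (intro mult_right_mono Gn g L2.nrm_nonneg G_L2 f)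
   finally show ?thesis by (simp add: mult_ac)
  qed
 qed (auto intro: G_ip_add G_ip_cmult G_L2 f)
 then obtain J where J: "\<And>f. f \<in> L2 S ==> J f \<in> L2 S" "\<And>f g. f \<in> L2 S ==> g \<in> L2 S ==> l2_inner S g (J f) = l2_inner N (G g) (G f)"
  by metis
 have Jl: "l2_inner S (J f) g = l2_inner N (G f) (G g)" if "f \<in> L2 S" "g \<in> L2 S" for f g
  using J that L2.ip_cnj[of g S "J f"] L2.ip_cnj[of "G g" N "G f"] G_L2 by simp
 \<comment> \<open>Positivity in the form that makes \<open>1 - J / C\<close> a contraction.\<close>
 have Jb: "(L2.nrm S (J f))^2 <= C * Re (l2_inner S (J f) f)" if f: "f \<in> L2 S" for f
 proof -
  have "(L2.nrm S (J f))^2 = Re (l2_inner N (G f) (G (J f)))" using Jl[OF f J(1)[OF f]] by (simp add: L2.nrm_sq J f)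
  also have "\<dots> <= L2.nrm N (G f) * L2.nrm N (G (J f))"
   using order_trans[OF complex_Re_le_cmod L2.Cauchy_Schwarz[OF G_L2[OF f] G_L2[OF J(1)[OF f]]]] .
  also have "\<dots> <= L2.nrm N (G f) * (sqrt C * L2.nrm S (J f))" by (intro mult_left_mono Gn J f L2.nrm_nonneg G_L2)
  finally have "L2.nrm S (J f) * L2.nrm S (J f) <= (sqrt C * L2.nrm N (G f)) * L2.nrm S (J f)" by (simp add: power2_eq_square mult_ac)
  then have "L2.nrm S (J f) <= sqrt C * L2.nrm N (G f)"
   using L2.nrm_nonneg[OF J(1)[OF f]] L2.nrm_nonneg[OF G_L2[OF f]] C(1)
   by (cases "L2.nrm S (J f) = 0") auto
  then have "(L2.nrm S (J f))^2 <= (sqrt C * L2.nrm N (G f))^2" by (intro power_mono L2.nrm_nonneg J f)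
  also have "\<dots> = C * Re (l2_inner S (J f) f)" using C(1) by (simp add: power_mult_distrib Jl f L2.nrm_sq G_L2)
  finally show ?thesis .
 qed
 obtain Q where Q: "\<And>f. f \<in> L2 S ==> Q f \<in> L2 S"
  "\<And>f g. f \<in> L2 S ==> g \<in> L2 S ==> l2_inner S (Q f) g = l2_inner S f (Q g)"
  "\<And>f. f \<in> L2 S ==> 0 <= Re (l2_inner S (Q f) f)"
  "\<And>f g. f \<in> L2 S ==> g \<in> L2 S ==> l2_inner S (Q (Q f)) g = l2_inner S (J f) g"
  and comm: "\<And>T f g. (\<And>f. f \<in> L2 S ==> T f \<in> L2 S) ==>
   (\<And>f g. f \<in> L2 S ==> g \<in> L2 S ==> l2_inner S (T f) g = l2_inner S f (T g)) ==>
   (\<And>f g. f \<in> L2 S ==> g \<in> L2 S ==> l2_inner S (T (J f)) g = l2_inner S (J (T f)) g) ==>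
   f \<in> L2 S ==> g \<in> L2 S ==> l2_inner S (T (Q f)) g = l2_inner S (Q (T f)) g"
 proof (rule L2.positive_sqrt_exists[where M = S and J = J and c = C])
  show "l2_inner S (J f) g = l2_inner S f (J g)" if "f \<in> L2 S" "g \<in> L2 S" for f g using J(2) Jl that by simp
 qed (use J(1) C(1) Jb in auto)
 have QQ: "l2_inner S (Q f) (Q g) = l2_inner N (G f) (G g)" if "f \<in> L2 S" "g \<in> L2 S" for f g
  using Q(2)[OF Q(1)[OF that(1)] that(2)] Q(4)[OF that] Jl that by simp
 let ?Q = "op_graph (L2 S) S (L2 S) Q"
 have graphQ: "(f, w) \<in> ?Q \<longleftrightarrow> f \<in> L2 S \<and> w \<in> L2 S \<and> (\<forall>h\<in>L2 S. l2_inner S h w = l2_inner S (Q h) f)" for f w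
  using L2_eq_AE_iff[of w S "Q f"] Q(1,2) unfolding op_graph_def by auto
 have sa: "self_adjoint_op S ?Q"
  unfolding self_adjoint_op_def
 proof (intro set_eqI iffI; clarify)
  fix v w assume vw: "(v, w) \<in> op_adjoint S S ?Q"
  have "l2_inner S h w = l2_inner S (Q h) v" if "h \<in> L2 S" for h
  proof -
   have "(h, Q h) \<in> ?Q" using that Q(1) by (simp add: op_graph_def)
   then show ?thesis using vw unfolding op_adjoint_def by fastforce
  qed
  then show "(v, w) \<in> ?Q" unfolding graphQ using vw by (simp add: op_adjoint_def)
 next
  fix v w assume vw: "(v, w) \<in> ?Q"
  have "l2_inner S u v = l2_inner S f w" if "(f, u) \<in> ?Q" for f u
  proof -
   have "l2_inner S u v = l2_inner S (Q f) v" by (rule l2_inner_cong) (use that vw Q(1) in \<open>auto simp: op_graph_def\<close>)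
   then show ?thesis using vw that unfolding graphQ by auto
  qed
  then show "(v, w) \<in> op_adjoint S S ?Q" using vw by (auto simp: op_adjoint_def op_graph_def)
 qed
 have nn: "nonneg_op S ?Q"
  unfolding nonneg_op_def
 proof clarify
  fix f g assume fg: "(f, g) \<in> ?Q"
  then have m: "f \<in> L2 S" "g \<in> L2 S" by (auto simp: op_graph_def)
  have e: "l2_inner S g f = l2_inner S (Q f) f" by (rule l2_inner_cong) (use fg Q(1) in \<open>auto simp: op_graph_def\<close>)
  have "l2_inner S (Q f) f = cnj (l2_inner S (Q f) f)" using L2.ip_cnj[OF Q(1)[OF m(1)] m(1)] Q(2)[OF m(1) m(1)] by simp
  then have "l2_inner S (Q f) f \<in> \<real>" using Reals_cnj_iff by metis
  then show "l2_inner S g f \<in> \<real> \<and> 0 <= Re (l2_inner S g f)" using Q(3)[OF m(1)] e by simp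
 qed
 have sq: "?Q \<circ>\<^sub>o ?Q = J_op \<Omega> G"
 proof (intro set_eqI iffI; clarify)
  fix f u w assume *: "(f, u) \<in> ?Q" "(u, w) \<in> ?Q"
  have "l2_inner S g w = l2_inner N (G g) (G f)" if g: "g \<in> L2 S" for g
  proof -
   have "l2_inner S g w = l2_inner S (Q g) u" using * g unfolding graphQ by blast
   also have "\<dots> = l2_inner S (Q g) (Q f)" by (rule l2_inner_cong) (use * g Q(1) in \<open>auto simp: op_graph_def\<close>)
   finally show ?thesis using QQ * g by (auto simp: op_graph_def)
  qed
  then show "(f, w) \<in> J_op \<Omega> G" unfolding J_op_eq using * by (auto simp: op_graph_def)
 next
  fix f w assume *: "(f, w) \<in> J_op \<Omega> G"
  then have "(Q f, w) \<in> ?Q" unfolding graphQ J_op_eq using Q(1) QQ by auto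
  moreover have "(f, Q f) \<in> ?Q" using * Q(1) by (auto simp: op_graph_def J_op_eq)
  ultimately show "(f, w) \<in> ?Q \<circ>\<^sub>o ?Q" by (rule relcompI[rotated])
 qed
 have uniq: "R = ?Q" if R: "self_adjoint_op S R" "nonneg_op S R" "R \<circ>\<^sub>o R = J_op \<Omega> G" for R
 proof -
  have RL: "f \<in> L2 S \<and> g \<in> L2 S" if "(f, g) \<in> R" for f g using R(1) that by (auto simp: self_adjoint_op_def op_adjoint_def)
  have Rs: "l2_inner S g h = l2_inner S f k" if "(f, g) \<in> R" "(h, k) \<in> R" for f g h k
  proof -
   have "(h, k) \<in> op_adjoint S S R" using R(1) that(2) by (simp add: self_adjoint_op_def)
   then show ?thesis using that(1) by (auto simp: op_adjoint_def)
  qed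
  \<comment> \<open>The composition of \<open>R\<close> with itself is everywhere defined, hence so
    is \<open>R\<close>.\<close>
  have "\<exists>g. (f, g) \<in> R" if "f \<in> L2 S" for f
  proof -
   have "(f, J f) \<in> R \<circ>\<^sub>o R" using that J unfolding R(3) J_op_eq by auto
   then show ?thesis by blast
  qed
  then obtain T where T: "\<And>f. f \<in> L2 S ==> (f, T f) \<in> R" by metis
  have T1: "T f \<in> L2 S" if "f \<in> L2 S" for f using RL[OF T[OF that]] by blast
  have T2: "l2_inner S (T f) g = l2_inner S f (T g)" if "f \<in> L2 S" "g \<in> L2 S" for f g by (rule Rs[OF T[OF that(1)] T[OF that(2)]])
  have T3: "0 <= Re (l2_inner S (T f) f)" if "f \<in> L2 S" for f using R(2) T[OF that] by (auto simp: nonneg_op_def)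
  have TT: "l2_inner S (T (T f)) g = l2_inner S (J f) g" if f: "f \<in> L2 S" and g: "g \<in> L2 S" for f g
  proof -
   have "(f, T (T f)) \<in> R \<circ>\<^sub>o R" using T[OF f] T[OF T1[OF f]] by blast
   then have "l2_inner S g (T (T f)) = l2_inner N (G g) (G f)" unfolding R(3) J_op_eq using g by blast
   then show ?thesis using L2.ip_cnj[of g S "T (T f)"] L2.ip_cnj[of g S "J f"] J f g T1 by simp
  qed
  \<comment> \<open>\<open>T\<close> commutes with \<open>J\<close> because \<open>J\<close> is its
    square.\<close>
  have TJ: "l2_inner S (T (J f)) g = l2_inner S (J (T f)) g" if f: "f \<in> L2 S" and g: "g \<in> L2 S" for f g
  proof -
   have "l2_inner S (T (J f)) g = l2_inner S (J f) (T g)" by (rule T2[OF J(1)[OF f] g])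
   also have "\<dots> = l2_inner S (T (T f)) (T g)" using TT[OF f T1[OF g]] by simp
   also have "\<dots> = l2_inner S (T (T (T f))) g" using T2[OF T1[OF T1[OF f]] g] by simp
   also have "\<dots> = l2_inner S (J (T f)) g" by (rule TT[OF T1[OF f] g])
   finally show ?thesis .
  qed
  have "L2.nrm S (Q f - T f) = 0" if f: "f \<in> L2 S" for f
  proof (rule L2.positive_sqrt_unique[where S = Q and T = T])
   show "l2_inner S (Q (Q f)) g = l2_inner S (T (T f)) g" if "f \<in> L2 S" "g \<in> L2 S" for f g using Q(4) TT that by simp
   show "l2_inner S (T (Q f)) g = l2_inner S (Q (T f)) g" if "f \<in> L2 S" "g \<in> L2 S" for f g by (rule comm[OF T1 T2 TJ that])
  qed (use Q T1 T2 T3 f in auto)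
  then have TQ: "AE x in S. T f x = Q f x" if f: "f \<in> L2 S" for f
   using L2_nrm_zero_iff[OF L2.diff_mem[OF Q(1)[OF f] T1[OF f]]] f by (auto elim: eventually_mono)
  \<comment> \<open>\<open>R\<close> equals its adjoint, so it contains every pair that is
    compatible with its own elements; this turns the equality of \<open>T\<close> and
    \<open>Q\<close> almost everywhere into an equality of graphs.\<close>
  show ?thesis
  proof (intro set_eqI iffI; clarify)
   fix f g assume fg: "(f, g) \<in> R"
   have "l2_inner S h g = l2_inner S (Q h) f" if h: "h \<in> L2 S" for h
   proof -
    have "l2_inner S h g = l2_inner S (T h) f" using Rs[OF T[OF h] fg] by simp
    also have "\<dots> = l2_inner S (Q h) f" by (rule l2_inner_cong) (use TQ h T1 Q(1) RL[OF fg] in auto)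
    finally show ?thesis .
   qed
   then show "(f, g) \<in> ?Q" unfolding graphQ using RL[OF fg] by blast
  next
   fix f g assume fg: "(f, g) \<in> ?Q"
   have "l2_inner S k f = l2_inner S h g" if hk: "(h, k) \<in> R" for h k
   proof -
    have h: "h \<in> L2 S" using RL[OF hk] by blast
    have fm: "f \<in> L2 S" using fg by (simp add: op_graph_def)
    have "l2_inner S k f = l2_inner S h (T f)" by (rule Rs[OF hk T[OF fm]])
    also have "\<dots> = l2_inner S (T h) f" using T2[OF h fm] by simp
    also have "\<dots> = l2_inner S (Q h) f" by (rule l2_inner_cong) (use TQ h T1 Q(1) fm in auto)
    also have "\<dots> = l2_inner S h g" using fg h unfolding graphQ by simp
    finally show ?thesis .
   qed
   then have "(f, g) \<in> op_adjoint S S R" using fg by (auto simp: op_adjoint_def op_graph_def)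
   then show "(f, g) \<in> R" using R(1) by (simp add: self_adjoint_op_def)
  qed
 qed
 have "op_sqrt S (J_op \<Omega> G) = ?Q"
  unfolding op_sqrt_def
 proof (rule the_equality)
  show "self_adjoint_op S ?Q \<and> nonneg_op S ?Q \<and> ?Q \<circ>\<^sub>o ?Q = J_op \<Omega> G" by (intro conjI sa nn sq)
  show "R = ?Q" if "self_adjoint_op S R \<and> nonneg_op S R \<and> R \<circ>\<^sub>o R = J_op \<Omega> G" for R
   by (rule uniq[OF that[THEN conjunct1] that[THEN conjunct2, THEN conjunct1] that[THEN conjunct2, THEN conjunct2]])
 qed
 with Q(1,2) QQ show ?thesis by (rule that)
qed

end

section \<open>Polar decomposition\<close>

locale poisson_root = poisson_domain +
 fixes Q :: "('a => complex) => 'a => complex"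
 assumes Q_L2: "f \<in> L2 S ==> Q f \<in> L2 S"
  and Q_sym: "f \<in> L2 S ==> g \<in> L2 S ==> l2_inner S (Q f) g = l2_inner S f (Q g)"
  and Q_iso: "f \<in> L2 S ==> g \<in> L2 S ==> l2_inner S (Q f) (Q g) = l2_inner N (G f) (G g)"
begin

text \<open>If \<open>y\<close> is orthogonal to the range, then \<open>\<langle>G y, G y\<rangle> =
  \<langle>Q (Q y), y\<rangle> = 0\<close>, and \<open>G\<close> is injective.\<close>

lemma Q_dense:
 assumes f: "f \<in> L2 S"
 obtains s where "\<And>n::nat. s n \<in> L2 S" "(\<lambda>n. L2.nrm S (Q (s n) - f)) \<longlonglongrightarrow> 0"
proof (rule L2.dense_range[OF L2.semi_inner_axioms[of S] Q_L2])
 show "L2.nrm S y = 0" if y: "y \<in> L2 S" "\<And>f. f \<in> L2 S ==> l2_inner S (Q f) y = 0" for y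
 proof -
  have "l2_inner N (G y) (G y) = l2_inner S (Q y) (Q y)" by (rule Q_iso[OF y(1) y(1), symmetric])
  also have "\<dots> = l2_inner S (Q (Q y)) y" by (rule Q_sym[OF Q_L2[OF y(1)] y(1), symmetric])
  also have "\<dots> = 0" by (rule y(2)[OF Q_L2[OF y(1)]])
  finally have "L2.nrm N (G y) = 0" by (simp add: L2.nrm_def)
  then have "AE x in N. G y x = 0" using L2_nrm_zero_iff[OF G_L2[OF y(1)]] by simp
  then show ?thesis using G_injective[OF y(1)] L2_nrm_zero_iff[OF y(1)] by simp
 qed
qed (use f that in \<open>auto simp: Q_sym Q_L2 L2.ip_simps L2.add_mem L2_cmult\<close>)

lemma G_dense:
 assumes v: "v \<in> K"
 obtains s where "\<And>n::nat. s n \<in> L2 S" "(\<lambda>n. L2.nrm N (G (s n) - v)) \<longlonglongrightarrow> 0"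
proof (rule K.dense_range[OF L2.semi_inner_axioms[of S] G_K])
 show "L2.nrm N y = 0" if y: "y \<in> K" "\<And>f. f \<in> L2 S ==> l2_inner N (G f) y = 0" for y
  using orthogonal_to_range_imp_zero[OF y] L2_nrm_zero_iff[OF K_L2[OF y(1)]] by simp
qed (use v that K_L2 G_ip_add G_ip_cmult in auto)

lemma nrm_G_Q_diff: "f \<in> L2 S ==> g \<in> L2 S ==> L2.nrm N (G f - G g) = L2.nrm S (Q f - Q g)"
proof -
 assume f: "f \<in> L2 S" and g: "g \<in> L2 S"
 have "(L2.nrm N (G f - G g))^2 = (L2.nrm S (Q f - Q g))^2"
  using Q_iso f g by (simp add: L2.nrm_sq L2.mems L2.ip_simps L2.ip_diff_right G_L2 Q_L2)
 then show ?thesis using f g by (simp add: power2_eq_iff_nonneg L2.nrm_nonneg L2.mems G_L2 Q_L2)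
qed

lemma Cauchy_if_convergent:
 assumes "\<And>n. s n \<in> L2 M" "f \<in> L2 M" "(\<lambda>n. L2.nrm M (s n - f)) \<longlonglongrightarrow> 0" "e > 0"
 shows "\<exists>n0. \<forall>m\<ge>n0. \<forall>n\<ge>n0. L2.nrm M (s m - s n) < e"
proof -
 have "eventually (\<lambda>n. L2.nrm M (s n - f) < e / 2) sequentially"
  using assms(3,4) by (intro order_tendstoD(2)) auto
 then obtain n0 where n0: "\<And>n. n >= n0 ==> L2.nrm M (s n - f) < e / 2" unfolding eventually_sequentially by blast
 have "L2.nrm M (s m - s n) < e" if "m >= n0" "n >= n0" for m n
  using L2.nrm_triangle3[of "s m" M f "s n"] L2.nrm_diff_commute[of f M "s n"] n0[OF that(1)] n0[OF that(2)] assms(1,2) by simp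
 then show ?thesis by blast
qed

text \<open>The polar decomposition \<open>G = U Q\<close>: on the dense range of \<open>Q\<close>, \<open>U\<close> maps \<open>Q h\<close> to \<open>G h\<close>.\<close>

lemma polar:
 obtains U where "\<And>f. f \<in> L2 S ==> U f \<in> K"
  "\<And>f h. f \<in> L2 S ==> h \<in> L2 S ==> l2_inner N (U f) (G h) = l2_inner S f (Q h)"
  "\<And>f g. f \<in> L2 S ==> g \<in> L2 S ==> l2_inner N (U f) (U g) = l2_inner S f g"
  "\<And>v. v \<in> K ==> \<exists>f\<in>L2 S. \<forall>h\<in>L2 S. l2_inner N v (G h) = l2_inner S f (Q h)"
proof -
 \<comment> \<open>Where \<open>Q (s n)\<close> converges, \<open>G (s n)\<close> is Cauchy, since
   \<open>G\<close> and \<open>Q\<close> give the same distances; its limit becomes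
   \<open>U f\<close>.\<close>
 have "\<exists>u s. u \<in> K \<and> (\<forall>n::nat. s n \<in> L2 S) \<and> (\<lambda>n. L2.nrm S (Q (s n) - f)) \<longlonglongrightarrow> 0 \<and> (\<lambda>n. L2.nrm N (G (s n) - u)) \<longlonglongrightarrow> 0"
  if f: "f \<in> L2 S" for f
 proof -
  obtain s where s: "\<And>n::nat. s n \<in> L2 S" "(\<lambda>n. L2.nrm S (Q (s n) - f)) \<longlonglongrightarrow> 0" using Q_dense[OF f] by blast
  have "\<exists>l\<in>K. (\<lambda>n. L2.nrm N (G (s n) - l)) \<longlonglongrightarrow> 0"
  proof (rule K.complete)
   show "G (s n) \<in> K" for n by (rule G_K[OF s(1)])
   show "\<exists>n0. \<forall>m\<ge>n0. \<forall>n\<ge>n0. L2.nrm N (G (s m) - G (s n)) < e" if "e > 0" for e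
    using Cauchy_if_convergent[of "\<lambda>n. Q (s n)", OF Q_L2[OF s(1)] f s(2) that] nrm_G_Q_diff s(1) by simp
  qed
  then show ?thesis using s by blast
 qed
 then obtain U s where U: "\<And>f. f \<in> L2 S ==> U f \<in> K" and s: "\<And>f n. f \<in> L2 S ==> s f (n::nat) \<in> L2 S"
  and sQ: "\<And>f. f \<in> L2 S ==> (\<lambda>n. L2.nrm S (Q (s f n) - f)) \<longlonglongrightarrow> 0"
  and sG: "\<And>f. f \<in> L2 S ==> (\<lambda>n. L2.nrm N (G (s f n) - U f)) \<longlonglongrightarrow> 0" by metis
 have UG: "l2_inner N (U f) (G h) = l2_inner S f (Q h)" if f: "f \<in> L2 S" and h: "h \<in> L2 S" for f h
 proof (rule LIMSEQ_unique)
  show "(\<lambda>n. l2_inner N (G (s f n)) (G h)) \<longlonglongrightarrow> l2_inner N (U f) (G h)"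
   by (rule L2.tendsto_ip_left[OF G_L2[OF s[OF f]] K_L2[OF U[OF f]] G_L2[OF h] sG[OF f]])
  have "(\<lambda>n. l2_inner S (Q (s f n)) (Q h)) \<longlonglongrightarrow> l2_inner S f (Q h)"
   by (rule L2.tendsto_ip_left[OF Q_L2[OF s[OF f]] f Q_L2[OF h] sQ[OF f]])
  then show "(\<lambda>n. l2_inner N (G (s f n)) (G h)) \<longlonglongrightarrow> l2_inner S f (Q h)" using Q_iso[OF s[OF f] h] by simp
 qed
 have UU: "l2_inner N (U f) (U g) = l2_inner S f g" if f: "f \<in> L2 S" and g: "g \<in> L2 S" for f g
 proof -
  have "(\<lambda>n. l2_inner N (G (s g n)) (U f)) \<longlonglongrightarrow> l2_inner N (U g) (U f)"
   by (rule L2.tendsto_ip_left[OF G_L2[OF s[OF g]] K_L2[OF U[OF g]] K_L2[OF U[OF f]] sG[OF g]])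
  moreover have "(\<lambda>n. l2_inner S (Q (s g n)) f) \<longlonglongrightarrow> l2_inner S g f"
   by (rule L2.tendsto_ip_left[OF Q_L2[OF s[OF g]] g f sQ[OF g]])
  moreover have "l2_inner N (G (s g n)) (U f) = l2_inner S (Q (s g n)) f" for n
   using UG[OF f s[OF g, of n]] L2.ip_cnj[OF K_L2[OF U[OF f]] G_L2[OF s[OF g, of n]]] L2.ip_cnj[OF f Q_L2[OF s[OF g, of n]]] by simp
  ultimately have "l2_inner N (U g) (U f) = l2_inner S g f" using LIMSEQ_unique by fastforce
  then show ?thesis using L2.ip_cnj[OF K_L2[OF U[OF g]] K_L2[OF U[OF f]]] L2.ip_cnj[OF g f] by simp
 qed
 \<comment> \<open>The same construction with \<open>Q\<close> and \<open>G\<close> exchanged,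
   starting from the density of the range of \<open>G\<close>.\<close>
 have surj: "\<exists>f\<in>L2 S. \<forall>h\<in>L2 S. l2_inner N v (G h) = l2_inner S f (Q h)" if v: "v \<in> K" for v
 proof -
  obtain t where t: "\<And>n::nat. t n \<in> L2 S" "(\<lambda>n. L2.nrm N (G (t n) - v)) \<longlonglongrightarrow> 0" using G_dense[OF v] by blast
  have "\<exists>l\<in>L2 S. (\<lambda>n. L2.nrm S (Q (t n) - l)) \<longlonglongrightarrow> 0"
  proof (rule L2.complete)
   show "Q (t n) \<in> L2 S" for n by (rule Q_L2[OF t(1)])
   show "\<exists>n0. \<forall>m\<ge>n0. \<forall>n\<ge>n0. L2.nrm S (Q (t m) - Q (t n)) < e" if "e > 0" for e
    using Cauchy_if_convergent[of "\<lambda>n. G (t n)", OF G_L2[OF t(1)] K_L2[OF v] t(2) that] nrm_G_Q_diff t(1) by simp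
  qed
  then obtain f where f: "f \<in> L2 S" "(\<lambda>n. L2.nrm S (Q (t n) - f)) \<longlonglongrightarrow> 0" by blast
  have "l2_inner N v (G h) = l2_inner S f (Q h)" if h: "h \<in> L2 S" for h
  proof (rule LIMSEQ_unique)
   show "(\<lambda>n. l2_inner N (G (t n)) (G h)) \<longlonglongrightarrow> l2_inner N v (G h)"
    by (rule L2.tendsto_ip_left[OF G_L2[OF t(1)] K_L2[OF v] G_L2[OF h] t(2)])
   have "(\<lambda>n. l2_inner S (Q (t n)) (Q h)) \<longlonglongrightarrow> l2_inner S f (Q h)"
    by (rule L2.tendsto_ip_left[OF Q_L2[OF t(1)] f(1) Q_L2[OF h] f(2)])
   then show "(\<lambda>n. l2_inner N (G (t n)) (G h)) \<longlonglongrightarrow> l2_inner S f (Q h)" using Q_iso[OF t(1) h] by simp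
  qed
  then show ?thesis using f(1) by blast
 qed
 show ?thesis by (rule that[OF U UG UU surj])
qed

end

section \<open>The weighted operators and the unitary equivalence\<close>

locale weighted_poisson = poisson_root +
 fixes V :: "'a => real" and B :: real
 assumes V_measurable: "V \<in> borel_measurable N" and V_bounded: "x \<in> \<Omega> ==> \<bar>V x\<bar> <= B"
  and Q_sqrt: "op_sqrt S (J_op \<Omega> G) = op_graph (L2 S) S (L2 S) Q"
begin

abbreviation mV :: "('a => complex) => 'a => complex" where
 "mV u \<equiv> \<lambda>x. complex_of_real (V x) * u x"

lemma mV_L2: "u \<in> L2 N ==> mV u \<in> L2 N"
 using V_measurable V_bounded by (intro L2_mult_bounded[where B = B]) (auto intro: AE_I2)

lemma B_nonneg: "B >= 0"
 using V_bounded ne abs_ge_zero order_trans by blast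

lemma nrm_mV: "u \<in> L2 N ==> L2.nrm N (mV u) <= B * L2.nrm N u"
proof (rule power2_le_imp_le)
 assume u: "u \<in> L2 N"
 have "(LINT x|N. (cmod (mV u x))^2) <= (LINT x|N. B^2 * (cmod (u x))^2)"
 proof (intro integral_mono L2_integrable mV_L2 u integrable_mult_right)
  fix x assume "x \<in> space N"
  then have "\<bar>V x\<bar>\<^sup>2 <= B^2" by (intro power_mono V_bounded) simp_all
  from mult_right_mono[OF this, of "(cmod (u x))^2"]
  show "(cmod (mV u x))^2 <= B^2 * (cmod (u x))^2" by (simp add: norm_mult power_mult_distrib)
 qed
 then show "(L2.nrm N (mV u))^2 <= (B * L2.nrm N u)^2"
  by (simp add: L2_nrm_sq mV_L2 u power_mult_distrib)
 show "0 <= B * L2.nrm N u" using B_nonneg L2.nrm_nonneg[OF u] by simp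
qed

lemma J_weighted_eq:
 "J_weighted \<Omega> G V = {(f, w). f \<in> L2 S \<and> w \<in> L2 S \<and> (\<forall>g\<in>L2 S. l2_inner S g w = l2_inner N (G g) (mV (G f)))}"
proof (intro set_eqI iffI; clarify)
 fix f w assume "(f, w) \<in> J_weighted \<Omega> G V"
 then obtain u u' where u: "f \<in> L2 S" "u \<in> L2 N" "AE x in N. u x = G f x" "u' \<in> L2 N" "AE x in N. u' x = mV u x"
   "w \<in> L2 S" "\<And>g. g \<in> L2 S ==> l2_inner N (G g) u' = l2_inner S g w"
  unfolding J_weighted_def op_adjoint_poisson_graph by (auto simp: poisson_graph_def op_graph_def mult_op_def)
 have "AE x in N. u' x = mV (G f) x" using u(3,5) by eventually_elim simp
 then have "l2_inner N (G g) u' = l2_inner N (G g) (mV (G f))" if "g \<in> L2 S" for g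
  by (intro l2_inner_cong) (use u that G_L2 mV_L2 in auto)
 then show "f \<in> L2 S \<and> w \<in> L2 S \<and> (\<forall>g\<in>L2 S. l2_inner S g w = l2_inner N (G g) (mV (G f)))" using u by simp
next
 fix f w assume *: "f \<in> L2 S" "w \<in> L2 S" "\<forall>g\<in>L2 S. l2_inner S g w = l2_inner N (G g) (mV (G f))"
 have "(f, G f) \<in> poisson_graph \<Omega> G" "(G f, mV (G f)) \<in> mult_op N V"
  "(mV (G f), w) \<in> op_adjoint S N (poisson_graph \<Omega> G)"
  unfolding op_adjoint_poisson_graph using * by (auto simp: poisson_graph_def op_graph_def mult_op_def G_L2 mV_L2)
 then show "(f, w) \<in> J_weighted \<Omega> G V" unfolding J_weighted_def by blast
qed

text \<open>Within the harmonic space, the projection of \<open>V u\<close> is determined by its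
  pairings with harmonic functions; the two other operators have weak descriptions of the same
  shape, which makes them comparable.\<close>

lemma toeplitz_op_eq:
 "toeplitz_op \<Omega> V = {(u, h). u \<in> K \<and> h \<in> K \<and> (\<forall>v\<in>K. l2_inner N v h = l2_inner N v (mV u))}"
proof -
 have sym: "l2_inner N (\<lambda>x. m x - h x) v = 0 \<longleftrightarrow> l2_inner N v h = l2_inner N v m"
  if "m \<in> L2 N" "h \<in> L2 N" "v \<in> L2 N" for m h v
 proof -
  have "l2_inner N (m - h) v = cnj (l2_inner N v (m - h))" using that by (intro L2.ip_cnj L2.mems)
  also have "l2_inner N v (m - h) = l2_inner N v m - l2_inner N v h" by (rule L2.ip_diff_right[OF that])
  finally show ?thesis unfolding fun_diff_def by auto
 qed
 show ?thesis
 proof (intro set_eqI iffI; clarify)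
  fix u h assume "(u, h) \<in> toeplitz_op \<Omega> V"
  then obtain m where m: "u \<in> K" "m \<in> L2 N" "AE x in N. m x = mV u x" "h \<in> K" "\<And>v. v \<in> K ==> l2_inner N (\<lambda>x. m x - h x) v = 0"
   unfolding toeplitz_op_def by (auto simp: op_graph_def mult_op_def orth_proj_def)
  have "l2_inner N v h = l2_inner N v (mV u)" if v: "v \<in> K" for v
  proof -
   have "l2_inner N v h = l2_inner N v m" using sym[of m h v] m v K_L2 by simp
   also have "\<dots> = l2_inner N v (mV u)" by (rule l2_inner_cong) (use m v K_L2 mV_L2 in auto)
   finally show ?thesis .
  qed
  then show "u \<in> K \<and> h \<in> K \<and> (\<forall>v\<in>K. l2_inner N v h = l2_inner N v (mV u))" using m by blast
 next
  fix u h assume *: "u \<in> K" "h \<in> K" "\<forall>v\<in>K. l2_inner N v h = l2_inner N v (mV u)"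
  have "(u, u) \<in> Id_on K" "(u, mV u) \<in> mult_op N V" "(mV u, h) \<in> orth_proj N K"
   using * K_L2 mV_L2 sym by (auto simp: op_graph_def mult_op_def orth_proj_def)
  then show "(u, h) \<in> toeplitz_op \<Omega> V" unfolding toeplitz_op_def by blast
 qed
qed

text \<open>\<open>U\<close> acts on representatives, so \<open>U^* V U\<close> is realised as a map
  \<open>W\<close> that represents the form \<open>b\<close>. Equality of operators is equality of
  graphs, domains included, hence every inclusion is checked pair by pair.\<close>

theorem toeplitz_unitarily_equivalent:
 "unitarily_equivalent N K (toeplitz_op \<Omega> V) S (L2 S)
   (op_closure S S (J_inv_sqrt \<Omega> G \<circ>\<^sub>o J_weighted \<Omega> G V \<circ>\<^sub>o J_inv_sqrt \<Omega> G))"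
proof -
 obtain U where U: "\<And>f. f \<in> L2 S ==> U f \<in> K"
  and UG: "\<And>f h. f \<in> L2 S ==> h \<in> L2 S ==> l2_inner N (U f) (G h) = l2_inner S f (Q h)"
  and UU: "\<And>f g. f \<in> L2 S ==> g \<in> L2 S ==> l2_inner N (U f) (U g) = l2_inner S f g"
  and surj: "\<And>v. v \<in> K ==> \<exists>f\<in>L2 S. \<forall>h\<in>L2 S. l2_inner N v (G h) = l2_inner S f (Q h)"
  using polar by blast
 note UL = K_L2[OF U]
 \<comment> \<open>The range of \<open>G\<close> separates harmonic functions up to null sets;
   linearity, surjectivity and \<open>U Q = G\<close> are all checked against
   \<open>G h\<close>.\<close>
 have eqK: "AE x in N. u x = v x" if u: "u \<in> K" and v: "v \<in> K" and e: "\<And>h. h \<in> L2 S ==> l2_inner N u (G h) = l2_inner N v (G h)" for u v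
 proof -
  have "l2_inner N (G h) (u - v) = 0" if h: "h \<in> L2 S" for h
   using e[OF h] L2.ip_cnj[OF K_L2[OF u] G_L2[OF h]] L2.ip_cnj[OF K_L2[OF v] G_L2[OF h]]
   by (simp add: L2.ip_diff_right K_L2 u v G_L2 h)
  then have "AE x in N. (u - v) x = 0" by (intro orthogonal_to_range_imp_zero K.diff_mem u v)
  then show ?thesis by eventually_elim simp
 qed
 have Usurj: "\<exists>f\<in>L2 S. AE x in N. v x = U f x" if v: "v \<in> K" for v
  using surj[OF v] eqK[OF v U] UG by metis
 have Ucong: "AE x in N. U f x = U g x" if "f \<in> L2 S" "g \<in> L2 S" "AE x in S. f x = g x" for f g
 proof (rule eqK[OF U U])
  fix h assume h: "h \<in> L2 S"
  have "l2_inner S f (Q h) = l2_inner S g (Q h)" by (rule l2_inner_cong) (use that h Q_L2 in auto)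
  then show "l2_inner N (U f) (G h) = l2_inner N (U g) (G h)" using that h UG by simp
 qed (use that in auto)
 have UQ: "AE x in N. U (Q f) x = G f x" if f: "f \<in> L2 S" for f
  by (rule eqK[OF U[OF Q_L2[OF f]] G_K[OF f]]) (use f UG Q_L2 Q_iso in simp)
 have Ulin: "AE x in N. U (\<lambda>y. f y + c * g y) x = U f x + c * U g x" if f: "f \<in> L2 S" and g: "g \<in> L2 S" for f g c
 proof (rule eqK)
  have fg: "(\<lambda>y. f y + c * g y) \<in> L2 S" by (intro L2_add L2_cmult f g)
  show "U (\<lambda>y. f y + c * g y) \<in> K" by (rule U[OF fg])
  show "(\<lambda>x. U f x + c * U g x) \<in> K" by (intro K_add_cmult U f g)
  fix h assume h: "h \<in> L2 S"
  have "l2_inner N (U (\<lambda>y. f y + c * g y)) (G h) = l2_inner S (f + (\<lambda>y. c * g y)) (Q h)"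
   using UG[OF fg h] by (simp add: plus_fun_def)
  also have "\<dots> = l2_inner N (U f + (\<lambda>x. c * U g x)) (G h)"
   using f g h UG by (simp add: L2.ip_simps Q_L2 L2_cmult UL G_L2)
  finally show "l2_inner N (U (\<lambda>y. f y + c * g y)) (G h) = l2_inner N (\<lambda>x. U f x + c * U g x) (G h)"
   by (simp add: plus_fun_def)
 qed
 have unit: "unitary_map S (L2 S) N K U"
  unfolding unitary_map_def using U Ulin UU Usurj by blast
 have nrmU: "L2.nrm N (U f - U g) = L2.nrm S (f - g)" if "f \<in> L2 S" "g \<in> L2 S" for f g
 proof -
  have "(L2.nrm N (U f - U g))^2 = (L2.nrm S (f - g))^2"
   using UU that by (simp add: L2.nrm_sq L2.mems L2.ip_simps L2.ip_diff_right UL)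
  then show ?thesis using that by (simp add: power2_eq_iff_nonneg L2.nrm_nonneg L2.mems UL)
 qed
 define b where "b f h = l2_inner N (U h) (mV (U f))" for f h
 have bbound: "cmod (b f h - b f' h) <= B * L2.nrm S (f - f') * L2.nrm S h" if f: "f \<in> L2 S" "f' \<in> L2 S" and h: "h \<in> L2 S" for f f' h
 proof -
  have d: "U f - U f' \<in> L2 N" by (intro L2.mems UL f)
  have e: "mV (U f) - mV (U f') = mV (U f - U f')" by (simp add: fun_eq_iff algebra_simps)
  have "b f h - b f' h = l2_inner N (U h) (mV (U f - U f'))"
   unfolding b_def e[symmetric] by (simp add: L2.ip_diff_right UL mV_L2 f h)
  also have "cmod \<dots> <= L2.nrm N (U h) * L2.nrm N (mV (U f - U f'))" by (rule L2.Cauchy_Schwarz[OF UL[OF h] mV_L2[OF d]])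
  also have "\<dots> <= L2.nrm N (U h) * (B * L2.nrm N (U f - U f'))" by (intro mult_left_mono nrm_mV d L2.nrm_nonneg UL h)
  also have "L2.nrm N (U h) = L2.nrm S h" using UU[OF h h] by (simp add: L2.nrm_def)
  finally show ?thesis unfolding nrmU[OF f] by (simp only: mult_ac)
 qed
 have Wex: "\<exists>w\<in>L2 S. \<forall>h\<in>L2 S. l2_inner S h w = b f h" if f: "f \<in> L2 S" for f
 proof (rule L2.Riesz)
  show "b f (g + h) = b f g + b f h" if "g \<in> L2 S" "h \<in> L2 S" for g h
  proof -
   have "AE x in N. U (g + h) x = (U g + U h) x" using Ulin[OF that, of 1] by (simp add: plus_fun_def)
   then have "b f (g + h) = l2_inner N (U g + U h) (mV (U f))"
    unfolding b_def by (intro l2_inner_cong) (use that f in \<open>auto intro!: UL mV_L2 L2.add_mem\<close>)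
   then show ?thesis unfolding b_def using that f by (simp add: L2.ip_simps UL mV_L2)
  qed
  show "b f (\<lambda>x. c * g x) = c * b f g" if g: "g \<in> L2 S" for c g
  proof -
   have "AE x in N. U (\<lambda>x. g x + (c - 1) * g x) x = c * U g x" using Ulin[OF g g, of "c - 1"] by (simp add: algebra_simps)
   moreover have "(\<lambda>x. g x + (c - 1) * g x) = (\<lambda>x. c * g x)" by (simp add: fun_eq_iff algebra_simps)
   ultimately have ae: "AE x in N. U (\<lambda>x. c * g x) x = c * U g x" by simp
   have "b f (\<lambda>x. c * g x) = l2_inner N (\<lambda>x. c * U g x) (mV (U f))"
    unfolding b_def by (rule l2_inner_cong[OF ae AE_I2[OF refl]]) (intro UL mV_L2 L2_cmult f g)+
   then show ?thesis unfolding b_def using g f by (simp add: L2.ip_simps UL mV_L2)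
  qed
  show "cmod (b f h) <= (B * L2.nrm N (U f)) * L2.nrm S h" if h: "h \<in> L2 S" for h
  proof -
   have "cmod (b f h) <= L2.nrm N (U h) * L2.nrm N (mV (U f))"
    unfolding b_def by (rule L2.Cauchy_Schwarz[OF UL[OF h] mV_L2[OF UL[OF f]]])
   also have "\<dots> <= L2.nrm N (U h) * (B * L2.nrm N (U f))" by (intro mult_left_mono nrm_mV L2.nrm_nonneg UL f h)
   also have "L2.nrm N (U h) = L2.nrm S h" using UU[OF h h] by (simp add: L2.nrm_def)
   finally show ?thesis by (simp only: mult_ac)
  qed
 qed
 then obtain W where W: "\<And>f. f \<in> L2 S ==> W f \<in> L2 S" "\<And>f h. f \<in> L2 S ==> h \<in> L2 S ==> l2_inner S h (W f) = b f h" by metis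
 have Wn: "L2.nrm S (W f - W f') <= B * L2.nrm S (f - f')" if f: "f \<in> L2 S" "f' \<in> L2 S" for f f'
 proof -
  let ?d = "W f - W f'"
  have d: "?d \<in> L2 S" by (intro L2.mems W f)
  have "l2_inner S ?d ?d = b f ?d - b f' ?d" using L2.ip_diff_right[OF W(1)[OF f(1)] W(1)[OF f(2)] d] W(2) d f by simp
  then have "(L2.nrm S ?d)^2 <= cmod (b f ?d - b f' ?d)" unfolding L2.nrm_sq[OF d] using complex_Re_le_cmod by metis
  also have "\<dots> <= B * L2.nrm S (f - f') * L2.nrm S ?d" by (rule bbound[OF f d])
  finally have "L2.nrm S ?d * L2.nrm S ?d <= B * L2.nrm S (f - f') * L2.nrm S ?d" by (simp only: power2_eq_square)
  moreover have "0 <= B * L2.nrm S (f - f')" using B_nonneg L2.nrm_nonneg[OF L2.diff_mem[OF f]] by simp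
  ultimately show ?thesis
   by (cases "L2.nrm S ?d = 0") (use L2.nrm_nonneg[OF d] in \<open>simp_all add: mult_le_cancel_right\<close>)
 qed
 define A where "A = J_inv_sqrt \<Omega> G \<circ>\<^sub>o J_weighted \<Omega> G V \<circ>\<^sub>o J_inv_sqrt \<Omega> G"
 have inv: "(f, g) \<in> J_inv_sqrt \<Omega> G \<longleftrightarrow> f \<in> L2 S \<and> g \<in> L2 S \<and> (AE x in S. f x = Q g x)" for f g
  unfolding J_inv_sqrt_def Q_sqrt op_graph_def by auto
 have bQ: "b (Q y) (Q g) = l2_inner N (G g) (mV (G y))" if "y \<in> L2 S" "g \<in> L2 S" for y g
 proof -
  have "AE x in N. mV (U (Q y)) x = mV (G y) x" using UQ[OF that(1)] by eventually_elim simp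
  then show ?thesis unfolding b_def by (intro l2_inner_cong UQ) (use that Q_L2 UL G_L2 mV_L2 in auto)
 qed
 have bcong: "b f h = b f' h" if "AE x in S. f x = f' x" "f \<in> L2 S" "f' \<in> L2 S" "h \<in> L2 S" for f f' h
 proof -
  have "AE x in N. mV (U f) x = mV (U f') x" using Ucong[OF that(2,3,1)] by eventually_elim simp
  then show ?thesis unfolding b_def by (intro l2_inner_cong) (use that UL mV_L2 in auto)
 qed
 \<comment> \<open>Testing with \<open>Q g\<close> gives \<open>z = W f\<close> on the range of
   \<open>Q\<close>, which is dense.\<close>
 have A1: "AE x in S. z x = W f x" if fz: "(f, z) \<in> A" for f z
 proof -
  obtain y w where y: "(f, y) \<in> J_inv_sqrt \<Omega> G" and w: "(y, w) \<in> J_weighted \<Omega> G V" and z: "(w, z) \<in> J_inv_sqrt \<Omega> G"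
   using fz unfolding A_def by blast
  have m: "f \<in> L2 S" "y \<in> L2 S" "w \<in> L2 S" "z \<in> L2 S" using y z by (auto simp: inv)
  have zW: "l2_inner S (Q g) z = l2_inner S (Q g) (W f)" if g: "g \<in> L2 S" for g
  proof -
   have "l2_inner S (Q g) z = l2_inner S g (Q z)" by (rule Q_sym[OF g m(4)])
   also have "\<dots> = l2_inner S g w" by (rule l2_inner_cong) (use z m g Q_L2 inv in auto)
   also have "\<dots> = b (Q y) (Q g)" using w g bQ[OF m(2) g] unfolding J_weighted_eq by auto
   also have "\<dots> = b f (Q g)" by (rule bcong) (use y m g Q_L2 inv in auto)
   finally show ?thesis using W(2)[OF m(1) Q_L2[OF g]] by simp
  qed
  show ?thesis
   unfolding L2_eq_AE_iff[OF m(4) W(1)[OF m(1)]]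
  proof
   fix h assume h: "h \<in> L2 S"
   obtain s where s: "\<And>n::nat. s n \<in> L2 S" "(\<lambda>n. L2.nrm S (Q (s n) - h)) \<longlonglongrightarrow> 0" using Q_dense[OF h] by blast
   have "(\<lambda>n. l2_inner S (Q (s n)) z) \<longlonglongrightarrow> l2_inner S h z"
    by (rule L2.tendsto_ip_left[OF Q_L2[OF s(1)] h m(4) s(2)])
   moreover have "(\<lambda>n. l2_inner S (Q (s n)) (W f)) \<longlonglongrightarrow> l2_inner S h (W f)"
    by (rule L2.tendsto_ip_left[OF Q_L2[OF s(1)] h W(1)[OF m(1)] s(2)])
   ultimately show "l2_inner S h z = l2_inner S h (W f)" using zW[OF s(1)] LIMSEQ_unique by fastforce
  qed
 qed
 \<comment> \<open>On the range of \<open>Q\<close> the domains match: \<open>J_V y\<close> is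
   represented by \<open>Q (W (Q y))\<close>, which lies in the range of \<open>Q\<close>
   again.\<close>
 have A2: "(Q y, W (Q y)) \<in> A" if y: "y \<in> L2 S" for y
 proof -
  have m: "Q y \<in> L2 S" "W (Q y) \<in> L2 S" "Q (W (Q y)) \<in> L2 S" using y Q_L2 W(1) by auto
  have "l2_inner S g (Q (W (Q y))) = l2_inner N (G g) (mV (G y))" if g: "g \<in> L2 S" for g
   using Q_sym[OF g m(2)] W(2)[OF m(1) Q_L2[OF g]] bQ[OF y g] by simp
  then have "(y, Q (W (Q y))) \<in> J_weighted \<Omega> G V" unfolding J_weighted_eq using y m by blast
  moreover have "(Q y, y) \<in> J_inv_sqrt \<Omega> G" "(Q (W (Q y)), W (Q y)) \<in> J_inv_sqrt \<Omega> G" unfolding inv using y m by auto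
  ultimately show ?thesis unfolding A_def by blast
 qed
 have clo: "op_closure S S A = op_graph (L2 S) S (L2 S) W"
 proof (intro set_eqI iffI; clarify)
  fix f g assume "(f, g) \<in> op_closure S S A"
  then have m: "f \<in> L2 S" "g \<in> L2 S"
   and cl: "\<And>e. e > 0 ==> \<exists>(f', g')\<in>A. l2_norm S (\<lambda>x. f' x - f x) < e \<and> l2_norm S (\<lambda>x. g' x - g x) < e"
   by (auto simp: op_closure_def)
  have d: "g - W f \<in> L2 S" by (intro L2.mems W m)
  have "L2.nrm S (g - W f) <= 0 + e" if e: "e > 0" for e
  proof -
   \<comment> \<open>The error of the first component passes through \<open>W\<close> and is
     multiplied by \<open>B\<close>; that of the second enters once.\<close>
   define e' where "e' = e / (B + 1)"
   have "e' > 0" "e' * (B + 1) = e" using e B_nonneg by (auto simp: e'_def)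
   then have e': "e' > 0" "B * e' + e' = e" by (simp_all add: distrib_left mult.commute)
   obtain f' g' where fg: "(f', g') \<in> A" "l2_norm S (\<lambda>x. f' x - f x) < e'" "l2_norm S (\<lambda>x. g' x - g x) < e'"
    using cl[OF e'(1)] by blast
   have m': "f' \<in> L2 S" "g' \<in> L2 S" using fg(1) by (auto simp: A_def inv)
   have n: "L2.nrm S (f' - f) < e'" "L2.nrm S (g' - g) < e'"
    using fg(2,3) L2_nrm_eq[OF L2.diff_mem[OF m'(1) m(1)]] L2_nrm_eq[OF L2.diff_mem[OF m'(2) m(2)]] by (simp_all add: fun_diff_def)
   have "AE x in S. (g' - W f') x = 0" using A1[OF fg(1)] by eventually_elim simp
   then have z: "L2.nrm S (g' - W f') = 0" using L2_nrm_zero_iff[OF L2.diff_mem[OF m'(2) W(1)[OF m'(1)]]] by simp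
   have "L2.nrm S (g - W f) <= L2.nrm S (g - g') + L2.nrm S (g' - W f)" by (rule L2.nrm_triangle3[OF m(2) m'(2) W(1)[OF m(1)]])
   also have "L2.nrm S (g' - W f) <= L2.nrm S (g' - W f') + L2.nrm S (W f' - W f)"
    by (rule L2.nrm_triangle3[OF m'(2) W(1)[OF m'(1)] W(1)[OF m(1)]])
   also have "L2.nrm S (W f' - W f) <= B * L2.nrm S (f' - f)" by (rule Wn[OF m'(1) m(1)])
   also have "B * L2.nrm S (f' - f) <= B * e'" using n(1) B_nonneg by (intro mult_left_mono) auto
   finally show ?thesis using n(2) z e'(2) L2.nrm_diff_commute[OF m(2) m'(2)] by linarith
  qed
  then have "L2.nrm S (g - W f) <= 0" by (rule field_le_epsilon)
  then have "L2.nrm S (g - W f) = 0" using L2.nrm_nonneg[OF d] by simp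
  then have "AE x in S. (g - W f) x = 0" using L2_nrm_zero_iff[OF d] by simp
  then have "AE x in S. g x = W f x" by eventually_elim simp
  then show "(f, g) \<in> op_graph (L2 S) S (L2 S) W" using m by (simp add: op_graph_def)
 next
  fix f g assume fg: "(f, g) \<in> op_graph (L2 S) S (L2 S) W"
  then have m: "f \<in> L2 S" "g \<in> L2 S" and ae: "AE x in S. g x = W f x" by (auto simp: op_graph_def)
  obtain s where s: "\<And>n::nat. s n \<in> L2 S" "(\<lambda>n. L2.nrm S (Q (s n) - f)) \<longlonglongrightarrow> 0" using Q_dense[OF m(1)] by blast
  have "\<exists>(f', g')\<in>A. l2_norm S (\<lambda>x. f' x - f x) < e \<and> l2_norm S (\<lambda>x. g' x - g x) < e" if e: "e > 0" for e
  proof -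
   have "eventually (\<lambda>n. L2.nrm S (Q (s n) - f) < e / (B + 1)) sequentially"
    using e B_nonneg by (intro order_tendstoD(2)[OF s(2)]) simp
   then obtain n where n: "L2.nrm S (Q (s n) - f) < e / (B + 1)" using eventually_happens'[OF sequentially_bot] by blast
   let ?f = "Q (s n)"
   have m': "?f \<in> L2 S" "W ?f \<in> L2 S" using Q_L2 W(1) s(1) by auto
   have nn: "0 <= L2.nrm S (?f - f)" by (intro L2.nrm_nonneg L2.mems m m')
   have lt: "(B + 1) * L2.nrm S (?f - f) < e" using n B_nonneg by (simp add: less_divide_eq mult.commute)
   have "AE x in S. (W f - g) x = 0" using ae by eventually_elim simp
   then have z: "L2.nrm S (W f - g) = 0" using L2_nrm_zero_iff[OF L2.diff_mem[OF W(1)[OF m(1)] m(2)]] by simp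
   have "L2.nrm S (W ?f - g) <= L2.nrm S (W ?f - W f) + L2.nrm S (W f - g)"
    by (rule L2.nrm_triangle3[OF m'(2) W(1)[OF m(1)] m(2)])
   also have "\<dots> <= B * L2.nrm S (?f - f)" using Wn[OF m'(1) m(1)] z by simp
   also have "\<dots> < e" using lt nn by (simp add: algebra_simps)
   finally have 2: "l2_norm S (\<lambda>x. W ?f x - g x) < e"
    using L2_nrm_eq[OF L2.diff_mem[OF m'(2) m(2)]] by (simp add: fun_diff_def)
   have "L2.nrm S (?f - f) < e" using lt nn mult_nonneg_nonneg[OF B_nonneg nn] by (simp add: algebra_simps)
   then have "l2_norm S (\<lambda>x. ?f x - f x) < e" using L2_nrm_eq[OF L2.diff_mem[OF m'(1) m(1)]] by (simp add: fun_diff_def)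
   then show ?thesis using A2[OF s(1)[of n]] 2 by blast
  qed
  then show "(f, g) \<in> op_closure S S A" using m by (auto simp: op_closure_def)
 qed
 \<comment> \<open>Every harmonic function is some \<open>U h\<close>, so the weak description of
   the Toeplitz operator becomes the one that defines \<open>W\<close>.\<close>
 have key: "(\<forall>v\<in>K. l2_inner N v (U g) = l2_inner N v (mV (U f))) \<longleftrightarrow> (AE x in S. g x = W f x)"
  if f: "f \<in> L2 S" and g: "g \<in> L2 S" for f g
 proof -
  have "(\<forall>v\<in>K. l2_inner N v (U g) = l2_inner N v (mV (U f))) \<longleftrightarrow> (\<forall>h\<in>L2 S. l2_inner N (U h) (U g) = b f h)" (is "?L \<longleftrightarrow> ?R")
  proof
   assume ?R
   show ?L
   proof
    fix v assume v: "v \<in> K"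
    obtain h where h: "h \<in> L2 S" "AE x in N. v x = U h x" using Usurj[OF v] by blast
    have "l2_inner N v (U g) = l2_inner N (U h) (U g)" by (rule l2_inner_cong) (use h v K_L2 UL g in auto)
    also have "\<dots> = b f h" using \<open>?R\<close> h(1) by blast
    also have "\<dots> = l2_inner N v (mV (U f))" unfolding b_def by (rule l2_inner_cong) (use h v K_L2 UL f mV_L2 in auto)
    finally show "l2_inner N v (U g) = l2_inner N v (mV (U f))" .
   qed
  qed (use U in \<open>auto simp: b_def\<close>)
  also have "?R \<longleftrightarrow> (\<forall>h\<in>L2 S. l2_inner S h g = l2_inner S h (W f))" using UU g W(2)[OF f] by simp
  finally show ?thesis using L2_eq_AE_iff[OF g W(1)[OF f]] by simp
 qed
 have "toeplitz_op \<Omega> V = op_graph (L2 S) N K U \<circ>\<^sub>o op_graph (L2 S) S (L2 S) W \<circ>\<^sub>o op_inverse (op_graph (L2 S) N K U)" (is "_ = ?R")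
 proof (intro set_eqI iffI; clarify)
  fix u h assume "(u, h) \<in> toeplitz_op \<Omega> V"
  then have uh: "u \<in> K" "h \<in> K" "\<forall>v\<in>K. l2_inner N v h = l2_inner N v (mV u)" unfolding toeplitz_op_eq by auto
  obtain f where f: "f \<in> L2 S" "AE x in N. u x = U f x" using Usurj[OF uh(1)] by blast
  obtain g where g: "g \<in> L2 S" "AE x in N. h x = U g x" using Usurj[OF uh(2)] by blast
  have mf: "AE x in N. mV u x = mV (U f) x" using f(2) by eventually_elim simp
  have "l2_inner N v (U g) = l2_inner N v (mV (U f))" if v: "v \<in> K" for v
  proof -
   have "l2_inner N v (U g) = l2_inner N v h" by (rule l2_inner_cong) (use g v K_L2 UL uh in auto)
   also have "\<dots> = l2_inner N v (mV u)" using uh(3) v by blast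
   also have "\<dots> = l2_inner N v (mV (U f))" by (rule l2_inner_cong) (use mf v K_L2 UL uh f mV_L2 in auto)
   finally show ?thesis .
  qed
  then have "AE x in S. g x = W f x" using key[OF f(1) g(1)] by blast
  then have "(f, u) \<in> op_graph (L2 S) N K U" "(f, g) \<in> op_graph (L2 S) S (L2 S) W" "(g, h) \<in> op_graph (L2 S) N K U"
   using f g uh by (auto simp: op_graph_def)
  then show "(u, h) \<in> ?R" by blast
 next
  fix f g u h
  assume "(f, u) \<in> op_graph (L2 S) N K U" "(f, g) \<in> op_graph (L2 S) S (L2 S) W" "(g, h) \<in> op_graph (L2 S) N K U"
  then have f: "f \<in> L2 S" "u \<in> K" "AE x in N. u x = U f x" and g: "g \<in> L2 S" "AE x in S. g x = W f x" and h: "h \<in> K" "AE x in N. h x = U g x"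
   by (auto simp: op_graph_def)
  have mf: "AE x in N. mV u x = mV (U f) x" using f(3) by eventually_elim simp
  have "l2_inner N v h = l2_inner N v (mV u)" if v: "v \<in> K" for v
  proof -
   have "l2_inner N v h = l2_inner N v (U g)" by (rule l2_inner_cong) (use h g v K_L2 UL in auto)
   also have "\<dots> = l2_inner N v (mV (U f))" using key[OF f(1) g(1)] g(2) v by blast
   also have "\<dots> = l2_inner N v (mV u)" by (rule l2_inner_cong) (use mf v K_L2 UL f mV_L2 in auto)
   finally show ?thesis .
  qed
  then show "(u, h) \<in> toeplitz_op \<Omega> V" unfolding toeplitz_op_eq using f h by blast
 qed
 then show ?thesis unfolding unitarily_equivalent_def using unit clo unfolding A_def by auto
qed

end

text \<open>If the outer measure were not additive on Borel sets, \<open>hausdorff_measure\<close> would be the null measure,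
 all boundary values would agree and the Dirichlet problem would have several solutions.\<close>

lemma frontier_measure_space_if_poisson:
 fixes \<Omega> :: "'a::euclidean_space set"
 assumes \<Omega>: "open \<Omega>" "bounded \<Omega>" "\<Omega> \<noteq> {}" and G: "poisson_operator \<Omega> G"
 shows "measure_space UNIV (sets borel) (hausdorff_outer (DIM('a) - 1) :: 'a set => ennreal)"
proof (rule ccontr)
 assume "\<not> ?thesis"
 then have 0: "emeasure (hausdorff_measure (DIM('a) - 1)) A = 0" for A :: "'a set"
  unfolding hausdorff_measure_def emeasure_measure_of_conv
  using sets.sigma_sets_eq[of "borel :: 'a measure"] by simp
 let ?S = "surface_measure \<Omega>"
 have "emeasure ?S (space ?S) = 0"
  unfolding surface_measure_def by (subst emeasure_restrict_space) (use 0[of "frontier \<Omega>"] in \<open>auto simp: space_restrict_space borel_closed\<close>)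
 then have ae: "AE x in ?S. P x" for P by (intro AE_I[of _ _ "space ?S"]) auto
 have sol: "dirichlet_solution \<Omega> (\<lambda>x. 0) (\<lambda>x. c)" for c
 proof -
  have "(\<integral>\<^sup>+x. ennreal ((cmod (c - 0))^2) \<partial>?S) = (\<integral>\<^sup>+x. 0 \<partial>?S)" by (intro nn_integral_cong_AE ae)
  then have z: "(\<integral>\<^sup>+x. ennreal ((cmod (c - 0))^2) \<partial>?S) = 0" by (simp only: nn_integral_const mult_zero_left)
  have "has_boundary_values \<Omega> (\<lambda>x. c) (\<lambda>x. 0)" unfolding has_boundary_values_def z by (rule tendsto_const)
  moreover have "(\<lambda>x. c) \<in> sobolev_half \<Omega>" by (rule sobolev_half_Lipschitz[OF \<Omega>, of _ 0]) simp
  ultimately show ?thesis using harmonic_on_const[OF \<Omega>(1)] by (simp add: dirichlet_solution_def)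
 qed
 obtain x where x: "x \<in> \<Omega>" using \<Omega>(3) by blast
 have "c = G (\<lambda>x. 0) x" for c using G sol[of c] L2_zero[of ?S] x unfolding poisson_operator_def by blast
 from this[of 0] this[of 1] show False by simp
qed

theorem proposition3p2:
  fixes \<Omega> :: "'a::euclidean_space set"
    and a \<tau> V :: "'a \<Rightarrow> real"
    and \<gamma> :: real
    and G :: "('a \<Rightarrow> complex) \<Rightarrow> ('a \<Rightarrow> complex)"
  assumes "DIM('a) \<ge> 2"
    and "open \<Omega>" "connected \<Omega>" "\<Omega> \<noteq> {}" "bounded \<Omega>"
    and "smooth_boundary \<Omega>"
    and "smooth_on_closure \<Omega> a" "smooth_on_closure \<Omega> \<tau>"
    and "\<forall>x\<in>closure \<Omega>. a x > 0"
    and "\<forall>x\<in>\<Omega>. \<tau> x > 0"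
    and "\<exists>\<epsilon>>0. \<forall>x\<in>closure \<Omega>. infdist x (frontier \<Omega>) < \<epsilon> \<longrightarrow> \<tau> x = infdist x (frontier \<Omega>)"
    and "\<gamma> \<ge> 0"
    and "\<forall>x\<in>\<Omega>. V x = \<tau> x powr \<gamma> * a x"
    and "poisson_operator \<Omega> G"
  shows "unitarily_equivalent
           (volume_on \<Omega>) (harmonic_L2 \<Omega>) (toeplitz_op \<Omega> V)
           (surface_measure \<Omega>) (L2 (surface_measure \<Omega>))
           (op_closure (surface_measure \<Omega>) (surface_measure \<Omega>)
              (J_inv_sqrt \<Omega> G \<circ>\<^sub>o J_weighted \<Omega> G V \<circ>\<^sub>o J_inv_sqrt \<Omega> G))"
proof -
 have cl: "x \<in> closure \<Omega>" if "x \<in> \<Omega>" for x using that closure_subset by blast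
 \<comment> \<open>Extensions to the whole space make gradients and compactness arguments available
   up to the boundary.\<close>
 obtain F where F: "smooth_on UNIV F" "\<And>x. x \<in> closure \<Omega> ==> \<tau> x = F x"
  using assms(8) by (auto simp: smooth_on_closure_def)
 obtain H where H: "smooth_on UNIV H" "\<And>x. x \<in> closure \<Omega> ==> a x = H x"
  using assms(7) by (auto simp: smooth_on_closure_def)
 have "Ck_on 2 UNIV F" using F(1) unfolding smooth_on_def by blast
 then obtain F' F'' where F2: "C2_on UNIV F F' F''" by (rule Ck_on_2_imp_C2_on) (rule that)
 have "Ck_on 0 UNIV H" using H(1) unfolding smooth_on_def by blast
 then have Hc: "continuous_on UNIV H" by simp
 obtain \<epsilon> where \<epsilon>: "\<epsilon> > 0" "\<forall>x\<in>closure \<Omega>. infdist x (frontier \<Omega>) < \<epsilon> --> \<tau> x = infdist x (frontier \<Omega>)"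
  using assms(11) by blast
 have Fp: "F x > 0" if "x \<in> \<Omega>" for x using assms(10) that F(2) cl by simp
 have Fd: "F x = infdist x (frontier \<Omega>)" if "x \<in> closure \<Omega>" "infdist x (frontier \<Omega>) < \<epsilon>" for x
  using \<epsilon>(2) that F(2) by simp
 interpret poisson_domain \<Omega> F F' F'' \<epsilon> G
 proof
  show "measure_space UNIV (sets borel) (hausdorff_outer (DIM('a) - 1) :: 'a set => ennreal)"
   by (rule frontier_measure_space_if_poisson[OF assms(2,5,4,14)])
 qed (assumption | rule assms(1,2,4-6,14) F2 Fp \<epsilon>(1) Fd)+
 obtain M1 where M1: "\<And>x. x \<in> closure \<Omega> ==> \<bar>F x\<bar> <= M1" using closure_bound[OF C2_on_cont[OF F2]] by blast
 obtain M2 where M2: "\<And>x. x \<in> closure \<Omega> ==> \<bar>H x\<bar> <= M2" using closure_bound[OF Hc] by blast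
 have V: "V x = F x powr \<gamma> * H x" if "x \<in> \<Omega>" for x using assms(13) that F(2) H(2) cl by simp
 have "continuous_on \<Omega> (\<lambda>x. F x powr \<gamma> * H x)"
  by (intro continuous_intros continuous_on_subset[OF C2_on_cont[OF F2]] continuous_on_subset[OF Hc])
   (use Fpos in force)+
 then have "continuous_on \<Omega> V" by (subst continuous_on_cong[OF refl V]) auto
 then have Vm: "V \<in> borel_measurable N" by (rule measurable_volume_on_continuous)
 \<comment> \<open>As \<open>\<gamma> >= 0\<close>, the power is monotone, so \<open>V\<close> stays
   bounded even though \<open>F\<close> vanishes at the boundary.\<close>
 have Vb: "\<bar>V x\<bar> <= M1 powr \<gamma> * M2" if x: "x \<in> \<Omega>" for x
 proof -
  have "F x powr \<gamma> <= M1 powr \<gamma>" using Fpos[OF x] M1[OF cl[OF x]] assms(12) by (intro powr_mono2) auto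
  then have "F x powr \<gamma> * \<bar>H x\<bar> <= M1 powr \<gamma> * M2" using M2[OF cl[OF x]] by (intro mult_mono) auto
  then show ?thesis by (simp add: V[OF x] abs_mult)
 qed
 obtain Q where Q: "\<And>f. f \<in> L2 S ==> Q f \<in> L2 S"
  "\<And>f g. f \<in> L2 S ==> g \<in> L2 S ==> l2_inner S (Q f) g = l2_inner S f (Q g)"
  "\<And>f g. f \<in> L2 S ==> g \<in> L2 S ==> l2_inner S (Q f) (Q g) = l2_inner N (G f) (G g)"
  "op_sqrt S (J_op \<Omega> G) = op_graph (L2 S) S (L2 S) Q"
  using op_sqrt_J by blast
 interpret weighted_poisson \<Omega> F F' F'' \<epsilon> G Q V "M1 powr \<gamma> * M2"
  by unfold_locales (use Q Vm Vb in auto)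
 show ?thesis by (rule toeplitz_unitarily_equivalent)
qed

end
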